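(* Consider a finite-dimensional quantum system with Hamiltonian $H=\sum_{i=0}^{d-1}E_i|h_i\rangle\langle h_i|$, where $\{h_i\}_{i=0}^{d-1}$ is an orthonormal basis (the energy eigenbasis), and Gibbs state $\gamma_\beta=e^{-\beta H}/\operatorname{Tr}(e^{-\beta H})$ at inverse temperature $\beta>0$. Suppose that $E_i>0$ for all $i$, and that the states $\rho$ and $\sigma$ are diagonal in the energy eigenbasis $\{h_i\}_i$. Then $\rho$ asymptotically catalytically thermally majorizes $\sigma$ if and only if $$F^{+}_{\alpha,\beta}(\rho)\ge F^{+}_{\alpha,\beta}(\sigma)\quad\text{and}\quad F^{-}_{\alpha,\beta}(\rho)\ge F^{-}_{\alpha,\beta}(\sigma)\qquad\text{for all }\alpha\ge\tfrac12.$$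
   Context: A state is a positive semidefinite operator of trace one on a finite-dimensional Hilbert space; a channel is a completely positive trace-preserving linear map; $\|\cdot\|_1$ is the trace norm; $\operatorname{supp}$ of a state denotes its supporting subspace. $\rho$ asymptotically catalytically thermally majorizes $\sigma$ if for every $\varepsilon>0$ there are states $\tau_\varepsilon^{(1)},\tau_\varepsilon^{(2)}$ on some finite-dimensional system (which may depend on $\varepsilon$) with $\operatorname{supp}\tau_\varepsilon^{(1)}\subseteq\operatorname{supp}\tau_\varepsilon^{(2)}$ (where $\tau_\varepsilon^{(2)}$ plays the role of a Gibbs state of that system), a state $\sigma_\varepsilon$ on the system of interest with $\|\sigma-\sigma_\varepsilon\|_1<\varepsilon$, and a channel $\Phi_\varepsilon$ such that $\Phi_\varepsilon(\rho\otimes\tau_\varepsilon^{(1)})=\sigma_\varepsilon\otimes\tau_\varepsilon^{(1)}$ and $\Phi_\varepsilon(\gamma_\beta\otimes\tau_\varepsilon^{(2)})=\gamma_\beta\otimes\tau_\varepsilon^{(2)}$. The sandwiched quantum Rényi divergence is, for $\alpha\in[1/2,1)$ and $\operatorname{supp}\rho\cap\operatorname{supp}\tau\ne\{0\}$, or $\alpha\in(1,\infty)$ and $\operatorname{supp}\rho\subseteq\operatorname{supp}\tau$, $$\tilde D_\alpha(\rho\|\tau)=\frac1{\alpha-1}\log\operatorname{Tr}\Big[\big(\tau^{\frac{1-\alpha}{2\alpha}}\rho\,\tau^{\frac{1-\alpha}{2\alpha}}\big)^\alpha\Big]$$ (negative powers taken on the support); $\tilde D_1(\rho\|\tau)=\operatorname{Tr}[\rho(\log\rho-\log\tau)]$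 if $\operatorname{supp}\rho\subseteq\operatorname{supp}\tau$; and $\tilde D_\alpha(\rho\|\tau)=\infty$ otherwise. The free energies are $F^+_{\alpha,\beta}(\rho)=\tilde D_\alpha(\rho\|\gamma_\beta)$ and $F^-_{\alpha,\beta}(\rho)=\tilde D_\alpha(\gamma_\beta\|\rho)$ for $\alpha\ge1/2$. *)

theory Defs
  imports
    Complex_Main
    "HOL-Library.Extended_Real"
    "Jordan_Normal_Form.Matrix_Kernel"
    "Jordan_Normal_Form.Schur_Decomposition"
begin

text \<open>
  Finite-dimensional Hilbert spaces are modelled as \<open>\<complex>\<^sup>n\<close>, with operators as square complex matrices.
  The product \<open>v \<bullet>c w\<close> is linear in \<open>v\<close> and conjugate-linear in \<open>w\<close>.
\<close>

definition mtrace :: "complex Matrix.mat \<Rightarrow> complex" where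
  "mtrace A = (\<Sum>i<dim_row A. A $$ (i, i))"

definition psd :: "nat \<Rightarrow> complex Matrix.mat \<Rightarrow> bool" where
  "psd n A \<longleftrightarrow> A \<in> carrier_mat n n \<and> mat_adjoint A = A \<and>
     (\<forall>v\<in>carrier_vec n. 0 \<le> Re ((A *\<^sub>v v) \<bullet>c v))"

definition state :: "nat \<Rightarrow> complex Matrix.mat \<Rightarrow> bool" where
  "state n \<rho> \<longleftrightarrow> psd n \<rho> \<and> mtrace \<rho> = 1"

text \<open>The supporting subspace is the orthogonal complement of the kernel.\<close>

definition supp :: "complex Matrix.mat \<Rightarrow> complex Matrix.vec set" where
  "supp A = {v \<in> carrier_vec (dim_col A). \<forall>w\<in>mat_kernel A. v \<bullet>c w = 0}"

definition orthonormal_basis :: "nat \<Rightarrow> (nat \<Rightarrow> complex Matrix.vec) \<Rightarrow> bool" where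
  "orthonormal_basis n h \<longleftrightarrow> (\<forall>i<n. h i \<in> carrier_vec n) \<and>
     (\<forall>i<n. \<forall>j<n. h i \<bullet>c h j = (if i = j then 1 else 0))"

text \<open>The operator \<open>\<Sum>i<n. e i |h i\<rangle>\<langle>h i|\<close>, written out entrywise.\<close>

definition spectral_sum ::
    "nat \<Rightarrow> (nat \<Rightarrow> complex Matrix.vec) \<Rightarrow> (nat \<Rightarrow> real) \<Rightarrow> complex Matrix.mat" where
  "spectral_sum n h e =
     Matrix.mat n n (\<lambda>(a, b). \<Sum>i<n. complex_of_real (e i) * (h i $ a) * cnj (h i $ b))"

definition diagonal_in_basis ::
    "nat \<Rightarrow> (nat \<Rightarrow> complex Matrix.vec) \<Rightarrow> complex Matrix.mat \<Rightarrow> bool" where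
  "diagonal_in_basis n h A \<longleftrightarrow> (\<forall>i<n. \<forall>j<n. i \<noteq> j \<longrightarrow> (A *\<^sub>v h j) \<bullet>c h i = 0)"

text \<open>
  Functional calculus of a Hermitian matrix: \<open>f(A)\<close> is the matrix acting as \<open>f x\<close> on the
  eigenspace of every eigenvalue \<open>x\<close>. It is unique because the eigenvectors span the space;
  see \<open>hfun_spectral_sum\<close> below. For non-Hermitian matrices the value is irrelevant.
\<close>

definition hfun :: "(real \<Rightarrow> real) \<Rightarrow> complex Matrix.mat \<Rightarrow> complex Matrix.mat" where
  "hfun f A = (THE B. B \<in> carrier_mat (dim_row A) (dim_row A) \<and>
     (\<forall>v\<in>carrier_vec (dim_row A). \<forall>x::real.
        A *\<^sub>v v = complex_of_real x \<cdot>\<^sub>v v \<longrightarrow> B *\<^sub>v v = complex_of_real (f x) \<cdot>\<^sub>v v))"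

definition trace_norm :: "complex Matrix.mat \<Rightarrow> real" where
  "trace_norm A = Re (mtrace (hfun sqrt (mat_adjoint A * A)))"

text \<open>The Kronecker product; the basis vector \<open>e\<^sub>i \<otimes> e\<^sub>j\<close> has index \<open>i * n + j\<close>, where \<open>n\<close> is the
  dimension of the second factor.\<close>

definition kron :: "complex Matrix.mat \<Rightarrow> complex Matrix.mat \<Rightarrow> complex Matrix.mat" where
  "kron A B = Matrix.mat (dim_row A * dim_row B) (dim_col A * dim_col B)
     (\<lambda>(i, j). A $$ (i div dim_row B, j div dim_col B) * B $$ (i mod dim_row B, j mod dim_col B))"

definition mat_block :: "nat \<Rightarrow> complex Matrix.mat \<Rightarrow> nat \<Rightarrow> nat \<Rightarrow> complex Matrix.mat" where
  "mat_block m X a b = Matrix.mat m m (\<lambda>(i, j). X $$ (a * m + i, b * m + j))"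

text \<open>The map \<open>id\<^sub>k \<otimes> \<Phi>\<close> applies \<open>\<Phi>\<close> to each of the \<open>k \<times> k\<close> blocks of its argument;
  see \<open>ampliation_kron\<close> below.\<close>

definition ampliation :: "nat \<Rightarrow> nat \<Rightarrow> nat \<Rightarrow> (complex Matrix.mat \<Rightarrow> complex Matrix.mat) \<Rightarrow>
    complex Matrix.mat \<Rightarrow> complex Matrix.mat" where
  "ampliation k m n \<Phi> X = Matrix.mat (k * n) (k * n)
     (\<lambda>(i, j). \<Phi> (mat_block m X (i div n) (j div n)) $$ (i mod n, j mod n))"

definition linear_map_mat :: "nat \<Rightarrow> nat \<Rightarrow> (complex Matrix.mat \<Rightarrow> complex Matrix.mat) \<Rightarrow> bool" where
  "linear_map_mat m n \<Phi> \<longleftrightarrow>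
     (\<forall>A\<in>carrier_mat m m. \<Phi> A \<in> carrier_mat n n) \<and>
     (\<forall>A\<in>carrier_mat m m. \<forall>B\<in>carrier_mat m m. \<Phi> (A + B) = \<Phi> A + \<Phi> B) \<and>
     (\<forall>c. \<forall>A\<in>carrier_mat m m. \<Phi> (c \<cdot>\<^sub>m A) = c \<cdot>\<^sub>m \<Phi> A)"

definition completely_positive ::
    "nat \<Rightarrow> nat \<Rightarrow> (complex Matrix.mat \<Rightarrow> complex Matrix.mat) \<Rightarrow> bool" where
  "completely_positive m n \<Phi> \<longleftrightarrow>
     (\<forall>k X. psd (k * m) X \<longrightarrow> psd (k * n) (ampliation k m n \<Phi> X))"

definition channel :: "nat \<Rightarrow> nat \<Rightarrow> (complex Matrix.mat \<Rightarrow> complex Matrix.mat) \<Rightarrow> bool" where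
  "channel m n \<Phi> \<longleftrightarrow> linear_map_mat m n \<Phi> \<and> completely_positive m n \<Phi> \<and>
     (\<forall>A\<in>carrier_mat m m. mtrace (\<Phi> A) = mtrace A)"

text \<open>
  Powers and logarithms of positive semidefinite matrices are taken on the support, which is
  automatic here because \<open>0 powr a = 0\<close> for every \<open>a\<close> and \<open>ln 0 = 0\<close>. Logarithms are natural.
\<close>

definition mpow :: "complex Matrix.mat \<Rightarrow> real \<Rightarrow> complex Matrix.mat" where
  "mpow A a = hfun (\<lambda>x. x powr a) A"

definition sandwiched_renyi :: "real \<Rightarrow> complex Matrix.mat \<Rightarrow> complex Matrix.mat \<Rightarrow> ereal" where
  "sandwiched_renyi \<alpha> \<rho> \<tau> =
    (if (1/2 \<le> \<alpha> \<and> \<alpha> < 1 \<and> supp \<rho> \<inter> supp \<tau> \<noteq> {0\<^sub>v (dim_row \<rho>)}) \<or> (1 < \<alpha> \<and> supp \<rho> \<subseteq> supp \<tau>) then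
       ereal (1 / (\<alpha> - 1) * ln (Re (mtrace (mpow
         (mpow \<tau> ((1 - \<alpha>) / (2 * \<alpha>)) * \<rho> * mpow \<tau> ((1 - \<alpha>) / (2 * \<alpha>))) \<alpha>))))
     else if \<alpha> = 1 \<and> supp \<rho> \<subseteq> supp \<tau> then
       ereal (Re (mtrace (\<rho> * (hfun ln \<rho> - hfun ln \<tau>))))
     else \<infinity>)"

definition gibbs_state :: "complex Matrix.mat \<Rightarrow> real \<Rightarrow> complex Matrix.mat" where
  "gibbs_state H \<beta> =
     (let K = hfun (\<lambda>x. exp (- \<beta> * x)) H in (1 / mtrace K) \<cdot>\<^sub>m K)"

definition free_energy_plus ::
    "complex Matrix.mat \<Rightarrow> real \<Rightarrow> real \<Rightarrow> complex Matrix.mat \<Rightarrow> ereal" where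
  "free_energy_plus H \<alpha> \<beta> \<rho> = sandwiched_renyi \<alpha> \<rho> (gibbs_state H \<beta>)"

definition free_energy_minus ::
    "complex Matrix.mat \<Rightarrow> real \<Rightarrow> real \<Rightarrow> complex Matrix.mat \<Rightarrow> ereal" where
  "free_energy_minus H \<alpha> \<beta> \<rho> = sandwiched_renyi \<alpha> (gibbs_state H \<beta>) \<rho>"

definition asymp_cat_thermally_majorizes ::
    "nat \<Rightarrow> complex Matrix.mat \<Rightarrow> real \<Rightarrow> complex Matrix.mat \<Rightarrow> complex Matrix.mat \<Rightarrow> bool" where
  "asymp_cat_thermally_majorizes d H \<beta> \<rho> \<sigma> \<longleftrightarrow>
     (\<forall>\<epsilon>>0. \<exists>n \<tau>1 \<tau>2 \<sigma>' \<Phi>.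
        state n \<tau>1 \<and> state n \<tau>2 \<and> supp \<tau>1 \<subseteq> supp \<tau>2 \<and>
        state d \<sigma>' \<and> trace_norm (\<sigma> - \<sigma>') < \<epsilon> \<and>
        channel (d * n) (d * n) \<Phi> \<and>
        \<Phi> (kron \<rho> \<tau>1) = kron \<sigma>' \<tau>1 \<and>
        \<Phi> (kron (gibbs_state H \<beta>) \<tau>2) = kron (gibbs_state H \<beta>) \<tau>2)"

lemma mult_mat_vec_index_sum:
  assumes "A \<in> carrier_mat n m" "v \<in> carrier_vec m" "a < n"
  shows "(A *\<^sub>v v) $ a = (\<Sum>b<m. A $$ (a, b) * v $ b)"
  using assms by (auto simp: scalar_prod_def atLeast0LessThan)

lemma cscalar_prod_sum:
  assumes "v \<in> carrier_vec n" "w \<in> carrier_vec n"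
  shows "v \<bullet>c w = (\<Sum>a<n. v $ a * cnj (w $ a))"
  using assms by (auto simp: scalar_prod_def atLeast0LessThan)

lemma spectral_sum_mult_vec:
  assumes h: "orthonormal_basis n h" and v: "v \<in> carrier_vec n" and a: "a < n"
  shows "(spectral_sum n h e *\<^sub>v v) $ a = (\<Sum>i<n. complex_of_real (e i) * (v \<bullet>c h i) * h i $ a)"
proof -
  have "(spectral_sum n h e *\<^sub>v v) $ a =
      (\<Sum>b<n. (\<Sum>i<n. complex_of_real (e i) * (h i $ a) * cnj (h i $ b)) * v $ b)"
    using a by (subst mult_mat_vec_index_sum[OF _ v a, of _ ]) (auto simp: spectral_sum_def)
  also have "\<dots> = (\<Sum>i<n. \<Sum>b<n. complex_of_real (e i) * (h i $ a) * cnj (h i $ b) * v $ b)"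
    by (simp add: sum_distrib_right) (rule sum.swap)
  also have "\<dots> = (\<Sum>i<n. complex_of_real (e i) * (v \<bullet>c h i) * h i $ a)"
  proof (rule sum.cong[OF refl])
    fix i assume "i \<in> {..<n}"
    then have "v \<bullet>c h i = (\<Sum>b<n. v $ b * cnj (h i $ b))"
      using h by (intro cscalar_prod_sum[OF v]) (auto simp: orthonormal_basis_def)
    then show "(\<Sum>b<n. complex_of_real (e i) * (h i $ a) * cnj (h i $ b) * v $ b) =
        complex_of_real (e i) * (v \<bullet>c h i) * h i $ a"
      by (simp add: sum_distrib_left sum_distrib_right mult_ac)
  qed
  finally show ?thesis .
qed

lemma orthonormal_basis_complete:
  assumes h: "orthonormal_basis n h"
  shows "spectral_sum n h (\<lambda>_. 1) = 1\<^sub>m n"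
proof -
  define U where "U = Matrix.mat n n (\<lambda>(a, i). h i $ a)"
  define V where "V = Matrix.mat n n (\<lambda>(i, a). cnj (h i $ a))"
  have U: "U \<in> carrier_mat n n" and V: "V \<in> carrier_mat n n" by (auto simp: U_def V_def)
  have "V * U = 1\<^sub>m n"
  proof (rule eq_matI)
    fix i j assume "i < dim_row (1\<^sub>m n :: complex Matrix.mat)" "j < dim_col (1\<^sub>m n :: complex Matrix.mat)"
    then have ij: "i < n" "j < n" by auto
    have "(V * U) $$ (i, j) = (\<Sum>a<n. h j $ a * cnj (h i $ a))"
      using ij by (simp add: U_def V_def scalar_prod_def atLeast0LessThan mult.commute)
    also have "\<dots> = h j \<bullet>c h i"
      using h ij by (intro cscalar_prod_sum[symmetric]) (auto simp: orthonormal_basis_def)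
    also have "\<dots> = 1\<^sub>m n $$ (i, j)"
      using h ij by (auto simp: orthonormal_basis_def)
    finally show "(V * U) $$ (i, j) = 1\<^sub>m n $$ (i, j)" .
  qed (auto simp: U_def V_def)
  then have "U * V = 1\<^sub>m n" by (rule mat_mult_left_right_inverse[OF V U])
  moreover have "U * V = spectral_sum n h (\<lambda>_. 1)"
    by (rule eq_matI) (auto simp: U_def V_def spectral_sum_def scalar_prod_def atLeast0LessThan)
  ultimately show ?thesis by simp
qed

lemma orthonormal_basis_expand:
  assumes h: "orthonormal_basis n h" and v: "v \<in> carrier_vec n" and a: "a < n"
  shows "v $ a = (\<Sum>i<n. (v \<bullet>c h i) * h i $ a)"
  using spectral_sum_mult_vec[OF h v a, of "\<lambda>_. 1"] orthonormal_basis_complete[OF h] v by simp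

lemma spectral_sum_carrier: "spectral_sum n h e \<in> carrier_mat n n"
  by (simp add: spectral_sum_def)

lemma spectral_sum_basis:
  assumes h: "orthonormal_basis n h" and i: "i < n"
  shows "spectral_sum n h e *\<^sub>v h i = complex_of_real (e i) \<cdot>\<^sub>v h i"
proof (rule eq_vecI)
  have hi: "h i \<in> carrier_vec n" using h i by (auto simp: orthonormal_basis_def)
  fix a assume "a < dim_vec (complex_of_real (e i) \<cdot>\<^sub>v h i)"
  then have a: "a < n" using hi by auto
  have "(spectral_sum n h e *\<^sub>v h i) $ a =
      (\<Sum>j<n. if j = i then complex_of_real (e i) * h i $ a else 0)"
    unfolding spectral_sum_mult_vec[OF h hi a]
    using h i by (intro sum.cong) (auto simp: orthonormal_basis_def)
  then show "(spectral_sum n h e *\<^sub>v h i) $ a = (complex_of_real (e i) \<cdot>\<^sub>v h i) $ a"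
    using i a hi by simp
next
  show "dim_vec (spectral_sum n h e *\<^sub>v h i) = dim_vec (complex_of_real (e i) \<cdot>\<^sub>v h i)"
    using h i by (auto simp: orthonormal_basis_def spectral_sum_def)
qed

lemma mat_eq_on_basis:
  assumes h: "orthonormal_basis n h" and B: "B \<in> carrier_mat n n" and C: "C \<in> carrier_mat n n"
    and eq: "\<And>i. i < n \<Longrightarrow> B *\<^sub>v h i = C *\<^sub>v h i"
  shows "B = C"
proof (rule eq_matI)
  have expand: "M $$ (a, b) = (\<Sum>i<n. (M *\<^sub>v h i) $ a * cnj (h i $ b))"
    if M: "M \<in> carrier_mat n n" and a: "a < n" and b: "b < n" for M a b
  proof -
    have "(\<Sum>i<n. (M *\<^sub>v h i) $ a * cnj (h i $ b)) =
        (\<Sum>i<n. (\<Sum>c<n. M $$ (a, c) * h i $ c) * cnj (h i $ b))"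
      using h by (intro sum.cong refl arg_cong2[where f = "(*)"] mult_mat_vec_index_sum[OF M _ a])
        (auto simp: orthonormal_basis_def)
    also have "\<dots> = (\<Sum>c<n. M $$ (a, c) * (\<Sum>i<n. h i $ c * cnj (h i $ b)))"
      by (simp add: sum_distrib_right sum_distrib_left mult.assoc) (rule sum.swap)
    also have "\<dots> = (\<Sum>c<n. M $$ (a, c) * spectral_sum n h (\<lambda>_. 1) $$ (c, b))"
      using b by (intro sum.cong) (auto simp: spectral_sum_def)
    also have "\<dots> = (\<Sum>c<n. if c = b then M $$ (a, b) else 0)"
      unfolding orthonormal_basis_complete[OF h] using b by (intro sum.cong) auto
    finally show ?thesis using b by simp
  qed
  fix a b assume "a < dim_row C" "b < dim_col C"
  then have "a < n" "b < n" using C by auto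
  then show "B $$ (a, b) = C $$ (a, b)"
    using eq by (simp add: expand[OF B] expand[OF C])
qed (use B C in auto)

lemma hfun_spectral_sum:
  assumes h: "orthonormal_basis n h"
  shows "hfun f (spectral_sum n h e) = spectral_sum n h (\<lambda>i. f (e i))"
  unfolding hfun_def
proof (rule the_equality)
  let ?A = "spectral_sum n h e" and ?F = "spectral_sum n h (\<lambda>i. f (e i))"
  have n: "dim_row ?A = n" by (simp add: spectral_sum_def)
  have hc: "h i \<in> carrier_vec n" if "i < n" for i using h that by (auto simp: orthonormal_basis_def)
  have coeff: "(spectral_sum n h g *\<^sub>v v) \<bullet>c h i = complex_of_real (g i) * (v \<bullet>c h i)"
    if v: "v \<in> carrier_vec n" and i: "i < n" for g v i
  proof -
    have "(spectral_sum n h g *\<^sub>v v) \<bullet>c h i = (\<Sum>a<n. (spectral_sum n h g *\<^sub>v v) $ a * cnj (h i $ a))"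
      using hc[OF i] mult_mat_vec_carrier[OF spectral_sum_carrier v] by (intro cscalar_prod_sum)
    also have "\<dots> = (\<Sum>a<n. \<Sum>j<n. complex_of_real (g j) * (v \<bullet>c h j) * (h j $ a * cnj (h i $ a)))"
      by (intro sum.cong refl) (simp add: spectral_sum_mult_vec[OF h v] sum_distrib_right mult.assoc)
    also have "\<dots> = (\<Sum>j<n. complex_of_real (g j) * (v \<bullet>c h j) * (\<Sum>a<n. h j $ a * cnj (h i $ a)))"
      by (subst sum.swap) (simp add: sum_distrib_left)
    also have "\<dots> = (\<Sum>j<n. if j = i then complex_of_real (g i) * (v \<bullet>c h i) else 0)"
      using h i by (intro sum.cong refl, subst cscalar_prod_sum[symmetric, OF hc hc])
        (auto simp: orthonormal_basis_def)
    finally show ?thesis using i by simp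
  qed
  have "?F *\<^sub>v v = complex_of_real (f x) \<cdot>\<^sub>v v"
    if v: "v \<in> carrier_vec n" and ev: "?A *\<^sub>v v = complex_of_real x \<cdot>\<^sub>v v" for v x
  proof (rule eq_vecI)
    fix a assume "a < dim_vec (complex_of_real (f x) \<cdot>\<^sub>v v)"
    then have a: "a < n" using v by auto
    have c: "complex_of_real (f (e i)) * (v \<bullet>c h i) = complex_of_real (f x) * (v \<bullet>c h i)"
      if i: "i < n" for i
    proof (cases "v \<bullet>c h i = 0")
      case False
      have "complex_of_real (e i) * (v \<bullet>c h i) = complex_of_real x * (v \<bullet>c h i)"
        using coeff[OF v i, of e] ev v hc[OF i] by auto
      then show ?thesis using False by simp
    qed simp
    have "(?F *\<^sub>v v) $ a = (\<Sum>i<n. complex_of_real (f x) * (v \<bullet>c h i) * h i $ a)"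
      unfolding spectral_sum_mult_vec[OF h v a] by (intro sum.cong) (simp_all add: c)
    also have "\<dots> = complex_of_real (f x) * v $ a"
      by (simp add: orthonormal_basis_expand[OF h v a] sum_distrib_left mult.assoc)
    finally show "(?F *\<^sub>v v) $ a = (complex_of_real (f x) \<cdot>\<^sub>v v) $ a" using a v by simp
  qed (use v in \<open>simp add: spectral_sum_def\<close>)
  then show "?F \<in> carrier_mat (dim_row ?A) (dim_row ?A) \<and>
     (\<forall>v\<in>carrier_vec (dim_row ?A). \<forall>x. ?A *\<^sub>v v = complex_of_real x \<cdot>\<^sub>v v \<longrightarrow>
        ?F *\<^sub>v v = complex_of_real (f x) \<cdot>\<^sub>v v)"
    unfolding n using spectral_sum_carrier by blast
  fix B
  assume B: "B \<in> carrier_mat (dim_row ?A) (dim_row ?A) \<and>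
     (\<forall>v\<in>carrier_vec (dim_row ?A). \<forall>x. ?A *\<^sub>v v = complex_of_real x \<cdot>\<^sub>v v \<longrightarrow>
        B *\<^sub>v v = complex_of_real (f x) \<cdot>\<^sub>v v)"
  show "B = ?F"
  proof (rule mat_eq_on_basis[OF h _ spectral_sum_carrier])
    show "B \<in> carrier_mat n n" using B n by simp
    fix i assume i: "i < n"
    show "B *\<^sub>v h i = ?F *\<^sub>v h i"
      using B n hc[OF i] spectral_sum_basis[OF h i] by auto
  qed
qed

lemma ampliation_kron:
  assumes A: "A \<in> carrier_mat k k" and B: "B \<in> carrier_mat m m" and lin: "linear_map_mat m n \<Phi>"
  shows "ampliation k m n \<Phi> (kron A B) = kron A (\<Phi> B)"
proof (rule eq_matI)
  have PB: "\<Phi> B \<in> carrier_mat n n" using B lin by (auto simp: linear_map_mat_def)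
  fix i j assume "i < dim_row (kron A (\<Phi> B))" "j < dim_col (kron A (\<Phi> B))"
  then have ij: "i < k * n" "j < k * n" using A PB by (auto simp: kron_def)
  then have n: "0 < n" by (cases n) auto
  have d: "i div n < k" "j div n < k" using ij by (auto simp: less_mult_imp_div_less)
  have lt: "a * m + b < k * m" if "a < k" "b < m" for a b
  proof -
    have "a * m + b < Suc a * m" using that by simp
    also have "\<dots> \<le> k * m" using that by (intro mult_le_mono1) simp
    finally show ?thesis .
  qed
  have "mat_block m (kron A B) (i div n) (j div n) = A $$ (i div n, j div n) \<cdot>\<^sub>m B"
    using A B d lt by (intro eq_matI) (auto simp: mat_block_def kron_def)
  then show "ampliation k m n \<Phi> (kron A B) $$ (i, j) = kron A (\<Phi> B) $$ (i, j)"
    using ij A B PB lin n by (auto simp: ampliation_def kron_def linear_map_mat_def)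
qed (use A B lin in \<open>auto simp: ampliation_def kron_def linear_map_mat_def\<close>)

end

theory Submission
  imports Defs "HOL-Analysis.Convex" "HOL-Real_Asymp.Real_Asymp"
begin

text \<open>
  For the sufficiency direction the states are classical: writing \<open>p = g a\<close>, \<open>q = g b\<close> with \<open>g\<close> the Gibbs
  weights, mixing a little of \<open>g\<close> into both states, and less into \<open>p\<close>, makes all inequalities between
  Renyi quantities strict, uniformly in \<open>\<alpha>\<close>. The logarithms of the likelihood ratios are then rounded
  to a lattice, where the two pairs of distributions become polynomials. The inequalities say that their
  difference is \<open>(x - 1) (x - e\<^sup>\<delta>) f(x)\<close> with \<open>f\<close> positive on the positive half-line. By Polya's
  theorem \<open>(1 + x)\<^sup>N f(x)\<close> has nonnegative coefficients for large \<open>N\<close>. The factor \<open>(1 + x)\<^sup>N\<close> amounts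
  to a catalyst made of two binomial weights, and each term of \<open>(x - 1) (x - e\<^sup>\<delta>) f\<close> encodes
  elementary moves of mass to neighbouring sites. The resulting stochastic matrix is implemented by
  measuring and preparing in the energy eigenbasis.

  Necessity must cope with catalysts \<open>\<tau>\<^sub>1\<close>, \<open>\<tau>\<^sub>2\<close> that do not commute. Instead of quantum divergences one
  uses decompositions of both operators into common positive ingredients with classical weights, to
  each of which a classical Renyi quantity is attached. A channel together with the catalyst turns one
  such decomposition into others whose values are changed by the ratio of the Renyi quantities of \<open>\<rho>\<close>
  and \<open>\<sigma>\<close>. As the catalyst is returned unchanged this can be iterated, which contradicts boundedness
  of the values if the ratio is on the wrong side of \<open>1\<close>.
\<close>

subsection \<open>Positivity of coefficients after multiplication by binomial powers\<close>

text \<open>The free-energy inequalities are closed conditions, while Polya's theorem needs open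
  ones. In the variable \<open>z = exp (\<delta> * \<alpha>)\<close> the difference of the two
  polynomials is, up to a positive factor, the difference of the power sums of order \<alpha>; its
  zeros at \<open>z = 1\<close> and \<open>z = exp \<delta>\<close> only record that both weights
  are normalized. As \<open>\<alpha> * (\<alpha> - 1)\<close> has the sign of
  \<open>(z - 1) * (z - exp \<delta>)\<close>, positivity of the quotient is strict dominance at
  every real order, the orders 0 and 1 standing for relative entropies. This dictates generators
  without singularities in the order, strictness at all orders at once, and strictly nested extreme
  likelihood ratios for orders tending to infinity in either direction.

  For necessity, the inclusion of the catalyst supports is used as an operator inequality:
  \<open>\<tau>1\<close> lies below a multiple of \<open>\<tau>2\<close>. An opposite bound may
  fail, so the divergences with exchanged arguments need an argument of their own.\<close>

lemma falling_fact:
  assumes "i \<le> k"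
  shows "(\<Prod>j<i. real k - real j) * fact (k - i) = fact k"
  using assms
proof (induction i)
  case (Suc i)
  then have e: "k - i = Suc (k - Suc i)" by simp
  have "fact (k - i) = real (k - i) * fact (k - Suc i)" unfolding e fact_Suc by (simp add: e)
  moreover have "(\<Prod>j<i. real k - real j) * fact (k - i) = fact k" using Suc by simp
  ultimately show ?case using Suc.prems by (simp add: of_nat_diff mult_ac)
qed simp

lemma falling_zero: "k < i \<Longrightarrow> (\<Prod>j<i. real k - real j) = 0"
  by (rule prod_zero) auto

text \<open>The factorials clear the denominators: the binomial coefficient becomes a polynomial in
  \<open>k\<close> and \<open>N + d - k\<close> of total degree \<open>d\<close>. Where the left
  side vanishes, one of the falling products contains the factor 0.\<close>

lemma binomial_falling:
  assumes "k \<le> N + d" "i \<le> d"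
  shows "(if i \<le> k then real (N choose (k - i)) else 0) * fact k * fact (N + d - k) =
    fact N * (\<Prod>j<i. real k - real j) * (\<Prod>j<d - i. real (N + d - k) - real j)"
proof (cases "i \<le> k \<and> k - i \<le> N")
  case True
  have "d - i \<le> N + d - k" using True assms by linarith
  from falling_fact[OF this] have 1: "(\<Prod>j<d - i. real (N + d - k) - real j) * fact (N - (k - i)) = fact (N + d - k)"
    using True assms by (simp add: algebra_simps)
  have 2: "(\<Prod>j<i. real k - real j) * fact (k - i) = fact k" using True falling_fact by blast
  have 3: "fact (k - i) * fact (N - (k - i)) * real (N choose (k - i)) = fact N"
    using True binomial_fact_lemma[of "k - i" N] by (metis of_nat_fact of_nat_mult)
  have "real (N choose (k - i)) * fact k * fact (N + d - k) =
     (fact (k - i) * fact (N - (k - i)) * real (N choose (k - i))) * (\<Prod>j<i. real k - real j) * (\<Prod>j<d - i. real (N + d - k) - real j)"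
    unfolding 1[symmetric] 2[symmetric] by (simp add: mult_ac)
  then show ?thesis unfolding 3 using True by simp
next
  case False
  then consider "k < i" | "i \<le> k" "N < k - i" by linarith
  then show ?thesis
  proof cases
    case 1
    then show ?thesis by (simp add: falling_zero)
  next
    case 2
    then have "N + d - k < d - i" using assms by linarith
    then show ?thesis using 2 by (simp add: falling_zero binomial_eq_0)
  qed
qed

lemma coeff_one_plus_power: "coeff ([:1, 1:] ^ N) k = (of_nat (N choose k) :: 'a :: comm_ring_1)"
proof (induction N arbitrary: k)
  case 0
  then show ?case by (cases k) auto
next
  case (Suc N)
  then show ?case by (cases k) (auto simp: coeff_pCons)
qed

lemma coeff_binomial_mult:
  fixes f :: "real poly"
  assumes "degree f \<le> d"
  shows "coeff ([:1, 1:] ^ N * f) k = (\<Sum>i\<le>d. coeff f i * (if i \<le> k then real (N choose (k - i)) else 0))"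
proof -
  have "coeff ([:1, 1:] ^ N * f) k = (\<Sum>i\<le>k. coeff f i * real (N choose (k - i)))"
    by (subst mult.commute) (simp add: coeff_mult coeff_one_plus_power)
  also have "\<dots> = (\<Sum>i\<in>{..max d k}. coeff f i * (if i \<le> k then real (N choose (k - i)) else 0))"
    by (rule sum.mono_neutral_cong_left) auto
  also have "\<dots> = (\<Sum>i\<le>d. coeff f i * (if i \<le> k then real (N choose (k - i)) else 0))"
    by (rule sum.mono_neutral_cong_right) (use assms in \<open>auto simp: coeff_eq_0\<close>)
  finally show ?thesis .
qed

text \<open>Homogenize \<open>f\<close> to \<open>F\<close> on the segment from 0 to 1. The
  coefficient at \<open>k\<close>, suitably rescaled, is a perturbed value of \<open>F\<close> at
  \<open>k / (N + d)\<close> in which each power is replaced by a falling product; the perturbation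
  is of order \<open>1 / (N + d)\<close> uniformly in \<open>k\<close>. The end values of
  \<open>F\<close> are the constant and the leading coefficient: the first is assumed positive, the
  second shown to be.\<close>

lemma polya_aux:
  fixes f :: "real poly"
  assumes pos: "\<And>z. z > 0 \<Longrightarrow> poly f z > 0" and f0: "coeff f 0 > 0"
  shows "\<exists>N. \<forall>k. coeff ([:1, 1:] ^ N * f) k \<ge> 0"
proof -
  define d where "d = degree f"
  have lc: "lead_coeff f > 0"
  proof (rule ccontr)
    assume "\<not> lead_coeff f > 0"
    moreover have "lead_coeff f \<noteq> 0" using f0 by auto
    ultimately have "lead_coeff (-f) > 0" by (simp add: not_less order.strict_iff_order)
    from poly_pinfty_gt_lc[OF this] obtain n where "\<forall>x\<ge>n. lead_coeff (-f) \<le> poly (-f) x" by auto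
    then have "poly (- f) (max n 1) > 0" using \<open>lead_coeff (-f) > 0\<close> by (meson max.cobounded1 less_le_trans)
    moreover have "max n 1 > 0" by (simp add: less_max_iff_disj)
    ultimately show False using pos[of "max n 1"] by simp
  qed
  define F where "F t = (\<Sum>i\<le>d. coeff f i * (t ^ i * (1 - t) ^ (d - i)))" for t :: real
  have Fpos: "F t > 0" if t: "t \<in> {0..1}" for t
  proof -
    consider "t = 0" | "t = 1" | "0 < t" "t < 1" using t unfolding atLeastAtMost_iff by linarith
    then show ?thesis
    proof cases
      case 1
      have "F t = (\<Sum>i\<le>d. if i = 0 then coeff f 0 else 0)" unfolding F_def 1 by (intro sum.cong) (auto simp: power_0_left)
      then show ?thesis using f0 by simp
    next
      case 2
      have "F t = (\<Sum>i\<le>d. if i = d then coeff f d else 0)" unfolding F_def 2 by (intro sum.cong) (auto simp: power_0_left)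
      then show ?thesis using lc by (simp add: d_def)
    next
      case 3
      have "F t = (1 - t) ^ d * poly f (t / (1 - t))" unfolding F_def poly_altdef sum_distrib_left d_def[symmetric]
      proof (rule sum.cong[OF refl])
        fix i assume "i \<in> {..d}"
        then have "(1 - t) ^ d = (1 - t) ^ i * (1 - t) ^ (d - i)" by (simp flip: power_add)
        then show "coeff f i * (t ^ i * (1 - t) ^ (d - i)) = (1 - t) ^ d * (coeff f i * (t / (1 - t)) ^ i)"
          using 3 by (simp add: power_divide)
      qed
      then show ?thesis using 3 pos[of "t / (1 - t)"] by simp
    qed
  qed
  have "continuous_on {0..1} F" unfolding F_def by (intro continuous_intros)
  from continuous_attains_inf[OF compact_Icc _ this] obtain t0 where t0: "t0 \<in> {0..1}" "\<forall>t\<in>{0..1}. F t0 \<le> F t" by auto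
  define c where "c = F t0"
  have c: "c > 0" using Fpos t0 by (auto simp: c_def)
  \<comment> \<open>\<open>S * d * d / (N + d)\<close> bounds the perturbation; \<open>N\<close> is
    taken so large that this falls below the minimum \<open>c\<close> of \<open>F\<close>.\<close>
  define S where "S = (\<Sum>i\<le>d. \<bar>coeff f i\<bar>)"
  obtain N :: nat where N: "real N > S * real d * real d / c" using reals_Archimedean2 by blast
  define M where "M = real (N + d)"
  have "S \<ge> 0" by (auto simp: S_def intro: sum_nonneg)
  then have "real N > 0" using N c by (smt (verit) divide_nonneg_pos mult_nonneg_nonneg of_nat_0_le_iff)
  then have M0: "M > 0" by (simp add: M_def)
  have err: "S * real d * real d / M < c"
  proof -
    have "S * real d * real d / c < M" using N by (simp add: M_def)
    then show ?thesis using c M0 by (simp add: field_simps)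
  qed
  have "coeff ([:1, 1:] ^ N * f) k \<ge> 0" for k
  proof (cases "k \<le> N + d")
    case False
    have "degree ([:1, 1:] ^ N * f) \<le> N + d"
      using degree_mult_le[of "[:1,1:]^N" f] degree_power_le[of "[:1,1::real:]" N] by (simp add: d_def)
    then show ?thesis using False by (simp add: coeff_eq_0)
  next
    case True
    define t where "t = real k / M"
    have t: "t \<in> {0..1}" using True M0 by (auto simp: t_def M_def divide_le_eq)
    have t1: "1 - t = real (N + d - k) / M" using True M0 by (simp add: t_def M_def of_nat_diff field_simps)
    \<comment> \<open>The monomial \<open>t ^ i * (1 - t) ^ (d - i)\<close> with its powers replaced
      by falling products, scaled by \<open>M\<close>.\<close>
    define P where "P i = (\<Prod>j<i. t - real j / M) * (\<Prod>j<d - i. (1 - t) - real j / M)" for i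
    have P: "\<bar>P i - t ^ i * (1 - t) ^ (d - i)\<bar> \<le> real d * real d / M" if i: "i \<le> d" for i
    proof -
      have bd: "\<bar>u - real j / M\<bar> \<le> 1" "\<bar>(u - real j / M) - u\<bar> \<le> real d / M" if "u \<in> {0..1}" "j < d" for u j
      proof -
        have "real j / M \<le> 1" using that M0 by (simp add: M_def divide_le_eq)
        moreover have "real j / M \<le> real d / M" "real j / M \<ge> 0" using that M0 by (simp_all add: divide_right_mono)
        ultimately show "\<bar>u - real j / M\<bar> \<le> 1" "\<bar>(u - real j / M) - u\<bar> \<le> real d / M" using that by auto
      qed
      have ut: "1 - t \<in> {0..1}" using t by auto
      have pd: "\<bar>(\<Prod>j<n. u - real j / M) - u ^ n\<bar> \<le> real n * (real d / M)" "\<bar>\<Prod>j<n. u - real j / M\<bar> \<le> 1"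
        if "u \<in> {0..1}" "n \<le> d" for u n
      proof -
        have "\<bar>(\<Prod>j<n. u - real j / M) - (\<Prod>j<n. u)\<bar> \<le> (\<Sum>j<n. \<bar>(u - real j / M) - u\<bar>)"
          using norm_prod_diff[of "{..<n}" "\<lambda>j. u - real j / M" "\<lambda>_. u"] bd(1)[OF that(1)] that by auto
        also have "\<dots> \<le> (\<Sum>j<n. real d / M)" by (intro sum_mono bd(2)) (use that in auto)
        finally show "\<bar>(\<Prod>j<n. u - real j / M) - u ^ n\<bar> \<le> real n * (real d / M)" by simp
        show "\<bar>\<Prod>j<n. u - real j / M\<bar> \<le> 1" unfolding abs_prod
          by (intro prod_le_1) (use bd(1)[OF that(1)] that in auto)
      qed
      have a: "\<bar>(1 - t) ^ (d - i)\<bar> \<le> 1" using ut by (simp add: power_le_one)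
      have "P i - t ^ i * (1 - t) ^ (d - i) =
         (\<Prod>j<i. t - real j / M) * ((\<Prod>j<d - i. (1 - t) - real j / M) - (1 - t) ^ (d - i)) +
         ((\<Prod>j<i. t - real j / M) - t ^ i) * (1 - t) ^ (d - i)" by (simp add: P_def algebra_simps)
      also have "\<bar>\<dots>\<bar> \<le> 1 * (real (d - i) * (real d / M)) + (real i * (real d / M)) * 1"
        by (intro order.trans[OF abs_triangle_ineq] add_mono; unfold abs_mult; intro mult_mono pd a)
          (use t ut i M0 in auto)
      also have "\<dots> = (real (d - i) + real i) * (real d / M)" by (simp only: distrib_right mult_1_left mult_1_right)
      also have "\<dots> = real d * real d / M" using i by (simp add: of_nat_diff)
      finally show ?thesis .
    qed
    have "\<bar>(\<Sum>i\<le>d. coeff f i * P i) - F t\<bar> = \<bar>\<Sum>i\<le>d. coeff f i * (P i - t ^ i * (1 - t) ^ (d - i))\<bar>"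
      by (simp add: F_def sum_subtractf right_diff_distrib)
    also have "\<dots> \<le> (\<Sum>i\<le>d. \<bar>coeff f i\<bar> * (real d * real d / M))"
    proof (intro order.trans[OF sum_abs] sum_mono)
      fix i assume "i \<in> {..d}"
      then show "\<bar>coeff f i * (P i - t ^ i * (1 - t) ^ (d - i))\<bar> \<le> \<bar>coeff f i\<bar> * (real d * real d / M)"
        unfolding abs_mult by (intro mult_left_mono P) auto
    qed
    also have "\<dots> = S * real d * real d / M" by (simp add: S_def sum_distrib_right sum_divide_distrib mult.assoc)
    finally have "(\<Sum>i\<le>d. coeff f i * P i) > 0" using err t t0 by (smt (verit) c_def)
    moreover have "coeff ([:1, 1:] ^ N * f) k * fact k * fact (N + d - k) = fact N * M ^ d * (\<Sum>i\<le>d. coeff f i * P i)"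
    proof -
      have "coeff ([:1, 1:] ^ N * f) k * fact k * fact (N + d - k) =
         (\<Sum>i\<le>d. coeff f i * ((if i \<le> k then real (N choose (k - i)) else 0) * fact k * fact (N + d - k)))"
        using coeff_binomial_mult[of f d N k] by (simp only: d_def sum_distrib_right mult.assoc order.refl simp_thms)
      also have "\<dots> = (\<Sum>i\<le>d. coeff f i * (fact N * M ^ d * P i))"
      proof (rule sum.cong[OF refl], rule arg_cong2[where f = "(*)", OF refl])
        fix i assume i: "i \<in> {..d}"
        have 1: "(\<Prod>j<i. real k - real j) = M ^ i * (\<Prod>j<i. t - real j / M)"
        proof -
          have "M ^ i * (\<Prod>j<i. t - real j / M) = (\<Prod>j<i. M * (t - real j / M))" by (simp add: prod.distrib)
          also have "\<dots> = (\<Prod>j<i. real k - real j)" by (intro prod.cong) (use M0 in \<open>auto simp: t_def field_simps\<close>)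
          finally show ?thesis by simp
        qed
        have 2: "(\<Prod>j<d-i. real (N + d - k) - real j) = M ^ (d-i) * (\<Prod>j<d-i. (1-t) - real j / M)"
        proof -
          have "M ^ (d-i) * (\<Prod>j<d-i. (1-t) - real j / M) = (\<Prod>j<d-i. M * ((1-t) - real j / M))" by (simp add: prod.distrib)
          also have "\<dots> = (\<Prod>j<d-i. real (N + d - k) - real j)" unfolding t1 by (intro prod.cong) (use M0 in \<open>auto simp: field_simps\<close>)
          finally show ?thesis by simp
        qed
        have "M ^ d = M ^ i * M ^ (d - i)" using i by (simp flip: power_add)
        then show "(if i \<le> k then real (N choose (k - i)) else 0) * fact k * fact (N + d - k) = fact N * M ^ d * P i"
          using i by (subst binomial_falling[OF True]) (auto simp: 1 2 P_def)
      qed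
      also have "\<dots> = fact N * M ^ d * (\<Sum>i\<le>d. coeff f i * P i)" by (simp add: sum_distrib_left mult_ac)
      finally show ?thesis .
    qed
    ultimately have "coeff ([:1, 1:] ^ N * f) k * fact k * fact (N + d - k) > 0" using M0 by simp
    then show ?thesis by (simp add: zero_less_mult_iff)
  qed
  then show ?thesis by blast
qed

text \<open>A vanishing constant coefficient is divided out as a factor of the variable, which does
  not affect signs on the positive half-line. Nonnegativity persists for larger exponents, since
  multiplication by \<open>1 + x\<close> only adds a shifted copy.\<close>

lemma polya:
  fixes f :: "real poly"
  assumes "\<And>z. z > 0 \<Longrightarrow> poly f z > 0"
  shows "\<exists>N. \<forall>n\<ge>N. \<forall>k. coeff ([:1, 1:] ^ n * f) k \<ge> 0"
proof -
  have "\<exists>N. \<forall>k. coeff ([:1, 1:] ^ N * f) k \<ge> 0" using assms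
  proof (induction f)
    case 0
    then show ?case by simp
  next
    case (pCons a f)
    show ?case
    proof (cases "a > 0")
      case True
      then show ?thesis using polya_aux[of "pCons a f"] pCons by simp
    next
      case False
      have "((\<lambda>z. poly (pCons a f) z) \<longlongrightarrow> poly (pCons a f) 0) (at_right 0)"
        by (intro tendsto_intros)
      moreover have "eventually (\<lambda>z. 0 \<le> poly (pCons a f) z) (at_right 0)"
        using pCons.prems by (auto simp: eventually_at_right_field intro!: exI[of _ 1] less_imp_le)
      ultimately have "0 \<le> poly (pCons a f) 0" by (intro tendsto_lowerbound) auto
      then have a: "a = 0" using False by simp
      have "poly f z > 0" if "z > 0" for z using pCons.prems[OF that] that by (simp add: a zero_less_mult_iff)
      then obtain N where N: "\<forall>k. coeff ([:1, 1:] ^ N * f) k \<ge> 0" using pCons.IH by auto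
      have "[:1, 1:] ^ N * pCons a f = pCons 0 ([:1, 1:] ^ N * f)" by (simp add: a mult_pCons_right)
      then show ?thesis using N by (intro exI[of _ N]) (auto simp: coeff_pCons split: nat.split)
    qed
  qed
  then obtain N where N: "\<forall>k. coeff ([:1, 1:] ^ N * f) k \<ge> 0" by blast
  have "\<forall>k. coeff ([:1, 1:] ^ n * f) k \<ge> 0" if "n \<ge> N" for n using that
  proof (induction n rule: dec_induct)
    case base
    show ?case by fact
  next
    case (step n)
    have "[:1, 1:] ^ Suc n * f = [:1, 1:] ^ n * f + pCons 0 ([:1, 1:] ^ n * f)" by (simp add: algebra_simps)
    then show ?case using step.IH by (auto simp: coeff_pCons split: nat.split)
  qed
  then show ?thesis by blast
qed

subsection \<open>Stochastic conversion of pairs of weights\<close>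

text \<open>One kernel has to treat both weights at once, as a channel acts on the state and on the
  Gibbs state. Total masses are not fixed to 1, so that unnormalized polynomial coefficients can
  serve as weights.\<close>

definition converts ::
    "'a set \<Rightarrow> ('a \<Rightarrow> real) \<Rightarrow> ('a \<Rightarrow> real) \<Rightarrow> 'b set \<Rightarrow> ('b \<Rightarrow> real) \<Rightarrow> ('b \<Rightarrow> real) \<Rightarrow> bool" where
  "converts I a b J a' b' \<longleftrightarrow> (\<exists>T.
     (\<forall>x\<in>I. (\<forall>y\<in>J. 0 \<le> T x y) \<and> (\<Sum>y\<in>J. T x y) = 1) \<and>
     (\<forall>y\<in>J. (\<Sum>x\<in>I. a x * T x y) = a' y \<and> (\<Sum>x\<in>I. b x * T x y) = b' y))"

lemma convertsI:
  assumes "\<And>x y. x \<in> I \<Longrightarrow> y \<in> J \<Longrightarrow> 0 \<le> T x y" "\<And>x. x \<in> I \<Longrightarrow> (\<Sum>y\<in>J. T x y) = 1"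
    "\<And>y. y \<in> J \<Longrightarrow> (\<Sum>x\<in>I. a x * T x y) = a' y" "\<And>y. y \<in> J \<Longrightarrow> (\<Sum>x\<in>I. b x * T x y) = b' y"
  shows "converts I a b J a' b'"
  unfolding converts_def using assms by blast

lemma convertsE:
  assumes "converts I a b J a' b'"
  obtains T where "\<And>x y. x \<in> I \<Longrightarrow> y \<in> J \<Longrightarrow> 0 \<le> T x y" "\<And>x. x \<in> I \<Longrightarrow> (\<Sum>y\<in>J. T x y) = 1"
    "\<And>y. y \<in> J \<Longrightarrow> (\<Sum>x\<in>I. a x * T x y) = a' y" "\<And>y. y \<in> J \<Longrightarrow> (\<Sum>x\<in>I. b x * T x y) = b' y"
  using assms unfolding converts_def by blast

lemma converts_cong:
  assumes "\<And>x. x \<in> I \<Longrightarrow> a x = c x" "\<And>x. x \<in> I \<Longrightarrow> b x = d x"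
    "\<And>y. y \<in> J \<Longrightarrow> a' y = c' y" "\<And>y. y \<in> J \<Longrightarrow> b' y = d' y"
  shows "converts I a b J a' b' \<longleftrightarrow> converts I c d J c' d'"
  unfolding converts_def using assms by (simp cong: sum.cong)

lemma converts_refl: "finite I \<Longrightarrow> converts I a b I a b"
  by (rule convertsI[where T = "\<lambda>x y. if x = y then 1 else 0"]) (auto simp: if_distrib cong: if_cong)

lemma converts_trans:
  assumes "finite J" "converts I a b J a' b'" "converts J a' b' K a'' b''"
  shows "converts I a b K a'' b''"
proof -
  obtain T where T: "\<And>x y. x \<in> I \<Longrightarrow> y \<in> J \<Longrightarrow> 0 \<le> T x y" "\<And>x. x \<in> I \<Longrightarrow> (\<Sum>y\<in>J. T x y) = 1"
    "\<And>y. y \<in> J \<Longrightarrow> (\<Sum>x\<in>I. a x * T x y) = a' y" "\<And>y. y \<in> J \<Longrightarrow> (\<Sum>x\<in>I. b x * T x y) = b' y"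
    using assms(2) by (rule convertsE) blast
  obtain S where S: "\<And>x y. x \<in> J \<Longrightarrow> y \<in> K \<Longrightarrow> 0 \<le> S x y" "\<And>x. x \<in> J \<Longrightarrow> (\<Sum>y\<in>K. S x y) = 1"
    "\<And>y. y \<in> K \<Longrightarrow> (\<Sum>x\<in>J. a' x * S x y) = a'' y" "\<And>y. y \<in> K \<Longrightarrow> (\<Sum>x\<in>J. b' x * S x y) = b'' y"
    using assms(3) by (rule convertsE) blast
  have push: "(\<Sum>x\<in>I. u x * (\<Sum>y\<in>J. T x y * S y z)) = (\<Sum>y\<in>J. (\<Sum>x\<in>I. u x * T x y) * S y z)" for u z
    unfolding sum_distrib_left sum_distrib_right mult.assoc by (rule sum.swap)
  show ?thesis
  proof (rule convertsI[where T = "\<lambda>x z. \<Sum>y\<in>J. T x y * S y z"])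
    fix x assume x: "x \<in> I"
    have "(\<Sum>z\<in>K. \<Sum>y\<in>J. T x y * S y z) = (\<Sum>y\<in>J. T x y * (\<Sum>z\<in>K. S y z))"
      unfolding sum_distrib_left by (rule sum.swap)
    then show "(\<Sum>z\<in>K. \<Sum>y\<in>J. T x y * S y z) = 1" using S T x by simp
  qed (use T S in \<open>auto simp: push intro!: sum_nonneg mult_nonneg_nonneg\<close>)
qed

lemma converts_scale:
  assumes "converts I a b J a' b'"
  shows "converts I (\<lambda>x. u * a x) (\<lambda>x. v * b x) J (\<lambda>y. u * a' y) (\<lambda>y. v * b' y)"
  using assms unfolding converts_def by (simp add: mult.assoc flip: sum_distrib_left) blast

lemma converts_tensor:
  assumes "converts I a b J a' b'" "finite C" "finite I" "finite J"
  shows "converts (I \<times> C) (\<lambda>(x, c). a x * r c) (\<lambda>(x, c). b x * s c)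
    (J \<times> C) (\<lambda>(x, c). a' x * r c) (\<lambda>(x, c). b' x * s c)"
proof -
  obtain T where T: "\<And>x y. x \<in> I \<Longrightarrow> y \<in> J \<Longrightarrow> 0 \<le> T x y" "\<And>x. x \<in> I \<Longrightarrow> (\<Sum>y\<in>J. T x y) = 1"
    "\<And>y. y \<in> J \<Longrightarrow> (\<Sum>x\<in>I. a x * T x y) = a' y" "\<And>y. y \<in> J \<Longrightarrow> (\<Sum>x\<in>I. b x * T x y) = b' y"
    using assms(1) by (rule convertsE) blast
  have *: "(\<Sum>x\<in>I. \<Sum>c\<in>C. u x * v c * (if c = c' then T x y else 0)) = (\<Sum>x\<in>I. u x * T x y) * v c'"
    if "c' \<in> C" for u v y c'
  proof -
    have "(\<Sum>c\<in>C. u x * v c * (if c = c' then T x y else 0)) = u x * T x y * v c'" for x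
      using assms(2) that by (simp add: if_distrib cong: if_cong)
    then show ?thesis by (simp add: sum_distrib_right)
  qed
  show ?thesis
  proof (rule convertsI[where T = "\<lambda>(x, c) (y, c'). if c = c' then T x y else 0"])
    fix xc assume "xc \<in> I \<times> C"
    then obtain x c where xc: "xc = (x, c)" "x \<in> I" "c \<in> C" by auto
    have "(\<Sum>y\<in>J \<times> C. (case xc of (x, c) \<Rightarrow> \<lambda>(y, c'). if c = c' then T x y else 0) y) = (\<Sum>y\<in>J. \<Sum>c'\<in>C. if c = c' then T x y else 0)"
      by (simp add: xc sum.cartesian_product case_prod_unfold cong: if_cong)
    then show "(\<Sum>y\<in>J \<times> C. (case xc of (x, c) \<Rightarrow> \<lambda>(y, c'). if c = c' then T x y else 0) y) = 1"
      using assms xc T by simp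
  next
    fix yc assume "yc \<in> J \<times> C"
    then obtain y c where yc: "yc = (y, c)" "y \<in> J" "c \<in> C" by auto
    have "(\<Sum>xc\<in>I \<times> C. (case xc of (x, c) \<Rightarrow> u x * v c) * (case xc of (x, c) \<Rightarrow> \<lambda>(y, c'). if c = c' then T x y else 0) yc)
       = (\<Sum>x\<in>I. \<Sum>c'\<in>C. u x * v c' * (if c' = c then T x y else 0))" for u v
      by (simp add: yc sum.cartesian_product case_prod_unfold cong: if_cong)
    then show "(\<Sum>xc\<in>I \<times> C. (case xc of (x, c) \<Rightarrow> a x * r c) * (case xc of (x, c) \<Rightarrow> \<lambda>(y, c'). if c = c' then T x y else 0) yc)
       = (case yc of (y, c) \<Rightarrow> a' y * r c)"
     "(\<Sum>xc\<in>I \<times> C. (case xc of (x, c) \<Rightarrow> b x * s c) * (case xc of (x, c) \<Rightarrow> \<lambda>(y, c'). if c = c' then T x y else 0) yc)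
       = (case yc of (y, c) \<Rightarrow> b' y * s c)"
      using yc T by (simp_all add: *)
  qed (auto simp: T)
qed

lemma converts_push:
  assumes "finite I" "finite J" "f \<in> I \<rightarrow> J"
  shows "converts I a b J (\<lambda>y. \<Sum>x | x \<in> I \<and> f x = y. a x) (\<lambda>y. \<Sum>x | x \<in> I \<and> f x = y. b x)"
proof (rule convertsI[where T = "\<lambda>x y. if f x = y then 1 else 0"])
  have *: "(\<Sum>x\<in>I. u x * (if f x = y then 1 else 0)) = (\<Sum>x | x \<in> I \<and> f x = y. u x)" for u :: "_ \<Rightarrow> real" and y
  proof -
    have "(\<Sum>x\<in>I. u x * (if f x = y then 1 else 0)) = (\<Sum>x\<in>I. if f x = y then u x else 0)" by (rule sum.cong) auto
    also have "\<dots> = (\<Sum>x\<in>I \<inter> {x. f x = y}. u x)" by (simp add: sum.inter_restrict[OF assms(1)]) 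
    finally show ?thesis by (simp add: Int_def)
  qed
  show "(\<Sum>x\<in>I. a x * (if f x = y then 1 else 0)) = (\<Sum>x | x \<in> I \<and> f x = y. a x)" for y by (rule *)
  show "(\<Sum>x\<in>I. b x * (if f x = y then 1 else 0)) = (\<Sum>x | x \<in> I \<and> f x = y. b x)" for y by (rule *)
qed (use assms in auto)

text \<open>Coarse-graining is reversible when it only merges points with equal likelihood ratio.\<close>

lemma converts_refine:
  assumes fin: "finite I" "finite J" and f: "f \<in> I \<rightarrow> J" and ne: "I \<noteq> {}"
    and b: "\<And>x. x \<in> I \<Longrightarrow> b x \<ge> 0" and B: "\<And>y. y \<in> J \<Longrightarrow> (\<Sum>x | x \<in> I \<and> f x = y. b x) = B y"
    and a: "\<And>x. x \<in> I \<Longrightarrow> a x = \<rho> (f x) * b x"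
  shows "converts J (\<lambda>y. \<rho> y * B y) B I a b"
proof -
  obtain x0 where x0: "x0 \<in> I" using ne by blast
  \<comment> \<open>The conditional distribution of \<open>b\<close> within a fibre; a fibre of
    weight 0 is sent to \<open>x0\<close> to keep the kernel stochastic.\<close>
  define T where "T y x = (if B y = 0 then (if x = x0 then 1 else 0) else if f x = y then b x / B y else 0)" for y x
  have B0: "B y \<ge> 0" if "y \<in> J" for y using B[OF that] b by (metis (mono_tags, lifting) mem_Collect_eq sum_nonneg)
  show ?thesis
  proof (rule convertsI[where T = T])
    show "0 \<le> T y x" if "y \<in> J" "x \<in> I" for y x using b[OF that(2)] B0[OF that(1)] by (simp add: T_def)
  next
    fix y assume y: "y \<in> J"
    have "(\<Sum>x\<in>I. if f x = y then b x / B y else 0) = (\<Sum>x\<in>I \<inter> {x. f x = y}. b x / B y)"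
      by (simp add: sum.inter_restrict[OF fin(1)])
    also have "\<dots> = B y / B y" using B[OF y] by (simp add: Int_def flip: sum_divide_distrib)
    finally show "(\<Sum>x\<in>I. T y x) = 1" using fin x0 by (cases "B y = 0") (simp_all add: T_def)
  next
    fix x assume x: "x \<in> I"
    then have fx: "f x \<in> J" using f by auto
    have b0: "b x = 0" if "B (f x) = 0"
    proof -
      have "(\<Sum>x' | x' \<in> I \<and> f x' = f x. b x') = 0" using B[OF fx] that by simp
      then show ?thesis using fin x b by (subst (asm) sum_nonneg_eq_0_iff) auto
    qed
    have BT: "B y * T y x = (if y = f x then b x else 0)" for y
      using b0 by (auto simp: T_def)
    have *: "(\<Sum>y\<in>J. u y * (B y * T y x)) = u (f x) * b x" for u
      unfolding BT using fin fx by (simp add: if_distrib cong: if_cong)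
    show "(\<Sum>y\<in>J. \<rho> y * B y * T y x) = a x" "(\<Sum>y\<in>J. B y * T y x) = b x"
      using *[of \<rho>] *[of "\<lambda>_. 1"] a[OF x] by (simp_all add: mult.assoc)
  qed
qed

section \<open>Moves of mass between neighbouring lattice sites\<close>

lemma converts_birth_death:
  fixes G H u v :: "nat \<Rightarrow> real"
  assumes nonneg: "\<And>k. k \<le> n \<Longrightarrow> 0 \<le> u k \<and> 0 \<le> v k \<and> u k + v k \<le> 1" and ends: "v 0 = 0" "u n = 0"
  shows "converts {..n} G H {..n}
     (\<lambda>k. G k * (1 - u k - v k) + (if k = 0 then 0 else G (k - 1) * u (k - 1)) + (if k = n then 0 else G (Suc k) * v (Suc k)))
     (\<lambda>k. H k * (1 - u k - v k) + (if k = 0 then 0 else H (k - 1) * u (k - 1)) + (if k = n then 0 else H (Suc k) * v (Suc k)))"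
proof (rule convertsI[where T = "\<lambda>k l. (if l = k then 1 - u k - v k else 0) + (if l = Suc k then u k else 0) + (if Suc l = k then v k else 0)"])
  have *: "(\<Sum>x\<le>n. G x * ((if y = x then 1 - u x - v x else 0) + (if y = Suc x then u x else 0) + (if Suc y = x then v x else 0))) =
    G y * (1 - u y - v y) + (if y = 0 then 0 else G (y - 1) * u (y - 1)) + (if y = n then 0 else G (Suc y) * v (Suc y))"
    if "y \<in> {..n}" for y and G :: "nat \<Rightarrow> real"
  proof -
    have "(\<Sum>x\<le>n. G x * (if y = Suc x then u x else 0)) = (if y = 0 then 0 else G (y - 1) * u (y - 1))"
    proof (cases y)
      case (Suc y')
      then show ?thesis using that by (simp add: if_distrib cong: if_cong)
    qed simp
    moreover have "(\<Sum>x\<le>n. G x * (if y = x then 1 - u x - v x else 0)) = G y * (1 - u y - v y)"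
      using that by (simp add: if_distrib cong: if_cong)
    moreover have "(\<Sum>x\<le>n. G x * (if Suc y = x then v x else 0)) = (if y = n then 0 else G (Suc y) * v (Suc y))"
      using that by (simp add: if_distrib cong: if_cong) 
    ultimately show ?thesis by (simp only: distrib_left sum.distrib)
  qed
  note * = *
  show "(\<Sum>x\<le>n. G x * ((if y = x then 1 - u x - v x else 0) + (if y = Suc x then u x else 0) + (if Suc y = x then v x else 0))) =
    G y * (1 - u y - v y) + (if y = 0 then 0 else G (y - 1) * u (y - 1)) + (if y = n then 0 else G (Suc y) * v (Suc y))"
    if "y \<in> {..n}" for y using that by (rule *)
  show "(\<Sum>x\<le>n. H x * ((if y = x then 1 - u x - v x else 0) + (if y = Suc x then u x else 0) + (if Suc y = x then v x else 0))) =
    H y * (1 - u y - v y) + (if y = 0 then 0 else H (y - 1) * u (y - 1)) + (if y = n then 0 else H (Suc y) * v (Suc y))"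
    if "y \<in> {..n}" for y using that by (rule *)
  fix x assume x: "x \<in> {..n}"
  have "(\<Sum>y\<le>n. if Suc y = x then v x else 0) = v x"
  proof (cases x)
    case 0
    then show ?thesis using ends by simp
  next
    case (Suc x')
    then show ?thesis using x by simp
  qed
  moreover have "(\<Sum>y\<le>n. if y = Suc x then u x else 0) = u x"
    using x ends by (cases "x = n") auto
  moreover have "(\<Sum>y\<le>n. if y = x then 1 - u x - v x else 0) = 1 - u x - v x" using x by simp
  ultimately show "(\<Sum>y\<le>n. (if y = x then 1 - u x - v x else 0) + (if y = Suc x then u x else 0) + (if Suc y = x then v x else 0)) = 1"
    by (simp add: sum.distrib)
qed (use nonneg in \<open>auto simp: add_nonneg_nonneg algebra_simps\<close>)

text \<open>The likelihood ratio at lattice site \<open>k\<close> and catalyst position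
  \<open>m\<close> will depend only on \<open>k + m\<close>, so the relevant coarse-graining sums
  over antidiagonals. This is a convolution with binomial coefficients, that is, multiplication by a
  power of \<open>1 + x\<close>.\<close>

lemma sum_binomial_coarse:
  fixes w :: "real poly"
  assumes "degree w \<le> b"
  shows "(\<Sum>p | p \<in> {..b} \<times> {..N} \<and> fst p + snd p = l. coeff w (fst p) * real (N choose snd p)) =
    coeff ([:1, 1:] ^ N * w) l"
proof -
  have "coeff ([:1, 1:] ^ N * w) l = (\<Sum>k\<le>b. coeff w k * (if k \<le> l then real (N choose (l - k)) else 0))"
    by (rule coeff_binomial_mult[OF assms])
  also have "\<dots> = (\<Sum>k | k \<le> b \<and> k \<le> l \<and> l - k \<le> N. coeff w k * real (N choose (l - k)))"
    by (rule sum.mono_neutral_cong_right) (auto simp: binomial_eq_0)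
  also have "\<dots> = (\<Sum>p | p \<in> {..b} \<times> {..N} \<and> fst p + snd p = l. coeff w (fst p) * real (N choose snd p))"
    by (rule sum.reindex_bij_witness[where i = fst and j = "\<lambda>k. (k, l - k)"]) auto
  finally show ?thesis by simp
qed

text \<open>The factor \<open>[:-1, 1:] * [:-x, 1:]\<close> reflects that a move of mass from two neighbouring lattice
  sites to the site between them must preserve both distributions.\<close>

lemma lattice_step:
  fixes w1 w2 f :: "real poly" and x c :: real
  assumes x: "x > 0" and deg: "degree w1 \<le> b" "degree w2 \<le> b"
    and w1: "\<And>k. coeff w1 k \<ge> 0" and w2: "\<And>k. coeff w2 k \<ge> 0"
    and diff: "w1 - w2 = [:-1, 1:] * [:-x, 1:] * f"
    and W1: "\<And>k. k \<le> b + N \<Longrightarrow> coeff ([:1, 1:] ^ N * w1) k > 0"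
    and W2: "\<And>k. k \<le> b + N \<Longrightarrow> coeff ([:1, 1:] ^ N * w2) k > 0"
    and F: "\<And>k. coeff ([:1, 1:] ^ N * f) k \<ge> 0"
    and small: "\<And>k. k \<le> b + N \<Longrightarrow>
      (if 2 \<le> k then coeff ([:1, 1:] ^ N * f) (k - 2) else 0) + x * coeff ([:1, 1:] ^ N * f) k \<le> coeff ([:1, 1:] ^ N * w1) k"
  shows "converts ({..b} \<times> {..N})
    (\<lambda>(k, m). c * x ^ k * coeff w1 k * (real (N choose m) * x ^ m)) (\<lambda>(k, m). coeff w1 k * real (N choose m))
    ({..b} \<times> {..N})
    (\<lambda>(k, m). c * x ^ k * coeff w2 k * (real (N choose m) * x ^ m)) (\<lambda>(k, m). coeff w2 k * real (N choose m))"
proof -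
  define n where "n = b + N"
  define Fc where "Fc k = coeff ([:1, 1:] ^ N * f) k" for k
  define Fd where "Fd k = (if 2 \<le> k then Fc (k - 2) else 0)" for k
  define V1 where "V1 k = coeff ([:1, 1:] ^ N * w1) k" for k
  define V2 where "V2 k = coeff ([:1, 1:] ^ N * w2) k" for k
  have V1pos: "V1 k > 0" and V2pos: "V2 k > 0" if "k \<le> n" for k using W1[of k] W2[of k] that by (auto simp: V1_def V2_def n_def)
  have Fpos: "Fc k \<ge> 0" "Fd k \<ge> 0" for k using F by (auto simp: Fc_def Fd_def)
  have sm: "Fd k + x * Fc k \<le> V1 k" if "k \<le> n" for k using small[of k] that by (auto simp: Fd_def Fc_def V1_def n_def)
  \<comment> \<open>A nonzero \<open>f\<close> has degree at most \<open>b - 2\<close>, hence the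
    flow coefficients vanish from site \<open>n - 1\<close> on and no mass is pushed past the top
    site \<open>n\<close>.\<close>
  have FN: "Fc k = 0" if "k + 1 \<ge> n" for k
  proof (cases "f = 0")
    case False
    have "degree (w1 - w2) \<le> b" using deg by (rule degree_diff_le)
    moreover have "degree (w1 - w2) = degree f + 2"
    proof -
      have "[:-1, 1:] * [:-x, 1:] = [:x, - x - 1, 1:]" by simp
      then show ?thesis unfolding diff using False degree_mult_eq[of "[:x, - x - 1, 1:]" f] by simp
    qed
    moreover have "degree ([:1, 1:] ^ N * f) = N + degree f" using False by (simp add: degree_mult_eq degree_power_eq)
    ultimately show ?thesis using that by (intro coeff_eq_0[of "[:1, 1:] ^ N * f" k, folded Fc_def]) (auto simp: n_def)
  qed (simp add: Fc_def)
  have rec: "V1 k - V2 k = Fd k - (if k = 0 then 0 else (1 + x) * Fc (k - 1)) + x * Fc k" for k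
  proof -
    have "[:1, 1:] ^ N * w1 - [:1, 1:] ^ N * w2 = [:1, 1:] ^ N * (w1 - w2)" by (simp add: algebra_simps)
    also have "\<dots> = [:x, -(1+x), 1:] * ([:1, 1:] ^ N * f)"
      unfolding diff by (simp add: algebra_simps)
    also have "\<dots> = smult x ([:1, 1:] ^ N * f) + pCons 0 (smult (-(1+x)) ([:1, 1:] ^ N * f) + pCons 0 ([:1, 1:] ^ N * f))"
      by (simp add: algebra_simps)
    finally have e: "[:1, 1:] ^ N * w1 - [:1, 1:] ^ N * w2 = \<dots>" .
    have "V1 k - V2 k = coeff ([:1, 1:] ^ N * w1 - [:1, 1:] ^ N * w2) k" by (simp add: V1_def V2_def)
    also have "\<dots> = Fd k - (if k = 0 then 0 else (1 + x) * Fc (k - 1)) + x * Fc k" unfolding e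
      by (auto simp: Fd_def Fc_def coeff_pCons numeral_2_eq_2 algebra_simps split: nat.split)
    finally show ?thesis .
  qed
  have coarse: "(\<Sum>p | p \<in> {..b} \<times> {..N} \<and> fst p + snd p = l. coeff w (fst p) * real (N choose snd p)) = coeff ([:1, 1:] ^ N * w) l"
    "(\<Sum>p | p \<in> {..b} \<times> {..N} \<and> fst p + snd p = l. c * x ^ fst p * coeff w (fst p) * (real (N choose snd p) * x ^ snd p)) = c * x ^ l * coeff ([:1, 1:] ^ N * w) l"
    if "degree w \<le> b" for w l
  proof -
    show 1: "(\<Sum>p | p \<in> {..b} \<times> {..N} \<and> fst p + snd p = l. coeff w (fst p) * real (N choose snd p)) = coeff ([:1, 1:] ^ N * w) l"
      using that by (rule sum_binomial_coarse)
    have "(\<Sum>p | p \<in> {..b} \<times> {..N} \<and> fst p + snd p = l. c * x ^ fst p * coeff w (fst p) * (real (N choose snd p) * x ^ snd p)) =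
      (\<Sum>p | p \<in> {..b} \<times> {..N} \<and> fst p + snd p = l. c * x ^ l * (coeff w (fst p) * real (N choose snd p)))"
      by (rule sum.cong) (auto simp: power_add)
    then show "(\<Sum>p | p \<in> {..b} \<times> {..N} \<and> fst p + snd p = l. c * x ^ fst p * coeff w (fst p) * (real (N choose snd p) * x ^ snd p)) = c * x ^ l * coeff ([:1, 1:] ^ N * w) l"
      using 1 by (simp flip: sum_distrib_left)
  qed
  have fn: "(\<lambda>p. fst p + snd p) \<in> {..b} \<times> {..N} \<rightarrow> {..n}" by (auto simp: n_def)
  have A: "converts ({..b} \<times> {..N})
    (\<lambda>(k, m). c * x ^ k * coeff w1 k * (real (N choose m) * x ^ m)) (\<lambda>(k, m). coeff w1 k * real (N choose m))
    {..n} (\<lambda>l. c * x ^ l * V1 l) V1"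
    using converts_push[OF _ _ fn, of "\<lambda>(k, m). c * x ^ k * coeff w1 k * (real (N choose m) * x ^ m)" "\<lambda>(k, m). coeff w1 k * real (N choose m)"]
    by (simp add: case_prod_unfold coarse[OF deg(1)] flip: V1_def)
  \<comment> \<open>Site \<open>k + 1\<close> receives \<open>x * Fc k\<close> from site
    \<open>k\<close> and \<open>Fc k\<close> from site \<open>k + 2\<close>. In the second weight
    this makes \<open>(1 + x) * Fc k\<close>. In the first, where site \<open>j\<close> carries the
    ratio \<open>c * x ^ j\<close>, it is the same amount times the ratio of site
    \<open>k + 1\<close>, because
    \<open>x ^ k * x + x ^ (k + 2) = x ^ (k + 1) * (1 + x)\<close>.\<close>
  define u where "u k = x * Fc k / V1 k" for k
  define v where "v k = Fd k / V1 k" for k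
  have flows: "V1 k * u k = x * Fc k" "V1 k * v k = Fd k" if "k \<le> n" for k
    using V1pos[OF that] by (auto simp: u_def v_def)
  have B: "converts {..n} (\<lambda>l. c * x ^ l * V1 l) V1 {..n} (\<lambda>l. c * x ^ l * V2 l) V2"
  proof -
    have h: "V1 k * (1 - u k - v k) + (if k = 0 then 0 else V1 (k - 1) * u (k - 1)) + (if k = n then 0 else V1 (Suc k) * v (Suc k)) = V2 k"
      if k: "k \<le> n" for k
    proof -
      have "(if k = n then 0 else V1 (Suc k) * v (Suc k)) = (if k = 0 then 0 else Fc (k - 1))"
        using k flows(2)[of "Suc k"] FN[of "k - 1"] by (auto simp: Fd_def)
      moreover have "(if k = 0 then 0 else V1 (k - 1) * u (k - 1)) = (if k = 0 then 0 else x * Fc (k - 1))"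
        using k flows(1)[of "k - 1"] by auto
      moreover have "V1 k * (1 - u k - v k) = V1 k - x * Fc k - Fd k" using flows[OF k] by (simp add: algebra_simps)
      ultimately show ?thesis using rec[of k] by (auto simp: algebra_simps split: if_splits)
    qed
    have g: "c * x ^ k * V1 k * (1 - u k - v k) + (if k = 0 then 0 else c * x ^ (k - 1) * V1 (k - 1) * u (k - 1)) + (if k = n then 0 else c * x ^ Suc k * V1 (Suc k) * v (Suc k)) = c * x ^ k * V2 k"
      if k: "k \<le> n" for k
    proof -
      have e1: "(if k = n then 0 else c * x ^ Suc k * V1 (Suc k) * v (Suc k)) = (if k = 0 then 0 else c * x ^ k * x * Fc (k - 1))"
        using k flows(2)[of "Suc k"] FN[of "k - 1"] by (auto simp: Fd_def mult.assoc)
      have e2: "(if k = 0 then 0 else c * x ^ (k - 1) * V1 (k - 1) * u (k - 1)) = (if k = 0 then 0 else c * x ^ k * Fc (k - 1))"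
      proof (cases k)
        case (Suc k')
        then show ?thesis using k flows(1)[of k'] by (simp add: mult.assoc)
      qed simp
      have "c * x ^ k * V1 k * (1 - u k - v k) = c * x ^ k * (V1 k - V1 k * u k - V1 k * v k)" by (simp add: algebra_simps)
      then have e3: "c * x ^ k * V1 k * (1 - u k - v k) = c * x ^ k * (V1 k - x * Fc k - Fd k)" unfolding flows[OF k] .
      have e4: "V2 k = V1 k - x * Fc k - Fd k + (if k = 0 then 0 else (1 + x) * Fc (k - 1))" using rec[of k] by simp
      show ?thesis unfolding e1 e2 e3 e4 by (simp add: algebra_simps)
    qed
    have "converts {..n} (\<lambda>l. c * x ^ l * V1 l) V1 {..n}
       (\<lambda>k. c * x ^ k * V1 k * (1 - u k - v k) + (if k = 0 then 0 else c * x ^ (k - 1) * V1 (k - 1) * u (k - 1)) + (if k = n then 0 else c * x ^ Suc k * V1 (Suc k) * v (Suc k)))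
       (\<lambda>k. V1 k * (1 - u k - v k) + (if k = 0 then 0 else V1 (k - 1) * u (k - 1)) + (if k = n then 0 else V1 (Suc k) * v (Suc k)))"
    proof (rule converts_birth_death)
      fix k assume k: "k \<le> n"
      have "u k + v k = (Fd k + x * Fc k) / V1 k" by (simp add: u_def v_def add_divide_distrib)
      then show "0 \<le> u k \<and> 0 \<le> v k \<and> u k + v k \<le> 1"
        using V1pos[OF k] sm[OF k] Fpos x by (auto simp: u_def v_def less_imp_le)
    qed (use FN in \<open>auto simp: u_def v_def Fd_def\<close>)
    then show ?thesis by (subst (asm) converts_cong[OF refl refl g h]) auto
  qed
  have C: "converts {..n} (\<lambda>l. c * x ^ l * V2 l) V2 ({..b} \<times> {..N})
    (\<lambda>(k, m). c * x ^ k * coeff w2 k * (real (N choose m) * x ^ m)) (\<lambda>(k, m). coeff w2 k * real (N choose m))"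
    by (rule converts_refine[OF _ _ fn])
      (use w2 in \<open>auto simp: case_prod_unfold coarse[OF deg(2)] power_add V2_def\<close>)
  show ?thesis by (rule converts_trans[OF _ A converts_trans[OF _ B C]]) simp_all
qed

text \<open>A single step needs its flow to be smaller than the mass present at each coarse site.
  The segment from \<open>w\<close> to \<open>w'\<close> is therefore cut into \<open>M\<close>
  equal pieces; all intermediate polynomials stay above a fixed multiple of \<open>w\<close>, so one
  \<open>M\<close> works for all of them, and one catalyst serves all steps because each step
  returns it.\<close>

lemma lattice_catalysis:
  fixes w w' f :: "real poly" and x c \<kappa> :: real
  assumes x: "x > 0" and deg: "degree w = b" "degree w' \<le> b"
    and w: "\<And>k. coeff w k \<ge> 0" "coeff w 0 > 0"
    and \<kappa>: "\<kappa> > 0" "\<And>k. coeff w' k \<ge> \<kappa> * coeff w k"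
    and diff: "w - w' = [:-1, 1:] * [:-x, 1:] * f"
    and f: "\<And>z. z > 0 \<Longrightarrow> poly f z > 0"
  shows "\<exists>N. converts ({..b} \<times> {..N})
    (\<lambda>(k, m). c * x ^ k * coeff w k * (real (N choose m) * x ^ m)) (\<lambda>(k, m). coeff w k * real (N choose m))
    ({..b} \<times> {..N})
    (\<lambda>(k, m). c * x ^ k * coeff w' k * (real (N choose m) * x ^ m)) (\<lambda>(k, m). coeff w' k * real (N choose m))"
proof -
  \<comment> \<open>\<open>N \<ge> b\<close> makes all coarse masses up to site \<open>b + N\<close>
    positive: the two end coefficients of \<open>w\<close>, spread over \<open>N + 1\<close>
    consecutive sites each, leave no gap even if inner coefficients vanish.\<close>
  obtain N where N: "N \<ge> b" "\<And>k. coeff ([:1, 1:] ^ N * f) k \<ge> 0"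
    using polya[OF f] by (metis nle_le)
  define \<mu> where "\<mu> = min \<kappa> 1"
  have \<mu>: "0 < \<mu>" "\<mu> \<le> 1" "\<And>k. coeff w' k \<ge> \<mu> * coeff w k"
    using \<kappa> w(1) by (auto simp: \<mu>_def intro: order.trans[OF mult_right_mono \<kappa>(2)])
  have lc: "coeff w b > 0"
    using w(1)[of b] w(2) deg(1) by (metis coeff_0 leading_coeff_0_iff less_eq_real_def order_less_irrefl)
  define W where "W k = coeff ([:1, 1:] ^ N * w) k" for k
  have W: "W k > 0" if k: "k \<le> b + N" for k
  proof -
    have e: "W k = (\<Sum>i\<le>b. coeff w i * (if i \<le> k then real (N choose (k - i)) else 0))"
      unfolding W_def by (rule coeff_binomial_mult) (simp add: deg)
    define i where "i = (if k \<le> N then 0 else b)"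
    have "0 < coeff w i * (if i \<le> k then real (N choose (k - i)) else 0)"
      using k N lc w(2) by (auto simp: i_def)
    moreover have "i \<in> {..b}" by (auto simp: i_def)
    ultimately show ?thesis unfolding e by (intro sum_pos2[of _ i]) (use w(1) in auto)
  qed
  define Fl where "Fl k = (if 2 \<le> k then coeff ([:1, 1:] ^ N * f) (k - 2) else 0) + x * coeff ([:1, 1:] ^ N * f) k" for k
  have Fl: "Fl k \<ge> 0" for k using N x by (auto simp: Fl_def)
  obtain M :: nat where M: "real M > (\<Sum>k\<le>b + N. Fl k / (\<mu> * W k))" using reals_Archimedean2 by blast
  have bound: "Fl k \<le> real M * (\<mu> * W k)" if "k \<le> b + N" for k
  proof -
    have "Fl k / (\<mu> * W k) \<le> (\<Sum>k\<le>b + N. Fl k / (\<mu> * W k))"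
      by (rule member_le_sum) (use that Fl W \<mu> in \<open>auto intro!: divide_nonneg_pos\<close>)
    then have "Fl k / (\<mu> * W k) \<le> real M" using M by simp
    then show ?thesis using W[OF that] \<mu> by (simp add: pos_divide_le_eq)
  qed
  have "(\<Sum>k\<le>b + N. Fl k / (\<mu> * W k)) \<ge> 0" by (intro sum_nonneg divide_nonneg_pos) (use Fl W \<mu> in auto)
  then have M0: "real M > 0" using M by linarith
  define wt where "wt t = w - smult (real t / real M) (w - w')" for t
  have wt: "coeff (wt t) k \<ge> \<mu> * coeff w k" if "t \<le> M" for t k
  proof -
    define s where "s = real t / real M"
    have s: "0 \<le> s" "s \<le> 1" using that M0 by (auto simp: s_def)
    have "\<mu> * coeff w k = (1 - s) * (\<mu> * coeff w k) + s * (\<mu> * coeff w k)" by (simp add: algebra_simps)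
    also have "\<dots> \<le> (1 - s) * coeff w k + s * coeff w' k"
      by (intro add_mono mult_left_mono) (use s \<mu> w in \<open>auto intro: mult_left_le_one_le\<close>)
    also have "\<dots> = coeff (wt t) k" by (simp add: wt_def s_def[symmetric] algebra_simps)
    finally show ?thesis .
  qed
  have degt: "degree (wt t) \<le> b" for t
    unfolding wt_def by (intro degree_diff_le order.trans[OF degree_smult_le]) (use deg in \<open>auto intro: degree_diff_le\<close>)
  have Wt: "coeff ([:1, 1:] ^ N * wt t) k \<ge> \<mu> * W k" if "t \<le> M" for t k
  proof -
    have "\<mu> * W k = (\<Sum>i\<le>b. (\<mu> * coeff w i) * (if i \<le> k then real (N choose (k - i)) else 0))"
      unfolding W_def by (subst coeff_binomial_mult[of w b]) (simp_all add: deg sum_distrib_left mult_ac)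
    also have "\<dots> \<le> (\<Sum>i\<le>b. coeff (wt t) i * (if i \<le> k then real (N choose (k - i)) else 0))"
      by (intro sum_mono mult_right_mono wt that) auto
    also have "\<dots> = coeff ([:1, 1:] ^ N * wt t) k" by (simp add: coeff_binomial_mult[OF degt])
    finally show ?thesis .
  qed
  define conv where "conv u v \<longleftrightarrow> converts ({..b} \<times> {..N})
    (\<lambda>(k, m). c * x ^ k * coeff u k * (real (N choose m) * x ^ m)) (\<lambda>(k, m). coeff u k * real (N choose m))
    ({..b} \<times> {..N})
    (\<lambda>(k, m). c * x ^ k * coeff v k * (real (N choose m) * x ^ m)) (\<lambda>(k, m). coeff v k * real (N choose m))" for u v
  have "conv w (wt t)" if "t \<le> M" for t using that
  proof (induction t)
    case 0
    then show ?case by (simp add: wt_def conv_def converts_refl)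
  next
    case (Suc t)
    have pos: "coeff ([:1, 1:] ^ N * wt s) k > 0" if "s \<le> M" "k \<le> b + N" for s k
      using Wt[OF that(1), of k] W[OF that(2)] \<mu>(1) by (meson less_le_trans mult_pos_pos)
    have step: "conv (wt t) (wt (Suc t))" unfolding conv_def
    proof (rule lattice_step[where f = "smult (1 / real M) f", OF x degt degt])
      have "wt t - wt (Suc t) = smult (1 / real M) (w - w')"
        by (simp add: wt_def smult_diff_left[symmetric] add_divide_distrib flip: smult_add_left)
      then show "wt t - wt (Suc t) = [:-1, 1:] * [:-x, 1:] * smult (1 / real M) f" by (simp add: diff)
      fix k
      show "coeff (wt t) k \<ge> 0" "coeff (wt (Suc t)) k \<ge> 0"
        using wt[of t k] wt[of "Suc t" k] Suc.prems mult_nonneg_nonneg[OF less_imp_le[OF \<mu>(1)] w(1)[of k]] by linarith+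
      show "coeff ([:1, 1:] ^ N * smult (1 / real M) f) k \<ge> 0" using N(2) by simp
      assume k: "k \<le> b + N"
      then show "coeff ([:1, 1:] ^ N * wt t) k > 0" "coeff ([:1, 1:] ^ N * wt (Suc t)) k > 0"
        using pos Suc.prems by auto
      have "(if 2 \<le> k then coeff ([:1, 1:] ^ N * smult (1 / real M) f) (k - 2) else 0) + x * coeff ([:1, 1:] ^ N * smult (1 / real M) f) k = Fl k / real M"
        by (simp add: Fl_def add_divide_distrib)
      also have "\<dots> \<le> \<mu> * W k" using bound[OF k] M0 by (simp add: pos_divide_le_eq mult_ac)
      also have "\<dots> \<le> coeff ([:1, 1:] ^ N * wt t) k" using Wt Suc.prems by simp
      finally show "(if 2 \<le> k then coeff ([:1, 1:] ^ N * smult (1 / real M) f) (k - 2) else 0) + x * coeff ([:1, 1:] ^ N * smult (1 / real M) f) k \<le> coeff ([:1, 1:] ^ N * wt t) k" .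
    qed
    have "conv w (wt t)" using Suc by simp
    then show ?case unfolding conv_def using step unfolding conv_def by (rule converts_trans[rotated]) simp
  qed
  from this[of M] have "conv w w'" using M0 by (simp add: wt_def)
  then show ?thesis unfolding conv_def by blast
qed

subsection \<open>Generators of the Renyi divergences\<close>

definition expm1_quot :: "real \<Rightarrow> real" where
  "expm1_quot u = (if u = 0 then 1 else (exp u - 1) / u)"

text \<open>This is \<open>(exp (k * t) - 1) / k\<close>, continued by \<open>t\<close> at
  \<open>k = 0\<close>: the primitive of \<open>exp (k * t)\<close> that vanishes at 0. The detour
  through the quotient makes continuity in \<open>k\<close> immediate.\<close>

definition power_potential :: "real \<Rightarrow> real \<Rightarrow> real" where
  "power_potential k t = t * expm1_quot (k * t)"

text \<open>This is \<open>(u powr \<alpha> - 1 - \<alpha> * (u - 1)) / (\<alpha> * (\<alpha> - 1))\<close> at \<open>u = exp t\<close>, with the removable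
  singularities at \<open>\<alpha> = 0\<close> and \<open>\<alpha> = 1\<close> filled in. These functions generate all Renyi divergences
  and both relative entropies.\<close>

definition renyi_gen :: "real \<Rightarrow> real \<Rightarrow> real" where
  "renyi_gen \<alpha> t = (if \<alpha> = 1 then exp t * t - (exp t - 1)
     else (power_potential \<alpha> t - (exp t - 1)) / (\<alpha> - 1))"

lemma expm1_quot_pos: "expm1_quot u > 0"
  by (cases "u > 0") (auto simp: expm1_quot_def zero_less_divide_iff)

lemma continuous_expm1_quot: "continuous_on UNIV expm1_quot"
proof -
  have "isCont expm1_quot u" for u
  proof (cases "u = 0")
    case True
    have "((\<lambda>h. (exp (0 + h) - exp 0) / h) \<longlongrightarrow> exp 0) (at (0::real))"
      using DERIV_exp[of "0::real"] unfolding DERIV_def .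
    then have "((\<lambda>h. (exp h - 1) / h) \<longlongrightarrow> 1) (at (0::real))" by simp
    then have "(expm1_quot \<longlongrightarrow> 1) (at 0)"
      by (rule Lim_transform_eventually) (auto simp: expm1_quot_def eventually_at_filter)
    then show ?thesis by (simp add: True isCont_def expm1_quot_def)
  next
    case False
    have "isCont (\<lambda>u. (exp u - 1) / u) u" using False by (intro continuous_intros)
    moreover have "\<forall>\<^sub>F v in nhds u. expm1_quot v = (exp v - 1) / v"
      using t1_space_nhds[OF False] by (rule eventually_mono) (auto simp: expm1_quot_def)
    ultimately show ?thesis by (simp add: isCont_cong)
  qed
  then show ?thesis by (simp add: continuous_at_imp_continuous_on)
qed

lemma power_potential_mult: "k * power_potential k t = exp (k * t) - 1"
  by (auto simp: power_potential_def expm1_quot_def)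

lemma power_potential_0 [simp]: "power_potential 0 t = t" "power_potential k 0 = 0"
  by (auto simp: power_potential_def expm1_quot_def)

lemma power_potential_sign: "t > 0 \<Longrightarrow> power_potential k t > 0" "t < 0 \<Longrightarrow> power_potential k t < 0"
  using expm1_quot_pos[of "k * t"] by (auto simp: power_potential_def mult_neg_pos)

lemma power_potential_deriv: "(power_potential k has_real_derivative exp (k * t)) (at t)"
proof (cases "k = 0")
  case False
  have "power_potential k = (\<lambda>t. (exp (k * t) - 1) / k)"
    using power_potential_mult[of k] False by (auto simp: field_simps)
  then show ?thesis using False by (auto intro!: derivative_eq_intros)
next
  case True
  then have "power_potential k = (\<lambda>t. t)" by auto
  then show ?thesis using True by simp
qed

lemma power_potential_mono: "s \<le> t \<Longrightarrow> power_potential k s \<le> power_potential k t"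
  by (rule DERIV_nonneg_imp_nondecreasing) (auto intro: power_potential_deriv)

lemma continuous_power_potential: "continuous_on S (\<lambda>k. power_potential (k + c) t)"
  unfolding power_potential_def
  by (intro continuous_intros continuous_on_compose2[OF continuous_expm1_quot]) auto

lemma renyi_gen_mult: "\<alpha> * (\<alpha> - 1) * renyi_gen \<alpha> t = exp (\<alpha> * t) - 1 - \<alpha> * (exp t - 1)"
proof -
  have "\<alpha> * (\<alpha> - 1) * renyi_gen \<alpha> t = \<alpha> * power_potential \<alpha> t - \<alpha> * (exp t - 1)" if "\<alpha> \<noteq> 1"
    using that by (simp add: renyi_gen_def) (simp add: right_diff_distrib)
  then show ?thesis by (cases "\<alpha> = 1") (simp_all add: power_potential_mult)
qed

lemma renyi_gen_0: "renyi_gen 0 t = exp t - 1 - t"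
  by (simp add: renyi_gen_def)

text \<open>The defining formula is manifestly regular away from order 1, this one away from order
  0; the two open sets cover the line, which gives continuity in the order.\<close>

lemma renyi_gen_alt:
  assumes "\<alpha> \<noteq> 0"
  shows "renyi_gen \<alpha> t = (exp t * power_potential (\<alpha> - 1) t - (exp t - 1)) / \<alpha>"
proof (cases "\<alpha> = 1")
  case False
  have "\<alpha> * (\<alpha> - 1) * renyi_gen \<alpha> t = exp t * (exp ((\<alpha> - 1) * t) - 1) - (\<alpha> - 1) * (exp t - 1)"
    unfolding renyi_gen_mult by (simp add: algebra_simps flip: exp_add)
  also have "\<dots> = (\<alpha> - 1) * (exp t * power_potential (\<alpha> - 1) t - (exp t - 1))"
    unfolding power_potential_mult[symmetric] by (simp add: right_diff_distrib mult.left_commute)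
  finally have "(\<alpha> - 1) * (\<alpha> * renyi_gen \<alpha> t) = (\<alpha> - 1) * (exp t * power_potential (\<alpha> - 1) t - (exp t - 1))"
    by (simp only: mult.left_commute mult.assoc)
  then have "\<alpha> * renyi_gen \<alpha> t = exp t * power_potential (\<alpha> - 1) t - (exp t - 1)" using False by simp
  then show ?thesis using assms by (simp add: eq_divide_eq mult.commute)
qed (simp add: renyi_gen_def)

lemma continuous_renyi_gen: "continuous_on UNIV (\<lambda>\<alpha>. renyi_gen \<alpha> t)"
proof -
  have "continuous_on (- {1}) (\<lambda>\<alpha>. (power_potential (\<alpha> + 0) t - (exp t - 1)) / (\<alpha> - 1))"
    by (intro continuous_intros continuous_power_potential) auto
  then have 1: "continuous_on (- {1}) (\<lambda>\<alpha>. renyi_gen \<alpha> t)"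
    by (rule continuous_on_cong[THEN iffD1, rotated 2]) (auto simp: renyi_gen_def)
  have "continuous_on (- {0}) (\<lambda>\<alpha>. (exp t * power_potential (\<alpha> + (-1)) t - (exp t - 1)) / \<alpha>)"
    by (intro continuous_intros continuous_power_potential) auto
  then have 2: "continuous_on (- {0}) (\<lambda>\<alpha>. renyi_gen \<alpha> t)"
    by (rule continuous_on_cong[THEN iffD1, rotated 2]) (auto simp: renyi_gen_alt)
  have "- {1} \<union> - {0::real} = UNIV" by auto
  then show ?thesis using continuous_on_open_Un[OF _ _ 1 2] by (simp add: open_Compl)
qed

lemma renyi_gen_at_0 [simp]: "renyi_gen \<alpha> 0 = 0"
  by (simp add: renyi_gen_def)

text \<open>The derivative has the sign of \<open>t\<close> for every order. Thus all generators
  have their only minimum at likelihood ratio 1, and nonnegativity, strict positivity and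
  monotonicity on either side need no distinction of orders.\<close>

lemma renyi_gen_deriv: "(renyi_gen \<alpha> has_real_derivative exp t * power_potential (\<alpha> - 1) t) (at t)"
proof (cases "\<alpha> = 0")
  case True
  have "(renyi_gen 0 has_real_derivative exp t - 1) (at t)"
    unfolding renyi_gen_0[abs_def] by (auto intro!: derivative_eq_intros)
  moreover have "power_potential (- 1) t = 1 - exp (- t)"
    using power_potential_mult[of "-1" t] by simp
  then have "exp t * power_potential (- 1) t = exp t - 1"
    by (simp add: right_diff_distrib exp_minus)
  ultimately show ?thesis using True by simp
next
  case False
  have "((\<lambda>t. (exp t * power_potential (\<alpha> - 1) t - (exp t - 1)) / \<alpha>) has_real_derivative
     (exp t * power_potential (\<alpha> - 1) t + exp t * exp ((\<alpha> - 1) * t) - exp t) / \<alpha>) (at t)"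
    by (auto intro!: derivative_eq_intros power_potential_deriv simp: False)
  moreover have "exp t * exp ((\<alpha> - 1) * t) - exp t = (\<alpha> - 1) * (exp t * power_potential (\<alpha> - 1) t)"
  proof -
    have "(\<alpha> - 1) * (exp t * power_potential (\<alpha> - 1) t) = exp t * (exp ((\<alpha> - 1) * t) - 1)"
      by (simp add: power_potential_mult[symmetric])
    then show ?thesis by (simp add: algebra_simps)
  qed
  then have "(exp t * power_potential (\<alpha> - 1) t + exp t * exp ((\<alpha> - 1) * t) - exp t) / \<alpha> = exp t * power_potential (\<alpha> - 1) t"
    using False by (simp add: field_simps)
  moreover have "renyi_gen \<alpha> = (\<lambda>t. (exp t * power_potential (\<alpha> - 1) t - (exp t - 1)) / \<alpha>)"
    using False by (auto simp: renyi_gen_alt)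
  ultimately show ?thesis by simp
qed

lemma isCont_renyi_gen: "isCont (renyi_gen \<alpha>) t"
  using DERIV_isCont[OF renyi_gen_deriv] .

lemma renyi_gen_mono_right:
  assumes "0 \<le> s" "s \<le> t"
  shows "renyi_gen \<alpha> s \<le> renyi_gen \<alpha> t"
proof (rule DERIV_nonneg_imp_nondecreasing[OF assms(2)])
  fix x assume x: "s \<le> x"
  have "0 \<le> power_potential (\<alpha> - 1) x" using power_potential_mono[of 0 x "\<alpha> - 1"] assms x by simp
  then show "\<exists>y. (renyi_gen \<alpha> has_real_derivative y) (at x) \<and> 0 \<le> y"
    using renyi_gen_deriv by (meson exp_ge_zero mult_nonneg_nonneg)
qed

lemma renyi_gen_mono_left:
  assumes "t \<le> s" "s \<le> 0"
  shows "renyi_gen \<alpha> s \<le> renyi_gen \<alpha> t"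
proof (rule DERIV_nonpos_imp_nonincreasing[OF assms(1)])
  fix x assume x: "t \<le> x" "x \<le> s"
  have "power_potential (\<alpha> - 1) x \<le> 0" using power_potential_mono[of x 0 "\<alpha> - 1"] assms x by simp
  then show "\<exists>y. (renyi_gen \<alpha> has_real_derivative y) (at x) \<and> y \<le> 0"
    using renyi_gen_deriv by (meson exp_ge_zero mult_nonneg_nonpos)
qed

lemma renyi_gen_nonneg: "renyi_gen \<alpha> t \<ge> 0"
  using renyi_gen_mono_right[of 0 t \<alpha>] renyi_gen_mono_left[of t 0 \<alpha>] by (cases "t \<ge> 0") auto

lemma renyi_gen_pos:
  assumes "t \<noteq> 0"
  shows "renyi_gen \<alpha> t > 0"
proof (cases "t > 0")
  case True
  from MVT2[OF this renyi_gen_deriv, of \<alpha>]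
  obtain z where "0 < z" "renyi_gen \<alpha> t - renyi_gen \<alpha> 0 = (t - 0) * (exp z * power_potential (\<alpha> - 1) z)" by blast
  then show ?thesis using True power_potential_sign(1)[of z "\<alpha> - 1"] by simp
next
  case False
  then have t: "t < 0" using assms by simp
  from MVT2[OF this renyi_gen_deriv, of \<alpha>]
  obtain z where z: "z < 0" "renyi_gen \<alpha> 0 - renyi_gen \<alpha> t = (0 - t) * (exp z * power_potential (\<alpha> - 1) z)" by blast
  then have "exp z * power_potential (\<alpha> - 1) z < 0" using power_potential_sign(2)[of z "\<alpha> - 1"] by (simp add: mult_pos_neg)
  then have "(0 - t) * (exp z * power_potential (\<alpha> - 1) z) < 0" using t by (subst mult_less_0_iff) auto
  then show ?thesis using z by simp
qed

text \<open>Uniform over a bounded range of orders; this controls the error of rounding logarithmic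
  likelihood ratios to the lattice. Larger orders are treated by comparing extreme values
  instead.\<close>

lemma renyi_gen_lipschitz:
  assumes "\<bar>\<alpha>\<bar> \<le> A" "\<bar>s\<bar> \<le> B" "\<bar>t\<bar> \<le> B"
  shows "\<bar>renyi_gen \<alpha> s - renyi_gen \<alpha> t\<bar> \<le> exp B * (B * exp ((A + 1) * B)) * \<bar>s - t\<bar>"
proof -
  have pb: "\<bar>power_potential k t\<bar> \<le> B * exp ((A + 1) * B)" if k: "\<bar>k\<bar> \<le> A + 1" and t: "\<bar>t\<bar> \<le> B" for k t
  proof -
    have *: "\<bar>power_potential k y - power_potential k x\<bar> \<le> \<bar>y - x\<bar> * exp ((A + 1) * B)" if "x < y" "\<bar>x\<bar> \<le> B" "\<bar>y\<bar> \<le> B" for x y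
    proof -
      from MVT2[OF that(1) power_potential_deriv, of k]
      obtain z where z: "x < z" "z < y" "power_potential k y - power_potential k x = (y - x) * exp (k * z)" by blast
      have "k * z \<le> \<bar>k\<bar> * \<bar>z\<bar>" by (metis abs_ge_self abs_mult)
      also have "\<dots> \<le> (A + 1) * B" by (rule mult_mono) (use z that k in auto)
      finally show ?thesis using z by (simp add: abs_mult)
    qed
    have "\<bar>power_potential k t\<bar> \<le> \<bar>t\<bar> * exp ((A + 1) * B)"
      using *[of 0 t] *[of t 0] t by (cases t "0 :: real" rule: linorder_cases) auto
    also have "\<dots> \<le> B * exp ((A + 1) * B)" using t by simp
    finally show ?thesis .
  qed
  have *: "\<bar>renyi_gen \<alpha> y - renyi_gen \<alpha> x\<bar> \<le> exp B * (B * exp ((A + 1) * B)) * \<bar>y - x\<bar>" if "x < y" "\<bar>x\<bar> \<le> B" "\<bar>y\<bar> \<le> B" for x y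
  proof -
    from MVT2[OF that(1) renyi_gen_deriv, of \<alpha>]
    obtain z where z: "x < z" "z < y" "renyi_gen \<alpha> y - renyi_gen \<alpha> x = (y - x) * (exp z * power_potential (\<alpha> - 1) z)" by blast
    have "\<bar>exp z * power_potential (\<alpha> - 1) z\<bar> \<le> exp B * (B * exp ((A + 1) * B))"
      unfolding abs_mult by (intro mult_mono pb) (use z that assms in auto)
    then show ?thesis unfolding z(3) abs_mult[of "y - x"] by (metis abs_ge_zero mult.commute mult_left_mono)
  qed
  show ?thesis using *[of s t] *[of t s] assms
    by (cases s t rule: linorder_cases) (auto simp: abs_minus_commute)
qed

text \<open>In the likelihood ratio itself the derivative is
  \<open>power_potential (\<alpha> - 1) (ln u)\<close>, which increases with
  \<open>u\<close>.\<close>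

lemma renyi_gen_convex: "convex_on {0<..} (\<lambda>u. renyi_gen \<alpha> (ln u))"
proof (rule convex_on_realI)
  fix x :: real assume "x \<in> {0<..}"
  then have x: "x > 0" by simp
  have "((\<lambda>u. renyi_gen \<alpha> (ln u)) has_real_derivative (exp (ln x) * power_potential (\<alpha> - 1) (ln x)) * (1 / x)) (at x)"
    by (rule DERIV_chain2[OF renyi_gen_deriv]) (use x in \<open>auto intro!: derivative_eq_intros\<close>)
  then show "((\<lambda>u. renyi_gen \<alpha> (ln u)) has_real_derivative power_potential (\<alpha> - 1) (ln x)) (at x)"
    using x by simp
qed (auto intro: power_potential_mono)

lemma renyi_gen_contract:
  assumes "u > 0" "0 \<le> s" "s \<le> 1"
  shows "renyi_gen \<alpha> (ln ((1 - s) * u + s)) \<le> (1 - s) * renyi_gen \<alpha> (ln u)"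
  using convex_onD[OF renyi_gen_convex, of s u 1] assms by simp

text \<open>Mixing moves a likelihood ratio monotonically towards 1, the common minimum of all
  generators. Lowering the mixing parameter therefore lowers no generator, whatever the order, so
  that finitely many parameters can later be replaced by their minimum.\<close>

lemma renyi_gen_contract_mono:
  assumes "0 \<le> u" "0 < s" "s \<le> r" "r \<le> 1"
  shows "renyi_gen \<alpha> (ln ((1 - r) * u + r)) \<le> renyi_gen \<alpha> (ln ((1 - s) * u + s))"
proof -
  have e: "(1 - k) * u + k = u + k * (1 - u)" for k by (simp add: algebra_simps)
  have p: "(1 - s) * u + s > 0" "(1 - r) * u + r > 0" using assms by (auto intro: add_nonneg_pos)
  show ?thesis
  proof (cases "u \<ge> 1")
    case True
    then have "u + 1 * (1 - u) \<le> u + r * (1 - u)" "u + r * (1 - u) \<le> u + s * (1 - u)"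
      by (intro add_left_mono mult_right_mono_neg; use assms in simp)+
    then have "1 \<le> (1 - r) * u + r \<and> (1 - r) * u + r \<le> (1 - s) * u + s" unfolding e by simp
    then show ?thesis by (intro renyi_gen_mono_right) auto
  next
    case False
    then have "u + r * (1 - u) \<le> u + 1 * (1 - u)" "u + s * (1 - u) \<le> u + r * (1 - u)"
      by (intro add_left_mono mult_right_mono; use assms in simp)+
    then have "(1 - r) * u + r \<le> 1 \<and> (1 - r) * u + r \<ge> (1 - s) * u + s" unfolding e by simp
    then show ?thesis using p by (intro renyi_gen_mono_left) auto
  qed
qed

lemma renyi_gen_ln:
  assumes "u > 0" "\<alpha> \<noteq> 0" "\<alpha> \<noteq> 1"
  shows "renyi_gen \<alpha> (ln u) = (u powr \<alpha> - 1 - \<alpha> * (u - 1)) / (\<alpha> * (\<alpha> - 1))"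
proof -
  have "\<alpha> * (\<alpha> - 1) * renyi_gen \<alpha> (ln u) = u powr \<alpha> - 1 - \<alpha> * (u - 1)"
    using assms by (simp add: renyi_gen_mult powr_def)
  then show ?thesis using assms by (simp add: eq_divide_eq mult.commute)
qed

lemma renyi_gen_at_zero_pos:
  assumes "\<alpha> > 0"
  shows "((\<lambda>u. renyi_gen \<alpha> (ln u)) \<longlongrightarrow> 1 / \<alpha>) (at_right 0)"
proof (cases "\<alpha> = 1")
  case True
  have "((\<lambda>u::real. u * ln u - (u - 1)) \<longlongrightarrow> 1) (at_right 0)" by real_asymp
  moreover have "\<forall>\<^sub>F u :: real in at_right 0. u * ln u - (u - 1) = renyi_gen 1 (ln u)"
    by (auto simp: eventually_at_right_field renyi_gen_def intro!: exI[of _ 1])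
  ultimately show ?thesis using True by (simp add: filterlim_cong)
next
  case False
  have "((\<lambda>u::real. (u powr \<alpha> - 1 - \<alpha> * (u - 1)) / (\<alpha> * (\<alpha> - 1))) \<longlongrightarrow> (0 - 1 - \<alpha> * (0 - 1)) / (\<alpha> * (\<alpha> - 1))) (at_right 0)"
    using assms False by (auto intro!: tendsto_eq_intros tendsto_powr2 simp: eventually_at_right_field intro: exI[of _ 1])
  moreover have "(0 - 1 - \<alpha> * (0 - 1)) / (\<alpha> * (\<alpha> - 1)) = 1 / \<alpha>" using assms False by (simp add: field_simps)
  moreover have "\<forall>\<^sub>F u :: real in at_right 0. (u powr \<alpha> - 1 - \<alpha> * (u - 1)) / (\<alpha> * (\<alpha> - 1)) = renyi_gen \<alpha> (ln u)"
    using assms False by (auto simp: eventually_at_right_field renyi_gen_ln intro!: exI[of _ 1])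
  ultimately show ?thesis by (simp add: filterlim_cong)
qed

lemma renyi_gen_at_zero_nonpos:
  assumes "\<alpha> \<le> 0"
  shows "filterlim (\<lambda>u. renyi_gen \<alpha> (ln u)) at_top (at_right 0)"
proof (cases "\<alpha> = 0")
  case True
  have "filterlim (\<lambda>u::real. u - 1 - ln u) at_top (at_right 0)" by real_asymp
  moreover have "\<forall>\<^sub>F u :: real in at_right 0. u - 1 - ln u = renyi_gen \<alpha> (ln u)"
    by (auto simp: eventually_at_right_field renyi_gen_0 True intro!: exI[of _ 1])
  ultimately show ?thesis by (simp add: filterlim_cong)
next
  case False
  then have neg: "\<alpha> < 0" using assms by simp
  have c: "1 / (\<alpha> * (\<alpha> - 1)) > 0" using neg by (simp add: mult_neg_neg)
  have "filterlim (\<lambda>u::real. (u powr \<alpha> - 1 - \<alpha> * (u - 1)) * (1 / (\<alpha> * (\<alpha> - 1)))) at_top (at_right 0)"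
    using c neg by real_asymp
  moreover have "\<forall>\<^sub>F u :: real in at_right 0. (u powr \<alpha> - 1 - \<alpha> * (u - 1)) * (1 / (\<alpha> * (\<alpha> - 1))) = renyi_gen \<alpha> (ln u)"
    using neg by (auto simp: eventually_at_right_field renyi_gen_ln intro!: exI[of _ 1])
  ultimately show ?thesis by (simp add: filterlim_cong)
qed

text \<open>For large orders only the extreme likelihood ratio counts, whatever weight
  \<open>m\<close> it carries. The bound \<open>A \<ge> 2\<close> keeps
  \<open>\<alpha> * (\<alpha> - 1)\<close> positive beyond \<open>A\<close> and below
  \<open>- A\<close>.\<close>

lemma powr_eventually_dominates:
  fixes B1 B2 m :: real
  assumes "0 < B2" "B2 < B1" "m > 0"
  obtains A where "A \<ge> 2" "\<And>\<alpha>. \<alpha> \<ge> A \<Longrightarrow> B2 powr \<alpha> < m * B1 powr \<alpha>"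
proof -
  define L where "L = ln B1 - ln B2"
  have L: "L > 0" using assms by (simp add: L_def)
  define A where "A = max 2 (1 - ln m / L)"
  have "B2 powr \<alpha> < m * B1 powr \<alpha>" if "\<alpha> \<ge> A" for \<alpha>
  proof -
    have "\<alpha> > - ln m / L" using that by (auto simp: A_def)
    then have "- ln m < \<alpha> * L" using pos_divide_less_eq[OF L, of "- ln m" \<alpha>] by simp
    then have "\<alpha> * ln B2 < ln m + \<alpha> * ln B1" by (simp add: L_def algebra_simps)
    then have "exp (\<alpha> * ln B2) < exp (ln m + \<alpha> * ln B1)" by simp
    then show ?thesis using assms by (simp add: powr_def exp_add)
  qed
  then show ?thesis using that[of A] by (simp add: A_def)
qed

subsection \<open>Strict dominance by mixing\<close>

text \<open>The limit of infinite order: a value of \<open>b\<close> above \<open>B\<close> would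
  eventually dominate the power sum. Applied to reciprocals, the same argument compares
  minima.\<close>

lemma powr_bound_of_dominance:
  fixes g a b :: "'a \<Rightarrow> real"
  assumes I: "finite I" and g: "\<And>i. i \<in> I \<Longrightarrow> g i > 0" "sum g I = 1"
    and a: "\<And>i. i \<in> I \<Longrightarrow> 0 \<le> a i \<and> a i \<le> B" and B: "B > 0" and j: "j \<in> I"
    and dom: "\<And>\<alpha>. \<alpha> > 1 \<Longrightarrow> (\<Sum>i\<in>I. g i * b i powr \<alpha>) \<le> (\<Sum>i\<in>I. g i * a i powr \<alpha>)"
  shows "b j \<le> B"
proof (rule ccontr)
  assume "\<not> b j \<le> B"
  then obtain A where A: "A \<ge> 2" "\<And>\<alpha>. \<alpha> \<ge> A \<Longrightarrow> B powr \<alpha> < g j * b j powr \<alpha>"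
    using powr_eventually_dominates[of B "b j" "g j"] B g(1)[OF j] by (metis not_le)
  have "g j * b j powr A \<le> (\<Sum>i\<in>I. g i * b i powr A)"
    by (rule member_le_sum) (use j I g(1) in \<open>auto simp: less_imp_le\<close>)
  also have "\<dots> \<le> (\<Sum>i\<in>I. g i * a i powr A)" using dom A by simp
  also have "\<dots> \<le> (\<Sum>i\<in>I. g i * B powr A)"
    by (intro sum_mono mult_left_mono powr_mono2) (use a g(1) A in \<open>auto simp: less_imp_le\<close>)
  also have "\<dots> = B powr A" using g(2) by (simp flip: sum_distrib_right)
  finally show False using A(2)[of A] by simp
qed

lemma sum_renyi_gen:
  assumes "sum g I = 1" "(\<Sum>i\<in>I. g i * u i) = 1" "\<And>i. i \<in> I \<Longrightarrow> u i > 0"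
  shows "\<alpha> * (\<alpha> - 1) * (\<Sum>i\<in>I. g i * renyi_gen \<alpha> (ln (u i))) = (\<Sum>i\<in>I. g i * u i powr \<alpha>) - 1"
proof -
  have "\<alpha> * (\<alpha> - 1) * (\<Sum>i\<in>I. g i * renyi_gen \<alpha> (ln (u i))) = (\<Sum>i\<in>I. g i * (\<alpha> * (\<alpha> - 1) * renyi_gen \<alpha> (ln (u i))))"
    by (simp add: sum_distrib_left mult_ac)
  also have "\<dots> = (\<Sum>i\<in>I. g i * u i powr \<alpha> - g i - \<alpha> * (g i * u i - g i))"
  proof (intro sum.cong refl)
    fix i assume "i \<in> I"
    then have "u i > 0" by (rule assms(3))
    then show "g i * (\<alpha> * (\<alpha> - 1) * renyi_gen \<alpha> (ln (u i))) = g i * u i powr \<alpha> - g i - \<alpha> * (g i * u i - g i)"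
      unfolding renyi_gen_mult by (simp add: powr_def algebra_simps)
  qed
  also have "\<dots> = (\<Sum>i\<in>I. g i * u i powr \<alpha>) - 1"
    using assms by (simp add: sum_subtractf flip: sum_distrib_left)
  finally show ?thesis .
qed

text \<open>The continuous extension to likelihood ratio 0. The value \<open>1 / \<alpha>\<close> is
  the limit for positive orders; for nonpositive ones the limit is infinite, whence the recurring
  condition \<open>\<alpha> > 0 \<or> u > 0\<close>.\<close>

definition renyi_gen0 :: "real \<Rightarrow> real \<Rightarrow> real" where
  "renyi_gen0 \<alpha> u = (if u = 0 then 1 / \<alpha> else renyi_gen \<alpha> (ln u))"

lemma renyi_gen0_nonneg: "\<alpha> > 0 \<or> u > 0 \<Longrightarrow> renyi_gen0 \<alpha> u \<ge> 0"
  by (auto simp: renyi_gen0_def renyi_gen_nonneg)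

lemma renyi_gen0_pos: "\<alpha> > 0 \<or> u > 0 \<Longrightarrow> u \<ge> 0 \<Longrightarrow> u \<noteq> 1 \<Longrightarrow> renyi_gen0 \<alpha> u > 0"
  by (auto simp: renyi_gen0_def intro: renyi_gen_pos)

lemma renyi_gen0_powr:
  assumes "\<alpha> > 0 \<or> u > 0" "u \<ge> 0" "\<alpha> \<noteq> 0" "\<alpha> \<noteq> 1"
  shows "renyi_gen0 \<alpha> u = (u powr \<alpha> - 1 - \<alpha> * (u - 1)) / (\<alpha> * (\<alpha> - 1))"
proof (cases "u = 0")
  case True
  then show ?thesis using assms by (simp add: renyi_gen0_def divide_eq_eq eq_divide_eq)
qed (use assms in \<open>auto simp: renyi_gen0_def renyi_gen_ln\<close>)

lemma tendsto_renyi_gen0: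
  assumes "\<alpha> > 0 \<or> u > 0" "u \<ge> 0"
  shows "((\<lambda>\<eta>. renyi_gen \<alpha> (ln ((1 - \<eta>) * u + \<eta>))) \<longlongrightarrow> renyi_gen0 \<alpha> u) (at_right 0)"
proof (cases "u = 0")
  case True
  then show ?thesis using assms renyi_gen_at_zero_pos by (simp add: renyi_gen0_def)
next
  case False
  then have u: "u > 0" using assms by simp
  have "((\<lambda>\<eta>. ln ((1 - \<eta>) * u + \<eta>)) \<longlongrightarrow> ln u) (at_right 0)"
    using u by (auto intro!: tendsto_eq_intros)
  from isCont_tendsto_compose[OF isCont_renyi_gen this] show ?thesis using False by (simp add: renyi_gen0_def)
qed

lemma renyi_gen0_contract:
  assumes "\<alpha> > 0 \<or> u > 0" "u \<ge> 0" "0 < s" "s < 1"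
  shows "renyi_gen \<alpha> (ln ((1 - s) * u + s)) \<le> (1 - s) * renyi_gen0 \<alpha> u"
proof (cases "u = 0")
  case False
  then show ?thesis using assms renyi_gen_contract[of u s \<alpha>] by (simp add: renyi_gen0_def)
next
  case True
  then have \<alpha>: "\<alpha> > 0" using assms by simp
  have 1: "((\<lambda>v. (1 - s) * renyi_gen \<alpha> (ln v)) \<longlongrightarrow> (1 - s) * (1 / \<alpha>)) (at_right 0)"
    by (intro tendsto_intros renyi_gen_at_zero_pos \<alpha>)
  have "((\<lambda>v. ln ((1 - s) * v + s)) \<longlongrightarrow> ln s) (at_right 0)"
    using assms by (auto intro!: tendsto_eq_intros)
  from isCont_tendsto_compose[OF isCont_renyi_gen this, of \<alpha>]
  have 2: "((\<lambda>v. renyi_gen \<alpha> (ln ((1 - s) * v + s))) \<longlongrightarrow> renyi_gen \<alpha> (ln s)) (at_right 0)" .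
  have "renyi_gen \<alpha> (ln s) \<le> (1 - s) * (1 / \<alpha>)"
    by (rule tendsto_le[OF _ 1 2])
      (use assms in \<open>auto simp: eventually_at_right_field intro!: exI[of _ 1] renyi_gen_contract\<close>)
  then show ?thesis using True by (simp add: renyi_gen0_def)
qed

text \<open>Strictness comes from the asymmetry of the two mixings. By convexity the fixed mixing of
  \<open>b\<close> multiplies its value by at most \<open>1 - \<epsilon>\<close>, while the value of
  \<open>a\<close> is positive and is recovered in the limit of vanishing mixing. If
  \<open>a\<close> has a zero and the order is nonpositive, that limit is infinite and exceeds
  whatever \<open>b\<close> gives.\<close>

lemma strict_dominance_pointwise:
  fixes g a b :: "'a \<Rightarrow> real"
  assumes I: "finite I" and g: "\<And>i. i \<in> I \<Longrightarrow> g i > 0" "sum g I = 1"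
    and a: "\<And>i. i \<in> I \<Longrightarrow> a i \<ge> 0" "(\<Sum>i\<in>I. g i * a i) = 1"
    and b: "\<And>i. i \<in> I \<Longrightarrow> b i \<ge> 0" "(\<Sum>i\<in>I. g i * b i) = 1"
    and dom_gt1: "\<And>\<alpha>. \<alpha> > 1 \<Longrightarrow> (\<Sum>i\<in>I. g i * b i powr \<alpha>) \<le> (\<Sum>i\<in>I. g i * a i powr \<alpha>)"
    and dom_01: "\<And>\<alpha>. 0 < \<alpha> \<Longrightarrow> \<alpha> < 1 \<Longrightarrow> (\<Sum>i\<in>I. g i * a i powr \<alpha>) \<le> (\<Sum>i\<in>I. g i * b i powr \<alpha>)"
    and dom_1: "(\<Sum>i\<in>I. g i * (b i * ln (b i))) \<le> (\<Sum>i\<in>I. g i * (a i * ln (a i)))"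
    and dom_neg: "(\<And>i. i \<in> I \<Longrightarrow> a i > 0) \<Longrightarrow> (\<forall>i\<in>I. b i > 0) \<and>
       (\<Sum>i\<in>I. g i * ln (a i)) \<le> (\<Sum>i\<in>I. g i * ln (b i)) \<and>
       (\<forall>\<alpha><0. (\<Sum>i\<in>I. g i * b i powr \<alpha>) \<le> (\<Sum>i\<in>I. g i * a i powr \<alpha>))"
    and ne: "\<exists>i\<in>I. a i \<noteq> 1"
    and \<epsilon>: "0 < \<epsilon>" "\<epsilon> < 1"
  shows "\<forall>\<^sub>F \<eta> in at_right 0. (\<Sum>i\<in>I. g i * renyi_gen \<alpha> (ln ((1 - \<epsilon>) * b i + \<epsilon>))) <
           (\<Sum>i\<in>I. g i * renyi_gen \<alpha> (ln ((1 - \<eta>) * a i + \<eta>)))"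
proof (cases "\<alpha> > 0 \<or> (\<forall>i\<in>I. a i > 0)")
  case True
  have A: "\<alpha> > 0 \<or> a i > 0" if "i \<in> I" for i using True that by blast
  have B: "\<alpha> > 0 \<or> b i > 0" if "i \<in> I" for i using True dom_neg that by blast
  have lim: "((\<lambda>\<eta>. \<Sum>i\<in>I. g i * renyi_gen \<alpha> (ln ((1 - \<eta>) * a i + \<eta>))) \<longlongrightarrow> (\<Sum>i\<in>I. g i * renyi_gen0 \<alpha> (a i))) (at_right 0)"
    by (intro tendsto_intros tendsto_renyi_gen0) (use A a in auto)
  have pos: "(\<Sum>i\<in>I. g i * renyi_gen0 \<alpha> (a i)) > 0"
  proof -
    obtain i where i: "i \<in> I" "a i \<noteq> 1" using ne by blast
    show ?thesis
    proof (rule sum_pos2[OF I i(1)])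
      show "0 < g i * renyi_gen0 \<alpha> (a i)" using renyi_gen0_pos[OF A[OF i(1)] a(1)[OF i(1)] i(2)] g(1)[OF i(1)] by simp
      show "0 \<le> g i * renyi_gen0 \<alpha> (a i)" if "i \<in> I" for i
        using renyi_gen0_nonneg[OF A[OF that]] g(1)[OF that] by simp
    qed
  qed
  have le: "(\<Sum>i\<in>I. g i * renyi_gen0 \<alpha> (b i)) \<le> (\<Sum>i\<in>I. g i * renyi_gen0 \<alpha> (a i))"
  proof -
    consider "\<alpha> = 0" | "\<alpha> = 1" | "\<alpha> \<noteq> 0" "\<alpha> \<noteq> 1" by blast
    then show ?thesis
    proof cases
      case 1
      then have ap: "\<And>i. i \<in> I \<Longrightarrow> a i > 0" using A by auto
      have e: "(\<Sum>i\<in>I. g i * renyi_gen0 \<alpha> (u i)) = (\<Sum>i\<in>I. g i * u i) - sum g I - (\<Sum>i\<in>I. g i * ln (u i))"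
        if "\<And>i. i \<in> I \<Longrightarrow> u i > 0" for u
        unfolding sum_subtractf[symmetric]
        by (intro sum.cong refl) (use that 1 in \<open>auto simp: renyi_gen0_def renyi_gen_0 algebra_simps dest: that\<close>)
      show ?thesis using dom_neg[OF ap] by (simp add: e[OF ap] e a b)
    next
      case 2
      have e: "(\<Sum>i\<in>I. g i * renyi_gen0 \<alpha> (u i)) = (\<Sum>i\<in>I. g i * (u i * ln (u i))) - (\<Sum>i\<in>I. g i * u i) + sum g I"
        if "\<And>i. i \<in> I \<Longrightarrow> u i \<ge> 0" for u
        unfolding sum_subtractf[symmetric] sum.distrib[symmetric]
      proof (intro sum.cong refl)
        fix i assume "i \<in> I"
        then have "u i > 0 \<or> u i = 0" using that by force
        then show "g i * renyi_gen0 \<alpha> (u i) = g i * (u i * ln (u i)) - g i * u i + g i"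
          using 2 by (auto simp: renyi_gen0_def renyi_gen_def algebra_simps)
      qed
      show ?thesis using dom_1 by (simp add: e a b)
    next
      case 3
      have e: "(\<Sum>i\<in>I. g i * renyi_gen0 \<alpha> (u i)) = ((\<Sum>i\<in>I. g i * u i powr \<alpha>) - 1) / (\<alpha> * (\<alpha> - 1))"
        if u: "\<And>i. i \<in> I \<Longrightarrow> (\<alpha> > 0 \<or> u i > 0) \<and> u i \<ge> 0" "(\<Sum>i\<in>I. g i * u i) = 1" for u
      proof -
        have "(\<Sum>i\<in>I. g i * renyi_gen0 \<alpha> (u i)) = (\<Sum>i\<in>I. (g i * u i powr \<alpha> - g i - \<alpha> * (g i * u i - g i)) / (\<alpha> * (\<alpha> - 1)))"
        proof (intro sum.cong refl)
          fix i assume i: "i \<in> I"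
          show "g i * renyi_gen0 \<alpha> (u i) = (g i * u i powr \<alpha> - g i - \<alpha> * (g i * u i - g i)) / (\<alpha> * (\<alpha> - 1))"
            using u(1)[OF i] 3 by (subst renyi_gen0_powr) (auto simp: algebra_simps)
        qed
        also have "\<dots> = ((\<Sum>i\<in>I. g i * u i powr \<alpha>) - sum g I - \<alpha> * ((\<Sum>i\<in>I. g i * u i) - sum g I)) / (\<alpha> * (\<alpha> - 1))"
          unfolding sum_subtractf[symmetric] sum_distrib_left sum_divide_distrib by simp
        finally show ?thesis using u g by simp
      qed
      have ea: "(\<Sum>i\<in>I. g i * renyi_gen0 \<alpha> (a i)) = ((\<Sum>i\<in>I. g i * a i powr \<alpha>) - 1) / (\<alpha> * (\<alpha> - 1))" using A a by (intro e) auto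
      have eb: "(\<Sum>i\<in>I. g i * renyi_gen0 \<alpha> (b i)) = ((\<Sum>i\<in>I. g i * b i powr \<alpha>) - 1) / (\<alpha> * (\<alpha> - 1))" using B b by (intro e) auto
      consider "\<alpha> < 0" | "0 < \<alpha>" "\<alpha> < 1" | "1 < \<alpha>" using 3 by linarith
      then show ?thesis
      proof cases
        case 1
        then have "\<And>i. i \<in> I \<Longrightarrow> a i > 0" using A by force
        from dom_neg[OF this] show ?thesis unfolding ea eb using 1
          by (intro divide_right_mono) (auto simp: mult_nonpos_nonpos)
      next
        case 2
        then show ?thesis unfolding ea eb using dom_01[OF 2]
          by (intro divide_right_mono_neg) (auto simp: mult_nonneg_nonpos)
      next
        case 3
        then show ?thesis unfolding ea eb using dom_gt1[OF 3]
          by (intro divide_right_mono) auto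
      qed
    qed
  qed
  have "(\<Sum>i\<in>I. g i * renyi_gen \<alpha> (ln ((1 - \<epsilon>) * b i + \<epsilon>))) \<le> (\<Sum>i\<in>I. g i * ((1 - \<epsilon>) * renyi_gen0 \<alpha> (b i)))"
    by (intro sum_mono mult_left_mono renyi_gen0_contract) (use B b g(1) \<epsilon> in \<open>auto simp: less_imp_le\<close>)
  also have "\<dots> = (1 - \<epsilon>) * (\<Sum>i\<in>I. g i * renyi_gen0 \<alpha> (b i))" by (simp add: sum_distrib_left mult_ac)
  also have "\<dots> \<le> (1 - \<epsilon>) * (\<Sum>i\<in>I. g i * renyi_gen0 \<alpha> (a i))" using le \<epsilon> by (intro mult_left_mono) auto
  also have "\<dots> < (\<Sum>i\<in>I. g i * renyi_gen0 \<alpha> (a i))" using pos \<epsilon> by (simp add: left_diff_distrib)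
  finally show ?thesis by (rule order_tendstoD(1)[OF lim])
next
  case False
  then obtain i where i: "i \<in> I" "a i = 0" and \<alpha>: "\<alpha> \<le> 0" using a(1) by force
  define X where "X = (\<Sum>i\<in>I. g i * renyi_gen \<alpha> (ln ((1 - \<epsilon>) * b i + \<epsilon>)))"
  have "\<forall>\<^sub>F \<eta> in at_right 0. X / g i < renyi_gen \<alpha> (ln \<eta>)"
    using renyi_gen_at_zero_nonpos[OF \<alpha>] by (auto simp: filterlim_at_top_dense)
  then show ?thesis unfolding X_def[symmetric]
  proof (rule eventually_mono)
    fix \<eta> assume "X / g i < renyi_gen \<alpha> (ln \<eta>)"
    then have "X < g i * renyi_gen \<alpha> (ln ((1 - \<eta>) * a i + \<eta>))"
      using g(1)[OF i(1)] i by (simp add: pos_divide_less_eq mult.commute)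
    also have "\<dots> \<le> (\<Sum>i\<in>I. g i * renyi_gen \<alpha> (ln ((1 - \<eta>) * a i + \<eta>)))"
      by (rule member_le_sum) (use i I g(1) renyi_gen_nonneg in \<open>auto simp: less_imp_le\<close>)
    finally show "X < (\<Sum>i\<in>I. g i * renyi_gen \<alpha> (ln ((1 - \<eta>) * a i + \<eta>)))" .
  qed
qed

text \<open>A single \<open>\<eta>\<close> must serve all real orders. Outside a compact interval
  the extreme likelihood ratios decide, uniformly for \<open>\<eta> \<le> \<epsilon> / 2\<close>; on
  the interval, continuity in the order and compactness leave finitely many candidates, and since a
  smaller \<open>\<eta>\<close> is never worse, their minimum works.\<close>

lemma strict_dominance:
  fixes g a b :: "'a \<Rightarrow> real"
  assumes I: "finite I" and g: "\<And>i. i \<in> I \<Longrightarrow> g i > 0" "sum g I = 1"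
    and a: "\<And>i. i \<in> I \<Longrightarrow> a i \<ge> 0" "(\<Sum>i\<in>I. g i * a i) = 1"
    and b: "\<And>i. i \<in> I \<Longrightarrow> b i \<ge> 0" "(\<Sum>i\<in>I. g i * b i) = 1"
    and dom_gt1: "\<And>\<alpha>. \<alpha> > 1 \<Longrightarrow> (\<Sum>i\<in>I. g i * b i powr \<alpha>) \<le> (\<Sum>i\<in>I. g i * a i powr \<alpha>)"
    and dom_01: "\<And>\<alpha>. 0 < \<alpha> \<Longrightarrow> \<alpha> < 1 \<Longrightarrow> (\<Sum>i\<in>I. g i * a i powr \<alpha>) \<le> (\<Sum>i\<in>I. g i * b i powr \<alpha>)"
    and dom_1: "(\<Sum>i\<in>I. g i * (b i * ln (b i))) \<le> (\<Sum>i\<in>I. g i * (a i * ln (a i)))"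
    and dom_neg: "(\<And>i. i \<in> I \<Longrightarrow> a i > 0) \<Longrightarrow> (\<forall>i\<in>I. b i > 0) \<and>
       (\<Sum>i\<in>I. g i * ln (a i)) \<le> (\<Sum>i\<in>I. g i * ln (b i)) \<and>
       (\<forall>\<alpha><0. (\<Sum>i\<in>I. g i * b i powr \<alpha>) \<le> (\<Sum>i\<in>I. g i * a i powr \<alpha>))"
    and ne: "\<exists>i\<in>I. a i \<noteq> 1"
    and \<epsilon>: "0 < \<epsilon>" "\<epsilon> < 1"
  obtains \<eta> where "0 < \<eta>" "\<eta> < 1"
    "\<And>\<alpha>. (\<Sum>i\<in>I. g i * renyi_gen \<alpha> (ln ((1 - \<epsilon>) * b i + \<epsilon>))) <
          (\<Sum>i\<in>I. g i * renyi_gen \<alpha> (ln ((1 - \<eta>) * a i + \<eta>)))"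
    "\<exists>i\<in>I. \<forall>j\<in>I. (1 - \<epsilon>) * b j + \<epsilon> < (1 - \<eta>) * a i + \<eta>"
    "\<exists>i\<in>I. \<forall>j\<in>I. (1 - \<eta>) * a i + \<eta> < (1 - \<epsilon>) * b j + \<epsilon>"
proof -
  have c: "(1 - k) * u + k = u + k * (1 - u)" for k u :: real by (simp add: algebra_simps)
  define ca where "ca \<eta> i = (1 - \<eta>) * a i + \<eta>" for \<eta> i
  define cb where "cb i = (1 - \<epsilon>) * b i + \<epsilon>" for i
  have ca_pos: "ca \<eta> i > 0" if "i \<in> I" "0 < \<eta>" "\<eta> < 1" for \<eta> i
    using that a(1)[OF that(1)] by (auto simp: ca_def intro: add_nonneg_pos)
  have cb_pos: "cb i > 0" if "i \<in> I" for i
    using that b(1)[OF that(1)] \<epsilon> by (auto simp: cb_def intro: add_nonneg_pos)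
  have mean_c: "(\<Sum>i\<in>I. g i * ((1 - k) * u i + k)) = 1" if "(\<Sum>i\<in>I. g i * u i) = 1" for u and k :: real
  proof -
    have "(\<Sum>i\<in>I. g i * ((1 - k) * u i + k)) = (\<Sum>i\<in>I. (1 - k) * (g i * u i) + k * g i)"
      by (intro sum.cong) (auto simp: algebra_simps)
    also have "\<dots> = (1 - k) * (\<Sum>i\<in>I. g i * u i) + k * sum g I" by (simp only: sum.distrib sum_distrib_left)
    finally have "(\<Sum>i\<in>I. g i * ((1 - k) * u i + k)) = (1 - k) * (\<Sum>i\<in>I. g i * u i) + k * sum g I" .
    then show ?thesis using that g by simp
  qed
  have Ine: "I \<noteq> {}" using g(2) by auto
  have "Max (a ` I) \<in> a ` I" using I Ine by (intro Max_in) auto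
  then obtain i1 where i1: "i1 \<in> I" "a i1 = Max (a ` I)" by (metis imageE)
  have max: "a i \<le> a i1" if "i \<in> I" for i using I that by (simp add: i1)
  have "Min (a ` I) \<in> a ` I" using I Ine by (intro Min_in) auto
  then obtain i0 where i0: "i0 \<in> I" "a i0 = Min (a ` I)" by (metis imageE)
  have min: "a i0 \<le> a i" if "i \<in> I" for i using I that by (simp add: i0)
  have dev: "(\<Sum>i\<in>I. g i * (a i - 1)) = 0" using a g by (simp add: right_diff_distrib sum_subtractf)
  \<comment> \<open>With mean 1 and not constantly 1, \<open>a\<close> takes values on both sides of
    1; therefore mixing strictly shrinks its extremes.\<close>
  have all1: "False" if "(\<forall>i\<in>I. a i \<le> 1) \<or> (\<forall>i\<in>I. a i \<ge> 1)"
  proof -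
    have "(\<forall>i\<in>I. g i * (a i - 1) = 0)"
    proof (cases "\<forall>i\<in>I. a i \<ge> 1")
      case True
      then show ?thesis using sum_nonneg_eq_0_iff[OF I, of "\<lambda>i. g i * (a i - 1)"] dev g(1) by (simp add: less_imp_le)
    next
      case False
      then have "\<forall>i\<in>I. a i \<le> 1" using that by blast
      moreover have "(\<Sum>i\<in>I. g i * (1 - a i)) = 0" using dev by (simp add: right_diff_distrib sum_subtractf)
      ultimately show ?thesis using sum_nonneg_eq_0_iff[OF I, of "\<lambda>i. g i * (1 - a i)"] g(1) by (simp add: less_imp_le)
    qed
    then show False using ne g(1) by fastforce
  qed
  have a1: "a i1 > 1" using all1 max by (meson not_le order_trans)
  have a0: "a i0 < 1" using all1 min by (meson not_le order_trans)
  have b1: "b j \<le> a i1" if "j \<in> I" for j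
    by (rule powr_bound_of_dominance[OF I g, where a = a]) (use a max a1 that dom_gt1 in auto)
  \<comment> \<open>A vanishing minimum of \<open>a\<close> is trivial. Otherwise sums of negative
    order are power sums of the reciprocals, and the bound on maxima applies to these.\<close>
  have b0: "a i0 \<le> b j" if j: "j \<in> I" for j
  proof (cases "a i0 = 0")
    case False
    then have ap: "\<And>i. i \<in> I \<Longrightarrow> a i > 0" using min a(1) i0(1) by (metis less_eq_real_def order_less_le_trans)
    have bp: "\<And>i. i \<in> I \<Longrightarrow> b i > 0" using dom_neg[OF ap] by blast
    have inv: "inverse u powr \<alpha> = u powr (- \<alpha>)" if "u > 0" for u \<alpha> :: real
      using that by (simp add: powr_minus inverse_powr)
    have "inverse (b j) \<le> inverse (a i0)"
    proof (rule powr_bound_of_dominance[OF I g, where a = "\<lambda>i. inverse (a i)" and b = "\<lambda>i. inverse (b i)"])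
      fix \<alpha> :: real assume "\<alpha> > 1"
      then have "(\<Sum>i\<in>I. g i * b i powr (- \<alpha>)) \<le> (\<Sum>i\<in>I. g i * a i powr (- \<alpha>))" using dom_neg[OF ap] by simp
      then show "(\<Sum>i\<in>I. g i * inverse (b i) powr \<alpha>) \<le> (\<Sum>i\<in>I. g i * inverse (a i) powr \<alpha>)"
        using ap bp by (simp add: inv cong: sum.cong)
    qed (use ap i0(1) j min in \<open>auto simp: less_imp_le intro!: le_imp_inverse_le\<close>)
    then show ?thesis using bp[OF j] ap[OF i0(1)] by simp
  qed (use b j in auto)
  have up: "cb j < ca \<eta> i1" and dn: "ca \<eta> i0 < cb j" if "j \<in> I" "0 < \<eta>" "\<eta> < \<epsilon>" for j \<eta>
  proof -
    have "cb j \<le> (1 - \<epsilon>) * a i1 + \<epsilon>" unfolding cb_def using b1[OF that(1)] \<epsilon> by (intro add_right_mono mult_left_mono) auto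
    also have "\<dots> < ca \<eta> i1" unfolding ca_def c using mult_strict_right_mono_neg[OF that(3), of "1 - a i1"] a1 by simp
    finally show "cb j < ca \<eta> i1" .
    have "ca \<eta> i0 < (1 - \<epsilon>) * a i0 + \<epsilon>" unfolding ca_def c using mult_strict_right_mono[OF that(3), of "1 - a i0"] a0 by simp
    also have "\<dots> \<le> cb j" unfolding cb_def using b0[OF that(1)] \<epsilon> by (intro add_right_mono mult_left_mono) auto
    finally show "ca \<eta> i0 < cb j" .
  qed
  \<comment> \<open>\<open>U1\<close> and \<open>U0\<close> bound the mixed \<open>b\<close> from
    above and below; \<open>V1\<close> and \<open>V0\<close> are the extremes of \<open>a\<close> at
    the largest admissible mixing \<open>\<epsilon> / 2\<close>. Halving the mixing leaves a strict
    gap at both ends.\<close>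
  define U1 where "U1 = (1 - \<epsilon>) * a i1 + \<epsilon>"
  define V1 where "V1 = (1 - \<epsilon> / 2) * a i1 + \<epsilon> / 2"
  define U0 where "U0 = (1 - \<epsilon>) * a i0 + \<epsilon>"
  define V0 where "V0 = (1 - \<epsilon> / 2) * a i0 + \<epsilon> / 2"
  have "\<epsilon> * (1 - a i1) < \<epsilon> / 2 * (1 - a i1)" using \<epsilon> a1 by (intro mult_strict_right_mono_neg) auto
  then have "U1 < V1" unfolding U1_def V1_def c by linarith
  moreover have "0 < U1" unfolding U1_def using a1 \<epsilon> by (intro add_nonneg_pos) auto
  ultimately have UV1: "0 < U1" "U1 < V1" by auto
  have "\<epsilon> / 2 * (1 - a i0) < \<epsilon> * (1 - a i0)" using \<epsilon> a0 by (intro mult_strict_right_mono) auto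
  then have "V0 < U0" unfolding U0_def V0_def c by linarith
  moreover have "0 < V0" unfolding V0_def using a(1)[OF i0(1)] \<epsilon> by (intro add_nonneg_pos) auto
  ultimately have UV0: "0 < V0" "V0 < U0" by auto
  obtain A1 where A1: "A1 \<ge> 2" "\<And>\<alpha>. \<alpha> \<ge> A1 \<Longrightarrow> U1 powr \<alpha> < g i1 * V1 powr \<alpha>"
    using powr_eventually_dominates[OF UV1 g(1)[OF i1(1)]] by blast
  have "0 < inverse U0" "inverse U0 < inverse V0" using UV0 by (auto intro: less_imp_inverse_less)
  then obtain A0 where A0: "A0 \<ge> 2" "\<And>\<alpha>. \<alpha> \<ge> A0 \<Longrightarrow> inverse U0 powr \<alpha> < g i0 * inverse V0 powr \<alpha>"
    using powr_eventually_dominates[OF _ _ g(1)[OF i0(1)]] by blast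
  define G where "G \<eta> \<alpha> = (\<Sum>i\<in>I. g i * renyi_gen \<alpha> (ln (ca \<eta> i))) - (\<Sum>i\<in>I. g i * renyi_gen \<alpha> (ln (cb i)))" for \<eta> \<alpha>
  have G_powr: "\<alpha> * (\<alpha> - 1) * G \<eta> \<alpha> = (\<Sum>i\<in>I. g i * ca \<eta> i powr \<alpha>) - (\<Sum>i\<in>I. g i * cb i powr \<alpha>)" if "0 < \<eta>" "\<eta> < 1" for \<eta> \<alpha>
  proof -
    have "\<alpha> * (\<alpha> - 1) * (\<Sum>i\<in>I. g i * renyi_gen \<alpha> (ln (ca \<eta> i))) = (\<Sum>i\<in>I. g i * ca \<eta> i powr \<alpha>) - 1"
      by (rule sum_renyi_gen) (use g that ca_pos mean_c[OF a(2)] in \<open>auto simp: ca_def\<close>)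
    moreover have "\<alpha> * (\<alpha> - 1) * (\<Sum>i\<in>I. g i * renyi_gen \<alpha> (ln (cb i))) = (\<Sum>i\<in>I. g i * cb i powr \<alpha>) - 1"
      by (rule sum_renyi_gen) (use g cb_pos mean_c[OF b(2)] in \<open>auto simp: cb_def\<close>)
    ultimately show ?thesis unfolding G_def right_diff_distrib[of "\<alpha> * (\<alpha> - 1)"] by simp
  qed
  have large: "G \<eta> \<alpha> > 0" if \<eta>: "0 < \<eta>" "\<eta> \<le> \<epsilon> / 2" and \<alpha>: "\<alpha> \<ge> A1 \<or> \<alpha> \<le> - A0" for \<eta> \<alpha>
  proof -
    have \<eta>1: "\<eta> < 1" using \<eta> \<epsilon> by simp
    have "(\<Sum>i\<in>I. g i * cb i powr \<alpha>) < (\<Sum>i\<in>I. g i * ca \<eta> i powr \<alpha>)"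
    proof (cases "\<alpha> \<ge> A1")
      case True
      have "(\<Sum>i\<in>I. g i * cb i powr \<alpha>) \<le> (\<Sum>i\<in>I. g i * U1 powr \<alpha>)"
      proof (intro sum_mono mult_left_mono powr_mono2)
        fix i assume i: "i \<in> I"
        show "cb i \<le> U1" unfolding cb_def U1_def using b1[OF i] \<epsilon> by (intro add_right_mono mult_left_mono) auto
      qed (use g cb_pos True A1 in \<open>auto simp: less_imp_le\<close>)
      also have "\<dots> = U1 powr \<alpha>" using g by (simp flip: sum_distrib_right)
      also have "\<dots> < g i1 * V1 powr \<alpha>" using A1 True by blast
      also have "\<dots> \<le> g i1 * ca \<eta> i1 powr \<alpha>"
      proof (intro mult_left_mono powr_mono2)
        show "V1 \<le> ca \<eta> i1" unfolding V1_def ca_def c using mult_right_mono_neg[OF \<eta>(2), of "1 - a i1"] a1 by simp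
      qed (use g i1 True A1 UV1 in \<open>auto simp: less_imp_le\<close>)
      also have "\<dots> \<le> (\<Sum>i\<in>I. g i * ca \<eta> i powr \<alpha>)"
        by (rule member_le_sum) (use I i1 g in \<open>auto simp: less_imp_le\<close>)
      finally show ?thesis .
    next
      case False
      then have \<alpha>n: "- \<alpha> \<ge> A0" using \<alpha> by simp
      have inv: "inverse u powr (- \<alpha>) = u powr \<alpha>" if "u > 0" for u
        using that by (simp add: powr_minus inverse_powr)
      have "(\<Sum>i\<in>I. g i * cb i powr \<alpha>) \<le> (\<Sum>i\<in>I. g i * U0 powr \<alpha>)"
      proof (intro sum_mono mult_left_mono powr_mono2')
        fix i assume i: "i \<in> I"
        show "U0 \<le> cb i" unfolding cb_def U0_def using b0[OF i] \<epsilon> by (intro add_right_mono mult_left_mono) auto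
      qed (use g UV0 \<alpha>n A0 in \<open>auto simp: less_imp_le\<close>)
      also have "\<dots> = U0 powr \<alpha>" using g by (simp flip: sum_distrib_right)
      also have "\<dots> < g i0 * V0 powr \<alpha>" using A0(2)[OF \<alpha>n] UV0 by (simp add: inv)
      also have "\<dots> \<le> g i0 * ca \<eta> i0 powr \<alpha>"
      proof (intro mult_left_mono powr_mono2')
        show "ca \<eta> i0 \<le> V0" unfolding V0_def ca_def c using mult_right_mono[OF \<eta>(2), of "1 - a i0"] a0 by simp
      qed (use g i0 \<alpha>n A0 ca_pos[OF i0(1) \<eta>(1) \<eta>1] in \<open>auto simp: less_imp_le\<close>)
      also have "\<dots> \<le> (\<Sum>i\<in>I. g i * ca \<eta> i powr \<alpha>)"
        by (rule member_le_sum) (use I i0 g in \<open>auto simp: less_imp_le\<close>)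
      finally show ?thesis .
    qed
    then have "\<alpha> * (\<alpha> - 1) * G \<eta> \<alpha> > 0" using G_powr[OF \<eta>(1) \<eta>1] by simp
    moreover have "\<alpha> * (\<alpha> - 1) > 0" using \<alpha> A1 A0 by (auto intro: mult_pos_pos mult_neg_neg)
    ultimately show ?thesis by (simp add: zero_less_mult_iff)
  qed
  have G_mono: "G \<eta> \<alpha> \<le> G \<eta>' \<alpha>" if "0 < \<eta>'" "\<eta>' \<le> \<eta>" "\<eta> < 1" for \<eta> \<eta>' \<alpha>
    unfolding G_def ca_def
    by (intro diff_mono sum_mono mult_left_mono renyi_gen_contract_mono order.refl) (use that a g in \<open>auto simp: less_imp_le\<close>)
  have "\<exists>\<eta>. 0 < \<eta> \<and> \<eta> \<le> \<epsilon> / 2 \<and> G \<eta> \<alpha> > 0" for \<alpha>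
  proof -
    have "\<forall>\<^sub>F \<eta> in at_right 0. G \<eta> \<alpha> > 0"
      using strict_dominance_pointwise[OF I g a b dom_gt1 dom_01 dom_1 dom_neg ne \<epsilon>, of \<alpha>]
      by (simp add: G_def ca_def cb_def)
    moreover have "\<forall>\<^sub>F \<eta> in at_right (0::real). \<eta> \<in> {0<..<\<epsilon> / 2}" using \<epsilon> by (intro eventually_at_right_real) auto
    ultimately have "\<forall>\<^sub>F \<eta> in at_right 0. G \<eta> \<alpha> > 0 \<and> \<eta> \<in> {0<..<\<epsilon> / 2}" by (rule eventually_conj)
    then obtain \<eta> where "G \<eta> \<alpha> > 0 \<and> \<eta> \<in> {0<..<\<epsilon> / 2}"
      using eventually_happens trivial_limit_at_right_real by blast
    then show ?thesis by (intro exI[of _ \<eta>]) auto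
  qed
  then obtain h where h: "\<And>\<alpha>. 0 < h \<alpha>" "\<And>\<alpha>. h \<alpha> \<le> \<epsilon> / 2" "\<And>\<alpha>. G (h \<alpha>) \<alpha> > 0" by metis
  define W where "W \<alpha> = {\<alpha>'. G (h \<alpha>) \<alpha>' > 0}" for \<alpha>
  have "open (W \<alpha>)" for \<alpha>
  proof -
    have "continuous_on UNIV (\<lambda>\<alpha>'. G (h \<alpha>) \<alpha>')" unfolding G_def by (intro continuous_intros continuous_renyi_gen)
    then show ?thesis unfolding W_def by (intro open_Collect_less continuous_on_const)
  qed
  moreover have "{- A0..A1} \<subseteq> (\<Union>\<alpha>\<in>UNIV. W \<alpha>)" using h by (auto simp: W_def)
  ultimately obtain C where C: "finite C" "{- A0..A1} \<subseteq> (\<Union>\<alpha>\<in>C. W \<alpha>)"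
    using compactE_image[OF compact_Icc, of UNIV W "-A0" A1] by (metis subset_UNIV)
  define \<eta> where "\<eta> = Min (insert (\<epsilon> / 2) (h ` C))"
  have fin: "finite (insert (\<epsilon> / 2) (h ` C))" using C by simp
  have \<eta>: "0 < \<eta>" "\<eta> \<le> \<epsilon> / 2" "\<And>\<alpha>. \<alpha> \<in> C \<Longrightarrow> \<eta> \<le> h \<alpha>"
  proof -
    show "0 < \<eta>" unfolding \<eta>_def using fin h(1) \<epsilon> by (subst Min_gr_iff) auto
    show "\<eta> \<le> \<epsilon> / 2" unfolding \<eta>_def by (rule Min_le[OF fin]) simp
    show "\<And>\<alpha>. \<alpha> \<in> C \<Longrightarrow> \<eta> \<le> h \<alpha>" unfolding \<eta>_def by (rule Min_le[OF fin]) simp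
  qed
  have "G \<eta> \<alpha> > 0" for \<alpha>
  proof (cases "\<alpha> \<in> {- A0..A1}")
    case True
    then obtain \<alpha>' where \<alpha>': "\<alpha>' \<in> C" "G (h \<alpha>') \<alpha> > 0" using C by (auto simp: W_def)
    have "h \<alpha>' < 1" using h(2)[of \<alpha>'] \<epsilon> by simp
    then have "G (h \<alpha>') \<alpha> \<le> G \<eta> \<alpha>" using \<eta> \<alpha>'(1) by (intro G_mono) auto
    then show ?thesis using \<alpha>' by simp
  next
    case False
    then show ?thesis using \<eta> by (intro large) auto
  qed
  then have "\<And>\<alpha>. (\<Sum>i\<in>I. g i * renyi_gen \<alpha> (ln ((1 - \<epsilon>) * b i + \<epsilon>))) <
          (\<Sum>i\<in>I. g i * renyi_gen \<alpha> (ln ((1 - \<eta>) * a i + \<eta>)))"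
    by (simp add: G_def ca_def cb_def)
  moreover have "\<exists>i\<in>I. \<forall>j\<in>I. (1 - \<epsilon>) * b j + \<epsilon> < (1 - \<eta>) * a i + \<eta>"
    using i1(1) up[of _ \<eta>] \<eta> \<epsilon> unfolding ca_def cb_def by (intro bexI[of _ i1]) auto
  moreover have "\<exists>i\<in>I. \<forall>j\<in>I. (1 - \<eta>) * a i + \<eta> < (1 - \<epsilon>) * b j + \<epsilon>"
    using i0(1) dn[of _ \<eta>] \<eta> \<epsilon> unfolding ca_def cb_def by (intro bexI[of _ i0]) auto
  moreover have "\<eta> < 1" using \<eta> \<epsilon> by simp
  ultimately show ?thesis using that \<eta>(1) by blast
qed

subsection \<open>Catalytic conversion on a lattice\<close>

text \<open>Position \<open>k\<close> of the lattice carries likelihood ratio \<open>exp (\<delta> * (k - K))\<close>.\<close>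

lemma lattice_factorization:
  fixes D :: "real poly" and K \<delta> :: real
  assumes \<delta>: "\<delta> > 0" and deg: "degree D \<le> b"
    and zero: "(\<Sum>k\<le>b. coeff D k) = 0" "(\<Sum>k\<le>b. coeff D k * exp (\<delta> * (real k - K))) = 0"
    and pos: "\<And>\<alpha>. (\<Sum>k\<le>b. coeff D k * renyi_gen \<alpha> (\<delta> * (real k - K))) > 0"
  obtains f where "D = [:-1, 1:] * [:- exp \<delta>, 1:] * f" "\<And>z. z > 0 \<Longrightarrow> poly f z > 0"
proof -
  define x where "x = exp \<delta>"
  have x: "x > 1" using \<delta> by (simp add: x_def)
  have polyD: "poly D z = (\<Sum>k\<le>b. coeff D k * z ^ k)" for z
  proof -
    have "(\<Sum>k\<le>b. coeff D k * z ^ k) = (\<Sum>k\<le>degree D. coeff D k * z ^ k)"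
      by (rule sum.mono_neutral_right) (use deg in \<open>auto simp: coeff_eq_0\<close>)
    then show ?thesis by (simp add: poly_altdef)
  qed
  have shift: "poly D (exp (\<delta> * \<alpha>)) = exp (\<alpha> * \<delta> * K) * (\<Sum>k\<le>b. coeff D k * exp (\<alpha> * (\<delta> * (real k - K))))" for \<alpha>
    unfolding polyD sum_distrib_left
    by (intro sum.cong refl) (simp add: exp_of_nat_mult[symmetric] exp_add[symmetric] algebra_simps flip: exp_add)
  \<comment> \<open>The zero at 1 is equality of the masses of the second weights, the zero at
    \<open>exp \<delta>\<close> equality of the masses of the first.\<close>
  have "poly D 1 = 0" using zero(1) by (simp add: polyD)
  then obtain D1 where D1: "D = [:-1, 1:] * D1" by (metis dvdE poly_eq_0_iff_dvd)
  have "poly D x = 0" using shift[of 1] zero(2) by (simp add: x_def)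
  then have "poly D1 x = 0" using x by (simp add: D1)
  then obtain f where f: "D1 = [:-x, 1:] * f" by (metis dvdE poly_eq_0_iff_dvd)
  have D: "D = [:-1, 1:] * [:-x, 1:] * f" by (simp only: D1 f mult.assoc)
  have Dz: "poly D z = (z - 1) * (z - x) * poly f z" for z unfolding D by (simp add: algebra_simps)
  have dD: "poly (pderiv D) z = (\<Sum>k\<le>b. coeff D k * (real k * z ^ (k - 1)))" for z
  proof -
    have "((\<lambda>z. \<Sum>k\<le>b. coeff D k * z ^ k) has_real_derivative (\<Sum>k\<le>b. coeff D k * (real k * z ^ (k - 1)))) (at z)"
      by (auto intro!: derivative_eq_intros simp: mult_ac)
    moreover have "(poly D has_real_derivative poly (pderiv D) z) (at z)" by (rule poly_DERIV)
    moreover have "poly D = (\<lambda>z. \<Sum>k\<le>b. coeff D k * z ^ k)" using polyD by auto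
    ultimately show ?thesis using DERIV_unique by metis
  qed
  have dD1: "poly (pderiv D) 1 = (1 - x) * poly f 1" "poly (pderiv D) x = (x - 1) * poly f x"
  proof -
    have Dq: "D = [:x, - x - 1, 1:] * f" unfolding D by simp
    show "poly (pderiv D) 1 = (1 - x) * poly f 1" "poly (pderiv D) x = (x - 1) * poly f x"
      unfolding Dq pderiv_mult poly_add poly_mult by (simp_all add: pderiv_mult pderiv_pCons algebra_simps)
  qed
  have "poly f z > 0" if z: "z > 0" for z
  proof -
    define \<alpha> where "\<alpha> = ln z / \<delta>"
    have za: "z = exp (\<delta> * \<alpha>)" using z \<delta> by (simp add: \<alpha>_def)
    consider "\<alpha> = 0" | "\<alpha> = 1" | "\<alpha> \<noteq> 0" "\<alpha> \<noteq> 1" by blast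
    then show ?thesis
    proof cases
      \<comment> \<open>At a divided-out zero the quotient is a derivative: \<open>poly f 1\<close>
        is \<open>poly (pderiv D) 1 / (1 - x)\<close>. The generator of order 0 sums to
        \<open>- (\<delta> * poly (pderiv D) 1)\<close>, as its other terms vanish by equality of
        masses. Order 1 plays the same role at \<open>z = x\<close>.\<close>
      case 1
      have "(\<Sum>k\<le>b. coeff D k * renyi_gen 0 (\<delta> * (real k - K))) =
        (\<Sum>k\<le>b. coeff D k * exp (\<delta> * (real k - K)) - (1 - \<delta> * K) * coeff D k - \<delta> * (coeff D k * real k))"
        by (intro sum.cong refl) (simp add: renyi_gen_0 algebra_simps)
      also have "\<dots> = - (\<delta> * poly (pderiv D) 1)"
        using zero by (simp add: sum_subtractf dD flip: sum_distrib_left)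
      finally have "\<delta> * ((x - 1) * poly f 1) > 0" using pos[of 0] by (simp add: dD1 algebra_simps)
      then show ?thesis using 1 x \<delta> by (simp add: za zero_less_mult_iff)
    next
      case 2
      have "(\<Sum>k\<le>b. coeff D k * renyi_gen 1 (\<delta> * (real k - K))) =
        (\<Sum>k\<le>b. \<delta> * (exp (- \<delta> * K) * x) * (coeff D k * (real k * x ^ (k - 1))) - (1 + \<delta> * K) * (coeff D k * exp (\<delta> * (real k - K))) + coeff D k)"
      proof (intro sum.cong refl)
        fix k
        have "real k * exp (\<delta> * (real k - K)) = exp (- \<delta> * K) * x * (real k * x ^ (k - 1))"
        proof (cases k)
          case (Suc j)
          have "exp (\<delta> * (real k - K)) = exp (- \<delta> * K) * x ^ k"
            by (simp add: x_def exp_of_nat_mult[symmetric] flip: exp_add) (simp add: algebra_simps)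
          then show ?thesis using Suc by simp
        qed simp
        then have *: "coeff D k * (\<delta> * (real k * exp (\<delta> * (real k - K)))) = \<delta> * (exp (- \<delta> * K) * x) * (coeff D k * (real k * x ^ (k - 1)))"
          by simp
        show "coeff D k * renyi_gen 1 (\<delta> * (real k - K)) =
          \<delta> * (exp (- \<delta> * K) * x) * (coeff D k * (real k * x ^ (k - 1))) - (1 + \<delta> * K) * (coeff D k * exp (\<delta> * (real k - K))) + coeff D k"
          unfolding *[symmetric] by (simp add: renyi_gen_def algebra_simps)
      qed
      also have "\<dots> = \<delta> * (exp (- \<delta> * K) * x) * poly (pderiv D) x"
        using zero by (simp add: sum_subtractf sum.distrib dD flip: sum_distrib_left)
      finally have "\<delta> * (exp (- \<delta> * K) * x) * ((x - 1) * poly f x) > 0" using pos[of 1] by (simp add: dD1)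
      moreover have "\<delta> * (exp (- \<delta> * K) * x) > 0" using \<delta> x by simp
      ultimately have "(x - 1) * poly f x > 0" by (rule zero_less_mult_pos)
      then show ?thesis using 2 x by (simp add: za x_def zero_less_mult_iff)
    next
      case 3
      have "\<alpha> * (\<alpha> - 1) * (\<Sum>k\<le>b. coeff D k * renyi_gen \<alpha> (\<delta> * (real k - K))) =
        (\<Sum>k\<le>b. coeff D k * (\<alpha> * (\<alpha> - 1) * renyi_gen \<alpha> (\<delta> * (real k - K))))"
        by (simp add: sum_distrib_left mult_ac)
      also have "\<dots> = (\<Sum>k\<le>b. coeff D k * exp (\<alpha> * (\<delta> * (real k - K))) - (1 - \<alpha>) * coeff D k - \<alpha> * (coeff D k * exp (\<delta> * (real k - K))))"
        unfolding renyi_gen_mult by (intro sum.cong refl) (simp add: algebra_simps)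
      also have "\<dots> = (\<Sum>k\<le>b. coeff D k * exp (\<alpha> * (\<delta> * (real k - K))))"
        using zero by (simp add: sum_subtractf flip: sum_distrib_left)
      finally have "poly D z = exp (\<alpha> * \<delta> * K) * (\<alpha> * (\<alpha> - 1) * (\<Sum>k\<le>b. coeff D k * renyi_gen \<alpha> (\<delta> * (real k - K))))"
        unfolding za shift by simp
      then have e: "(z - 1) * (z - x) * poly f z = (exp (\<alpha> * \<delta> * K) * (\<Sum>k\<le>b. coeff D k * renyi_gen \<alpha> (\<delta> * (real k - K)))) * (\<alpha> * (\<alpha> - 1))"
        unfolding Dz by (simp only: mult_ac)
      have S: "exp (\<alpha> * \<delta> * K) * (\<Sum>k\<le>b. coeff D k * renyi_gen \<alpha> (\<delta> * (real k - K))) > 0" using pos by simp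
      \<comment> \<open>\<open>z - 1\<close> and \<open>z - x\<close> have the signs of \<alpha> and
        \<open>\<alpha> - 1\<close>, so the divided-out factors have the sign of the prefactor
        \<open>\<alpha> * (\<alpha> - 1)\<close> of the generator.\<close>
      have z1: "z > 1 \<longleftrightarrow> \<alpha> > 0" "z > x \<longleftrightarrow> \<alpha> > 1" "z < 1 \<longleftrightarrow> \<alpha> < 0" "z < x \<longleftrightarrow> \<alpha> < 1"
        using \<delta> by (auto simp: za x_def zero_less_mult_iff mult_less_0_iff)
      consider "\<alpha> < 0 \<or> \<alpha> > 1" | "0 < \<alpha>" "\<alpha> < 1" using 3 by linarith
      then show ?thesis
      proof cases
        case 1
        then have "\<alpha> * (\<alpha> - 1) > 0" by (auto intro: mult_pos_pos mult_neg_neg)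
        then have "(z - 1) * (z - x) * poly f z > 0" unfolding e using S by simp
        moreover have "(z - 1) * (z - x) > 0"
          using 1 z1 x mult_pos_pos[of "z - 1" "z - x"] mult_neg_neg[of "z - 1" "z - x"] by fastforce
        ultimately show ?thesis by (simp add: zero_less_mult_iff)
      next
        case 2
        then have "\<alpha> * (\<alpha> - 1) < 0" by (auto intro: mult_pos_neg)
        then have "(z - 1) * (z - x) * poly f z < 0" unfolding e using S by (simp add: mult_pos_neg)
        moreover have "(z - 1) * (z - x) < 0" using 2 z1 by (auto intro!: mult_pos_neg)
        ultimately show ?thesis by (auto simp: mult_less_0_iff)
      qed
    qed
  qed
  then show ?thesis using that[of f] D by (simp add: x_def)
qed

lemma coeff_sum_monom: "finite Y \<Longrightarrow> coeff (\<Sum>y\<in>Y. monom (v y) (pos y)) k = (\<Sum>y | y \<in> Y \<and> pos y = k. v y)"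
  by (simp add: coeff_sum sum.inter_filter)

lemma sum_coeff_sum_monom:
  fixes F :: "nat \<Rightarrow> real"
  assumes "finite Y" "pos \<in> Y \<rightarrow> {..b}"
  shows "(\<Sum>k\<le>b. coeff (\<Sum>y\<in>Y. monom (v y) (pos y)) k * F k) = (\<Sum>y\<in>Y. v y * F (pos y))"
proof -
  have "(\<Sum>k\<le>b. coeff (\<Sum>y\<in>Y. monom (v y) (pos y)) k * F k) = (\<Sum>k\<le>b. \<Sum>y | y \<in> Y \<and> pos y = k. v y * F (pos y))"
    unfolding coeff_sum_monom[OF assms(1)] sum_distrib_right by (intro sum.cong) auto
  also have "\<dots> = (\<Sum>y\<in>Y. v y * F (pos y))"
    by (rule sum.group) (use assms in auto)
  finally show ?thesis .
qed

text \<open>The interface to polynomials. \<open>Y\<close> and \<open>Z\<close> index the atoms of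
  two pairs of weights whose likelihood ratios lie on the lattice. Atoms at one site have equal
  ratio, so merging them is reversible and only the site masses, which become coefficients, matter.
  \<open>conv\<close> leads into this form and \<open>conv'\<close> out of it; the bound by \<kappa>
  and the mass at both ends are what the path between the polynomials requires.\<close>

lemma catalysis_from_lattice:
  fixes pos :: "'y \<Rightarrow> nat" and pos' :: "'z \<Rightarrow> nat" and v :: "'y \<Rightarrow> real" and u :: "'z \<Rightarrow> real"
  assumes \<delta>: "\<delta> > 0" and fin: "finite I" "finite Y" "finite Z" "Z \<noteq> {}"
    and pos: "pos \<in> Y \<rightarrow> {..b}" and pos': "pos' \<in> Z \<rightarrow> {..b}"
    and v: "\<And>y. y \<in> Y \<Longrightarrow> v y \<ge> 0" and u: "\<And>z. z \<in> Z \<Longrightarrow> u z \<ge> 0"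
    and ends: "\<exists>y\<in>Y. pos y = 0 \<and> v y > 0" "\<exists>y\<in>Y. pos y = b \<and> v y > 0"
    and \<kappa>: "\<kappa> > 0" "\<And>k. (\<Sum>z | z \<in> Z \<and> pos' z = k. u z) \<ge> \<kappa> * (\<Sum>y | y \<in> Y \<and> pos y = k. v y)"
    and mass: "sum v Y = sum u Z"
      "(\<Sum>y\<in>Y. v y * exp (\<delta> * (real (pos y) - K))) = (\<Sum>z\<in>Z. u z * exp (\<delta> * (real (pos' z) - K)))"
    and dom: "\<And>\<alpha>. (\<Sum>z\<in>Z. u z * renyi_gen \<alpha> (\<delta> * (real (pos' z) - K))) < (\<Sum>y\<in>Y. v y * renyi_gen \<alpha> (\<delta> * (real (pos y) - K)))"
    and conv: "converts I A B Y (\<lambda>y. exp (\<delta> * (real (pos y) - K)) * v y) v"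
    and conv': "converts Z (\<lambda>z. exp (\<delta> * (real (pos' z) - K)) * u z) u I A' B'"
  shows "\<exists>N. converts (I \<times> {..N}) (\<lambda>(i, m). A i * (real (N choose m) * exp \<delta> ^ m)) (\<lambda>(i, m). B i * real (N choose m))
    (I \<times> {..N}) (\<lambda>(i, m). A' i * (real (N choose m) * exp \<delta> ^ m)) (\<lambda>(i, m). B' i * real (N choose m))"
proof -
  define w where "w = (\<Sum>y\<in>Y. monom (v y) (pos y))"
  define w' where "w' = (\<Sum>z\<in>Z. monom (u z) (pos' z))"
  have cw: "coeff w k = (\<Sum>y | y \<in> Y \<and> pos y = k. v y)" for k unfolding w_def by (rule coeff_sum_monom[OF fin(2)])
  have cw': "coeff w' k = (\<Sum>z | z \<in> Z \<and> pos' z = k. u z)" for k unfolding w'_def by (rule coeff_sum_monom[OF fin(3)])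
  have Sw: "(\<Sum>k\<le>b. coeff w k * F k) = (\<Sum>y\<in>Y. v y * F (pos y))" for F :: "nat \<Rightarrow> real"
    unfolding w_def by (rule sum_coeff_sum_monom[OF fin(2) pos])
  have Sw': "(\<Sum>k\<le>b. coeff w' k * F k) = (\<Sum>z\<in>Z. u z * F (pos' z))" for F :: "nat \<Rightarrow> real"
    unfolding w'_def by (rule sum_coeff_sum_monom[OF fin(3) pos'])
  have w0: "coeff w k \<ge> 0" for k unfolding cw by (intro sum_nonneg) (use v in auto)
  have wpos: "coeff w (pos y) > 0" if "y \<in> Y" "v y > 0" for y
    unfolding cw by (rule sum_pos2[of _ y]) (use that v fin in auto)
  have deg: "degree w \<le> b" "degree w' \<le> b"
    unfolding w_def w'_def by (intro degree_sum_le order.trans[OF degree_monom_le]; use fin pos pos' in auto)+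
  have "coeff w b > 0" using ends(2) wpos by auto
  then have degw: "degree w = b" using deg(1) by (metis antisym le_degree less_irrefl)
  have dist: "(\<Sum>k\<le>b. coeff (w - w') k * F k) = (\<Sum>k\<le>b. coeff w k * F k) - (\<Sum>k\<le>b. coeff w' k * F k)" for F :: "nat \<Rightarrow> real"
    by (simp add: left_diff_distrib sum_subtractf)
  have z1: "(\<Sum>k\<le>b. coeff (w - w') k) = 0" using dist[of "\<lambda>_. 1"] Sw[of "\<lambda>_. 1"] Sw'[of "\<lambda>_. 1"] mass by simp
  have z2: "(\<Sum>k\<le>b. coeff (w - w') k * exp (\<delta> * (real k - K))) = 0" unfolding dist Sw Sw' using mass by simp
  have z3: "(\<Sum>k\<le>b. coeff (w - w') k * renyi_gen \<alpha> (\<delta> * (real k - K))) > 0" for \<alpha> unfolding dist Sw Sw' using dom[of \<alpha>] by simp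
  obtain f where f: "w - w' = [:-1, 1:] * [:- exp \<delta>, 1:] * f" "\<And>z. z > 0 \<Longrightarrow> poly f z > 0"
    using lattice_factorization[OF \<delta> degree_diff_le[OF deg] z1 z2 z3] by metis
  define c where "c = exp (- \<delta> * K)"
  have ex: "exp (\<delta> * (real k - K)) = c * exp \<delta> ^ k" for k
    by (simp add: c_def exp_of_nat_mult[symmetric] flip: exp_add) (simp add: algebra_simps)
  obtain N where N: "converts ({..b} \<times> {..N})
    (\<lambda>(k, m). c * exp \<delta> ^ k * coeff w k * (real (N choose m) * exp \<delta> ^ m)) (\<lambda>(k, m). coeff w k * real (N choose m))
    ({..b} \<times> {..N})
    (\<lambda>(k, m). c * exp \<delta> ^ k * coeff w' k * (real (N choose m) * exp \<delta> ^ m)) (\<lambda>(k, m). coeff w' k * real (N choose m))"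
    using lattice_catalysis[OF _ degw deg(2) w0 _ \<kappa>(1) _ f] ends(1) wpos \<kappa>(2) by (force simp: cw cw')
  have "converts Y (\<lambda>y. exp (\<delta> * (real (pos y) - K)) * v y) v {..b}
    (\<lambda>k. \<Sum>y | y \<in> Y \<and> pos y = k. exp (\<delta> * (real (pos y) - K)) * v y) (\<lambda>k. \<Sum>y | y \<in> Y \<and> pos y = k. v y)"
    by (rule converts_push[OF fin(2) _ pos]) simp
  moreover have "(\<Sum>y | y \<in> Y \<and> pos y = k. exp (\<delta> * (real (pos y) - K)) * v y) = c * exp \<delta> ^ k * coeff w k" for k
    unfolding ex cw sum_distrib_left by (rule sum.cong) auto
  ultimately have "converts Y (\<lambda>y. exp (\<delta> * (real (pos y) - K)) * v y) v {..b} (\<lambda>k. c * exp \<delta> ^ k * coeff w k) (coeff w)"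
    by (simp add: cw[abs_def])
  then have 1: "converts I A B {..b} (\<lambda>k. c * exp \<delta> ^ k * coeff w k) (coeff w)"
    by (rule converts_trans[OF fin(2) conv])
  have "converts {..b} (\<lambda>k. c * exp \<delta> ^ k * coeff w' k) (coeff w') Z (\<lambda>z. exp (\<delta> * (real (pos' z) - K)) * u z) u"
    by (rule converts_refine[OF fin(3) _ pos' fin(4)]) (auto simp: u cw' ex)
  then have 2: "converts {..b} (\<lambda>k. c * exp \<delta> ^ k * coeff w' k) (coeff w') I A' B'"
    by (rule converts_trans[OF fin(3) _ conv'])
  have 3: "converts (I \<times> {..N}) (\<lambda>(i, m). A i * (real (N choose m) * exp \<delta> ^ m)) (\<lambda>(i, m). B i * real (N choose m))
    ({..b} \<times> {..N}) (\<lambda>(k, m). c * exp \<delta> ^ k * coeff w' k * (real (N choose m) * exp \<delta> ^ m)) (\<lambda>(k, m). coeff w' k * real (N choose m))"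
    by (rule converts_trans[OF _ converts_tensor[OF 1] N]) (use fin in auto)
  have "converts (I \<times> {..N}) (\<lambda>(i, m). A i * (real (N choose m) * exp \<delta> ^ m)) (\<lambda>(i, m). B i * real (N choose m))
    (I \<times> {..N}) (\<lambda>(i, m). A' i * (real (N choose m) * exp \<delta> ^ m)) (\<lambda>(i, m). B' i * real (N choose m))"
    by (rule converts_trans[OF _ 3 converts_tensor[OF 2]]) (use fin in auto)
  then show ?thesis by blast
qed

subsection \<open>Classical catalytic conversion\<close>

text \<open>Rounding must be realized by stochastic maps in the right direction: from the given pair
  to a lattice pair, and from another lattice pair back. On the \<open>b\<close> side each ratio is
  split between its two lattice neighbours, of which it is a coarse-graining. On the
  \<open>a\<close> side each ratio is moved towards 1 by adding equal masses to both weights. The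
  part \<open>1 - T\<close> reserves a copy of the source inside the target, which yields the lower
  bound needed along the path between the polynomials.\<close>

lemma catalytic_conversion_strict:
  fixes g a b :: "'a \<Rightarrow> real"
  assumes I: "finite I" and g: "\<And>i. i \<in> I \<Longrightarrow> g i > 0" "sum g I = 1"
    and a: "\<And>i. i \<in> I \<Longrightarrow> a i > 0" "(\<Sum>i\<in>I. g i * a i) = 1"
    and b: "\<And>i. i \<in> I \<Longrightarrow> b i > 0" "(\<Sum>i\<in>I. g i * b i) = 1"
    and dom: "\<And>\<alpha>. (\<Sum>i\<in>I. g i * renyi_gen \<alpha> (ln (b i))) < (\<Sum>i\<in>I. g i * renyi_gen \<alpha> (ln (a i)))"
    and i1: "i1 \<in> I" "\<And>j. j \<in> I \<Longrightarrow> b j < a i1"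
    and i0: "i0 \<in> I" "\<And>j. j \<in> I \<Longrightarrow> a i0 < b j"
    and T: "0 < T" "T < 1"
  shows "\<exists>N \<delta>. converts (I \<times> {..N})
    (\<lambda>(i, m). g i * a i * (real (N choose m) * exp \<delta> ^ m)) (\<lambda>(i, m). g i * real (N choose m))
    (I \<times> {..N})
    (\<lambda>(i, m). ((1 - T) * g i + T * (g i * b i)) * (real (N choose m) * exp \<delta> ^ m)) (\<lambda>(i, m). g i * real (N choose m))"
proof -
  have Ine: "I \<noteq> {}" using i1 by auto
  define \<beta>1 where "\<beta>1 = Max ((\<lambda>j. ln (b j)) ` I)"
  define \<beta>0 where "\<beta>0 = Min ((\<lambda>j. ln (b j)) ` I)"
  have \<beta>: "ln (b j) \<le> \<beta>1" "\<beta>0 \<le> ln (b j)" if "j \<in> I" for j using I that by (auto simp: \<beta>1_def \<beta>0_def)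
  have "\<beta>1 < ln (a i1)" "ln (a i0) < \<beta>0"
    unfolding \<beta>1_def \<beta>0_def using I Ine i1 i0 a b by (subst Max_less_iff Min_gr_iff; auto)+
  \<comment> \<open>A third of each gap is spent on rounding \<open>a\<close> and a third on
    rounding \<open>b\<close>; the last third keeps the extremes strictly separated.\<close>
  define gap1 where "gap1 = (ln (a i1) - \<beta>1) / 3"
  define gap0 where "gap0 = (\<beta>0 - ln (a i0)) / 3"
  have gap: "gap1 > 0" "gap0 > 0" "ln (a i1) = \<beta>1 + 3 * gap1" "ln (a i0) = \<beta>0 - 3 * gap0"
  proof -
    show "gap1 > 0" "gap0 > 0" using \<open>\<beta>1 < ln (a i1)\<close> \<open>ln (a i0) < \<beta>0\<close> by (auto simp: gap1_def gap0_def)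
    show "ln (a i1) = \<beta>1 + 3 * gap1" "ln (a i0) = \<beta>0 - 3 * gap0" by (simp_all add: gap1_def gap0_def diff_divide_distrib)
  qed
  \<comment> \<open>The weights are halved because mixing with probability
    \<open>\<eta> \<le> 1/2\<close> may remove up to half of them.\<close>
  have "exp (\<beta>1 + gap1) < exp (ln (a i1) - gap1)" "exp (- (\<beta>0 - gap0)) < exp (- (ln (a i0) + gap0))" "g i1 / 2 > 0" "g i0 / 2 > 0"
    using gap g i1 i0 by auto
  then obtain A1 A0 where A1: "A1 \<ge> 2" "\<And>\<alpha>. \<alpha> \<ge> A1 \<Longrightarrow> exp (\<beta>1 + gap1) powr \<alpha> < g i1 / 2 * exp (ln (a i1) - gap1) powr \<alpha>"
    and A0: "A0 \<ge> 2" "\<And>\<alpha>. \<alpha> \<ge> A0 \<Longrightarrow> exp (- (\<beta>0 - gap0)) powr \<alpha> < g i0 / 2 * exp (- (ln (a i0) + gap0)) powr \<alpha>"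
    using powr_eventually_dominates[OF exp_gt_zero] by metis
  define A where "A = max A1 A0"
  define Bd where "Bd = 1 + (\<Sum>i\<in>I. \<bar>ln (a i)\<bar>) + (\<Sum>i\<in>I. \<bar>ln (b i)\<bar>)"
  have Bd: "\<bar>ln (a i)\<bar> + 1 \<le> Bd" "\<bar>ln (b i)\<bar> + 1 \<le> Bd" if "i \<in> I" for i
    using member_le_sum[OF that _ I, of "\<lambda>i. \<bar>ln (a i)\<bar>"] member_le_sum[OF that _ I, of "\<lambda>i. \<bar>ln (b i)\<bar>"]
      sum_nonneg[of I "\<lambda>i. \<bar>ln (a i)\<bar>"] sum_nonneg[of I "\<lambda>i. \<bar>ln (b i)\<bar>"] by (auto simp: Bd_def)
  have Bd1: "Bd \<ge> 1" unfolding Bd_def by (simp add: sum_nonneg)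
  define L where "L = exp Bd * (Bd * exp ((A + 1) * Bd))"
  have L: "L > 0" using Bd1 by (simp add: L_def)
  have lip: "\<bar>renyi_gen \<alpha> s - renyi_gen \<alpha> t\<bar> \<le> L * \<bar>s - t\<bar>" if "\<bar>\<alpha>\<bar> \<le> A" "\<bar>s\<bar> \<le> Bd" "\<bar>t\<bar> \<le> Bd" for \<alpha> s t
    unfolding L_def using renyi_gen_lipschitz[OF that] .
  define G where "G \<alpha> = (\<Sum>i\<in>I. g i * renyi_gen \<alpha> (ln (a i))) - (\<Sum>i\<in>I. g i * renyi_gen \<alpha> (ln (b i)))" for \<alpha>
  have "continuous_on {-A..A} G" unfolding G_def
    by (intro continuous_intros continuous_on_subset[OF continuous_renyi_gen]) auto
  moreover have "{-A..A} \<noteq> {}" using A1 by (auto simp: A_def)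
  ultimately obtain \<alpha>0 where "\<alpha>0 \<in> {-A..A}" "\<forall>\<alpha>\<in>{-A..A}. G \<alpha>0 \<le> G \<alpha>"
    using continuous_attains_inf[OF compact_Icc] by blast
  moreover define \<mu> where "\<mu> = G \<alpha>0"
  ultimately have \<mu>: "\<mu> > 0" "\<And>\<alpha>. \<bar>\<alpha>\<bar> \<le> A \<Longrightarrow> \<mu> \<le> G \<alpha>" using dom by (auto simp: G_def abs_le_iff)
  \<comment> \<open>On the compact range of orders the gain is at least \<open>\<mu>\<close>. One
    half of it pays for the mixing, which costs at most \<open>\<eta> * (L * Bd)\<close>, the other
    half for the two rounding errors \<open>L * \<delta>\<close>.\<close>
  define \<eta> where "\<eta> = min (1/2) (\<mu> / (4 * (L * Bd + 1)))"
  have LB: "L * Bd + 1 > 0" using L Bd1 by (simp add: add_pos_pos)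
  have \<eta>: "0 < \<eta>" "\<eta> \<le> 1/2" 
  proof -
    show "0 < \<eta>" unfolding \<eta>_def using \<mu>(1) LB by simp
    show "\<eta> \<le> 1/2" unfolding \<eta>_def by (rule min.cobounded1)
  qed
  have "\<eta> * (L * Bd + 1) \<le> \<mu> / 4"
  proof -
    define X where "X = L * Bd + 1"
    have "\<eta> * X \<le> \<mu> / (4 * X) * X"
      using LB by (intro mult_right_mono) (auto simp: \<eta>_def X_def)
    also have "\<dots> = \<mu> / 4" using LB by (simp flip: X_def)
    finally show ?thesis by (simp add: X_def)
  qed
  moreover have "\<eta> * (L * Bd + 1) = \<eta> * (L * Bd) + \<eta>" by (simp add: distrib_left)
  ultimately have \<eta>2: "\<eta> * (L * Bd) < \<mu> / 2" using \<eta> \<mu>(1) by linarith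
  \<comment> \<open>\<open>cc\<close> solves \<open>(1 - \<eta>) * g j * a j + \<eta> * cc = exp s *
    ((1 - \<eta>) * g j + \<eta> * cc)\<close>: the common extra mass that puts the ratio exactly on
    the lattice. Rounding towards ratio 1 makes it nonnegative; at ratio 1 the division by zero
    gives 0, as it should.\<close>
  define k where "k \<delta> j = (if a j \<ge> 1 then \<lfloor>ln (a j) / \<delta>\<rfloor> else \<lceil>ln (a j) / \<delta>\<rceil>)" for \<delta> j
  define s where "s \<delta> j = \<delta> * of_int (k \<delta> j)" for \<delta> j
  define cc where "cc \<delta> j = (1 - \<eta>) * g j * (a j - exp (s \<delta> j)) / (\<eta> * (exp (s \<delta> j) - 1))" for \<delta> j
  have s_near: "\<bar>s \<delta> j - ln (a j)\<bar> \<le> \<delta>" if \<delta>: "\<delta> > 0" for \<delta> j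
  proof -
    have "\<bar>of_int (k \<delta> j) - ln (a j) / \<delta>\<bar> \<le> 1" unfolding k_def by (auto simp: abs_le_iff) linarith+
    then have "\<delta> * \<bar>of_int (k \<delta> j) - ln (a j) / \<delta>\<bar> \<le> \<delta> * 1" using \<delta> by (intro mult_left_mono) auto
    moreover have "\<delta> * \<bar>of_int (k \<delta> j) - ln (a j) / \<delta>\<bar> = \<bar>s \<delta> j - ln (a j)\<bar>"
      using \<delta> by (simp add: s_def right_diff_distrib abs_mult_pos' flip: abs_mult)
    ultimately show ?thesis by simp
  qed
  have s_sign: "(a j \<ge> 1 \<longrightarrow> 0 \<le> s \<delta> j \<and> exp (s \<delta> j) \<le> a j) \<and> (a j < 1 \<longrightarrow> s \<delta> j \<le> 0 \<and> a j \<le> exp (s \<delta> j))"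
    if "\<delta> > 0" "j \<in> I" for \<delta> j
  proof (cases "a j \<ge> 1")
    case True
    have "of_int (k \<delta> j) \<le> ln (a j) / \<delta>" "k \<delta> j \<ge> 0" using True that by (auto simp: k_def)
    then have "s \<delta> j \<le> ln (a j)" "s \<delta> j \<ge> 0" using that by (auto simp: s_def field_simps)
    then show ?thesis using True a(1)[OF that(2)] by (metis exp_le_cancel_iff exp_ln not_le)
  next
    case False
    then have "ln (a j) / \<delta> \<le> 0" using that a(1)[OF that(2)] by (simp add: divide_le_0_iff)
    then have "of_int (k \<delta> j) \<ge> ln (a j) / \<delta>" "k \<delta> j \<le> 0" using False by (auto simp: k_def ceiling_le_zero)
    then have "s \<delta> j \<ge> ln (a j)" "s \<delta> j \<le> 0" using that by (auto simp: s_def field_simps mult_nonneg_nonpos)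
    then show ?thesis using False a(1)[OF that(2)] by (metis exp_le_cancel_iff exp_ln)
  qed
  have cc_nonneg: "cc \<delta> j \<ge> 0" if "\<delta> > 0" "j \<in> I" for \<delta> j
    using s_sign[OF that] \<eta> g(1)[OF that(2)] unfolding cc_def
    by (cases "a j \<ge> 1") (auto intro!: divide_nonneg_nonneg divide_nonpos_nonpos mult_nonneg_nonneg mult_nonneg_nonpos)
  have s_lim: "((\<lambda>\<delta>. s \<delta> j) \<longlongrightarrow> ln (a j)) (at_right 0)" for j
  proof (rule tendstoI)
    fix e :: real assume "e > 0"
    then have "\<forall>\<^sub>F \<delta> in at_right 0. \<delta> \<in> {0<..<e}" by (rule eventually_at_right_real)
    then show "\<forall>\<^sub>F \<delta> in at_right 0. dist (s \<delta> j) (ln (a j)) < e"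
    proof (rule eventually_mono)
      fix \<delta> assume "\<delta> \<in> {0<..<e}"
      then show "dist (s \<delta> j) (ln (a j)) < e" using s_near[of \<delta> j] by (simp add: dist_real_def)
    qed
  qed
  have cc_lim: "((\<lambda>\<delta>. cc \<delta> j) \<longlongrightarrow> 0) (at_right 0)" if j: "j \<in> I" for j
  proof (cases "a j = 1")
    case True
    then show ?thesis by (simp add: cc_def s_def k_def)
  next
    case False
    have "((\<lambda>\<delta>. cc \<delta> j) \<longlongrightarrow> (1 - \<eta>) * g j * (a j - exp (ln (a j))) / (\<eta> * (exp (ln (a j)) - 1))) (at_right 0)"
      unfolding cc_def by (intro tendsto_intros s_lim) (use False a(1)[OF j] \<eta> in auto)
    then show ?thesis using a(1)[OF j] by simp
  qed
  \<comment> \<open>A small \<delta> makes the corrections sum to less than 1, so that they can be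
    used as probabilities, and prevents a ratio other than 1 from being rounded to 1, where the
    equation for \<open>cc\<close> has no solution.\<close>
  have "((\<lambda>\<delta>. \<Sum>j\<in>I. cc \<delta> j) \<longlongrightarrow> (\<Sum>j\<in>I. 0)) (at_right 0)" by (intro tendsto_sum cc_lim)
  then have "\<forall>\<^sub>F \<delta> in at_right 0. (\<Sum>j\<in>I. cc \<delta> j) < 1" by (intro order_tendstoD(2)) auto
  moreover have "\<forall>\<^sub>F \<delta> in at_right 0. \<delta> \<in> {0<..<Min {gap1, gap0, 1, \<mu> / (4 * L)}}"
    using gap \<mu> L by (intro eventually_at_right_real) auto
  moreover have "\<forall>\<^sub>F \<delta> in at_right 0. \<forall>j\<in>I. a j \<noteq> 1 \<longrightarrow> s \<delta> j \<noteq> 0"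
  proof (intro eventually_ball_finite[OF I] ballI)
    fix j assume j: "j \<in> I"
    show "\<forall>\<^sub>F \<delta> in at_right 0. a j \<noteq> 1 \<longrightarrow> s \<delta> j \<noteq> 0"
    proof (cases "a j = 1")
      case False
      then have "ln (a j) \<noteq> 0" using a(1)[OF j] by simp
      from tendsto_imp_eventually_ne[OF s_lim this] show ?thesis by (rule eventually_mono) auto
    qed simp
  qed
  ultimately have "\<forall>\<^sub>F \<delta> in at_right 0. (\<Sum>j\<in>I. cc \<delta> j) < 1 \<and> \<delta> \<in> {0<..<Min {gap1, gap0, 1, \<mu> / (4 * L)}} \<and> (\<forall>j\<in>I. a j \<noteq> 1 \<longrightarrow> s \<delta> j \<noteq> 0)"
    by (intro eventually_conj)
  then obtain \<delta> where d0: "(\<Sum>j\<in>I. cc \<delta> j) < 1" "\<delta> \<in> {0<..<Min {gap1, gap0, 1, \<mu> / (4 * L)}}" "\<forall>j\<in>I. a j \<noteq> 1 \<longrightarrow> s \<delta> j \<noteq> 0"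
    using eventually_happens trivial_limit_at_right_real by blast
  have \<delta>: "\<delta> > 0" "\<delta> < gap1" "\<delta> < gap0" "\<delta> < 1" "\<delta> < \<mu> / (4 * L)" using d0(2) by auto
  then have \<delta>L: "2 * (L * \<delta>) < \<mu> / 2" using L by (simp add: field_simps)
  define C where "C = (\<Sum>j\<in>I. cc \<delta> j)"
  define m where "m j = \<lfloor>ln (b j) / \<delta>\<rfloor>" for j
  have m_near: "\<delta> * of_int (m j) \<le> ln (b j)" "ln (b j) \<le> \<delta> * (of_int (m j) + 1)" for j
  proof -
    have "of_int (m j) \<le> ln (b j) / \<delta>" "ln (b j) / \<delta> \<le> of_int (m j) + 1" unfolding m_def by linarith+
    then show "\<delta> * of_int (m j) \<le> ln (b j)" "ln (b j) \<le> \<delta> * (of_int (m j) + 1)" using \<delta> by (simp_all add: field_simps)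
  qed
  define \<theta> where "\<theta> j = (b j - exp (\<delta> * of_int (m j))) / (exp (\<delta> * (of_int (m j) + 1)) - exp (\<delta> * of_int (m j)))" for j
  have \<theta>: "0 \<le> \<theta> j" "\<theta> j \<le> 1" "(1 - \<theta> j) * exp (\<delta> * of_int (m j)) + \<theta> j * exp (\<delta> * (of_int (m j) + 1)) = b j" if j: "j \<in> I" for j
  proof -
    have lt: "exp (\<delta> * of_int (m j)) < exp (\<delta> * (of_int (m j) + 1))" using \<delta> by simp
    have bd: "exp (\<delta> * of_int (m j)) \<le> b j" "b j \<le> exp (\<delta> * (of_int (m j) + 1))"
      using m_near[of j] b(1)[OF j] by (metis exp_le_cancel_iff exp_ln)+
    show "0 \<le> \<theta> j" "\<theta> j \<le> 1" using lt bd by (auto simp: \<theta>_def)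
    have "\<theta> j * (exp (\<delta> * (of_int (m j) + 1)) - exp (\<delta> * of_int (m j))) = b j - exp (\<delta> * of_int (m j))"
      unfolding \<theta>_def by (rule nonzero_divide_eq_eq[THEN iffD1, symmetric]) (use lt in auto)
    then show "(1 - \<theta> j) * exp (\<delta> * of_int (m j)) + \<theta> j * exp (\<delta> * (of_int (m j) + 1)) = b j"
      by (simp add: algebra_simps)
  qed
  \<comment> \<open>The atom \<open>None\<close> has ratio 1 and absorbs the mixing probability left
    over by the corrections.\<close>
  define Y where "Y = insert None (Some ` I)"
  define v where "v y = (case y of None \<Rightarrow> \<eta> * (1 - C) | Some j \<Rightarrow> (1 - \<eta>) * g j + \<eta> * cc \<delta> j)" for y
  define ky where "ky y = (case y of None \<Rightarrow> 0 | Some j \<Rightarrow> k \<delta> j)" for y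
  \<comment> \<open>The left summand is a copy of the source, scaled to mass \<open>1 - T\<close>;
    the right one holds the two lattice neighbours of each \<open>b j\<close>.\<close>
  define Z where "Z = Y <+> (I \<times> (UNIV :: bool set))"
  define u where "u z = (case z of Inl y \<Rightarrow> (1 - T) * v y | Inr (j, e) \<Rightarrow> T * (g j * (if e then \<theta> j else 1 - \<theta> j)))" for z
  define kz where "kz z = (case z of Inl y \<Rightarrow> ky y | Inr (j, e) \<Rightarrow> m j + (if e then 1 else 0))" for z
  have finY: "finite Y" and finZ: "finite Z" and Zne: "Z \<noteq> {}" using I by (auto simp: Y_def Z_def)
  have sumY: "sum F Y = F None + (\<Sum>j\<in>I. F (Some j))" for F :: "'a option \<Rightarrow> real"
    unfolding Y_def by (subst sum.insert) (use I in \<open>auto simp: sum.reindex\<close>)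
  have sumZ: "sum F Z = (\<Sum>y\<in>Y. F (Inl y)) + (\<Sum>j\<in>I. F (Inr (j, False)) + F (Inr (j, True)))" for F :: "'a option + 'a \<times> bool \<Rightarrow> real"
    unfolding Z_def using finY I by (simp add: sum.Plus sum.cartesian_product' UNIV_bool add.commute)
  define Q where "Q F = (\<Sum>j\<in>I. g j * ((1 - \<theta> j) * F (\<delta> * of_int (m j)) + \<theta> j * F (\<delta> * (of_int (m j) + 1))))" for F :: "real \<Rightarrow> real"
  have sumZ': "(\<Sum>z\<in>Z. u z * F (\<delta> * of_int (kz z))) = (1 - T) * (\<Sum>y\<in>Y. v y * F (\<delta> * of_int (ky y))) + T * Q F" for F
    unfolding sumZ Q_def by (simp add: u_def kz_def sum_distrib_left algebra_simps)
  have v0: "v y \<ge> 0" if "y \<in> Y" for y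
    using that d0(1) \<eta> g(1) cc_nonneg \<delta>(1) by (auto simp: Y_def v_def C_def less_imp_le)
  have vS: "v (Some j) > 0" if "j \<in> I" for j
    using g(1)[OF that] cc_nonneg[OF \<delta>(1) that] \<eta> by (auto simp: v_def intro: add_pos_nonneg)
  have u0: "u z \<ge> 0" if "z \<in> Z" for z
    using that v0 T g(1) \<theta> by (auto simp: Z_def u_def less_imp_le)
  have v_exp: "exp (s \<delta> j) * v (Some j) = (1 - \<eta>) * (g j * a j) + \<eta> * cc \<delta> j" if j: "j \<in> I" for j
  proof (cases "exp (s \<delta> j) = 1")
    case True
    then have "a j = 1" "cc \<delta> j = 0" using d0(3) j by (auto simp: cc_def)
    then show ?thesis using True by (simp add: v_def)
  next
    case False
    then have "\<eta> * cc \<delta> j * (exp (s \<delta> j) - 1) = (1 - \<eta>) * g j * (a j - exp (s \<delta> j))" using \<eta> by (simp add: cc_def)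
    then show ?thesis by (simp add: v_def algebra_simps)
  qed
  have Yexp: "(\<Sum>y\<in>Y. v y * exp (\<delta> * of_int (ky y))) = 1"
  proof -
    have "(\<Sum>y\<in>Y. v y * exp (\<delta> * of_int (ky y))) = \<eta> * (1 - C) + (\<Sum>j\<in>I. exp (s \<delta> j) * v (Some j))"
      unfolding sumY by (simp add: ky_def s_def mult.commute v_def)
    also have "\<dots> = \<eta> * (1 - C) + (\<Sum>j\<in>I. (1 - \<eta>) * (g j * a j) + \<eta> * cc \<delta> j)" by (simp add: v_exp)
    also have "\<dots> = 1" using a(2) by (simp add: sum.distrib C_def flip: sum_distrib_left) (simp add: algebra_simps)
    finally show ?thesis .
  qed
  have Ysum: "sum v Y = 1"
    unfolding sumY using g(2) by (simp add: v_def sum.distrib C_def flip: sum_distrib_left) (simp add: algebra_simps)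
  have Q1: "Q (\<lambda>_. 1) = 1" using g(2) by (simp add: Q_def)
  have Qexp: "Q exp = 1" unfolding Q_def using \<theta>(3) b(2) by simp
  have dom': "Q (renyi_gen \<alpha>) < (\<Sum>y\<in>Y. v y * renyi_gen \<alpha> (\<delta> * of_int (ky y)))" for \<alpha>
  proof (cases "\<bar>\<alpha>\<bar> \<le> A")
    case True
    have 1: "renyi_gen \<alpha> (ln (a j)) - L * \<delta> - \<eta> * (L * Bd) \<le> (1 - \<eta>) * renyi_gen \<alpha> (s \<delta> j)" if j: "j \<in> I" for j
    proof -
      have sB: "\<bar>s \<delta> j\<bar> \<le> Bd" using s_near[OF \<delta>(1), of j] Bd(1)[OF j] \<delta> by linarith
      have "renyi_gen \<alpha> (ln (a j)) - renyi_gen \<alpha> (s \<delta> j) \<le> L * \<bar>ln (a j) - s \<delta> j\<bar>"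
        using lip[OF True, of "ln (a j)" "s \<delta> j"] sB Bd(1)[OF j] by linarith
      also have "\<dots> \<le> L * \<delta>" using s_near[OF \<delta>(1), of j] L by (simp add: abs_minus_commute)
      finally have x1: "renyi_gen \<alpha> (ln (a j)) - L * \<delta> \<le> renyi_gen \<alpha> (s \<delta> j)" by simp
      have "renyi_gen \<alpha> (s \<delta> j) \<le> L * \<bar>s \<delta> j\<bar>" using lip[OF True sB, of 0] Bd1 by simp
      also have "\<dots> \<le> L * Bd" using sB L by simp
      finally have "\<eta> * renyi_gen \<alpha> (s \<delta> j) \<le> \<eta> * (L * Bd)" using \<eta> by simp
      then show ?thesis using x1 by (simp add: left_diff_distrib)
    qed
    have 2: "(1 - \<theta> j) * renyi_gen \<alpha> (\<delta> * of_int (m j)) + \<theta> j * renyi_gen \<alpha> (\<delta> * (of_int (m j) + 1)) \<le> renyi_gen \<alpha> (ln (b j)) + L * \<delta>"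
      if j: "j \<in> I" for j
    proof -
      have *: "renyi_gen \<alpha> t \<le> renyi_gen \<alpha> (ln (b j)) + L * \<delta>" if t: "\<bar>t - ln (b j)\<bar> \<le> \<delta>" for t
      proof -
        have "\<bar>t\<bar> \<le> Bd" using t Bd(2)[OF j] \<delta> by linarith
        then have "renyi_gen \<alpha> t - renyi_gen \<alpha> (ln (b j)) \<le> L * \<bar>t - ln (b j)\<bar>"
          using lip[OF True, of t "ln (b j)"] Bd(2)[OF j] by linarith
        also have "\<dots> \<le> L * \<delta>" using t L by simp
        finally show ?thesis by simp
      qed
      have "\<bar>\<delta> * of_int (m j) - ln (b j)\<bar> \<le> \<delta>" "\<bar>\<delta> * (of_int (m j) + 1) - ln (b j)\<bar> \<le> \<delta>"
        using m_near[of j] \<delta> by (auto simp: algebra_simps abs_le_iff)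
      then have "(1 - \<theta> j) * renyi_gen \<alpha> (\<delta> * of_int (m j)) + \<theta> j * renyi_gen \<alpha> (\<delta> * (of_int (m j) + 1))
         \<le> (1 - \<theta> j) * (renyi_gen \<alpha> (ln (b j)) + L * \<delta>) + \<theta> j * (renyi_gen \<alpha> (ln (b j)) + L * \<delta>)"
        using \<theta>[OF j] by (intro add_mono mult_left_mono *) auto
      then show ?thesis by (simp add: algebra_simps)
    qed
    have "Q (renyi_gen \<alpha>) \<le> (\<Sum>j\<in>I. g j * (renyi_gen \<alpha> (ln (b j)) + L * \<delta>))"
      unfolding Q_def by (intro sum_mono mult_left_mono 2) (use g in \<open>auto simp: less_imp_le\<close>)
    also have "\<dots> = (\<Sum>j\<in>I. g j * renyi_gen \<alpha> (ln (b j))) + L * \<delta>"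
      using g(2) by (simp add: distrib_left sum.distrib flip: sum_distrib_right)
    also have "\<dots> < (\<Sum>j\<in>I. g j * renyi_gen \<alpha> (ln (a j))) - L * \<delta> - \<eta> * (L * Bd)"
      using \<mu>(2)[OF True] \<delta>L \<eta>2 unfolding G_def by linarith
    also have "\<dots> = (\<Sum>j\<in>I. g j * (renyi_gen \<alpha> (ln (a j)) - L * \<delta> - \<eta> * (L * Bd)))"
      using g(2) by (simp add: right_diff_distrib sum_subtractf flip: sum_distrib_right)
    also have "\<dots> \<le> (\<Sum>j\<in>I. g j * ((1 - \<eta>) * renyi_gen \<alpha> (s \<delta> j)))"
      by (intro sum_mono mult_left_mono 1) (use g in \<open>auto simp: less_imp_le\<close>)
    also have "\<dots> \<le> (\<Sum>j\<in>I. v (Some j) * renyi_gen \<alpha> (s \<delta> j))"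
    proof (rule sum_mono)
      fix j assume j: "j \<in> I"
      have "0 \<le> \<eta> * cc \<delta> j * renyi_gen \<alpha> (s \<delta> j)"
        using \<eta> cc_nonneg[OF \<delta>(1) j] renyi_gen_nonneg[of \<alpha> "s \<delta> j"] by simp
      then show "g j * ((1 - \<eta>) * renyi_gen \<alpha> (s \<delta> j)) \<le> v (Some j) * renyi_gen \<alpha> (s \<delta> j)"
        by (simp add: v_def algebra_simps)
    qed
    also have "\<dots> = (\<Sum>y\<in>Y. v y * renyi_gen \<alpha> (\<delta> * of_int (ky y)))"
      unfolding sumY by (simp add: ky_def s_def)
    finally show ?thesis .
  next
    \<comment> \<open>At large orders power sums are compared instead: even after rounding, an
      extreme ratio of \<open>a\<close> lies beyond all those of \<open>b\<close>, so no Lipschitz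
      bound is involved.\<close>
    case False
    have lb: "g j / 2 * exp (\<alpha> * s \<delta> j) \<le> (\<Sum>y\<in>Y. v y * exp (\<alpha> * (\<delta> * of_int (ky y))))" if j: "j \<in> I" for j
    proof -
      have "g j / 2 \<le> v (Some j)"
      proof -
        have "1/2 * g j \<le> (1 - \<eta>) * g j" using \<eta> g(1)[OF j] by (intro mult_right_mono) auto
        then show ?thesis using cc_nonneg[OF \<delta>(1) j] \<eta> by (simp add: v_def add_increasing2)
      qed
      then have "g j / 2 * exp (\<alpha> * s \<delta> j) \<le> v (Some j) * exp (\<alpha> * (\<delta> * of_int (ky (Some j))))"
        by (simp add: ky_def s_def)
      also have "\<dots> \<le> (\<Sum>y\<in>Y. v y * exp (\<alpha> * (\<delta> * of_int (ky y))))"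
        by (rule member_le_sum) (use j finY v0 in \<open>auto simp: Y_def\<close>)
      finally show ?thesis .
    qed
    have ub: "Q (\<lambda>t. exp (\<alpha> * t)) \<le> E" if E: "\<And>j. j \<in> I \<Longrightarrow> exp (\<alpha> * (\<delta> * of_int (m j))) \<le> E \<and> exp (\<alpha> * (\<delta> * (of_int (m j) + 1))) \<le> E" for E
    proof -
      have "Q (\<lambda>t. exp (\<alpha> * t)) \<le> (\<Sum>j\<in>I. g j * ((1 - \<theta> j) * E + \<theta> j * E))"
        unfolding Q_def by (intro sum_mono mult_left_mono add_mono) (use E g(1) \<theta> in \<open>auto simp: less_imp_le\<close>)
      also have "\<dots> = E" using g(2) by (simp add: left_diff_distrib flip: sum_distrib_right)
      finally show ?thesis .
    qed
    have "Q (\<lambda>t. exp (\<alpha> * t)) < (\<Sum>y\<in>Y. v y * exp (\<alpha> * (\<delta> * of_int (ky y))))"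
    proof (cases "\<alpha> > 0")
      case True
      then have \<alpha>: "\<alpha> \<ge> A1" using False by (auto simp: A_def)
      have "Q (\<lambda>t. exp (\<alpha> * t)) \<le> exp (\<beta>1 + gap1) powr \<alpha>"
      proof (rule ub)
        fix j assume j: "j \<in> I"
        have "\<delta> * of_int (m j) \<le> \<beta>1 + gap1" "\<delta> * (of_int (m j) + 1) \<le> \<beta>1 + gap1"
          using m_near[of j] \<beta>(1)[OF j] \<delta> by (auto simp: algebra_simps)
        then show "exp (\<alpha> * (\<delta> * of_int (m j))) \<le> exp (\<beta>1 + gap1) powr \<alpha> \<and> exp (\<alpha> * (\<delta> * (of_int (m j) + 1))) \<le> exp (\<beta>1 + gap1) powr \<alpha>"
          using True by (auto simp: powr_def intro!: mult_left_mono)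
      qed
      also have "\<dots> < g i1 / 2 * exp (ln (a i1) - gap1) powr \<alpha>" by (rule A1(2)[OF \<alpha>])
      also have "\<dots> \<le> g i1 / 2 * exp (\<alpha> * s \<delta> i1)"
      proof (intro mult_left_mono)
        have "ln (a i1) - gap1 \<le> s \<delta> i1" using s_near[OF \<delta>(1), of i1] \<delta> by linarith
        then show "exp (ln (a i1) - gap1) powr \<alpha> \<le> exp (\<alpha> * s \<delta> i1)" using True by (simp add: powr_def)
      qed (use g i1 in \<open>auto simp: less_imp_le\<close>)
      also have "\<dots> \<le> (\<Sum>y\<in>Y. v y * exp (\<alpha> * (\<delta> * of_int (ky y))))" by (rule lb[OF i1(1)])
      finally show ?thesis .
    next
      case neg: False
      then have \<alpha>: "- \<alpha> \<ge> A0" using False by (auto simp: A_def)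
      have "Q (\<lambda>t. exp (\<alpha> * t)) \<le> exp (- (\<beta>0 - gap0)) powr (- \<alpha>)"
      proof (rule ub)
        fix j assume j: "j \<in> I"
        have "\<beta>0 - gap0 \<le> \<delta> * of_int (m j)" "\<beta>0 - gap0 \<le> \<delta> * (of_int (m j) + 1)"
          using m_near[of j] \<beta>(2)[OF j] \<delta> by (auto simp: algebra_simps)
        then show "exp (\<alpha> * (\<delta> * of_int (m j))) \<le> exp (- (\<beta>0 - gap0)) powr (- \<alpha>) \<and> exp (\<alpha> * (\<delta> * (of_int (m j) + 1))) \<le> exp (- (\<beta>0 - gap0)) powr (- \<alpha>)"
          using neg by (auto simp: powr_def simp del: minus_diff_eq intro!: mult_left_mono_neg)
      qed
      also have "\<dots> < g i0 / 2 * exp (- (ln (a i0) + gap0)) powr (- \<alpha>)" by (rule A0(2)[OF \<alpha>])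
      also have "\<dots> \<le> g i0 / 2 * exp (\<alpha> * s \<delta> i0)"
      proof (intro mult_left_mono)
        have "s \<delta> i0 \<le> ln (a i0) + gap0" using s_near[OF \<delta>(1), of i0] \<delta> by linarith
        then have "\<alpha> * (ln (a i0) + gap0) \<le> \<alpha> * s \<delta> i0" using neg by (intro mult_left_mono_neg) auto
        then show "exp (- (ln (a i0) + gap0)) powr (- \<alpha>) \<le> exp (\<alpha> * s \<delta> i0)" by (simp add: powr_def algebra_simps)
      qed (use g i0 in \<open>auto simp: less_imp_le\<close>)
      also have "\<dots> \<le> (\<Sum>y\<in>Y. v y * exp (\<alpha> * (\<delta> * of_int (ky y))))" by (rule lb[OF i0(1)])
      finally show ?thesis .
    qed
    moreover have "\<alpha> * (\<alpha> - 1) * (\<Sum>y\<in>Y. v y * renyi_gen \<alpha> (\<delta> * of_int (ky y))) = (\<Sum>y\<in>Y. v y * exp (\<alpha> * (\<delta> * of_int (ky y)))) - 1"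
    proof -
      have "\<alpha> * (\<alpha> - 1) * (\<Sum>y\<in>Y. v y * renyi_gen \<alpha> (\<delta> * of_int (ky y))) = (\<Sum>y\<in>Y. v y * (\<alpha> * (\<alpha> - 1) * renyi_gen \<alpha> (\<delta> * of_int (ky y))))"
        by (simp add: sum_distrib_left mult_ac)
      also have "\<dots> = (\<Sum>y\<in>Y. v y * exp (\<alpha> * (\<delta> * of_int (ky y))) - (1 - \<alpha>) * v y - \<alpha> * (v y * exp (\<delta> * of_int (ky y))))"
        unfolding renyi_gen_mult by (intro sum.cong refl) (simp add: algebra_simps)
      also have "\<dots> = (\<Sum>y\<in>Y. v y * exp (\<alpha> * (\<delta> * of_int (ky y)))) - 1"
        using Ysum Yexp by (simp add: sum_subtractf flip: sum_distrib_left)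
      finally show ?thesis .
    qed
    moreover have "\<alpha> * (\<alpha> - 1) * Q (renyi_gen \<alpha>) = Q (\<lambda>t. exp (\<alpha> * t)) - 1"
    proof -
      have "\<alpha> * (\<alpha> - 1) * Q (renyi_gen \<alpha>) = Q (\<lambda>t. \<alpha> * (\<alpha> - 1) * renyi_gen \<alpha> t)"
        unfolding Q_def sum_distrib_left by (intro sum.cong refl) (simp only: distrib_left mult_ac)
      also have "\<dots> = (\<Sum>j\<in>I. g j * ((1 - \<theta> j) * exp (\<alpha> * (\<delta> * of_int (m j))) + \<theta> j * exp (\<alpha> * (\<delta> * (of_int (m j) + 1))))
         - (1 - \<alpha>) * g j - \<alpha> * (g j * ((1 - \<theta> j) * exp (\<delta> * of_int (m j)) + \<theta> j * exp (\<delta> * (of_int (m j) + 1)))))"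
        unfolding renyi_gen_mult Q_def by (intro sum.cong refl) (simp add: algebra_simps)
      also have "\<dots> = Q (\<lambda>t. exp (\<alpha> * t)) - (1 - \<alpha>) * sum g I - \<alpha> * Q exp"
        unfolding Q_def by (simp only: sum_subtractf sum_distrib_left)
      finally show ?thesis using Qexp g(2) by simp
    qed
    ultimately have "\<alpha> * (\<alpha> - 1) * Q (renyi_gen \<alpha>) < \<alpha> * (\<alpha> - 1) * (\<Sum>y\<in>Y. v y * renyi_gen \<alpha> (\<delta> * of_int (ky y)))" by simp
    moreover have "\<alpha> * (\<alpha> - 1) > 0" using False A1 A0 by (cases "\<alpha> > 0") (auto simp: A_def intro: mult_pos_pos mult_neg_neg)
    ultimately show ?thesis using mult_less_cancel_left_pos by blast
  qed
  define kmin where "kmin = Min (k \<delta> ` I)"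
  define kmax where "kmax = Max (k \<delta> ` I)"
  have kb: "kmin \<le> k \<delta> j" "k \<delta> j \<le> kmax" if "j \<in> I" for j using I that by (auto simp: kmin_def kmax_def)
  have "kmin \<in> k \<delta> ` I" "kmax \<in> k \<delta> ` I" using I Ine by (auto simp: kmin_def kmax_def)
  then obtain jmin jmax where jm: "jmin \<in> I" "k \<delta> jmin = kmin" "jmax \<in> I" "k \<delta> jmax = kmax" by auto
  have "a i0 * sum g I < 1"
  proof -
    have "a i0 * sum g I = (\<Sum>j\<in>I. g j * a i0)" by (simp add: sum_distrib_left mult.commute)
    also have "\<dots> < (\<Sum>j\<in>I. g j * b j)" by (rule sum_strict_mono) (use I Ine g(1) i0 in auto)
    finally show ?thesis using b by simp
  qed
  then have ai0: "a i0 < 1" using g by simp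
  have "1 < a i1 * sum g I"
  proof -
    have "(\<Sum>j\<in>I. g j * b j) < (\<Sum>j\<in>I. g j * a i1)" by (rule sum_strict_mono) (use I Ine g(1) i1 in auto)
    also have "\<dots> = a i1 * sum g I" by (simp add: sum_distrib_left mult.commute)
    finally show ?thesis using b by simp
  qed
  then have ai1: "a i1 > 1" using g by simp
  have k01: "k \<delta> i0 \<le> 0" "0 \<le> k \<delta> i1"
    using s_sign[OF \<delta>(1) i0(1)] s_sign[OF \<delta>(1) i1(1)] ai0 ai1 \<delta>(1)
    by (auto simp: s_def mult_le_0_iff zero_le_mult_iff)
  \<comment> \<open>The extremes of the rounded \<open>a\<close> enclose all sites used by
    \<open>b\<close>, so the source has positive mass at both ends of the lattice.\<close>
  have mb: "kmin \<le> m j" "m j + 1 \<le> kmax" if j: "j \<in> I" for j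
  proof -
    have "\<delta> * of_int (k \<delta> i0) \<le> ln (a i0) + \<delta>" "ln (a i1) - \<delta> \<le> \<delta> * of_int (k \<delta> i1)"
      using s_near[OF \<delta>(1), of i0] s_near[OF \<delta>(1), of i1] unfolding s_def by linarith+
    moreover have "ln (b j) \<le> \<delta> * of_int (m j) + \<delta>" "\<delta> * of_int (m j + 1) \<le> ln (b j) + \<delta>"
      using m_near[of j] by (simp_all add: distrib_left)
    ultimately have lt: "\<delta> * of_int (k \<delta> i0) < \<delta> * of_int (m j)" "\<delta> * of_int (m j + 1) < \<delta> * of_int (k \<delta> i1)"
      using \<beta>[OF j] gap \<delta> by linarith+
    then have "k \<delta> i0 < m j" using \<delta>(1) by simp
    then show "kmin \<le> m j" using kb(1)[OF i0(1)] by simp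
    have "m j + 1 < k \<delta> i1" using lt(2) \<delta>(1) by (simp del: of_int_add)
    then show "m j + 1 \<le> kmax" using kb(2)[OF i1(1)] by simp
  qed
  have Yb: "kmin \<le> ky y \<and> ky y \<le> kmax" if "y \<in> Y" for y
    using that kb k01 kb(1)[OF i0(1)] kb(2)[OF i1(1)] by (auto simp: Y_def ky_def)
  have Zb: "kmin \<le> kz z \<and> kz z \<le> kmax" if "z \<in> Z" for z
    using that Yb mb by (force simp: Z_def kz_def)
  define pos where "pos y = nat (ky y - kmin)" for y
  define pos' where "pos' z = nat (kz z - kmin)" for z
  \<comment> \<open>Sites are counted from the lowest exponent; subtracting \<open>K\<close> returns
    to signed exponents.\<close>
  define K where "K = - real_of_int kmin"
  have pk: "real (pos y) - K = of_int (ky y)" if "y \<in> Y" for y using Yb[OF that] by (simp add: pos_def K_def)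
  have pk': "real (pos' z) - K = of_int (kz z)" if "z \<in> Z" for z using Zb[OF that] by (simp add: pos'_def K_def)
  have "\<exists>N. converts (I \<times> {..N}) (\<lambda>(i, m). g i * a i * (real (N choose m) * exp \<delta> ^ m)) (\<lambda>(i, m). g i * real (N choose m))
    (I \<times> {..N}) (\<lambda>(i, m). ((1 - T) * g i + T * (g i * b i)) * (real (N choose m) * exp \<delta> ^ m)) (\<lambda>(i, m). g i * real (N choose m))"
  proof (rule catalysis_from_lattice[OF \<delta>(1) I finY finZ Zne, where pos = pos and pos' = pos' and b = "nat (kmax - kmin)" and v = v and u = u and K = K and \<kappa> = "1 - T"])
    show "pos \<in> Y \<rightarrow> {..nat (kmax - kmin)}" "pos' \<in> Z \<rightarrow> {..nat (kmax - kmin)}"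
      using Yb Zb by (auto simp: pos_def pos'_def intro!: nat_mono)
    show "\<exists>y\<in>Y. pos y = 0 \<and> v y > 0"
      using jm vS by (intro bexI[of _ "Some jmin"]) (auto simp: Y_def pos_def ky_def)
    show "\<exists>y\<in>Y. pos y = nat (kmax - kmin) \<and> v y > 0"
      using jm vS by (intro bexI[of _ "Some jmax"]) (auto simp: Y_def pos_def ky_def)
    show "sum v Y = sum u Z"
      using sumZ'[of "\<lambda>_. 1"] Ysum Q1 by simp
    show "(\<Sum>y\<in>Y. v y * exp (\<delta> * (real (pos y) - K))) = (\<Sum>z\<in>Z. u z * exp (\<delta> * (real (pos' z) - K)))"
      using sumZ'[of exp] Yexp Qexp by (simp add: pk pk')
    show "(\<Sum>z\<in>Z. u z * renyi_gen \<alpha> (\<delta> * (real (pos' z) - K))) < (\<Sum>y\<in>Y. v y * renyi_gen \<alpha> (\<delta> * (real (pos y) - K)))" for \<alpha>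
    proof -
      have "T * Q (renyi_gen \<alpha>) < T * (\<Sum>y\<in>Y. v y * renyi_gen \<alpha> (\<delta> * of_int (ky y)))" using dom'[of \<alpha>] T by simp
      then have "(\<Sum>z\<in>Z. u z * renyi_gen \<alpha> (\<delta> * of_int (kz z))) < (\<Sum>y\<in>Y. v y * renyi_gen \<alpha> (\<delta> * of_int (ky y)))"
        unfolding sumZ' left_diff_distrib by simp
      then show ?thesis by (simp add: pk pk')
    qed
    show "(\<Sum>z | z \<in> Z \<and> pos' z = n. u z) \<ge> (1 - T) * (\<Sum>y | y \<in> Y \<and> pos y = n. v y)" for n
    proof -
      have "(1 - T) * (\<Sum>y | y \<in> Y \<and> pos y = n. v y) = (\<Sum>z \<in> Inl ` {y. y \<in> Y \<and> pos y = n}. u z)"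
        by (subst sum.reindex) (auto simp: u_def sum_distrib_left)
      also have "\<dots> \<le> (\<Sum>z | z \<in> Z \<and> pos' z = n. u z)"
        by (rule sum_mono2) (use finZ u0 in \<open>auto simp: Z_def pos'_def kz_def pos_def\<close>)
      finally show ?thesis .
    qed
    have kernel: "(\<Sum>i\<in>I. w i * ((if i = j then 1 - \<eta> else 0) + \<eta> * cc \<delta> j)) = (1 - \<eta>) * w j + \<eta> * cc \<delta> j * sum w I"
      if "j \<in> I" for w j
    proof -
      have "(\<Sum>i\<in>I. w i * ((if i = j then 1 - \<eta> else 0) + \<eta> * cc \<delta> j)) = (\<Sum>i\<in>I. (if i = j then (1 - \<eta>) * w i else 0) + \<eta> * cc \<delta> j * w i)"
        by (intro sum.cong refl) (simp add: distrib_left mult.commute)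
      then show ?thesis using that I by (simp add: sum.distrib flip: sum_distrib_left)
    qed
    have "converts I (\<lambda>i. g i * a i) g Y (\<lambda>y. exp (\<delta> * of_int (ky y)) * v y) v"
    proof (rule convertsI[where T = "\<lambda>i y. case y of None \<Rightarrow> \<eta> * (1 - C) | Some j \<Rightarrow> (if i = j then 1 - \<eta> else 0) + \<eta> * cc \<delta> j"])
      show "0 \<le> (case y of None \<Rightarrow> \<eta> * (1 - C) | Some j \<Rightarrow> (if i = j then 1 - \<eta> else 0) + \<eta> * cc \<delta> j)" if "i \<in> I" "y \<in> Y" for i y
        using that \<eta> d0(1) cc_nonneg[OF \<delta>(1)] by (auto simp: Y_def C_def)
      show "(\<Sum>y\<in>Y. case y of None \<Rightarrow> \<eta> * (1 - C) | Some j \<Rightarrow> (if i = j then 1 - \<eta> else 0) + \<eta> * cc \<delta> j) = 1" if "i \<in> I" for i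
        unfolding sumY using that I by (simp add: sum.distrib C_def flip: sum_distrib_left) (simp add: algebra_simps)
      show "(\<Sum>i\<in>I. g i * (case y of None \<Rightarrow> \<eta> * (1 - C) | Some j \<Rightarrow> (if i = j then 1 - \<eta> else 0) + \<eta> * cc \<delta> j)) = v y" if "y \<in> Y" for y
        using that g(2) by (auto simp: Y_def v_def kernel simp flip: sum_distrib_right)
      show "(\<Sum>i\<in>I. g i * a i * (case y of None \<Rightarrow> \<eta> * (1 - C) | Some j \<Rightarrow> (if i = j then 1 - \<eta> else 0) + \<eta> * cc \<delta> j)) = exp (\<delta> * of_int (ky y)) * v y" if y: "y \<in> Y" for y
      proof (cases y)
        case None
        then show ?thesis using a(2) by (simp add: v_def ky_def flip: sum_distrib_right)
      next
        case (Some j)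
        then have j: "j \<in> I" using y by (auto simp: Y_def)
        show ?thesis using v_exp[OF j] a(2) by (simp add: Some kernel[OF j] ky_def s_def)
      qed
    qed
    moreover have "converts I (\<lambda>i. g i * a i) g Y (\<lambda>y. exp (\<delta> * of_int (ky y)) * v y) v \<longleftrightarrow>
      converts I (\<lambda>i. g i * a i) g Y (\<lambda>y. exp (\<delta> * (real (pos y) - K)) * v y) v"
      by (rule converts_cong) (auto simp: pk)
    ultimately show "converts I (\<lambda>i. g i * a i) g Y (\<lambda>y. exp (\<delta> * (real (pos y) - K)) * v y) v" by simp
    have kernel': "(\<Sum>z\<in>Z. F z * (case z of Inl y \<Rightarrow> g i | Inr (j, e) \<Rightarrow> if j = i then 1 else 0)) = g i * (\<Sum>y\<in>Y. F (Inl y)) + (F (Inr (i, False)) + F (Inr (i, True)))"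
      if "i \<in> I" for F i
      unfolding sumZ using that I by (simp add: sum_distrib_left mult.commute if_distrib sum.distrib cong: if_cong)
    \<comment> \<open>The copied source is replaced by a fresh sample of \<open>g\<close>, which is
      why the output is \<open>(1 - T) * g i + T * (g i * b i)\<close>.\<close>
    have "converts Z (\<lambda>z. exp (\<delta> * of_int (kz z)) * u z) u I (\<lambda>i. (1 - T) * g i + T * (g i * b i)) g"
    proof (rule convertsI[where T = "\<lambda>z i. case z of Inl y \<Rightarrow> g i | Inr (j, e) \<Rightarrow> if j = i then 1 else 0"])
      show "0 \<le> (case z of Inl y \<Rightarrow> g i | Inr (j, e) \<Rightarrow> if j = i then 1 else 0)" if "z \<in> Z" "i \<in> I" for z i
        using g(1)[OF that(2)] by (auto split: sum.split)
      show "(\<Sum>i\<in>I. case z of Inl y \<Rightarrow> g i | Inr (j, e) \<Rightarrow> if j = i then 1 else 0) = 1" if "z \<in> Z" for z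
        using that g(2) I by (auto simp: Z_def)
      show "(\<Sum>z\<in>Z. exp (\<delta> * of_int (kz z)) * u z * (case z of Inl y \<Rightarrow> g i | Inr (j, e) \<Rightarrow> if j = i then 1 else 0)) = (1 - T) * g i + T * (g i * b i)"
        if i: "i \<in> I" for i
      proof -
        have "(\<Sum>y\<in>Y. exp (\<delta> * of_int (kz (Inl y))) * u (Inl y)) = (1 - T) * (\<Sum>y\<in>Y. v y * exp (\<delta> * of_int (ky y)))"
          by (simp add: kz_def u_def sum_distrib_left mult_ac)
        then have 1: "(\<Sum>y\<in>Y. exp (\<delta> * of_int (kz (Inl y))) * u (Inl y)) = 1 - T" by (simp add: Yexp)
        have "exp (\<delta> * of_int (kz (Inr (i, False)))) * u (Inr (i, False)) + exp (\<delta> * of_int (kz (Inr (i, True)))) * u (Inr (i, True))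
          = T * (g i * ((1 - \<theta> i) * exp (\<delta> * of_int (m i)) + \<theta> i * exp (\<delta> * (of_int (m i) + 1))))"
          by (simp add: kz_def u_def distrib_left mult_ac)
        then show ?thesis unfolding kernel'[OF i] 1 \<theta>(3)[OF i] by (simp add: mult.commute)
      qed
      show "(\<Sum>z\<in>Z. u z * (case z of Inl y \<Rightarrow> g i | Inr (j, e) \<Rightarrow> if j = i then 1 else 0)) = g i" if i: "i \<in> I" for i
      proof -
        have 1: "(\<Sum>y\<in>Y. u (Inl y)) = 1 - T" using Ysum by (simp add: u_def flip: sum_distrib_left)
        show ?thesis unfolding kernel'[OF i] 1 by (simp add: u_def algebra_simps)
      qed
    qed
    moreover have "converts Z (\<lambda>z. exp (\<delta> * of_int (kz z)) * u z) u I (\<lambda>i. (1 - T) * g i + T * (g i * b i)) g \<longleftrightarrow>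
      converts Z (\<lambda>z. exp (\<delta> * (real (pos' z) - K)) * u z) u I (\<lambda>i. (1 - T) * g i + T * (g i * b i)) g"
      by (rule converts_cong) (auto simp: pk')
    ultimately show "converts Z (\<lambda>z. exp (\<delta> * (real (pos' z) - K)) * u z) u I (\<lambda>i. (1 - T) * g i + T * (g i * b i)) g" by simp
  qed (use v0 u0 T in auto)
  then show ?thesis by blast
qed

text \<open>Mixing with \<open>g\<close> preserves \<open>g\<close>, so the weakened
  \<open>a\<close> is reached from \<open>a\<close> for free, whereas the mixing of \<open>b\<close>
  remains in the result. One factor \<open>1 - \<epsilon>\<close> comes from there, the second from
  \<open>T = 1 - \<epsilon>\<close>.\<close>

lemma catalytic_conversion:
  fixes g a b :: "'a \<Rightarrow> real"
  assumes I: "finite I" and g: "\<And>i. i \<in> I \<Longrightarrow> g i > 0" "sum g I = 1"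
    and a: "\<And>i. i \<in> I \<Longrightarrow> a i \<ge> 0" "(\<Sum>i\<in>I. g i * a i) = 1"
    and b: "\<And>i. i \<in> I \<Longrightarrow> b i \<ge> 0" "(\<Sum>i\<in>I. g i * b i) = 1"
    and dom_gt1: "\<And>\<alpha>. \<alpha> > 1 \<Longrightarrow> (\<Sum>i\<in>I. g i * b i powr \<alpha>) \<le> (\<Sum>i\<in>I. g i * a i powr \<alpha>)"
    and dom_01: "\<And>\<alpha>. 0 < \<alpha> \<Longrightarrow> \<alpha> < 1 \<Longrightarrow> (\<Sum>i\<in>I. g i * a i powr \<alpha>) \<le> (\<Sum>i\<in>I. g i * b i powr \<alpha>)"
    and dom_1: "(\<Sum>i\<in>I. g i * (b i * ln (b i))) \<le> (\<Sum>i\<in>I. g i * (a i * ln (a i)))"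
    and dom_neg: "(\<And>i. i \<in> I \<Longrightarrow> a i > 0) \<Longrightarrow> (\<forall>i\<in>I. b i > 0) \<and>
       (\<Sum>i\<in>I. g i * ln (a i)) \<le> (\<Sum>i\<in>I. g i * ln (b i)) \<and>
       (\<forall>\<alpha><0. (\<Sum>i\<in>I. g i * b i powr \<alpha>) \<le> (\<Sum>i\<in>I. g i * a i powr \<alpha>))"
    and ne: "\<exists>i\<in>I. a i \<noteq> 1"
    and \<epsilon>: "0 < \<epsilon>" "\<epsilon> < 1"
  obtains N and r s :: "nat \<Rightarrow> real" where "\<And>m. r m > 0 \<and> s m > 0" "sum r {..N} = 1" "sum s {..N} = 1"
    "converts (I \<times> {..N}) (\<lambda>(i, m). g i * a i * r m) (\<lambda>(i, m). g i * s m)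
      (I \<times> {..N}) (\<lambda>(i, m). ((1 - \<epsilon>)\<^sup>2 * (g i * b i) + (1 - (1 - \<epsilon>)\<^sup>2) * g i) * r m) (\<lambda>(i, m). g i * s m)"
proof (rule strict_dominance[where I = I and g = g and a = a and b = b and \<epsilon> = \<epsilon>, OF assms])
  fix \<eta> assume \<eta>: "0 < \<eta>" "\<eta> < 1"
    "\<And>\<alpha>. (\<Sum>i\<in>I. g i * renyi_gen \<alpha> (ln ((1 - \<epsilon>) * b i + \<epsilon>))) <
          (\<Sum>i\<in>I. g i * renyi_gen \<alpha> (ln ((1 - \<eta>) * a i + \<eta>)))"
    "\<exists>i\<in>I. \<forall>j\<in>I. (1 - \<epsilon>) * b j + \<epsilon> < (1 - \<eta>) * a i + \<eta>"
    "\<exists>i\<in>I. \<forall>j\<in>I. (1 - \<eta>) * a i + \<eta> < (1 - \<epsilon>) * b j + \<epsilon>"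
  obtain i1 i0 where i1: "i1 \<in> I" "\<forall>j\<in>I. (1 - \<epsilon>) * b j + \<epsilon> < (1 - \<eta>) * a i1 + \<eta>"
    and i0: "i0 \<in> I" "\<forall>j\<in>I. (1 - \<eta>) * a i0 + \<eta> < (1 - \<epsilon>) * b j + \<epsilon>" using \<eta> by blast
  have mean_c: "(\<Sum>i\<in>I. g i * ((1 - k) * u i + k)) = 1" if "(\<Sum>i\<in>I. g i * u i) = 1" for u and k :: real
  proof -
    have "(\<Sum>i\<in>I. g i * ((1 - k) * u i + k)) = (\<Sum>i\<in>I. (1 - k) * (g i * u i) + k * g i)"
      by (intro sum.cong) (auto simp: algebra_simps)
    also have "\<dots> = (1 - k) * (\<Sum>i\<in>I. g i * u i) + k * sum g I" by (simp only: sum.distrib sum_distrib_left)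
    finally show ?thesis using that g by simp
  qed
  have pos_c: "(1 - k) * u + k > 0" if "u \<ge> 0" "0 < k" "k < 1" for u k :: real
    using that by (intro add_nonneg_pos) auto
  have "\<exists>N \<delta>. converts (I \<times> {..N})
    (\<lambda>(i, m). g i * ((1 - \<eta>) * a i + \<eta>) * (real (N choose m) * exp \<delta> ^ m)) (\<lambda>(i, m). g i * real (N choose m))
    (I \<times> {..N})
    (\<lambda>(i, m). ((1 - (1 - \<epsilon>)) * g i + (1 - \<epsilon>) * (g i * ((1 - \<epsilon>) * b i + \<epsilon>))) * (real (N choose m) * exp \<delta> ^ m)) (\<lambda>(i, m). g i * real (N choose m))"
  proof (rule catalytic_conversion_strict[where ?i1.0 = i1 and ?i0.0 = i0])
    show "(1 - \<eta>) * a i + \<eta> > 0" if "i \<in> I" for i by (rule pos_c[OF a(1)[OF that] \<eta>(1,2)])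
    show "(1 - \<epsilon>) * b i + \<epsilon> > 0" if "i \<in> I" for i by (rule pos_c[OF b(1)[OF that] \<epsilon>])
    show "(\<Sum>i\<in>I. g i * ((1 - \<eta>) * a i + \<eta>)) = 1" by (rule mean_c[OF a(2)])
    show "(\<Sum>i\<in>I. g i * ((1 - \<epsilon>) * b i + \<epsilon>)) = 1" by (rule mean_c[OF b(2)])
  qed (use I g \<eta>(3) i1 i0 \<epsilon> in simp_all)
  then obtain N \<delta> where conv: "converts (I \<times> {..N})
    (\<lambda>(i, m). g i * ((1 - \<eta>) * a i + \<eta>) * (real (N choose m) * exp \<delta> ^ m)) (\<lambda>(i, m). g i * real (N choose m))
    (I \<times> {..N})
    (\<lambda>(i, m). ((1 - (1 - \<epsilon>)) * g i + (1 - \<epsilon>) * (g i * ((1 - \<epsilon>) * b i + \<epsilon>))) * (real (N choose m) * exp \<delta> ^ m)) (\<lambda>(i, m). g i * real (N choose m))"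
    by blast
  have "converts I (\<lambda>i. g i * a i) g I (\<lambda>i. g i * ((1 - \<eta>) * a i + \<eta>)) g"
  proof (rule convertsI[where T = "\<lambda>i j. (if i = j then 1 - \<eta> else 0) + \<eta> * g j"])
    have kernel: "(\<Sum>i\<in>I. w i * ((if i = j then 1 - \<eta> else 0) + \<eta> * g j)) = (1 - \<eta>) * w j + \<eta> * g j * sum w I"
      if "j \<in> I" for w j
    proof -
      have "(\<Sum>i\<in>I. w i * ((if i = j then 1 - \<eta> else 0) + \<eta> * g j)) = (\<Sum>i\<in>I. (if i = j then (1 - \<eta>) * w i else 0) + \<eta> * g j * w i)"
        by (intro sum.cong refl) (simp add: distrib_left mult.commute)
      then show ?thesis using that I by (simp add: sum.distrib flip: sum_distrib_left)
    qed
    show "(\<Sum>i\<in>I. g i * a i * ((if i = j then 1 - \<eta> else 0) + \<eta> * g j)) = g j * ((1 - \<eta>) * a j + \<eta>)" if "j \<in> I" for j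
      unfolding kernel[OF that] a(2) by (simp add: algebra_simps)
    show "(\<Sum>i\<in>I. g i * ((if i = j then 1 - \<eta> else 0) + \<eta> * g j)) = g j" if "j \<in> I" for j
      unfolding kernel[OF that] g(2) by (simp add: algebra_simps)
    show "(\<Sum>j\<in>I. (if i = j then 1 - \<eta> else 0) + \<eta> * g j) = 1" if "i \<in> I" for i
      using that I g(2) by (simp add: sum.distrib flip: sum_distrib_left)
  qed (use \<eta> g in \<open>auto simp: less_imp_le\<close>)
  from converts_tensor[OF this, of "{..N}" "\<lambda>m. real (N choose m) * exp \<delta> ^ m" "\<lambda>m. real (N choose m)"]
  have mix: "converts (I \<times> {..N}) (\<lambda>(i, m). g i * a i * (real (N choose m) * exp \<delta> ^ m)) (\<lambda>(i, m). g i * real (N choose m))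
    (I \<times> {..N}) (\<lambda>(i, m). g i * ((1 - \<eta>) * a i + \<eta>) * (real (N choose m) * exp \<delta> ^ m)) (\<lambda>(i, m). g i * real (N choose m))"
    using I by simp
  define R where "R = (1 + exp \<delta>) ^ N"
  define S where "S = (2 :: real) ^ N"
  have RS: "R > 0" "S > 0" by (simp_all add: R_def S_def add_pos_pos)
  \<comment> \<open>The binomial weights are continued by positive values beyond \<open>N\<close>,
    so that positivity can be stated without a range condition.\<close>
  define r where "r m = inverse R * ((if m \<le> N then real (N choose m) else 1) * exp \<delta> ^ m)" for m
  define s where "s m = inverse S * (if m \<le> N then real (N choose m) else 1)" for m
  have all: "converts (I \<times> {..N}) (\<lambda>x. inverse R * (case x of (i, m) \<Rightarrow> g i * a i * (real (N choose m) * exp \<delta> ^ m))) (\<lambda>x. inverse S * (case x of (i, m) \<Rightarrow> g i * real (N choose m)))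
    (I \<times> {..N}) (\<lambda>x. inverse R * (case x of (i, m) \<Rightarrow> ((1 - (1 - \<epsilon>)) * g i + (1 - \<epsilon>) * (g i * ((1 - \<epsilon>) * b i + \<epsilon>))) * (real (N choose m) * exp \<delta> ^ m))) (\<lambda>x. inverse S * (case x of (i, m) \<Rightarrow> g i * real (N choose m)))"
    by (rule converts_scale, rule converts_trans[OF _ mix conv]) (use I in simp)
  have "converts (I \<times> {..N}) (\<lambda>(i, m). g i * a i * r m) (\<lambda>(i, m). g i * s m)
      (I \<times> {..N}) (\<lambda>(i, m). ((1 - \<epsilon>)\<^sup>2 * (g i * b i) + (1 - (1 - \<epsilon>)\<^sup>2) * g i) * r m) (\<lambda>(i, m). g i * s m)"
    by (rule iffD1[OF converts_cong all]) (auto simp: r_def s_def power2_eq_square algebra_simps)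
  moreover have "sum r {..N} = 1"
  proof -
    have "sum r {..N} = inverse R * (\<Sum>m\<le>N. real (N choose m) * exp \<delta> ^ m * 1 ^ (N - m))" by (simp add: r_def sum_distrib_left)
    also have "\<dots> = inverse R * (exp \<delta> + 1) ^ N" by (simp add: binomial_ring)
    finally have "sum r {..N} = inverse R * R" by (simp add: R_def add.commute)
    then show ?thesis using RS(1) by simp
  qed
  moreover have "sum s {..N} = 1"
  proof -
    have "sum s {..N} = inverse S * real (\<Sum>m\<le>N. N choose m)" by (simp add: s_def sum_distrib_left)
    then show ?thesis using RS by (simp add: choose_row_sum S_def)
  qed
  moreover have "r m > 0 \<and> s m > 0" for m using RS by (simp add: r_def s_def)
  ultimately show ?thesis by (intro that[of r s N])
qed

subsection \<open>Quadratic forms and diagonalization\<close>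

text \<open>The form \<open>(A *\<^sub>v v) \<bullet>c v\<close> with \<open>v\<close> as a plain
  function, so that blocks and tensor factors become reindexings of finite sums.\<close>

definition qform :: "nat \<Rightarrow> complex Matrix.mat \<Rightarrow> (nat \<Rightarrow> complex) \<Rightarrow> complex" where
  "qform n A v = (\<Sum>a<n. \<Sum>b<n. A $$ (a, b) * v b * cnj (v a))"

lemma mat_adjoint_carrier [simp]: "A \<in> carrier_mat n n \<Longrightarrow> mat_adjoint A \<in> carrier_mat n n"
  by (intro carrier_matI) (auto simp: mat_adjoint_def)

lemma mat_adjoint_index [simp]:
  "A \<in> carrier_mat n n \<Longrightarrow> i < n \<Longrightarrow> j < n \<Longrightarrow> mat_adjoint A $$ (i, j) = cnj (A $$ (j, i))"
  by (simp add: mat_adjoint_def mat_of_rows_def)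

lemma mat_adjoint_eq_iff:
  assumes "A \<in> carrier_mat n n"
  shows "mat_adjoint A = A \<longleftrightarrow> (\<forall>i<n. \<forall>j<n. cnj (A $$ (j, i)) = A $$ (i, j))"
proof
  assume "mat_adjoint A = A"
  then show "\<forall>i<n. \<forall>j<n. cnj (A $$ (j, i)) = A $$ (i, j)" using mat_adjoint_index[OF assms] by metis
next
  assume "\<forall>i<n. \<forall>j<n. cnj (A $$ (j, i)) = A $$ (i, j)"
  then have "mat_adjoint A $$ (i, j) = A $$ (i, j)" if "i < n" "j < n" for i j
    using mat_adjoint_index[OF assms that] that by metis
  then show "mat_adjoint A = A" using carrier_matD[OF mat_adjoint_carrier[OF assms]] assms by (intro eq_matI) auto
qed

lemma qform_vec:
  assumes "A \<in> carrier_mat n n" "v \<in> carrier_vec n"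
  shows "(A *\<^sub>v v) \<bullet>c v = qform n A (\<lambda>i. v $ i)"
proof -
  have "(A *\<^sub>v v) \<bullet>c v = (\<Sum>a<n. (A *\<^sub>v v) $ a * cnj (v $ a))"
    using assms by (intro cscalar_prod_sum) auto
  also have "\<dots> = qform n A (\<lambda>i. v $ i)"
    unfolding qform_def by (intro sum.cong refl) (simp add: mult_mat_vec_index_sum[OF assms] sum_distrib_right)
  finally show ?thesis .
qed

lemma psd_iff:
  "psd n A \<longleftrightarrow> A \<in> carrier_mat n n \<and> (\<forall>i<n. \<forall>j<n. cnj (A $$ (j, i)) = A $$ (i, j)) \<and> (\<forall>v. 0 \<le> Re (qform n A v))"
proof (cases "A \<in> carrier_mat n n")
  case True
  have "(\<forall>v\<in>carrier_vec n. 0 \<le> Re ((A *\<^sub>v v) \<bullet>c v)) \<longleftrightarrow> (\<forall>v. 0 \<le> Re (qform n A v))"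
  proof
    assume l: "\<forall>v\<in>carrier_vec n. 0 \<le> Re ((A *\<^sub>v v) \<bullet>c v)"
    show "\<forall>v. 0 \<le> Re (qform n A v)"
    proof
      fix v :: "nat \<Rightarrow> complex"
      have "qform n A v = qform n A (\<lambda>i. vec n v $ i)" unfolding qform_def by (intro sum.cong refl) auto
      then show "0 \<le> Re (qform n A v)" using bspec[OF l, of "vec n v"] qform_vec[OF True, of "vec n v"] by simp
    qed
  qed (simp add: qform_vec[OF True])
  then show ?thesis using True mat_adjoint_eq_iff[OF True] by (simp add: psd_def)
qed (simp add: psd_def)

lemma psd_carrier: "psd n A \<Longrightarrow> A \<in> carrier_mat n n"
  by (simp add: psd_def)

lemma psd_herm: "psd n A \<Longrightarrow> i < n \<Longrightarrow> j < n \<Longrightarrow> A $$ (i, j) = cnj (A $$ (j, i))"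
  by (metis psd_iff)

lemma qform_add: "A \<in> carrier_mat n n \<Longrightarrow> B \<in> carrier_mat n n \<Longrightarrow> qform n (A + B) v = qform n A v + qform n B v"
  by (simp add: qform_def sum.distrib distrib_right)

lemma qform_smult: "A \<in> carrier_mat n n \<Longrightarrow> qform n (c \<cdot>\<^sub>m A) v = c * qform n A v"
  by (simp add: qform_def sum_distrib_left mult.assoc)

lemma qform_minus: "A \<in> carrier_mat n n \<Longrightarrow> B \<in> carrier_mat n n \<Longrightarrow> qform n (A - B) v = qform n A v - qform n B v"
  by (simp add: qform_def sum_subtractf left_diff_distrib)

lemma psd_add: "psd n A \<Longrightarrow> psd n B \<Longrightarrow> psd n (A + B)"
  unfolding psd_iff by (auto simp: qform_add)

lemma psd_smult: "psd n A \<Longrightarrow> c \<ge> 0 \<Longrightarrow> psd n (complex_of_real c \<cdot>\<^sub>m A)"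
  unfolding psd_iff by (auto simp: qform_smult)

lemma psd_zero: "psd n (0\<^sub>m n n)"
  unfolding psd_iff by (auto simp: qform_def)

lemma mtrace_minus: "A \<in> carrier_mat n n \<Longrightarrow> B \<in> carrier_mat n n \<Longrightarrow> mtrace (A - B) = mtrace A - mtrace B"
  by (simp add: mtrace_def sum_subtractf)

lemma mtrace_smult: "A \<in> carrier_mat n n \<Longrightarrow> mtrace (c \<cdot>\<^sub>m A) = c * mtrace A"
  by (simp add: mtrace_def sum_distrib_left)

lemma mtrace_mult: 
  assumes "A \<in> carrier_mat n n" "B \<in> carrier_mat n n"
  shows "mtrace (A * B) = (\<Sum>i<n. \<Sum>j<n. A $$ (i, j) * B $$ (j, i))"
  using assms by (simp add: mtrace_def scalar_prod_def atLeast0LessThan)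

lemma mtrace_mult_commute:
  assumes "A \<in> carrier_mat n n" "B \<in> carrier_mat n n"
  shows "mtrace (A * B) = mtrace (B * A)"
  unfolding mtrace_mult[OF assms] mtrace_mult[OF assms(2,1)]
  by (subst sum.swap) (simp add: mult.commute)

section \<open>Spectral theorem for Hermitian matrices\<close>

lemma hermitian_nonzero_eigenvalue:
  assumes A: "A \<in> carrier_mat n n" and herm: "\<And>i j. i < n \<Longrightarrow> j < n \<Longrightarrow> A $$ (i, j) = cnj (A $$ (j, i))"
    and ne: "A \<noteq> 0\<^sub>m n n"
  obtains k v where "k \<noteq> 0" "v \<in> carrier_vec n" "v \<noteq> 0\<^sub>v n" "A *\<^sub>v v = k \<cdot>\<^sub>v v"
proof -
  obtain es where es: "char_poly A = (\<Prod>e\<leftarrow>es. [:- e, 1:])" using char_poly_factorized[OF A] by blast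
  obtain B P Q where BPQ: "schur_decomposition A es = (B, P, Q)" by (cases "schur_decomposition A es") auto
  from schur_decomposition[OF A es BPQ]
  have sim: "similar_mat_wit A B P Q" and ut: "upper_triangular B" and diag: "diag_mat B = es" by auto
  note c = similar_mat_witD2[OF A sim]
  \<comment> \<open>If all eigenvalues vanish, the Schur form is strictly triangular and
    \<open>A * A\<close> has trace 0; for Hermitian \<open>A\<close> that trace is the sum of the
    squared moduli of the entries.\<close>
  have "\<exists>e\<in>set es. e \<noteq> 0"
  proof (rule ccontr)
    assume "\<not> ?thesis"
    then have "B $$ (i, i) = 0" if "i < n" for i using diag that c(5) by (force simp: diag_mat_def)
    then have B0: "B $$ (i, j) = 0" if "j \<le> i" "i < n" for i j
      using that ut c(5) unfolding upper_triangular_def by (cases "i = j") auto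
    have "A * A = P * B * (Q * P) * B * Q" unfolding c(3) using c(5-7) by (simp add: assoc_mult_mat[of _ n n _ n _ n])
    also have "\<dots> = P * (B * B * Q)" unfolding c(2) using c(5-7) by (simp add: assoc_mult_mat[of _ n n _ n _ n])
    finally have "mtrace (A * A) = mtrace (P * (B * B * Q))" by simp
    also have "\<dots> = mtrace (B * B * Q * P)" using c(5-7) by (intro mtrace_mult_commute[of _ n]) auto
    also have "\<dots> = mtrace (B * B * (Q * P))" using c(5-7) by (simp add: assoc_mult_mat[of _ n n _ n _ n])
    also have "\<dots> = mtrace (B * B)" unfolding c(2) using c(5) by simp
    also have "\<dots> = 0" unfolding mtrace_mult[OF c(5) c(5)]
    proof (intro sum.neutral ballI)
      fix i j assume "i \<in> {..<n}" "j \<in> {..<n}"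
      then show "B $$ (i, j) * B $$ (j, i) = 0" using B0[of i j] B0[of j i] by (cases "i \<le> j") auto
    qed
    finally have "(\<Sum>i<n. \<Sum>j<n. A $$ (i, j) * A $$ (j, i)) = 0" unfolding mtrace_mult[OF A A] .
    moreover have "(\<Sum>i<n. \<Sum>j<n. A $$ (i, j) * A $$ (j, i)) = complex_of_real (\<Sum>i<n. \<Sum>j<n. (cmod (A $$ (i, j)))\<^sup>2)"
      unfolding of_real_sum
    proof (intro sum.cong refl)
      fix i j assume "i \<in> {..<n}" "j \<in> {..<n}"
      then show "A $$ (i, j) * A $$ (j, i) = complex_of_real ((cmod (A $$ (i, j)))\<^sup>2)"
        using herm[of j i] by (simp only: complex_norm_square lessThan_iff)
    qed
    ultimately have "complex_of_real (\<Sum>i<n. \<Sum>j<n. (cmod (A $$ (i, j)))\<^sup>2) = 0" by simp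
    then have z: "(\<Sum>i<n. \<Sum>j<n. (cmod (A $$ (i, j)))\<^sup>2) = 0" by (simp only: of_real_eq_0_iff)
    have "A $$ (i, j) = 0" if "i < n" "j < n" for i j
    proof -
      have "(\<Sum>j<n. (cmod (A $$ (i, j)))\<^sup>2) = 0" using z that(1)
        by (subst (asm) sum_nonneg_eq_0_iff) (auto intro: sum_nonneg)
      then show ?thesis using that(2) by (subst (asm) sum_nonneg_eq_0_iff) auto
    qed
    then have "A = 0\<^sub>m n n" using A by (intro eq_matI) auto
    then show False using ne by simp
  qed
  then obtain e where e: "e \<in> set es" "e \<noteq> 0" by blast
  have "poly (char_poly A) e = 0" unfolding es using e(1) by (simp add: poly_prod_list_zero_iff image_iff)
  then have "eigenvalue A e" using eigenvalue_root_char_poly[OF A] by simp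
  then obtain v where "eigenvector A v e" by (auto simp: eigenvalue_def)
  then show ?thesis using that[of e v] e A by (auto simp: eigenvector_def)
qed

lemma cscalar_smult:
  assumes "v \<in> carrier_vec n" "w \<in> carrier_vec n"
  shows "(c \<cdot>\<^sub>v v) \<bullet>c w = c * (v \<bullet>c w)" "v \<bullet>c (c \<cdot>\<^sub>v w) = cnj c * (v \<bullet>c w)"
proof -
  have "(c \<cdot>\<^sub>v v) \<bullet>c w = (\<Sum>a<n. (c \<cdot>\<^sub>v v) $ a * cnj (w $ a))" using assms by (intro cscalar_prod_sum) auto
  then show "(c \<cdot>\<^sub>v v) \<bullet>c w = c * (v \<bullet>c w)" using assms by (simp add: cscalar_prod_sum sum_distrib_left mult.assoc)
  have "v \<bullet>c (c \<cdot>\<^sub>v w) = (\<Sum>a<n. v $ a * cnj ((c \<cdot>\<^sub>v w) $ a))" using assms by (intro cscalar_prod_sum) auto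
  then show "v \<bullet>c (c \<cdot>\<^sub>v w) = cnj c * (v \<bullet>c w)" using assms by (simp add: cscalar_prod_sum sum_distrib_left mult_ac)
qed

lemma cscalar_commute:
  assumes "v \<in> carrier_vec n" "w \<in> carrier_vec n"
  shows "w \<bullet>c v = cnj (v \<bullet>c w)"
  using assms by (simp add: cscalar_prod_sum[of _ n] mult.commute)

lemma normalize_vec:
  assumes "v \<in> carrier_vec n" "v \<noteq> 0\<^sub>v n"
  obtains c where "(complex_of_real c \<cdot>\<^sub>v v) \<bullet>c (complex_of_real c \<cdot>\<^sub>v v) = 1"
proof -
  define S where "S = (\<Sum>a<n. (cmod (v $ a))\<^sup>2)"
  have vv: "v \<bullet>c v = complex_of_real S"
    unfolding cscalar_prod_sum[OF assms(1) assms(1)] S_def of_real_sum by (intro sum.cong refl) (simp only: complex_norm_square)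
  have "\<not> (\<forall>a<n. v $ a = 0)"
  proof
    assume "\<forall>a<n. v $ a = 0"
    then have "v = 0\<^sub>v n" using assms(1) by (intro eq_vecI) auto
    then show False using assms by simp
  qed
  then obtain a where a: "a < n" "v $ a \<noteq> 0" by blast
  then have S: "S > 0" unfolding S_def by (intro sum_pos2[of _ a]) auto
  define c where "c = 1 / sqrt S"
  have "(complex_of_real c \<cdot>\<^sub>v v) \<bullet>c (complex_of_real c \<cdot>\<^sub>v v) = complex_of_real (c * c * S)"
    using assms vv by (simp add: cscalar_smult[of _ n])
  also have "c * c * S = 1" using S by (simp add: c_def field_simps)
  finally show ?thesis using that[of c] by simp
qed

lemma hermitian_inner:
  assumes A: "A \<in> carrier_mat n n" and herm: "\<And>i j. i < n \<Longrightarrow> j < n \<Longrightarrow> A $$ (i, j) = cnj (A $$ (j, i))"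
    and v: "v \<in> carrier_vec n" and w: "w \<in> carrier_vec n"
  shows "(A *\<^sub>v v) \<bullet>c w = v \<bullet>c (A *\<^sub>v w)"
proof -
  have "(A *\<^sub>v v) \<bullet>c w = (\<Sum>a<n. (A *\<^sub>v v) $ a * cnj (w $ a))" using A v w by (intro cscalar_prod_sum) auto
  also have "\<dots> = (\<Sum>a<n. \<Sum>b<n. A $$ (a, b) * v $ b * cnj (w $ a))"
    by (intro sum.cong refl) (simp add: mult_mat_vec_index_sum[OF A v] sum_distrib_right)
  also have "\<dots> = (\<Sum>b<n. \<Sum>a<n. v $ b * (cnj (A $$ (b, a)) * cnj (w $ a)))"
    by (subst sum.swap, intro sum.cong refl) (simp add: mult_ac flip: herm)
  also have "\<dots> = (\<Sum>b<n. v $ b * cnj ((A *\<^sub>v w) $ b))"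
    by (intro sum.cong refl) (simp add: mult_mat_vec_index_sum[OF A w] sum_distrib_left)
  also have "\<dots> = v \<bullet>c (A *\<^sub>v w)" using A v w by (intro cscalar_prod_sum[symmetric]) auto
  finally show ?thesis .
qed

text \<open>Deflation: subtracting the known spectral part gives a Hermitian \<open>N\<close> that
  annihilates the \<open>u i\<close>. If \<open>N\<close> is nonzero, an eigenvector with nonzero
  eigenvalue is automatically orthogonal to them and hence an eigenvector of \<open>A\<close>. If
  \<open>N\<close> vanishes, \<open>A\<close> kills every vector orthogonal to them.\<close>

lemma orthonormal_eigenvectors_extend:
  fixes A :: "complex Matrix.mat" and u :: "nat \<Rightarrow> complex Matrix.vec" and e :: "nat \<Rightarrow> real"
  assumes A: "A \<in> carrier_mat n n" and herm: "\<And>i j. i < n \<Longrightarrow> j < n \<Longrightarrow> A $$ (i, j) = cnj (A $$ (j, i))"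
    and k: "k < n" and uc: "\<And>i. i < k \<Longrightarrow> u i \<in> carrier_vec n"
    and on: "\<And>i j. i < k \<Longrightarrow> j < k \<Longrightarrow> u i \<bullet>c u j = (if i = j then 1 else 0)"
    and ev: "\<And>i. i < k \<Longrightarrow> A *\<^sub>v u i = complex_of_real (e i) \<cdot>\<^sub>v u i"
  obtains v x where "v \<in> carrier_vec n" "v \<bullet>c v = 1" "\<And>i. i < k \<Longrightarrow> v \<bullet>c u i = 0"
    "A *\<^sub>v v = complex_of_real x \<cdot>\<^sub>v v"
proof -
  define N where "N = Matrix.mat n n (\<lambda>(a, b). A $$ (a, b) - (\<Sum>i<k. complex_of_real (e i) * u i $ a * cnj (u i $ b)))"
  have Nc: "N \<in> carrier_mat n n" by (simp add: N_def)
  have Nherm: "N $$ (i, j) = cnj (N $$ (j, i))" if "i < n" "j < n" for i j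
    using that by (simp add: N_def mult_ac flip: herm)
  have Nv: "(N *\<^sub>v v) $ a = (A *\<^sub>v v) $ a - (\<Sum>i<k. complex_of_real (e i) * (v \<bullet>c u i) * u i $ a)"
    if v: "v \<in> carrier_vec n" and a: "a < n" for v a
  proof -
    have "(N *\<^sub>v v) $ a = (\<Sum>b<n. A $$ (a, b) * v $ b - (\<Sum>i<k. complex_of_real (e i) * u i $ a * cnj (u i $ b)) * v $ b)"
      unfolding mult_mat_vec_index_sum[OF Nc v a] using a by (intro sum.cong refl) (simp add: N_def left_diff_distrib)
    also have "\<dots> = (A *\<^sub>v v) $ a - (\<Sum>b<n. \<Sum>i<k. complex_of_real (e i) * u i $ a * cnj (u i $ b) * v $ b)"
      by (simp add: sum_subtractf mult_mat_vec_index_sum[OF A v a] sum_distrib_right)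
    also have "(\<Sum>b<n. \<Sum>i<k. complex_of_real (e i) * u i $ a * cnj (u i $ b) * v $ b) = (\<Sum>i<k. complex_of_real (e i) * (v \<bullet>c u i) * u i $ a)"
      by (subst sum.swap, intro sum.cong refl) (simp add: cscalar_prod_sum[OF v uc] sum_distrib_left sum_distrib_right mult_ac)
    finally show ?thesis .
  qed
  have A_of_N: "A *\<^sub>v v = N *\<^sub>v v" if v: "v \<in> carrier_vec n" and orth: "\<And>i. i < k \<Longrightarrow> v \<bullet>c u i = 0" for v
    using Nv[OF v] orth A Nc by (intro eq_vecI) auto
  note ext = that
  have finish: thesis if v: "v \<in> carrier_vec n" "v \<noteq> 0\<^sub>v n" and orth: "\<And>i. i < k \<Longrightarrow> v \<bullet>c u i = 0"
    and Av: "A *\<^sub>v v = complex_of_real x \<cdot>\<^sub>v v" for v x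
  proof -
    obtain c where c: "(complex_of_real c \<cdot>\<^sub>v v) \<bullet>c (complex_of_real c \<cdot>\<^sub>v v) = 1" using normalize_vec[OF v] by blast
    have "A *\<^sub>v (complex_of_real c \<cdot>\<^sub>v v) = complex_of_real c \<cdot>\<^sub>v (A *\<^sub>v v)" using A v by (simp add: mult_mat_vec)
    also have "\<dots> = complex_of_real x \<cdot>\<^sub>v (complex_of_real c \<cdot>\<^sub>v v)" unfolding Av by (simp add: smult_smult_assoc mult.commute)
    finally have "A *\<^sub>v (complex_of_real c \<cdot>\<^sub>v v) = complex_of_real x \<cdot>\<^sub>v (complex_of_real c \<cdot>\<^sub>v v)" .
    then show thesis using ext[of "complex_of_real c \<cdot>\<^sub>v v" x] c v uc orth by (simp add: cscalar_smult[of _ n])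
  qed
  show thesis
  proof (cases "N = 0\<^sub>m n n")
    case False
    then obtain l w where w: "l \<noteq> 0" "w \<in> carrier_vec n" "w \<noteq> 0\<^sub>v n" "N *\<^sub>v w = l \<cdot>\<^sub>v w"
      using hermitian_nonzero_eigenvalue[OF Nc Nherm] by blast
    have Nu: "N *\<^sub>v u i = 0\<^sub>v n" if i: "i < k" for i
    proof (rule eq_vecI)
      fix a assume "a < dim_vec (0\<^sub>v n :: complex Matrix.vec)"
      then have a: "a < n" by simp
      have "(\<Sum>j<k. complex_of_real (e j) * (u i \<bullet>c u j) * u j $ a) = (\<Sum>j<k. if j = i then complex_of_real (e i) * u i $ a else 0)"
        by (intro sum.cong refl) (use on i in auto)
      then show "(N *\<^sub>v u i) $ a = 0\<^sub>v n $ a" using Nv[OF uc[OF i] a] ev[OF i] uc[OF i] a i by simp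
    qed (use Nc in simp)
    have orth: "w \<bullet>c u i = 0" if i: "i < k" for i
    proof -
      have "l * (w \<bullet>c u i) = (N *\<^sub>v w) \<bullet>c u i" unfolding w(4) using w(2) uc[OF i] by (simp add: cscalar_smult[of _ n])
      also have "\<dots> = w \<bullet>c (N *\<^sub>v u i)" by (rule hermitian_inner[OF Nc Nherm w(2) uc[OF i]])
      also have "\<dots> = 0" unfolding Nu[OF i] using w(2) by (simp add: cscalar_prod_sum[of _ n])
      finally show ?thesis using w(1) by simp
    qed
    have ww: "w \<bullet>c w \<noteq> 0" using w by simp
    have "l * (w \<bullet>c w) = (N *\<^sub>v w) \<bullet>c w" unfolding w(4) using w(2) by (simp add: cscalar_smult[of _ n])
    also have "\<dots> = w \<bullet>c (N *\<^sub>v w)" by (rule hermitian_inner[OF Nc Nherm w(2) w(2)])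
    also have "\<dots> = cnj l * (w \<bullet>c w)" unfolding w(4) using w(2) by (simp add: cscalar_smult[of _ n])
    finally have "l = cnj l" using ww by simp
    then have "l = complex_of_real (Re l)" by (metis Reals_cnj_iff of_real_Re)
    then show thesis using finish[of w "Re l"] w orth A_of_N by metis
  next
    case True
    \<comment> \<open>The projection onto the orthogonal complement has trace \<open>n - k\<close>,
      so some diagonal entry is nonzero and its column is a nonzero vector orthogonal to the
      \<open>u i\<close>.\<close>
    define P where "P a b = (if a = b then 1 else 0) - (\<Sum>j<k. u j $ a * cnj (u j $ b))" for a b
    have "(\<Sum>a<n. P a a) = of_nat n - (\<Sum>j<k. u j \<bullet>c u j)"
      unfolding P_def sum_subtractf by (subst sum.swap) (simp add: cscalar_prod_sum[OF uc uc])
    also have "\<dots> = of_nat n - of_nat k" using on by simp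
    also have "\<dots> \<noteq> 0" using k by simp
    finally obtain b where b: "b < n" "P b b \<noteq> 0" by (meson lessThan_iff sum.neutral)
    define v where "v = Matrix.vec n (\<lambda>a. P a b)"
    have v: "v \<in> carrier_vec n" "v \<noteq> 0\<^sub>v n"
    proof -
      show "v \<noteq> 0\<^sub>v n"
      proof
        assume "v = 0\<^sub>v n"
        then have "v $ b = 0" using b by simp
        then show False using b by (simp add: v_def)
      qed
    qed (simp add: v_def)
    have orth: "v \<bullet>c u i = 0" if i: "i < k" for i
    proof -
      have "v \<bullet>c u i = (\<Sum>a<n. (if a = b then cnj (u i $ a) else 0) - (\<Sum>j<k. u j $ a * cnj (u j $ b) * cnj (u i $ a)))"
        unfolding cscalar_prod_sum[OF v(1) uc[OF i]]
        by (intro sum.cong refl) (simp add: v_def P_def left_diff_distrib sum_distrib_right)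
      also have "\<dots> = cnj (u i $ b) - (\<Sum>j<k. cnj (u j $ b) * (u j \<bullet>c u i))"
      proof -
        have "(\<Sum>a<n. \<Sum>j<k. u j $ a * cnj (u j $ b) * cnj (u i $ a)) = (\<Sum>j<k. cnj (u j $ b) * (u j \<bullet>c u i))"
          by (subst sum.swap, intro sum.cong refl) (simp add: cscalar_prod_sum[OF uc uc[OF i]] sum_distrib_left mult_ac)
        then show ?thesis unfolding sum_subtractf using b by simp
      qed
      also have "(\<Sum>j<k. cnj (u j $ b) * (u j \<bullet>c u i)) = (\<Sum>j<k. if j = i then cnj (u i $ b) else 0)"
        by (intro sum.cong refl) (use on i in auto)
      finally show ?thesis using i by simp
    qed
    have "A *\<^sub>v v = complex_of_real 0 \<cdot>\<^sub>v v"
    proof -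
      have "A *\<^sub>v v = 0\<^sub>m n n *\<^sub>v v" using A_of_N[OF v(1) orth] True by metis
      also have "\<dots> = complex_of_real 0 \<cdot>\<^sub>v v" using v(1) by (intro eq_vecI) (auto simp: scalar_prod_def)
      finally show ?thesis .
    qed
    then show thesis using finish[OF v orth] by blast
  qed
qed

lemma hermitian_spectral:
  fixes A :: "complex Matrix.mat"
  assumes A: "A \<in> carrier_mat n n" and herm: "\<And>i j. i < n \<Longrightarrow> j < n \<Longrightarrow> A $$ (i, j) = cnj (A $$ (j, i))"
  obtains h e where "orthonormal_basis n h" "A = spectral_sum n h e"
proof -
  have "\<exists>u e. (\<forall>i<k. u i \<in> carrier_vec n \<and> A *\<^sub>v u i = complex_of_real (e i) \<cdot>\<^sub>v u i) \<and>
     (\<forall>i<k. \<forall>j<k. u i \<bullet>c u j = (if i = j then 1 else 0))" if "k \<le> n" for k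
    using that
  proof (induction k)
    case (Suc k)
    then obtain u e where IH: "\<forall>i<k. u i \<in> carrier_vec n \<and> A *\<^sub>v u i = complex_of_real (e i) \<cdot>\<^sub>v u i"
      "\<forall>i<k. \<forall>j<k. u i \<bullet>c u j = (if i = j then 1 else 0)" by auto
    obtain v x where v: "v \<in> carrier_vec n" "v \<bullet>c v = 1" "\<And>i. i < k \<Longrightarrow> v \<bullet>c u i = 0"
      "A *\<^sub>v v = complex_of_real x \<cdot>\<^sub>v v"
      by (rule orthonormal_eigenvectors_extend[OF A herm, of k u e]) (use Suc.prems IH in auto)
    have "u i \<bullet>c v = 0" if "i < k" for i using v IH that cscalar_commute[of v n "u i"] by simp
    then show ?case using IH v
      by (intro exI[of _ "u(k := v)"] exI[of _ "e(k := x)"]) (auto simp: less_Suc_eq)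
  qed simp
  from this[of n] obtain u e where u: "\<forall>i<n. u i \<in> carrier_vec n \<and> A *\<^sub>v u i = complex_of_real (e i) \<cdot>\<^sub>v u i"
     "\<forall>i<n. \<forall>j<n. u i \<bullet>c u j = (if i = j then 1 else 0)" by auto
  then have on: "orthonormal_basis n u" by (simp add: orthonormal_basis_def)
  have "A = spectral_sum n u e"
    by (rule mat_eq_on_basis[OF on A spectral_sum_carrier]) (use u spectral_sum_basis[OF on] in auto)
  then show ?thesis using that on by blast
qed

subsection \<open>Functions of operators in a fixed eigenbasis\<close>

lemma onb_carrier: "orthonormal_basis n h \<Longrightarrow> i < n \<Longrightarrow> h i \<in> carrier_vec n"
  by (simp add: orthonormal_basis_def)

lemma onb_sum:
  assumes "orthonormal_basis n h" "i < n" "j < n"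
  shows "(\<Sum>a<n. h i $ a * cnj (h j $ a)) = (if i = j then 1 else 0)"
  using assms cscalar_prod_sum[OF onb_carrier[OF assms(1,2)] onb_carrier[OF assms(1,3)]]
  by (simp add: orthonormal_basis_def)

lemma spectral_sum_index:
  "a < n \<Longrightarrow> b < n \<Longrightarrow> spectral_sum n h e $$ (a, b) = (\<Sum>i<n. complex_of_real (e i) * h i $ a * cnj (h i $ b))"
  by (simp add: spectral_sum_def)

lemma spectral_sum_cong:
  "(\<And>i. i < n \<Longrightarrow> e i = f i) \<Longrightarrow> spectral_sum n h e = spectral_sum n h f"
  unfolding spectral_sum_def by (intro cong_mat refl) (auto intro!: sum.cong)

lemma spectral_sum_herm: "a < n \<Longrightarrow> b < n \<Longrightarrow> spectral_sum n h e $$ (a, b) = cnj (spectral_sum n h e $$ (b, a))"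
  by (simp add: spectral_sum_index mult_ac)

lemma mat_adjoint_spectral_sum: "mat_adjoint (spectral_sum n h e) = spectral_sum n h e"
  using spectral_sum_herm[of _ n _ h e] by (subst mat_adjoint_eq_iff[OF spectral_sum_carrier]) metis

lemma mtrace_spectral_sum:
  assumes "orthonormal_basis n h"
  shows "mtrace (spectral_sum n h e) = complex_of_real (\<Sum>i<n. e i)"
proof -
  have "mtrace (spectral_sum n h e) = (\<Sum>a<n. \<Sum>i<n. complex_of_real (e i) * (h i $ a * cnj (h i $ a)))"
    unfolding mtrace_def carrier_matD(1)[OF spectral_sum_carrier]
    by (intro sum.cong refl) (simp add: spectral_sum_index mult.assoc)
  also have "\<dots> = (\<Sum>i<n. complex_of_real (e i) * (\<Sum>a<n. h i $ a * cnj (h i $ a)))"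
    by (subst sum.swap) (simp add: sum_distrib_left)
  also have "\<dots> = (\<Sum>i<n. complex_of_real (e i))"
    by (intro sum.cong refl) (simp add: onb_sum[OF assms])
  finally show ?thesis by simp
qed

lemma qform_spectral_sum:
  "qform n (spectral_sum n h e) v = complex_of_real (\<Sum>i<n. e i * (cmod (\<Sum>b<n. v b * cnj (h i $ b)))\<^sup>2)"
proof -
  have "qform n (spectral_sum n h e) v = (\<Sum>a<n. \<Sum>b<n. \<Sum>i<n. complex_of_real (e i) * ((v b * cnj (h i $ b)) * cnj (v a * cnj (h i $ a))))"
    unfolding qform_def by (intro sum.cong refl) (simp add: spectral_sum_index sum_distrib_right sum_distrib_left mult_ac)
  also have "\<dots> = (\<Sum>i<n. \<Sum>a<n. \<Sum>b<n. complex_of_real (e i) * ((v b * cnj (h i $ b)) * cnj (v a * cnj (h i $ a))))"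
  proof -
    have "(\<Sum>a<n. \<Sum>b<n. \<Sum>i<n. F a b i) = (\<Sum>i<n. \<Sum>a<n. \<Sum>b<n. F a b i)" for F :: "nat \<Rightarrow> nat \<Rightarrow> nat \<Rightarrow> complex"
    proof -
      have "(\<Sum>a<n. \<Sum>b<n. \<Sum>i<n. F a b i) = (\<Sum>a<n. \<Sum>i<n. \<Sum>b<n. F a b i)" by (intro sum.cong refl sum.swap)
      also have "\<dots> = (\<Sum>i<n. \<Sum>a<n. \<Sum>b<n. F a b i)" by (rule sum.swap)
      finally show ?thesis .
    qed
    then show ?thesis .
  qed
  also have "\<dots> = (\<Sum>i<n. complex_of_real (e i) * ((\<Sum>b<n. v b * cnj (h i $ b)) * cnj (\<Sum>a<n. v a * cnj (h i $ a))))"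
  proof (intro sum.cong refl)
    fix i
    show "(\<Sum>a<n. \<Sum>b<n. complex_of_real (e i) * ((v b * cnj (h i $ b)) * cnj (v a * cnj (h i $ a)))) =
      complex_of_real (e i) * ((\<Sum>b<n. v b * cnj (h i $ b)) * cnj (\<Sum>a<n. v a * cnj (h i $ a)))"
      unfolding cnj_sum sum_product by (subst sum_distrib_left, subst sum_distrib_left, rule sum.swap)
  qed
  finally show ?thesis by (simp only: of_real_sum of_real_mult complex_norm_square)
qed

lemma psd_spectral_sum:
  assumes "\<And>i. i < n \<Longrightarrow> e i \<ge> 0"
  shows "psd n (spectral_sum n h e)"
  unfolding psd_iff qform_spectral_sum using assms
  by (auto simp: spectral_sum_carrier spectral_sum_herm[symmetric] intro!: sum_nonneg)

lemma spectral_sum_eigenvalue: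
  assumes h: "orthonormal_basis n h" and i: "i < n"
  shows "qform n (spectral_sum n h e) (\<lambda>a. h i $ a) = complex_of_real (e i)"
proof -
  have "(\<Sum>j<n. e j * (cmod (\<Sum>b<n. h i $ b * cnj (h j $ b)))\<^sup>2) = (\<Sum>j<n. if j = i then e i else 0)"
    by (intro sum.cong refl) (use onb_sum[OF h i] in auto)
  then show ?thesis unfolding qform_spectral_sum using i by simp
qed

lemma psd_spectral:
  assumes "psd n A"
  obtains h e where "orthonormal_basis n h" "A = spectral_sum n h e" "\<And>i. i < n \<Longrightarrow> e i \<ge> 0"
proof -
  obtain h e where h: "orthonormal_basis n h" "A = spectral_sum n h e"
    using hermitian_spectral[OF psd_carrier[OF assms] psd_herm[OF assms]] by blast
  have "e i \<ge> 0" if "i < n" for i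
    using assms spectral_sum_eigenvalue[OF h(1) that, of e] h(2) unfolding psd_iff by (metis Re_complex_of_real)
  then show ?thesis using that h by blast
qed

lemma spectral_sum_mult:
  assumes h: "orthonormal_basis n h"
  shows "spectral_sum n h e * spectral_sum n h f = spectral_sum n h (\<lambda>i. e i * f i)"
proof (rule mat_eq_on_basis[OF h _ spectral_sum_carrier])
  fix i assume i: "i < n"
  have "(spectral_sum n h e * spectral_sum n h f) *\<^sub>v h i = spectral_sum n h e *\<^sub>v (spectral_sum n h f *\<^sub>v h i)"
    by (rule assoc_mult_mat_vec[OF spectral_sum_carrier spectral_sum_carrier onb_carrier[OF h i]])
  also have "\<dots> = spectral_sum n h e *\<^sub>v (complex_of_real (f i) \<cdot>\<^sub>v h i)" by (simp only: spectral_sum_basis[OF h i])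
  also have "\<dots> = complex_of_real (f i) \<cdot>\<^sub>v (spectral_sum n h e *\<^sub>v h i)"
    by (rule mult_mat_vec[OF spectral_sum_carrier onb_carrier[OF h i]])
  also have "\<dots> = spectral_sum n h (\<lambda>i. e i * f i) *\<^sub>v h i"
    unfolding spectral_sum_basis[OF h i] by (simp add: smult_smult_assoc mult.commute)
  finally show "(spectral_sum n h e * spectral_sum n h f) *\<^sub>v h i = spectral_sum n h (\<lambda>i. e i * f i) *\<^sub>v h i" .
qed (intro mult_carrier_mat[OF spectral_sum_carrier spectral_sum_carrier])

lemma spectral_sum_minus: "spectral_sum n h e - spectral_sum n h f = spectral_sum n h (\<lambda>i. e i - f i)"
  by (rule eq_matI) (auto simp: spectral_sum_def sum_subtractf left_diff_distrib)

lemma parseval: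
  assumes h: "orthonormal_basis n h" and v: "v \<in> carrier_vec n" and w: "w \<in> carrier_vec n"
  shows "v \<bullet>c w = (\<Sum>i<n. (v \<bullet>c h i) * cnj (w \<bullet>c h i))"
proof -
  have "v \<bullet>c w = (\<Sum>a<n. \<Sum>i<n. (v \<bullet>c h i) * (h i $ a * cnj (w $ a)))"
    unfolding cscalar_prod_sum[OF v w]
    by (intro sum.cong refl, subst orthonormal_basis_expand[OF h v]) (simp_all add: sum_distrib_right mult.assoc)
  also have "\<dots> = (\<Sum>i<n. (v \<bullet>c h i) * (\<Sum>a<n. h i $ a * cnj (w $ a)))"
    by (subst sum.swap) (simp add: sum_distrib_left)
  also have "\<dots> = (\<Sum>i<n. (v \<bullet>c h i) * cnj (w \<bullet>c h i))"
    by (intro sum.cong refl) (simp add: cscalar_prod_sum[OF w onb_carrier[OF h]] mult.commute)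
  finally show ?thesis .
qed

lemma spectral_sum_coeff:
  assumes h: "orthonormal_basis n h" and v: "v \<in> carrier_vec n" and i: "i < n"
  shows "(spectral_sum n h e *\<^sub>v v) \<bullet>c h i = complex_of_real (e i) * (v \<bullet>c h i)"
proof -
  have "(spectral_sum n h e *\<^sub>v v) \<bullet>c h i = v \<bullet>c (spectral_sum n h e *\<^sub>v h i)"
    by (rule hermitian_inner[OF spectral_sum_carrier spectral_sum_herm v onb_carrier[OF h i]])
  then show ?thesis unfolding spectral_sum_basis[OF h i] using cscalar_smult(2)[OF v onb_carrier[OF h i]] by simp
qed

lemma onb_zero_iff:
  assumes h: "orthonormal_basis n h" and v: "v \<in> carrier_vec n"
  shows "v = 0\<^sub>v n \<longleftrightarrow> (\<forall>i<n. v \<bullet>c h i = 0)"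
proof
  assume "\<forall>i<n. v \<bullet>c h i = 0"
  then show "v = 0\<^sub>v n" using orthonormal_basis_expand[OF h v] v by (intro eq_vecI) auto
qed (use onb_carrier[OF h] in \<open>auto simp: cscalar_prod_sum[of _ n]\<close>)

lemma mat_kernel_spectral_sum:
  assumes h: "orthonormal_basis n h"
  shows "mat_kernel (spectral_sum n h e) = {v \<in> carrier_vec n. \<forall>i<n. e i = 0 \<or> v \<bullet>c h i = 0}"
proof -
  have "spectral_sum n h e *\<^sub>v v = 0\<^sub>v n \<longleftrightarrow> (\<forall>i<n. e i = 0 \<or> v \<bullet>c h i = 0)" if v: "v \<in> carrier_vec n" for v
    unfolding onb_zero_iff[OF h mult_mat_vec_carrier[OF spectral_sum_carrier v]]
    using spectral_sum_coeff[OF h v] by simp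
  then show ?thesis unfolding mat_kernel[OF spectral_sum_carrier] by blast
qed

lemma supp_spectral_sum:
  assumes h: "orthonormal_basis n h"
  shows "supp (spectral_sum n h e) = {v \<in> carrier_vec n. \<forall>i<n. e i = 0 \<longrightarrow> v \<bullet>c h i = 0}"
proof -
  have "(\<forall>w\<in>mat_kernel (spectral_sum n h e). v \<bullet>c w = 0) \<longleftrightarrow> (\<forall>i<n. e i = 0 \<longrightarrow> v \<bullet>c h i = 0)"
    if v: "v \<in> carrier_vec n" for v
  proof
    assume l: "\<forall>w\<in>mat_kernel (spectral_sum n h e). v \<bullet>c w = 0"
    show "\<forall>i<n. e i = 0 \<longrightarrow> v \<bullet>c h i = 0"
    proof (intro allI impI)
      fix i assume i: "i < n" "e i = 0"
      have "h i \<in> mat_kernel (spectral_sum n h e)"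
        unfolding mat_kernel_spectral_sum[OF h] using i h by (auto simp: orthonormal_basis_def)
      then show "v \<bullet>c h i = 0" using l by blast
    qed
  next
    assume r: "\<forall>i<n. e i = 0 \<longrightarrow> v \<bullet>c h i = 0"
    show "\<forall>w\<in>mat_kernel (spectral_sum n h e). v \<bullet>c w = 0"
    proof
      fix w assume "w \<in> mat_kernel (spectral_sum n h e)"
      then have w: "w \<in> carrier_vec n" "\<forall>i<n. e i = 0 \<or> w \<bullet>c h i = 0" unfolding mat_kernel_spectral_sum[OF h] by auto
      show "v \<bullet>c w = 0" unfolding parseval[OF h v w(1)] by (intro sum.neutral) (use r w in auto)
    qed
  qed
  then show ?thesis unfolding supp_def carrier_matD(2)[OF spectral_sum_carrier] by blast
qed

lemma supp_spectral_sum_subset: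
  assumes h: "orthonormal_basis n h"
  shows "supp (spectral_sum n h e) \<subseteq> supp (spectral_sum n h f) \<longleftrightarrow> (\<forall>i<n. f i = 0 \<longrightarrow> e i = 0)"
proof
  assume s: "supp (spectral_sum n h e) \<subseteq> supp (spectral_sum n h f)"
  show "\<forall>i<n. f i = 0 \<longrightarrow> e i = 0"
  proof (intro allI impI)
    fix i assume i: "i < n" "f i = 0"
    show "e i = 0"
    proof (rule ccontr)
      assume "e i \<noteq> 0"
      then have "h i \<in> supp (spectral_sum n h e)"
        unfolding supp_spectral_sum[OF h] using i h by (auto simp: orthonormal_basis_def)
      then have "h i \<bullet>c h i = 0" using s i unfolding supp_spectral_sum[OF h] by blast
      then show False using i h by (simp add: orthonormal_basis_def)
    qed
  qed
qed (auto simp: supp_spectral_sum[OF h])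

lemma supp_spectral_sum_inter:
  assumes h: "orthonormal_basis n h"
  shows "supp (spectral_sum n h e) \<inter> supp (spectral_sum n h f) \<noteq> {0\<^sub>v n} \<longleftrightarrow> (\<exists>i<n. e i \<noteq> 0 \<and> f i \<noteq> 0)"
proof -
  have z: "0\<^sub>v n \<in> supp (spectral_sum n h e)" for e
    unfolding supp_spectral_sum[OF h] using onb_zero_iff[OF h, of "0\<^sub>v n"] by auto
  show ?thesis
  proof
    assume "supp (spectral_sum n h e) \<inter> supp (spectral_sum n h f) \<noteq> {0\<^sub>v n}"
    then obtain v where v: "v \<in> supp (spectral_sum n h e)" "v \<in> supp (spectral_sum n h f)" "v \<noteq> 0\<^sub>v n"
      using z by blast
    then have "v \<in> carrier_vec n" by (auto simp: supp_spectral_sum[OF h])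
    then obtain i where "i < n" "v \<bullet>c h i \<noteq> 0" using onb_zero_iff[OF h] v(3) by blast
    then show "\<exists>i<n. e i \<noteq> 0 \<and> f i \<noteq> 0" using v by (auto simp: supp_spectral_sum[OF h])
  next
    assume "\<exists>i<n. e i \<noteq> 0 \<and> f i \<noteq> 0"
    then obtain i where i: "i < n" "e i \<noteq> 0" "f i \<noteq> 0" by blast
    then have "h i \<in> supp (spectral_sum n h e) \<inter> supp (spectral_sum n h f)"
      unfolding supp_spectral_sum[OF h] using h by (auto simp: orthonormal_basis_def)
    moreover have "h i \<noteq> 0\<^sub>v n"
    proof
      assume "h i = 0\<^sub>v n"
      then have "h i \<bullet>c h i = 0" using onb_zero_iff[OF h onb_carrier[OF h i(1)]] i by blast
      then show False using i h by (simp add: orthonormal_basis_def)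
    qed
    ultimately show "supp (spectral_sum n h e) \<inter> supp (spectral_sum n h f) \<noteq> {0\<^sub>v n}" by blast
  qed
qed

lemma diagonal_in_basis_spectral:
  assumes h: "orthonormal_basis n h" and A: "psd n A" and d: "diagonal_in_basis n h A"
  shows "A = spectral_sum n h (\<lambda>i. Re (qform n A (\<lambda>a. h i $ a)))"
proof (rule mat_eq_on_basis[OF h psd_carrier[OF A] spectral_sum_carrier])
  fix i assume i: "i < n"
  note hi = onb_carrier[OF h i]
  have Ah: "A *\<^sub>v h i \<in> carrier_vec n" using psd_carrier[OF A] hi by simp
  have q: "(A *\<^sub>v h i) \<bullet>c h i = qform n A (\<lambda>a. h i $ a)" by (rule qform_vec[OF psd_carrier[OF A] hi])
  have "(A *\<^sub>v h i) \<bullet>c h i = cnj ((A *\<^sub>v h i) \<bullet>c h i)"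
    using hermitian_inner[OF psd_carrier[OF A] psd_herm[OF A] hi hi] cscalar_commute[OF Ah hi] by simp
  then have real: "qform n A (\<lambda>a. h i $ a) = complex_of_real (Re (qform n A (\<lambda>a. h i $ a)))"
    unfolding q by (metis Reals_cnj_iff of_real_Re)
  show "A *\<^sub>v h i = spectral_sum n h (\<lambda>i. Re (qform n A (\<lambda>a. h i $ a))) *\<^sub>v h i"
  proof (rule eq_vecI)
    fix a assume "a < dim_vec (spectral_sum n h (\<lambda>i. Re (qform n A (\<lambda>a. h i $ a))) *\<^sub>v h i)"
    then have a: "a < n" by (simp add: spectral_sum_def)
    have "(A *\<^sub>v h i) $ a = (\<Sum>j<n. if j = i then ((A *\<^sub>v h i) \<bullet>c h i) * h i $ a else 0)"
      unfolding orthonormal_basis_expand[OF h Ah a]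
      by (intro sum.cong refl) (use d i in \<open>auto simp: diagonal_in_basis_def\<close>)
    also have "\<dots> = complex_of_real (Re (qform n A (\<lambda>a. h i $ a))) * h i $ a" using i q real by simp
    finally show "(A *\<^sub>v h i) $ a = (spectral_sum n h (\<lambda>i. Re (qform n A (\<lambda>a. h i $ a))) *\<^sub>v h i) $ a"
      unfolding spectral_sum_basis[OF h i] using a hi by simp
  qed (use psd_carrier[OF A] in \<open>simp add: spectral_sum_def\<close>)
qed

lemma state_diagonal:
  assumes h: "orthonormal_basis n h" and A: "state n A" and d: "diagonal_in_basis n h A"
  obtains p where "A = spectral_sum n h p" "\<And>i. i < n \<Longrightarrow> p i \<ge> 0" "(\<Sum>i<n. p i) = 1"
proof -
  define p where "p i = Re (qform n A (\<lambda>a. h i $ a))" for i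
  have psd: "psd n A" using A by (simp add: state_def)
  have e: "A = spectral_sum n h p" unfolding p_def by (rule diagonal_in_basis_spectral[OF h psd d])
  moreover have "p i \<ge> 0" for i using psd by (simp add: psd_iff p_def)
  moreover have "complex_of_real (\<Sum>i<n. p i) = 1"
    using mtrace_spectral_sum[OF h, of p] A unfolding e[symmetric] by (simp add: state_def)
  then have "(\<Sum>i<n. p i) = 1" by (metis of_real_eq_1_iff)
  ultimately show ?thesis using that by blast
qed

lemma state_spectral_sum:
  assumes "orthonormal_basis n h" "\<And>i. i < n \<Longrightarrow> p i \<ge> 0" "(\<Sum>i<n. p i) = 1"
  shows "state n (spectral_sum n h p)"
  unfolding state_def mtrace_spectral_sum[OF assms(1)] using psd_spectral_sum[OF assms(2)] assms(3) by simp

text \<open>In a common eigenbasis sandwiching multiplies eigenvalues, with total exponent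
  \<open>2 * c * \<alpha> = 1 - \<alpha>\<close>, and the divergence becomes the classical
  one.\<close>

lemma sandwiched_renyi_spectral_sum:
  assumes h: "orthonormal_basis n h" and e: "\<And>i. i < n \<Longrightarrow> e i \<ge> 0" and f: "\<And>i. i < n \<Longrightarrow> f i \<ge> 0"
  shows "sandwiched_renyi \<alpha> (spectral_sum n h e) (spectral_sum n h f) =
    (if (1/2 \<le> \<alpha> \<and> \<alpha> < 1 \<and> (\<exists>i<n. e i \<noteq> 0 \<and> f i \<noteq> 0)) \<or> (1 < \<alpha> \<and> (\<forall>i<n. f i = 0 \<longrightarrow> e i = 0)) then
       ereal (1 / (\<alpha> - 1) * ln (\<Sum>i<n. e i powr \<alpha> * f i powr (1 - \<alpha>)))
     else if \<alpha> = 1 \<and> (\<forall>i<n. f i = 0 \<longrightarrow> e i = 0) then ereal (\<Sum>i<n. e i * (ln (e i) - ln (f i)))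
     else \<infinity>)"
proof -
  define c where "c = (1 - \<alpha>) / (2 * \<alpha>)"
  have dr: "dim_row (spectral_sum n h e) = n" by (simp add: spectral_sum_def)
  have pw: "mpow (spectral_sum n h f) c * spectral_sum n h e * mpow (spectral_sum n h f) c = spectral_sum n h (\<lambda>i. f i powr c * e i * f i powr c)"
    unfolding mpow_def hfun_spectral_sum[OF h] spectral_sum_mult[OF h] ..
  have "(\<Sum>i<n. (f i powr c * e i * f i powr c) powr \<alpha>) = (\<Sum>i<n. e i powr \<alpha> * f i powr (1 - \<alpha>))" if \<alpha>: "\<alpha> \<ge> 1/2"
  proof (intro sum.cong refl)
    fix i assume "i \<in> {..<n}"
    then have i: "i < n" by simp
    have "(f i powr c * e i * f i powr c) powr \<alpha> = (e i * f i powr (2 * c)) powr \<alpha>"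
      using powr_add[of "f i" c c] by (simp add: mult_ac)
    also have "\<dots> = e i powr \<alpha> * f i powr (2 * c * \<alpha>)" using e[OF i] by (simp add: powr_mult powr_powr)
    also have "2 * c * \<alpha> = 1 - \<alpha>" using \<alpha> by (simp add: c_def)
    finally show "(f i powr c * e i * f i powr c) powr \<alpha> = e i powr \<alpha> * f i powr (1 - \<alpha>)" .
  qed
  then have tr: "Re (mtrace (mpow (mpow (spectral_sum n h f) c * spectral_sum n h e * mpow (spectral_sum n h f) c) \<alpha>)) =
    (\<Sum>i<n. e i powr \<alpha> * f i powr (1 - \<alpha>))" if "\<alpha> \<ge> 1/2"
    unfolding pw mpow_def[of _ \<alpha>] hfun_spectral_sum[OF h] mtrace_spectral_sum[OF h] using that by simp
  have rel: "Re (mtrace (spectral_sum n h e * (hfun ln (spectral_sum n h e) - hfun ln (spectral_sum n h f)))) = (\<Sum>i<n. e i * (ln (e i) - ln (f i)))"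
    unfolding hfun_spectral_sum[OF h] spectral_sum_minus spectral_sum_mult[OF h] mtrace_spectral_sum[OF h] by simp
  show ?thesis
    unfolding sandwiched_renyi_def supp_spectral_sum_subset[OF h] dr supp_spectral_sum_inter[OF h] rel c_def[symmetric]
    using tr by auto
qed

lemma gibbs_state_spectral_sum:
  assumes h: "orthonormal_basis n h" and "n > 0"
  shows "gibbs_state (spectral_sum n h E) \<beta> = spectral_sum n h (\<lambda>i. exp (- \<beta> * E i) / (\<Sum>j<n. exp (- \<beta> * E j)))"
  unfolding gibbs_state_def Let_def hfun_spectral_sum[OF h] mtrace_spectral_sum[OF h]
  by (rule eq_matI) (auto simp: spectral_sum_def sum_divide_distrib[symmetric] intro!: arg_cong2[where f = "(/)"])

lemma trace_norm_spectral_sum: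
  assumes h: "orthonormal_basis n h"
  shows "trace_norm (spectral_sum n h e) = (\<Sum>i<n. \<bar>e i\<bar>)"
  unfolding trace_norm_def mat_adjoint_spectral_sum spectral_sum_mult[OF h] hfun_spectral_sum[OF h] mtrace_spectral_sum[OF h]
  by simp

text \<open>The form at a unit vector is a weighted mean of the eigenvalues. The bound turns
  trace-norm approximation into convergence of the diagonal entries in the energy
  eigenbasis.\<close>

lemma qform_le_trace_norm:
  assumes A: "A \<in> carrier_mat n n" and herm: "\<And>i j. i < n \<Longrightarrow> j < n \<Longrightarrow> A $$ (i, j) = cnj (A $$ (j, i))"
    and v: "v \<in> carrier_vec n" "v \<bullet>c v = 1"
  shows "\<bar>Re (qform n A (\<lambda>a. v $ a))\<bar> \<le> trace_norm A"
proof -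
  obtain h e where h: "orthonormal_basis n h" "A = spectral_sum n h e" using hermitian_spectral[OF A herm] by blast
  have co: "(\<Sum>b<n. v $ b * cnj (h i $ b)) = v \<bullet>c h i" if "i < n" for i
    using cscalar_prod_sum[OF v(1) onb_carrier[OF h(1) that]] by simp
  have "complex_of_real (\<Sum>i<n. (cmod (v \<bullet>c h i))\<^sup>2) = 1"
    using parseval[OF h(1) v(1) v(1)] v(2) by (simp only: of_real_sum complex_norm_square)
  then have bessel: "(\<Sum>i<n. (cmod (v \<bullet>c h i))\<^sup>2) = 1" by (metis of_real_eq_1_iff)
  have "Re (qform n A (\<lambda>a. v $ a)) = (\<Sum>i<n. e i * (cmod (v \<bullet>c h i))\<^sup>2)"
    unfolding h(2) qform_spectral_sum Re_complex_of_real by (intro sum.cong refl) (simp add: co)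
  also have "\<bar>\<dots>\<bar> \<le> (\<Sum>i<n. \<bar>e i\<bar> * 1)"
  proof (intro order.trans[OF sum_abs] sum_mono)
    fix i assume i: "i \<in> {..<n}"
    have "(cmod (v \<bullet>c h i))\<^sup>2 \<le> 1" unfolding bessel[symmetric] by (rule member_le_sum) (use i in auto)
    then show "\<bar>e i * (cmod (v \<bullet>c h i))\<^sup>2\<bar> \<le> \<bar>e i\<bar> * 1" unfolding abs_mult by (intro mult_left_mono) auto
  qed
  also have "\<dots> = trace_norm A" unfolding h(2) trace_norm_spectral_sum[OF h(1)] by simp
  finally show ?thesis .
qed

subsection \<open>Domination of positive operators\<close>

lemma bessel_sum:
  assumes h: "orthonormal_basis n h"
  shows "(\<Sum>i<n. (cmod (\<Sum>b<n. v b * cnj (h i $ b)))\<^sup>2) = (\<Sum>b<n. (cmod (v b))\<^sup>2)"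
proof -
  have "complex_of_real (\<Sum>i<n. 1 * (cmod (\<Sum>b<n. v b * cnj (h i $ b)))\<^sup>2) = qform n (spectral_sum n h (\<lambda>_. 1)) v"
    by (rule qform_spectral_sum[symmetric])
  also have "\<dots> = (\<Sum>a<n. \<Sum>b<n. if b = a then v a * cnj (v a) else 0)"
    unfolding orthonormal_basis_complete[OF h] qform_def by (intro sum.cong refl) auto
  also have "\<dots> = complex_of_real (\<Sum>a<n. (cmod (v a))\<^sup>2)"
    unfolding of_real_sum complex_norm_square by simp
  finally show ?thesis by (simp only: of_real_eq_iff mult_1)
qed

lemma psd_qform_le_trace:
  assumes "psd n A"
  shows "Re (qform n A v) \<le> Re (mtrace A) * (\<Sum>b<n. (cmod (v b))\<^sup>2)"
proof -
  obtain h e where h: "orthonormal_basis n h" "A = spectral_sum n h e" "\<And>i. i < n \<Longrightarrow> e i \<ge> 0"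
    using psd_spectral[OF assms] by metis
  have "Re (qform n A v) = (\<Sum>i<n. e i * (cmod (\<Sum>b<n. v b * cnj (h i $ b)))\<^sup>2)"
    unfolding h(2) qform_spectral_sum by simp
  also have "\<dots> \<le> (\<Sum>i<n. e i * (\<Sum>b<n. (cmod (v b))\<^sup>2))"
  proof (intro sum_mono mult_left_mono)
    fix i assume i: "i \<in> {..<n}"
    show "(cmod (\<Sum>b<n. v b * cnj (h i $ b)))\<^sup>2 \<le> (\<Sum>b<n. (cmod (v b))\<^sup>2)"
      unfolding bessel_sum[OF h(1), of v, symmetric] by (rule member_le_sum) (use i in auto)
  qed (use h in auto)
  also have "\<dots> = Re (mtrace A) * (\<Sum>b<n. (cmod (v b))\<^sup>2)"
    unfolding h(2) mtrace_spectral_sum[OF h(1)] by (simp add: sum_distrib_right)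
  finally show ?thesis .
qed

lemma psd_trace_nonneg: "psd n A \<Longrightarrow> 0 \<le> Re (mtrace A)"
  using psd_spectral mtrace_spectral_sum by (metis Re_complex_of_real lessThan_iff sum_nonneg)

lemma psd_kernel:
  assumes A: "psd n A" and v: "v \<in> carrier_vec n" and q: "Re (qform n A (\<lambda>a. v $ a)) = 0"
  shows "A *\<^sub>v v = 0\<^sub>v n"
proof -
  obtain h e where h: "orthonormal_basis n h" "A = spectral_sum n h e" "\<And>i. i < n \<Longrightarrow> e i \<ge> 0"
    using psd_spectral[OF A] by metis
  have "(\<Sum>i<n. e i * (cmod (\<Sum>b<n. v $ b * cnj (h i $ b)))\<^sup>2) = 0"
    using q unfolding h(2) qform_spectral_sum by simp
  then have z: "\<forall>i\<in>{..<n}. e i * (cmod (\<Sum>b<n. v $ b * cnj (h i $ b)))\<^sup>2 = 0"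
    by (subst (asm) sum_nonneg_eq_0_iff) (use h(3) in auto)
  have "v \<in> mat_kernel A" unfolding h(2) mat_kernel_spectral_sum[OF h(1)]
    using z v by (auto simp: cscalar_prod_sum[OF v onb_carrier[OF h(1)]])
  then show ?thesis using mat_kernelD[OF psd_carrier[OF A]] by blast
qed

lemma qform_shift_kernel:
  assumes A: "psd n A" and v: "v \<in> carrier_vec n" and w: "w \<in> carrier_vec n" and z: "A *\<^sub>v (v - w) = 0\<^sub>v n"
  shows "qform n A (\<lambda>a. v $ a) = qform n A (\<lambda>a. w $ a)"
proof -
  note Ac = psd_carrier[OF A]
  have "A *\<^sub>v v = A *\<^sub>v w"
  proof -
    have "A *\<^sub>v v = A *\<^sub>v (w + (v - w))" using v w by (intro arg_cong2[where f = "(*\<^sub>v)"] refl eq_vecI) auto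
    also have "\<dots> = A *\<^sub>v w + 0\<^sub>v n" unfolding z[symmetric] using Ac v w by (intro mult_add_distrib_mat_vec) auto
    finally show ?thesis using Ac w by simp
  qed
  then have "(A *\<^sub>v v) \<bullet>c v = (A *\<^sub>v w) \<bullet>c v" by simp
  also have "\<dots> = w \<bullet>c (A *\<^sub>v v)" by (rule hermitian_inner[OF Ac psd_herm[OF A] w v])
  also have "\<dots> = w \<bullet>c (A *\<^sub>v w)" using \<open>A *\<^sub>v v = A *\<^sub>v w\<close> by simp
  also have "\<dots> = (A *\<^sub>v w) \<bullet>c w" by (rule hermitian_inner[OF Ac psd_herm[OF A] w w, symmetric])
  finally show ?thesis using qform_vec[OF Ac v] qform_vec[OF Ac w] by simp
qed

lemma psd_minusI:
  assumes "psd n A" "psd n B" "\<And>v. Re (qform n A v) \<le> Re (qform n B v)"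
  shows "psd n (B - A)"
proof -
  have "cnj ((B - A) $$ (j, i)) = (B - A) $$ (i, j)" if "i < n" "j < n" for i j
    using that psd_carrier[OF assms(1)] psd_carrier[OF assms(2)] psd_herm[OF assms(1) that] psd_herm[OF assms(2) that] by simp
  then show ?thesis using assms psd_carrier[OF assms(1)] psd_carrier[OF assms(2)]
    unfolding psd_iff by (auto simp: qform_minus minus_carrier_mat simp del: index_minus_mat)
qed

text \<open>\<open>A\<close> ignores the component of a vector in the kernel of the spectral sum, so
  only the projection \<open>W\<close> to its support counts. There the spectral sum is at least
  \<open>\<mu>\<close>, while \<open>A\<close> is at most its trace.\<close>

lemma psd_le_of_kernel:
  assumes A: "psd n A" and h: "orthonormal_basis n h" and f: "\<And>i. i < n \<Longrightarrow> f i \<ge> 0"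
    and ker: "\<And>i. i < n \<Longrightarrow> f i = 0 \<Longrightarrow> A *\<^sub>v h i = 0\<^sub>v n"
    and \<mu>: "\<mu> > 0" "\<And>i. i < n \<Longrightarrow> f i \<noteq> 0 \<Longrightarrow> \<mu> \<le> f i" and c: "Re (mtrace A) \<le> c * \<mu>"
  shows "psd n (complex_of_real c \<cdot>\<^sub>m spectral_sum n h f - A)"
proof (rule psd_minusI[OF A])
  have c0: "0 \<le> c" using psd_trace_nonneg[OF A] c \<mu>(1) by (meson mult_neg_pos not_le order_trans)
  show "psd n (complex_of_real c \<cdot>\<^sub>m spectral_sum n h f)" by (intro psd_smult psd_spectral_sum c0 f)
  fix v :: "nat \<Rightarrow> complex"
  define cf where "cf i = (\<Sum>b<n. v b * cnj (h i $ b))" for i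
  define V where "V = Matrix.vec n v"
  define W where "W = Matrix.vec n (\<lambda>a. \<Sum>i | i < n \<and> f i \<noteq> 0. cf i * h i $ a)"
  have V: "V \<in> carrier_vec n" and W: "W \<in> carrier_vec n" by (auto simp: V_def W_def)
  have Vh: "V \<bullet>c h i = cf i" if "i < n" for i
    unfolding cscalar_prod_sum[OF V onb_carrier[OF h that]] cf_def by (intro sum.cong refl) (simp add: V_def)
  have Wh: "W \<bullet>c h j = (if f j = 0 then 0 else cf j)" if j: "j < n" for j
  proof -
    have "W \<bullet>c h j = (\<Sum>a<n. \<Sum>i | i < n \<and> f i \<noteq> 0. cf i * (h i $ a * cnj (h j $ a)))"
      unfolding cscalar_prod_sum[OF W onb_carrier[OF h j]] by (intro sum.cong refl) (simp add: W_def sum_distrib_right mult.assoc)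
    also have "\<dots> = (\<Sum>i | i < n \<and> f i \<noteq> 0. if i = j then cf j else 0)"
      by (subst sum.swap, intro sum.cong refl) (use onb_sum[OF h _ j] in \<open>auto simp flip: sum_distrib_left\<close>)
    finally show ?thesis using j by simp
  qed
  have Wb: "(\<Sum>b<n. W $ b * cnj (h i $ b)) = (if f i = 0 then 0 else cf i)" if "i < n" for i
    using Wh[OF that] cscalar_prod_sum[OF W onb_carrier[OF h that]] by simp
  have "A *\<^sub>v (V - W) = 0\<^sub>v n"
  proof (rule eq_vecI)
    fix a assume "a < dim_vec (0\<^sub>v n :: complex Matrix.vec)"
    then have a: "a < n" by simp
    have VW: "(V - W) $ b = (\<Sum>i | i < n \<and> f i = 0. cf i * h i $ b)" if b: "b < n" for b
    proof -
      have "V $ b = (\<Sum>i<n. cf i * h i $ b)" unfolding orthonormal_basis_expand[OF h V b] by (intro sum.cong refl) (simp add: Vh)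
      also have "\<dots> = (\<Sum>i | i < n \<and> f i = 0. cf i * h i $ b) + (\<Sum>i | i < n \<and> f i \<noteq> 0. cf i * h i $ b)"
        by (subst sum.union_disjoint[symmetric]) (auto intro!: sum.cong)
      finally show ?thesis using b W by (simp add: W_def)
    qed
    have VWc: "V - W \<in> carrier_vec n" using V W by simp
    have "(A *\<^sub>v (V - W)) $ a = (\<Sum>b<n. \<Sum>i | i < n \<and> f i = 0. cf i * (A $$ (a, b) * h i $ b))"
      unfolding mult_mat_vec_index_sum[OF psd_carrier[OF A] VWc a]
      by (intro sum.cong refl) (simp add: VW sum_distrib_left mult_ac del: index_minus_vec)
    also have "\<dots> = (\<Sum>i | i < n \<and> f i = 0. cf i * (A *\<^sub>v h i) $ a)"
      by (subst sum.swap, intro sum.cong refl)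
        (simp add: mult_mat_vec_index_sum[OF psd_carrier[OF A] onb_carrier[OF h] a] sum_distrib_left)
    also have "\<dots> = 0" by (intro sum.neutral) (use ker a in auto)
    finally show "(A *\<^sub>v (V - W)) $ a = 0\<^sub>v n $ a" using a by simp
  qed (use psd_carrier[OF A] in simp)
  from qform_shift_kernel[OF A V W this]
  have "qform n A (\<lambda>a. V $ a) = qform n A (\<lambda>a. W $ a)" .
  moreover have "qform n A v = qform n A (\<lambda>a. V $ a)"
    unfolding qform_def by (intro sum.cong refl) (simp add: V_def)
  ultimately have "qform n A v = qform n A (\<lambda>a. W $ a)" by simp
  then have "Re (qform n A v) \<le> Re (mtrace A) * (\<Sum>b<n. (cmod (W $ b))\<^sup>2)"
    using psd_qform_le_trace[OF A, of "\<lambda>a. W $ a"] by simp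
  also have "(\<Sum>b<n. (cmod (W $ b))\<^sup>2) = (\<Sum>i<n. (cmod (if f i = 0 then 0 else cf i))\<^sup>2)"
    unfolding bessel_sum[OF h, of "\<lambda>b. W $ b", symmetric] by (intro sum.cong refl) (simp add: Wb)
  also have "Re (mtrace A) * \<dots> \<le> c * \<mu> * \<dots>" by (intro mult_right_mono c sum_nonneg) auto
  also have "\<dots> = c * (\<Sum>i<n. \<mu> * (cmod (if f i = 0 then 0 else cf i))\<^sup>2)" by (simp add: sum_distrib_left mult_ac)
  also have "\<dots> \<le> c * (\<Sum>i<n. f i * (cmod (cf i))\<^sup>2)"
    by (intro mult_left_mono sum_mono c0) (use \<mu>(2) in \<open>auto intro!: mult_right_mono\<close>)
  also have "\<dots> = Re (qform n (complex_of_real c \<cdot>\<^sub>m spectral_sum n h f) v)"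
    unfolding qform_smult[OF spectral_sum_carrier] qform_spectral_sum cf_def[symmetric] by simp
  finally show "Re (qform n A v) \<le> Re (qform n (complex_of_real c \<cdot>\<^sub>m spectral_sum n h f) v)" .
qed

lemma positive_lower_bound:
  fixes f :: "nat \<Rightarrow> real"
  assumes "\<And>i. i < n \<Longrightarrow> f i \<ge> 0"
  obtains \<mu> where "\<mu> > 0" "\<And>i. i < n \<Longrightarrow> f i \<noteq> 0 \<Longrightarrow> \<mu> \<le> f i"
proof -
  define \<mu> where "\<mu> = Min (insert 1 {f i | i. i < n \<and> f i \<noteq> 0})"
  have fin: "finite (insert 1 {f i | i. i < n \<and> f i \<noteq> 0})" by simp
  have "\<mu> > 0" unfolding \<mu>_def using fin assms by (subst Min_gr_iff) (auto simp: order.strict_iff_order)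
  moreover have "\<mu> \<le> f i" if "i < n" "f i \<noteq> 0" for i unfolding \<mu>_def by (rule Min_le[OF fin]) (use that in auto)
  ultimately show ?thesis using that by blast
qed

lemma psd_le_of_supp:
  assumes A: "psd n A" and B: "psd n B" and s: "supp A \<subseteq> supp B"
  obtains c where "c > 0" "psd n (complex_of_real c \<cdot>\<^sub>m B - A)"
proof -
  obtain h f where h: "orthonormal_basis n h" "B = spectral_sum n h f" "\<And>i. i < n \<Longrightarrow> f i \<ge> 0"
    using psd_spectral[OF B] by metis
  obtain k e where k: "orthonormal_basis n k" "A = spectral_sum n k e" "\<And>i. i < n \<Longrightarrow> e i \<ge> 0"
    using psd_spectral[OF A] by metis
  obtain \<mu> where \<mu>: "\<mu> > 0" "\<And>i. i < n \<Longrightarrow> f i \<noteq> 0 \<Longrightarrow> \<mu> \<le> f i" using positive_lower_bound[of n f, OF h(3)] by metis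
  have ker: "A *\<^sub>v h i = 0\<^sub>v n" if i: "i < n" "f i = 0" for i
  proof -
    note hi = onb_carrier[OF h(1) i(1)]
    have "h i \<bullet>c k j = 0" if j: "j < n" "e j \<noteq> 0" for j
    proof -
      have "k j \<in> supp A" unfolding k(2) supp_spectral_sum[OF k(1)] using j k(1) by (auto simp: orthonormal_basis_def)
      then have "k j \<bullet>c h i = 0" using s i unfolding h(2) supp_spectral_sum[OF h(1)] by blast
      then show ?thesis using cscalar_commute[OF onb_carrier[OF k(1) j(1)] hi] by simp
    qed
    then have "h i \<in> mat_kernel A" unfolding k(2) mat_kernel_spectral_sum[OF k(1)] using hi by blast
    then show ?thesis using mat_kernelD[OF psd_carrier[OF A]] by blast
  qed
  define c where "c = Re (mtrace A) / \<mu> + 1"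
  have "c > 0" using psd_trace_nonneg[OF A] \<mu>(1) by (simp add: c_def add_nonneg_pos)
  moreover have "psd n (complex_of_real c \<cdot>\<^sub>m B - A)"
    unfolding h(2) by (rule psd_le_of_kernel[OF A h(1,3) ker \<mu>]) (use \<mu>(1) in \<open>auto simp: c_def distrib_right\<close>)
  ultimately show ?thesis using that by blast
qed

text \<open>Lying below some multiple of \<open>B\<close> already forces \<open>A\<close> to vanish
  on the kernel of \<open>B\<close>. Then a lower bound for the nonzero eigenvalues of
  \<open>B\<close> determines a multiple that serves all \<open>A\<close> of trace at most
  1.\<close>

lemma psd_le_uniform:
  assumes B: "psd n B"
  obtains \<mu> where "\<mu> > 0"
    "\<And>A c. psd n A \<Longrightarrow> psd n (complex_of_real c \<cdot>\<^sub>m B - A) \<Longrightarrow> Re (mtrace A) \<le> 1 \<Longrightarrow> psd n (complex_of_real (1 / \<mu>) \<cdot>\<^sub>m B - A)"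
proof -
  obtain h f where h: "orthonormal_basis n h" "B = spectral_sum n h f" "\<And>i. i < n \<Longrightarrow> f i \<ge> 0"
    using psd_spectral[OF B] by metis
  obtain \<mu> where \<mu>: "\<mu> > 0" "\<And>i. i < n \<Longrightarrow> f i \<noteq> 0 \<Longrightarrow> \<mu> \<le> f i" using positive_lower_bound[of n f, OF h(3)] by metis
  have "psd n (complex_of_real (1 / \<mu>) \<cdot>\<^sub>m B - A)"
    if A: "psd n A" and le: "psd n (complex_of_real c \<cdot>\<^sub>m B - A)" and tr: "Re (mtrace A) \<le> 1" for A c
  proof -
    have ker: "A *\<^sub>v h i = 0\<^sub>v n" if i: "i < n" "f i = 0" for i
    proof (rule psd_kernel[OF A onb_carrier[OF h(1) i(1)]])
      have "0 \<le> Re (qform n (complex_of_real c \<cdot>\<^sub>m B - A) (\<lambda>a. h i $ a))" using le by (simp add: psd_iff)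
      also have "\<dots> = c * f i - Re (qform n A (\<lambda>a. h i $ a))"
        using psd_carrier[OF A] psd_carrier[OF B] spectral_sum_eigenvalue[OF h(1) i(1), of f]
        by (simp add: qform_minus qform_smult h(2) spectral_sum_carrier)
      finally have "Re (qform n A (\<lambda>a. h i $ a)) \<le> 0" using i by simp
      moreover have "0 \<le> Re (qform n A (\<lambda>a. h i $ a))" using A by (simp add: psd_iff)
      ultimately show "Re (qform n A (\<lambda>a. h i $ a)) = 0" by simp
    qed
    show ?thesis unfolding h(2) by (rule psd_le_of_kernel[OF A h(1,3) ker \<mu>]) (use \<mu>(1) tr in auto)
  qed
  then show ?thesis using that \<mu>(1) by blast
qed

subsection \<open>Joint decompositions of non-commuting operators\<close>

text \<open>A joint preparation of two positive operators from common positive ingredients with classical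
  weights. Its value plays the role of a classical Renyi quantity; it behaves well under
  positive maps although the two operators need not commute.\<close>

definition joint_decomp ::
    "nat \<Rightarrow> (real \<times> real \<times> complex Matrix.mat) list \<Rightarrow> complex Matrix.mat \<Rightarrow> complex Matrix.mat \<Rightarrow> bool" where
  "joint_decomp n L A B \<longleftrightarrow> A \<in> carrier_mat n n \<and> B \<in> carrier_mat n n \<and>
     (\<forall>(a, b, w)\<in>set L. 0 \<le> a \<and> 0 < b \<and> psd n w) \<and>
     (\<forall>i<n. \<forall>j<n. A $$ (i, j) = (\<Sum>(a, b, w)\<leftarrow>L. complex_of_real a * w $$ (i, j)) \<and>
                 B $$ (i, j) = (\<Sum>(a, b, w)\<leftarrow>L. complex_of_real b * w $$ (i, j)))"

definition decomp_value :: "real \<Rightarrow> (real \<times> real \<times> complex Matrix.mat) list \<Rightarrow> real" where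
  "decomp_value \<alpha> L = (\<Sum>(a, b, w)\<leftarrow>L. a powr \<alpha> * b powr (1 - \<alpha>) * Re (mtrace w))"

text \<open>\<open>F i j\<close> abstracts the map on the catalyst that a channel induces when the
  system enters in the \<open>j\<close>-th energy eigenstate and is found in the \<open>i\<close>-th
  one. Only positivity and the trace condition are retained.\<close>

definition positive_family :: "nat \<Rightarrow> nat \<Rightarrow> (nat \<Rightarrow> nat \<Rightarrow> complex Matrix.mat \<Rightarrow> complex Matrix.mat) \<Rightarrow> bool" where
  "positive_family d n F \<longleftrightarrow> (\<forall>i<d. \<forall>j<d. linear_map_mat n n (F i j) \<and> (\<forall>Y. psd n Y \<longrightarrow> psd n (F i j Y))) \<and>
     (\<forall>j<d. \<forall>Y\<in>carrier_mat n n. (\<Sum>i<d. mtrace (F i j Y)) = mtrace Y)"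

text \<open>The zero matrix depends on the dimension, so the sum is a fold started at
  \<open>0\<^sub>m n n\<close>.\<close>

definition lincomb :: "nat \<Rightarrow> (complex \<times> complex Matrix.mat) list \<Rightarrow> complex Matrix.mat" where
  "lincomb n L = foldr (\<lambda>(c, w) M. c \<cdot>\<^sub>m w + M) L (0\<^sub>m n n)"

lemma lincomb_carrier: "lincomb n L \<in> carrier_mat n n"
  by (induction L) (auto simp: lincomb_def intro: add_carrier_mat)

lemma lincomb_index:
  assumes "\<And>c w. (c, w) \<in> set L \<Longrightarrow> w \<in> carrier_mat n n" "i < n" "j < n"
  shows "lincomb n L $$ (i, j) = (\<Sum>(c, w)\<leftarrow>L. c * w $$ (i, j))"
  using assms(1)
proof (induction L)
  case Nil
  then show ?case using assms(2,3) by (simp add: lincomb_def)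
next
  case (Cons x L)
  obtain c w where x: "x = (c, w)" by (cases x)
  have w: "w \<in> carrier_mat n n" using Cons.prems x by auto
  have L: "lincomb n L \<in> carrier_mat n n" by (rule lincomb_carrier)
  have "lincomb n (x # L) = c \<cdot>\<^sub>m w + lincomb n L" by (simp add: lincomb_def x)
  then have "lincomb n (x # L) $$ (i, j) = c * w $$ (i, j) + lincomb n L $$ (i, j)" using w L assms(2,3) by simp
  moreover have "lincomb n L $$ (i, j) = (\<Sum>(c, w)\<leftarrow>L. c * w $$ (i, j))" using Cons by auto
  ultimately show ?case by (simp add: x)
qed

lemma linear_map_lincomb:
  assumes F: "linear_map_mat n m F" and "\<And>c w. (c, w) \<in> set L \<Longrightarrow> w \<in> carrier_mat n n"
  shows "F (lincomb n L) = lincomb m (map (\<lambda>(c, w). (c, F w)) L)"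
  using assms(2)
proof (induction L)
  case Nil
  have "F (0 \<cdot>\<^sub>m 0\<^sub>m n n) = 0 \<cdot>\<^sub>m F (0\<^sub>m n n)" and c: "F (0\<^sub>m n n) \<in> carrier_mat m m"
    using F zero_carrier_mat[of n n] unfolding linear_map_mat_def by blast+
  moreover have "(0 :: complex) \<cdot>\<^sub>m 0\<^sub>m n n = 0\<^sub>m n n" by (rule eq_matI) auto
  moreover have "0 \<cdot>\<^sub>m F (0\<^sub>m n n) = 0\<^sub>m m m" using c by (intro eq_matI) auto
  ultimately show ?case by (simp add: lincomb_def)
next
  case (Cons x L)
  obtain c w where x: "x = (c, w)" by (cases x)
  have w: "w \<in> carrier_mat n n" using Cons.prems x by auto
  have L: "lincomb n L \<in> carrier_mat n n" by (rule lincomb_carrier)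
  have "F (c \<cdot>\<^sub>m w + lincomb n L) = c \<cdot>\<^sub>m F w + F (lincomb n L)"
    using F w L unfolding linear_map_mat_def by auto
  moreover have "F (lincomb n L) = lincomb m (map (\<lambda>(c, w). (c, F w)) L)" using Cons by auto
  ultimately show ?case by (simp add: lincomb_def x)
qed

lemma linear_map_joint:
  assumes F: "linear_map_mat n n F" and D: "joint_decomp n L A B" and ij: "i < n" "j < n"
  shows "F A $$ (i, j) = (\<Sum>(a, b, w)\<leftarrow>L. complex_of_real a * F w $$ (i, j))"
    "F B $$ (i, j) = (\<Sum>(a, b, w)\<leftarrow>L. complex_of_real b * F w $$ (i, j))"
proof -
  have psd: "psd n w" if "(a, b, w) \<in> set L" for a b w using D that by (auto simp: joint_decomp_def)
  have gen: "F X $$ (i, j) = (\<Sum>(a, b, w)\<leftarrow>L. complex_of_real (sel a b) * F w $$ (i, j))"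
    if X: "X \<in> carrier_mat n n" "\<And>i j. i < n \<Longrightarrow> j < n \<Longrightarrow> X $$ (i, j) = (\<Sum>(a, b, w)\<leftarrow>L. complex_of_real (sel a b) * w $$ (i, j))" for X sel
  proof -
    define M where "M = map (\<lambda>(a, b, w). (complex_of_real (sel a b), w)) L"
    have Mc: "w \<in> carrier_mat n n" if "(c, w) \<in> set M" for c w
      using that psd psd_carrier by (auto simp: M_def)
    have "lincomb n M $$ (i, j) = X $$ (i, j)" if ij: "i < n" "j < n" for i j
    proof -
      have "lincomb n M $$ (i, j) = (\<Sum>(c, w)\<leftarrow>M. c * w $$ (i, j))" by (rule lincomb_index[OF Mc ij])
      then show ?thesis unfolding X(2)[OF ij] by (simp add: M_def comp_def case_prod_unfold)
    qed
    then have "X = lincomb n M" using X(1) lincomb_carrier[of n M] by (intro eq_matI) auto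
    then have "F X = lincomb n (map (\<lambda>(c, w). (c, F w)) M)" using linear_map_lincomb[OF F Mc] by simp
    moreover have "w \<in> carrier_mat n n" if "(c, w) \<in> set (map (\<lambda>(c, w). (c, F w)) M)" for c w
      using that Mc F by (auto simp: linear_map_mat_def)
    ultimately show ?thesis using lincomb_index[OF _ ij, of "map (\<lambda>(c, w). (c, F w)) M"]
      by (simp add: M_def comp_def case_prod_unfold)
  qed
  show "F A $$ (i, j) = (\<Sum>(a, b, w)\<leftarrow>L. complex_of_real a * F w $$ (i, j))"
    by (rule gen[of A "\<lambda>a b. a"]) (use D in \<open>auto simp: joint_decomp_def\<close>)
  show "F B $$ (i, j) = (\<Sum>(a, b, w)\<leftarrow>L. complex_of_real b * F w $$ (i, j))"
    by (rule gen[of B "\<lambda>a b. b"]) (use D in \<open>auto simp: joint_decomp_def\<close>)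
qed

lemma sum_list_concat_map:
  fixes f :: "'b \<Rightarrow> 'c :: comm_monoid_add"
  shows "(\<Sum>x\<leftarrow>concat (map g [0..<d]). f x) = (\<Sum>j<d. \<Sum>x\<leftarrow>g j. f x)"
  by (induction d) auto

lemma sum_list_triple_mult:
  fixes c :: "'c :: semiring_0"
  shows "(\<Sum>(a, b, w)\<leftarrow>L. c * F a b w) = c * (\<Sum>(a, b, w)\<leftarrow>L. F a b w)"
  by (induction L) (auto simp: distrib_left)

text \<open>Each \<open>F i j\<close> is applied to every ingredient; the classical weights are
  multiplied by those of the input and divided by those of the output. No ingredients are merged, so
  the values obey an equality: trace preservation removes the sum over outcomes, and the sum over
  inputs factors off.\<close>

lemma joint_decomp_transfer:
  assumes F: "positive_family d n F" and D: "joint_decomp n L A B"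
    and p: "\<And>j. j < d \<Longrightarrow> p j \<ge> 0" and g: "\<And>j. j < d \<Longrightarrow> g j > 0"
    and q: "\<And>i. i < d \<Longrightarrow> q i > 0" and g': "\<And>i. i < d \<Longrightarrow> g' i > 0"
    and A': "\<And>i. i < d \<Longrightarrow> A' i \<in> carrier_mat n n" and B': "\<And>i. i < d \<Longrightarrow> B' i \<in> carrier_mat n n"
    and eqA: "\<And>i r s. i < d \<Longrightarrow> r < n \<Longrightarrow> s < n \<Longrightarrow>
      (\<Sum>j<d. complex_of_real (p j) * F i j A $$ (r, s)) = complex_of_real (q i) * A' i $$ (r, s)"
    and eqB: "\<And>i r s. i < d \<Longrightarrow> r < n \<Longrightarrow> s < n \<Longrightarrow>
      (\<Sum>j<d. complex_of_real (g j) * F i j B $$ (r, s)) = complex_of_real (g' i) * B' i $$ (r, s)"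
  obtains L' where "\<And>i. i < d \<Longrightarrow> joint_decomp n (L' i) (A' i) (B' i)"
    "(\<Sum>i<d. q i powr \<alpha> * g' i powr (1 - \<alpha>) * decomp_value \<alpha> (L' i)) =
     (\<Sum>j<d. p j powr \<alpha> * g j powr (1 - \<alpha>)) * decomp_value \<alpha> L"
proof -
  define L' where "L' i = concat (map (\<lambda>j. map (\<lambda>(a, b, w). (p j * a / q i, g j * b / g' i, F i j w)) L) [0..<d])" for i
  have psd: "psd n w" "0 \<le> a" "0 < b" if "(a, b, w) \<in> set L" for a b w using D that by (auto simp: joint_decomp_def)
  have lin: "linear_map_mat n n (F i j)" and pos: "psd n Y \<Longrightarrow> psd n (F i j Y)" if "i < d" "j < d" for i j Y
    using F that by (auto simp: positive_family_def)
  have tr: "(\<Sum>i<d. mtrace (F i j Y)) = mtrace Y" if "j < d" "Y \<in> carrier_mat n n" for j Y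
    using F that by (auto simp: positive_family_def)
  have sumL': "(\<Sum>(a, b, w)\<leftarrow>L' i. f a b w) = (\<Sum>j<d. \<Sum>(a, b, w)\<leftarrow>L. f (p j * a / q i) (g j * b / g' i) (F i j w))"
    for f :: "real \<Rightarrow> real \<Rightarrow> complex Matrix.mat \<Rightarrow> 'x :: comm_monoid_add" and i
    unfolding L'_def sum_list_concat_map by (simp add: comp_def case_prod_unfold)
  have "joint_decomp n (L' i) (A' i) (B' i)" if i: "i < d" for i
    unfolding joint_decomp_def
  proof (intro conjI allI impI ballI)
    fix x assume "x \<in> set (L' i)"
    then have "\<exists>j<d. \<exists>y\<in>set L. x = (case y of (a, b, w) \<Rightarrow> (p j * a / q i, g j * b / g' i, F i j w))"
      unfolding L'_def by force
    then obtain j a b w where x: "x = (p j * a / q i, g j * b / g' i, F i j w)" "j < d" "(a, b, w) \<in> set L"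
      by (metis (no_types, lifting) prod.collapse case_prod_conv)
    show "case x of (a, b, w) \<Rightarrow> 0 \<le> a \<and> 0 < b \<and> psd n w"
      using x psd[OF x(3)] pos[OF i x(2)] p[OF x(2)] g[OF x(2)] q[OF i] g'[OF i] by auto
  next
    fix r s assume rs: "r < n" "s < n"
    have "complex_of_real (q i) * A' i $$ (r, s) = (\<Sum>j<d. complex_of_real (p j) * (\<Sum>(a, b, w)\<leftarrow>L. complex_of_real a * F i j w $$ (r, s)))"
      unfolding eqA[OF i rs, symmetric] by (intro sum.cong refl) (use linear_map_joint(1)[OF lin[OF i] D rs] in auto)
    also have "\<dots> = complex_of_real (q i) * (\<Sum>j<d. \<Sum>(a, b, w)\<leftarrow>L. complex_of_real (p j * a / q i) * F i j w $$ (r, s))"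
      unfolding sum_distrib_left sum_list_triple_mult[symmetric] using q[OF i] by (intro sum.cong refl) (simp add: mult.assoc)
    finally show "A' i $$ (r, s) = (\<Sum>(a, b, w)\<leftarrow>L' i. complex_of_real a * w $$ (r, s))"
      unfolding sumL' using q[OF i] by simp
    have "complex_of_real (g' i) * B' i $$ (r, s) = (\<Sum>j<d. complex_of_real (g j) * (\<Sum>(a, b, w)\<leftarrow>L. complex_of_real b * F i j w $$ (r, s)))"
      unfolding eqB[OF i rs, symmetric] by (intro sum.cong refl) (use linear_map_joint(2)[OF lin[OF i] D rs] in auto)
    also have "\<dots> = complex_of_real (g' i) * (\<Sum>j<d. \<Sum>(a, b, w)\<leftarrow>L. complex_of_real (g j * b / g' i) * F i j w $$ (r, s))"
      unfolding sum_distrib_left sum_list_triple_mult[symmetric] using g'[OF i] by (intro sum.cong refl) (simp add: mult.assoc)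
    finally show "B' i $$ (r, s) = (\<Sum>(a, b, w)\<leftarrow>L' i. complex_of_real b * w $$ (r, s))"
      unfolding sumL' using g'[OF i] by simp
  qed (use A' B' i in auto)
  moreover have "(\<Sum>i<d. q i powr \<alpha> * g' i powr (1 - \<alpha>) * decomp_value \<alpha> (L' i)) =
     (\<Sum>j<d. p j powr \<alpha> * g j powr (1 - \<alpha>)) * decomp_value \<alpha> L"
  proof -
    have "(\<Sum>i<d. q i powr \<alpha> * g' i powr (1 - \<alpha>) * decomp_value \<alpha> (L' i)) =
      (\<Sum>i<d. \<Sum>j<d. \<Sum>(a, b, w)\<leftarrow>L. (p j powr \<alpha> * g j powr (1 - \<alpha>)) * (a powr \<alpha> * b powr (1 - \<alpha>) * Re (mtrace (F i j w))))"
    proof (intro sum.cong refl)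
      fix i assume "i \<in> {..<d}"
      then have i: "i < d" by simp
      have "q i powr \<alpha> * g' i powr (1 - \<alpha>) * decomp_value \<alpha> (L' i) =
        (\<Sum>j<d. \<Sum>(a, b, w)\<leftarrow>L. q i powr \<alpha> * g' i powr (1 - \<alpha>) * ((p j * a / q i) powr \<alpha> * (g j * b / g' i) powr (1 - \<alpha>) * Re (mtrace (F i j w))))"
        unfolding decomp_value_def sumL' sum_distrib_left sum_list_triple_mult ..
      also have "\<dots> = (\<Sum>j<d. \<Sum>(a, b, w)\<leftarrow>L. (p j powr \<alpha> * g j powr (1 - \<alpha>)) * (a powr \<alpha> * b powr (1 - \<alpha>) * Re (mtrace (F i j w))))"
      proof (intro sum.cong refl arg_cong[where f = sum_list] map_cong)
        fix j x assume j: "j \<in> {..<d}" and x: "x \<in> set L"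
        obtain a b w where abw: "x = (a, b, w)" by (cases x)
        have "(p j * a / q i) powr \<alpha> = p j powr \<alpha> * a powr \<alpha> / q i powr \<alpha>"
          using p[of j] j psd(2)[of a b w] x q[OF i] abw by (simp add: powr_mult powr_divide)
        moreover have "(g j * b / g' i) powr (1 - \<alpha>) = g j powr (1 - \<alpha>) * b powr (1 - \<alpha>) / g' i powr (1 - \<alpha>)"
          using g[of j] j psd(3)[of a b w] x g'[OF i] abw by (simp add: powr_mult powr_divide)
        ultimately show "(case x of (a, b, w) \<Rightarrow> q i powr \<alpha> * g' i powr (1 - \<alpha>) * ((p j * a / q i) powr \<alpha> * (g j * b / g' i) powr (1 - \<alpha>) * Re (mtrace (F i j w)))) =
          (case x of (a, b, w) \<Rightarrow> (p j powr \<alpha> * g j powr (1 - \<alpha>)) * (a powr \<alpha> * b powr (1 - \<alpha>) * Re (mtrace (F i j w))))"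
          using q[OF i] g'[OF i] by (simp add: abw)
      qed
      finally show "q i powr \<alpha> * g' i powr (1 - \<alpha>) * decomp_value \<alpha> (L' i) = \<dots>" .
    qed
    also have "\<dots> = (\<Sum>j<d. \<Sum>i<d. \<Sum>(a, b, w)\<leftarrow>L. (p j powr \<alpha> * g j powr (1 - \<alpha>)) * (a powr \<alpha> * b powr (1 - \<alpha>) * Re (mtrace (F i j w))))"
      by (rule sum.swap)
    also have "\<dots> = (\<Sum>j<d. (p j powr \<alpha> * g j powr (1 - \<alpha>)) * decomp_value \<alpha> L)"
    proof (intro sum.cong refl)
      fix j assume "j \<in> {..<d}"
      then have j: "j < d" by simp
      have swap: "(\<Sum>i<d. \<Sum>(a, b, w)\<leftarrow>M. G i a b w) = (\<Sum>(a, b, w)\<leftarrow>M. \<Sum>i<d. G i a b w)"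
        for M :: "(real \<times> real \<times> complex Matrix.mat) list" and G :: "nat \<Rightarrow> real \<Rightarrow> real \<Rightarrow> complex Matrix.mat \<Rightarrow> real"
        by (induction M) (auto simp: sum.distrib)
      have "(\<Sum>i<d. \<Sum>(a, b, w)\<leftarrow>L. (p j powr \<alpha> * g j powr (1 - \<alpha>)) * (a powr \<alpha> * b powr (1 - \<alpha>) * Re (mtrace (F i j w)))) =
        (\<Sum>(a, b, w)\<leftarrow>L. (p j powr \<alpha> * g j powr (1 - \<alpha>)) * (a powr \<alpha> * b powr (1 - \<alpha>) * Re (mtrace w)))"
        unfolding swap
      proof (intro arg_cong[where f = sum_list] map_cong refl)
        fix x assume x: "x \<in> set L"
        obtain a b w where abw: "x = (a, b, w)" by (cases x)
        have "Re (\<Sum>i<d. mtrace (F i j w)) = Re (mtrace w)" using tr[OF j] psd_carrier[OF psd(1)[of a b w]] x abw by simp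
        then have "(\<Sum>i<d. Re (mtrace (F i j w))) = Re (mtrace w)" by simp
        then show "(case x of (a, b, w) \<Rightarrow> \<Sum>i<d. (p j powr \<alpha> * g j powr (1 - \<alpha>)) * (a powr \<alpha> * b powr (1 - \<alpha>) * Re (mtrace (F i j w)))) =
          (case x of (a, b, w) \<Rightarrow> (p j powr \<alpha> * g j powr (1 - \<alpha>)) * (a powr \<alpha> * b powr (1 - \<alpha>) * Re (mtrace w)))"
          by (simp add: abw flip: sum_distrib_left)
      qed
      then show "(\<Sum>i<d. \<Sum>(a, b, w)\<leftarrow>L. (p j powr \<alpha> * g j powr (1 - \<alpha>)) * (a powr \<alpha> * b powr (1 - \<alpha>) * Re (mtrace (F i j w)))) =
        (p j powr \<alpha> * g j powr (1 - \<alpha>)) * decomp_value \<alpha> L"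
        unfolding decomp_value_def sum_list_triple_mult .
    qed
    finally show ?thesis by (simp add: sum_distrib_right)
  qed
  ultimately show ?thesis using that by blast
qed

text \<open>Two ingredients suffice, \<open>A\<close> and the difference \<open>c * B - A\<close>:
  both enter \<open>B\<close> with weight \<open>1 / c\<close>, and they enter \<open>A\<close> with
  weights 1 and 0.\<close>

lemma joint_decomp_of_le:
  assumes A: "psd n A" and B: "B \<in> carrier_mat n n" and c: "c > 0" and le: "psd n (complex_of_real c \<cdot>\<^sub>m B - A)" and \<alpha>: "\<alpha> > 0"
  obtains L where "joint_decomp n L A B" "decomp_value \<alpha> L = c powr (\<alpha> - 1) * Re (mtrace A)"
proof -
  define L where "L = [(1 :: real, 1 / c, A), (0, 1 / c, complex_of_real c \<cdot>\<^sub>m B - A)]"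
  have "joint_decomp n L A B"
    using A B c le psd_carrier[OF A] by (auto simp: joint_decomp_def L_def field_simps)
  moreover have "decomp_value \<alpha> L = c powr (\<alpha> - 1) * Re (mtrace A)"
    using c \<alpha> by (simp add: decomp_value_def L_def powr_divide powr_diff)
  ultimately show ?thesis using that by blast
qed

lemma joint_decomp_trace:
  assumes D: "joint_decomp n L A B"
  shows "Re (mtrace A) = (\<Sum>(a, b, w)\<leftarrow>L. a * Re (mtrace w))" "Re (mtrace B) = (\<Sum>(a, b, w)\<leftarrow>L. b * Re (mtrace w))"
proof -
  have gen: "Re (mtrace X) = (\<Sum>(a, b, w)\<leftarrow>M. sel a b * Re (mtrace w))"
    if "\<And>i. i < n \<Longrightarrow> X $$ (i, i) = (\<Sum>(a, b, w)\<leftarrow>M. complex_of_real (sel a b) * w $$ (i, i))" "X \<in> carrier_mat n n"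
      "\<forall>(a, b, w)\<in>set M. w \<in> carrier_mat n n" for X M and sel :: "real \<Rightarrow> real \<Rightarrow> real"
  proof -
    have "mtrace X = (\<Sum>i<n. \<Sum>(a, b, w)\<leftarrow>M. complex_of_real (sel a b) * w $$ (i, i))"
      unfolding mtrace_def using that(1,2) by simp
    also have "\<dots> = (\<Sum>(a, b, w)\<leftarrow>M. complex_of_real (sel a b) * mtrace w)"
      using that(3) by (induction M) (auto simp: sum.distrib mtrace_def sum_distrib_left)
    finally have "Re (mtrace X) = Re (\<Sum>(a, b, w)\<leftarrow>M. complex_of_real (sel a b) * mtrace w)" by simp
    also have "\<dots> = (\<Sum>(a, b, w)\<leftarrow>M. sel a b * Re (mtrace w))" by (induction M) auto
    finally show ?thesis .
  qed
  have c: "\<forall>(a, b, w)\<in>set L. w \<in> carrier_mat n n" using D psd_carrier by (auto simp: joint_decomp_def)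
  show "Re (mtrace A) = (\<Sum>(a, b, w)\<leftarrow>L. a * Re (mtrace w))"
    by (rule gen[where X = A and M = L and sel = "\<lambda>a b. a"]) (use D c in \<open>auto simp: joint_decomp_def\<close>)
  show "Re (mtrace B) = (\<Sum>(a, b, w)\<leftarrow>L. b * Re (mtrace w))"
    by (rule gen[where X = B and M = L and sel = "\<lambda>a b. b"]) (use D c in \<open>auto simp: joint_decomp_def\<close>)
qed

text \<open>The function \<open>a powr \<alpha> * b powr (1 - \<alpha>)\<close> is homogeneous of
  degree 1, convex for orders above 1 and concave for those between 0 and 1; the linear expression
  is its tangent along the ray \<open>a = c * b\<close>. The inequalities amount to nonnegativity of
  \<open>renyi_gen\<close> at the ratio \<open>a / (b * c)\<close>.\<close>

lemma powr_tangent: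
  fixes a b c :: real
  assumes "a \<ge> 0" "b > 0" "c > 0"
  shows "\<alpha> > 1 \<Longrightarrow> \<alpha> * c powr (\<alpha> - 1) * a + (1 - \<alpha>) * c powr \<alpha> * b \<le> a powr \<alpha> * b powr (1 - \<alpha>)"
    "0 < \<alpha> \<Longrightarrow> \<alpha> < 1 \<Longrightarrow> a powr \<alpha> * b powr (1 - \<alpha>) \<le> \<alpha> * c powr (\<alpha> - 1) * a + (1 - \<alpha>) * c powr \<alpha> * b"
proof -
  define u where "u = a / (b * c)"
  have u0: "u \<ge> 0" using assms by (simp add: u_def)
  have e1: "a powr \<alpha> * b powr (1 - \<alpha>) = b * c powr \<alpha> * u powr \<alpha>"
    using assms by (simp add: u_def powr_divide powr_mult powr_diff field_simps)
  have e2: "\<alpha> * c powr (\<alpha> - 1) * a + (1 - \<alpha>) * c powr \<alpha> * b = b * c powr \<alpha> * (1 + \<alpha> * (u - 1))"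
    using assms by (simp add: u_def powr_diff field_simps)
  have bc: "b * c powr \<alpha> > 0" using assms by simp
  have bern: "\<alpha> * (\<alpha> - 1) * renyi_gen \<alpha> (ln u) = u powr \<alpha> - 1 - \<alpha> * (u - 1)" if "u > 0"
    using that by (simp add: renyi_gen_mult powr_def)
  show "\<alpha> * c powr (\<alpha> - 1) * a + (1 - \<alpha>) * c powr \<alpha> * b \<le> a powr \<alpha> * b powr (1 - \<alpha>)" if \<alpha>: "\<alpha> > 1"
  proof -
    have "1 + \<alpha> * (u - 1) \<le> u powr \<alpha>"
    proof (cases "u = 0")
      case False
      have "0 \<le> \<alpha> * (\<alpha> - 1) * renyi_gen \<alpha> (ln u)" using \<alpha> renyi_gen_nonneg by simp
      then show ?thesis using bern False u0 by simp
    qed (use \<alpha> in simp)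
    then show ?thesis unfolding e1 e2 using bc by (intro mult_left_mono) auto
  qed
  show "a powr \<alpha> * b powr (1 - \<alpha>) \<le> \<alpha> * c powr (\<alpha> - 1) * a + (1 - \<alpha>) * c powr \<alpha> * b" if \<alpha>: "0 < \<alpha>" "\<alpha> < 1"
  proof -
    have "u powr \<alpha> \<le> 1 + \<alpha> * (u - 1)"
    proof (cases "u = 0")
      case False
      have "\<alpha> * (\<alpha> - 1) * renyi_gen \<alpha> (ln u) \<le> 0" using \<alpha> renyi_gen_nonneg by (simp add: mult_nonneg_nonpos mult_nonpos_nonneg)
      then show ?thesis using bern False u0 by simp
    qed (use \<alpha> in simp)
    then show ?thesis unfolding e1 e2 using bc by (intro mult_left_mono) auto
  qed
qed

text \<open>Summing the tangents gives bounds that see only the traces of \<open>A\<close> and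
  \<open>B\<close>, not the decomposition. When \<open>c\<close> is the ratio of these traces, they
  are the data-processing bounds for forgetting all but the total masses.\<close>

lemma decomp_value_bounds:
  assumes D: "joint_decomp n L A B" and c: "c > 0"
  shows "\<alpha> > 1 \<Longrightarrow> \<alpha> * c powr (\<alpha> - 1) * Re (mtrace A) + (1 - \<alpha>) * c powr \<alpha> * Re (mtrace B) \<le> decomp_value \<alpha> L"
    "0 < \<alpha> \<Longrightarrow> \<alpha> < 1 \<Longrightarrow> decomp_value \<alpha> L \<le> \<alpha> * c powr (\<alpha> - 1) * Re (mtrace A) + (1 - \<alpha>) * c powr \<alpha> * Re (mtrace B)"
proof -
  have e: "\<alpha> * c powr (\<alpha> - 1) * Re (mtrace A) + (1 - \<alpha>) * c powr \<alpha> * Re (mtrace B) =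
    (\<Sum>(a, b, w)\<leftarrow>L. (\<alpha> * c powr (\<alpha> - 1) * a + (1 - \<alpha>) * c powr \<alpha> * b) * Re (mtrace w))"
  proof -
    have "k1 * (\<Sum>(a, b, w)\<leftarrow>M. a * Re (mtrace w)) + k2 * (\<Sum>(a, b, w)\<leftarrow>M. b * Re (mtrace w)) =
      (\<Sum>(a, b, w)\<leftarrow>M. (k1 * a + k2 * b) * Re (mtrace w))" for k1 k2 and M :: "(real \<times> real \<times> complex Matrix.mat) list"
      by (induction M) (auto simp: algebra_simps)
    then show ?thesis unfolding joint_decomp_trace[OF D] .
  qed
  have psd: "0 \<le> Re (mtrace w)" "0 \<le> a" "0 < b" if "(a, b, w) \<in> set L" for a b w
    using D that psd_trace_nonneg by (auto simp: joint_decomp_def)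
  show "\<alpha> * c powr (\<alpha> - 1) * Re (mtrace A) + (1 - \<alpha>) * c powr \<alpha> * Re (mtrace B) \<le> decomp_value \<alpha> L" if "\<alpha> > 1"
    unfolding e decomp_value_def using psd powr_tangent(1)[OF _ _ c that]
    by (intro sum_list_mono) (auto intro!: mult_right_mono)
  show "decomp_value \<alpha> L \<le> \<alpha> * c powr (\<alpha> - 1) * Re (mtrace A) + (1 - \<alpha>) * c powr \<alpha> * Re (mtrace B)" if "0 < \<alpha>" "\<alpha> < 1"
    unfolding e decomp_value_def using psd powr_tangent(2)[OF _ _ c that]
    by (intro sum_list_mono) (auto intro!: mult_right_mono)
qed

subsection \<open>Monotonicity under catalytic families\<close>

lemma weighted_min:
  fixes f x :: "nat \<Rightarrow> real"
  assumes "\<And>i. i < d \<Longrightarrow> f i > 0" "0 < d" "(\<Sum>i<d. f i * x i) = (\<Sum>i<d. f i) * v"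
  shows "\<exists>i<d. x i \<le> v" "\<exists>i<d. x i \<ge> v"
proof -
  show "\<exists>i<d. x i \<le> v"
  proof (rule ccontr)
    assume "\<not> ?thesis"
    then have "(\<Sum>i<d. f i * v) < (\<Sum>i<d. f i * x i)" using assms by (intro sum_strict_mono) auto
    then show False using assms(3) by (simp add: sum_distrib_right)
  qed
  show "\<exists>i<d. x i \<ge> v"
  proof (rule ccontr)
    assume "\<not> ?thesis"
    then have "(\<Sum>i<d. f i * x i) < (\<Sum>i<d. f i * v)" using assms by (intro sum_strict_mono) auto
    then show False using assms(3) by (simp add: sum_distrib_right)
  qed
qed

text \<open>The same catalyst can be used again and again, so a strict violation of the inequality would be
  amplified exponentially while the value of a decomposition stays bounded.\<close>

lemma positive_family_monotone:
  assumes F: "positive_family d n F" and d: "0 < d"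
    and A: "psd n A" "Re (mtrace A) = 1" and B: "psd n B" "Re (mtrace B) = 1"
    and c: "c > 0" and le: "psd n (complex_of_real c \<cdot>\<^sub>m B - A)"
    and p: "\<And>j. j < d \<Longrightarrow> p j \<ge> 0" and g: "\<And>j. j < d \<Longrightarrow> g j > 0"
    and q: "\<And>i. i < d \<Longrightarrow> q i > 0"
    and eqA: "\<And>i r s. i < d \<Longrightarrow> r < n \<Longrightarrow> s < n \<Longrightarrow>
      (\<Sum>j<d. complex_of_real (p j) * F i j A $$ (r, s)) = complex_of_real (q i) * A $$ (r, s)"
    and eqB: "\<And>i r s. i < d \<Longrightarrow> r < n \<Longrightarrow> s < n \<Longrightarrow>
      (\<Sum>j<d. complex_of_real (g j) * F i j B $$ (r, s)) = complex_of_real (g i) * B $$ (r, s)"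
  shows "\<alpha> > 1 \<Longrightarrow> (\<Sum>i<d. q i powr \<alpha> * g i powr (1 - \<alpha>)) \<le> (\<Sum>j<d. p j powr \<alpha> * g j powr (1 - \<alpha>))"
    and "0 < \<alpha> \<Longrightarrow> \<alpha> < 1 \<Longrightarrow> (\<Sum>j<d. p j powr \<alpha> * g j powr (1 - \<alpha>)) \<le> (\<Sum>i<d. q i powr \<alpha> * g i powr (1 - \<alpha>))"
proof -
  define Sq where "Sq = (\<Sum>i<d. q i powr \<alpha> * g i powr (1 - \<alpha>))"
  define Sp where "Sp = (\<Sum>j<d. p j powr \<alpha> * g j powr (1 - \<alpha>))"
  have f: "q i powr \<alpha> * g i powr (1 - \<alpha>) > 0" if "i < d" for i using q[OF that] g[OF that] by simp
  have Sq: "Sq > 0" unfolding Sq_def by (intro sum_pos) (use f d in auto)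
  have Sp: "Sp \<ge> 0" unfolding Sp_def by (intro sum_nonneg) auto
  define \<theta> where "\<theta> = Sp / Sq"
  have \<theta>: "\<theta> \<ge> 0" using Sq Sp by (simp add: \<theta>_def)
  \<comment> \<open>The output values average to \<open>\<theta>\<close> times the input value, so
    some outcome lies at or below this and some at or above; each outcome again decomposes the same
    \<open>A\<close> and \<open>B\<close>.\<close>
  have step: "\<exists>L1 L2. joint_decomp n L1 A B \<and> joint_decomp n L2 A B \<and>
     decomp_value \<alpha> L1 \<le> \<theta> * decomp_value \<alpha> L \<and> \<theta> * decomp_value \<alpha> L \<le> decomp_value \<alpha> L2" if L: "joint_decomp n L A B" for L
  proof -
    obtain L' where L': "\<And>i. i < d \<Longrightarrow> joint_decomp n (L' i) A B"
      "(\<Sum>i<d. q i powr \<alpha> * g i powr (1 - \<alpha>) * decomp_value \<alpha> (L' i)) =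
       (\<Sum>j<d. p j powr \<alpha> * g j powr (1 - \<alpha>)) * decomp_value \<alpha> L"
      using joint_decomp_transfer[OF F L p g q g psd_carrier[OF A(1)] psd_carrier[OF B(1)] eqA eqB, of \<alpha>] by blast
    have "(\<Sum>i<d. q i powr \<alpha> * g i powr (1 - \<alpha>) * decomp_value \<alpha> (L' i)) = (\<Sum>i<d. q i powr \<alpha> * g i powr (1 - \<alpha>)) * (\<theta> * decomp_value \<alpha> L)"
      unfolding L'(2) Sq_def[symmetric] Sp_def[symmetric] using Sq by (simp add: \<theta>_def)
    from weighted_min[OF f d this] L'(1) show ?thesis by blast
  qed
  have start: "\<exists>L. joint_decomp n L A B \<and> decomp_value \<alpha> L = c powr (\<alpha> - 1)" if "\<alpha> > 0"
    using joint_decomp_of_le[OF A(1) psd_carrier[OF B(1)] c le that] A(2) by (metis mult.right_neutral)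
  have iter: "\<exists>L1 L2. joint_decomp n L1 A B \<and> joint_decomp n L2 A B \<and>
     decomp_value \<alpha> L1 \<le> \<theta> ^ k * c powr (\<alpha> - 1) \<and> \<theta> ^ k * c powr (\<alpha> - 1) \<le> decomp_value \<alpha> L2" if a0: "\<alpha> > 0" for k
  proof (induction k)
    case 0
    obtain L where "joint_decomp n L A B" "decomp_value \<alpha> L = c powr (\<alpha> - 1)" using start[OF a0] by blast
    then show ?case by (intro exI[of _ L]) auto
  next
    case (Suc k)
    then obtain L1 L2 where L: "joint_decomp n L1 A B" "joint_decomp n L2 A B"
      "decomp_value \<alpha> L1 \<le> \<theta> ^ k * c powr (\<alpha> - 1)" "\<theta> ^ k * c powr (\<alpha> - 1) \<le> decomp_value \<alpha> L2" by blast
    have "\<theta> * decomp_value \<alpha> L1 \<le> \<theta> ^ Suc k * c powr (\<alpha> - 1)" "\<theta> ^ Suc k * c powr (\<alpha> - 1) \<le> \<theta> * decomp_value \<alpha> L2"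
      using mult_left_mono[OF L(3) \<theta>] mult_left_mono[OF L(4) \<theta>] by (simp_all add: mult.assoc)
    then show ?case using step[OF L(1)] step[OF L(2)] by (meson order_trans)
  qed
  show "(\<Sum>i<d. q i powr \<alpha> * g i powr (1 - \<alpha>)) \<le> (\<Sum>j<d. p j powr \<alpha> * g j powr (1 - \<alpha>))" if \<alpha>: "\<alpha> > 1"
  proof (rule ccontr)
    assume "\<not> ?thesis"
    then have "\<theta> < 1" using Sq by (simp add: \<theta>_def Sq_def Sp_def)
    then obtain k where k: "\<theta> ^ k < 1 / c powr (\<alpha> - 1)" using real_arch_pow_inv[of "1 / c powr (\<alpha> - 1)" \<theta>] c by auto
    obtain L where L: "joint_decomp n L A B" "decomp_value \<alpha> L \<le> \<theta> ^ k * c powr (\<alpha> - 1)" using iter[of k] \<alpha> by auto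
    \<comment> \<open>The tangent at ratio 1, both traces being 1.\<close>
    have "1 \<le> decomp_value \<alpha> L" using decomp_value_bounds(1)[OF L(1), of 1 \<alpha>] \<alpha> A B by simp
    moreover have "\<theta> ^ k * c powr (\<alpha> - 1) < 1" using k c by (simp add: field_simps)
    ultimately show False using L(2) by simp
  qed
  show "(\<Sum>j<d. p j powr \<alpha> * g j powr (1 - \<alpha>)) \<le> (\<Sum>i<d. q i powr \<alpha> * g i powr (1 - \<alpha>))" if \<alpha>: "0 < \<alpha>" "\<alpha> < 1"
  proof (rule ccontr)
    assume "\<not> ?thesis"
    then have "\<theta> > 1" using Sq by (simp add: \<theta>_def Sq_def Sp_def)
    then obtain k where k: "1 / c powr (\<alpha> - 1) < \<theta> ^ k" using real_arch_pow by blast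
    obtain L where L: "joint_decomp n L A B" "\<theta> ^ k * c powr (\<alpha> - 1) \<le> decomp_value \<alpha> L" using iter[of k] \<alpha> by auto
    have "decomp_value \<alpha> L \<le> 1" using decomp_value_bounds(2)[OF L(1), of 1 \<alpha>] \<alpha> A B by simp
    moreover have "\<theta> ^ k * c powr (\<alpha> - 1) > 1" using k c by (simp add: field_simps)
    ultimately show False using L(2) by simp
  qed
qed

section \<open>Weighted sums of operators\<close>

definition wsum :: "nat \<Rightarrow> nat \<Rightarrow> (nat \<Rightarrow> real) \<Rightarrow> (nat \<Rightarrow> complex Matrix.mat) \<Rightarrow> complex Matrix.mat" where
  "wsum d n w M = Matrix.mat n n (\<lambda>(r, s). \<Sum>j<d. complex_of_real (w j) * M j $$ (r, s))"

lemma wsum_carrier [simp]: "wsum d n w M \<in> carrier_mat n n"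
  by (simp add: wsum_def)

lemma wsum_dim [simp]: "dim_row (wsum d n w M) = n" "dim_col (wsum d n w M) = n"
  by (simp_all add: wsum_def)

lemma wsum_index [simp]: "r < n \<Longrightarrow> s < n \<Longrightarrow> wsum d n w M $$ (r, s) = (\<Sum>j<d. complex_of_real (w j) * M j $$ (r, s))"
  by (simp add: wsum_def)

lemma qform_wsum: "qform n (wsum d n w M) v = (\<Sum>j<d. complex_of_real (w j) * qform n (M j) v)"
proof -
  have "qform n (wsum d n w M) v = (\<Sum>a<n. \<Sum>b<n. \<Sum>j<d. complex_of_real (w j) * (M j $$ (a, b) * v b * cnj (v a)))"
    unfolding qform_def by (intro sum.cong refl) (simp add: sum_distrib_right mult.assoc)
  also have "\<dots> = (\<Sum>a<n. \<Sum>j<d. \<Sum>b<n. complex_of_real (w j) * (M j $$ (a, b) * v b * cnj (v a)))"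
    by (intro sum.cong refl sum.swap)
  also have "\<dots> = (\<Sum>j<d. \<Sum>a<n. \<Sum>b<n. complex_of_real (w j) * (M j $$ (a, b) * v b * cnj (v a)))" by (rule sum.swap)
  finally show ?thesis by (simp add: qform_def sum_distrib_left)
qed

lemma psd_wsum:
  assumes "\<And>j. j < d \<Longrightarrow> w j \<ge> 0" "\<And>j. j < d \<Longrightarrow> psd n (M j)"
  shows "psd n (wsum d n w M)"
  unfolding psd_iff qform_wsum
proof (intro conjI allI impI)
  fix i j assume ij: "i < n" "j < n"
  have "cnj (wsum d n w M $$ (j, i)) = (\<Sum>k<d. complex_of_real (w k) * cnj (M k $$ (j, i)))" using ij by simp
  also have "\<dots> = wsum d n w M $$ (i, j)" unfolding wsum_index[OF ij] by (intro sum.cong refl) (use psd_herm[OF assms(2) ij] in auto)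
  finally show "cnj (wsum d n w M $$ (j, i)) = wsum d n w M $$ (i, j)" .
next
  fix v
  have "0 \<le> Re (qform n (M j) v)" if "j < d" for j using assms(2)[OF that] by (simp add: psd_iff)
  then show "0 \<le> Re (\<Sum>j<d. complex_of_real (w j) * qform n (M j) v)" using assms(1) by (auto intro!: sum_nonneg)
qed simp

lemma mtrace_wsum: "(\<And>j. j < d \<Longrightarrow> M j \<in> carrier_mat n n) \<Longrightarrow> mtrace (wsum d n w M) = (\<Sum>j<d. complex_of_real (w j) * mtrace (M j))"
proof -
  assume M: "\<And>j. j < d \<Longrightarrow> M j \<in> carrier_mat n n"
  have "mtrace (wsum d n w M) = (\<Sum>r<n. \<Sum>j<d. complex_of_real (w j) * M j $$ (r, r))"
    unfolding mtrace_def carrier_matD(1)[OF wsum_carrier] by (intro sum.cong refl) simp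
  also have "\<dots> = (\<Sum>j<d. complex_of_real (w j) * mtrace (M j))"
    by (subst sum.swap, intro sum.cong refl) (use M in \<open>auto simp: mtrace_def sum_distrib_left\<close>)
  finally show ?thesis .
qed

lemma linear_map_minus:
  assumes F: "linear_map_mat n m F" and A: "A \<in> carrier_mat n n" and B: "B \<in> carrier_mat n n" and rs: "r < m" "s < m"
  shows "F (complex_of_real c \<cdot>\<^sub>m A - B) $$ (r, s) = complex_of_real c * F A $$ (r, s) - F B $$ (r, s)"
proof -
  have "complex_of_real c \<cdot>\<^sub>m A - B = complex_of_real c \<cdot>\<^sub>m A + (-1) \<cdot>\<^sub>m B" using A B by (intro eq_matI) auto
  then have "F (complex_of_real c \<cdot>\<^sub>m A - B) = complex_of_real c \<cdot>\<^sub>m F A + (-1) \<cdot>\<^sub>m F B"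
    using F A B unfolding linear_map_mat_def by auto
  moreover have "F A \<in> carrier_mat m m" "F B \<in> carrier_mat m m" using F A B unfolding linear_map_mat_def by auto
  ultimately show ?thesis using rs by simp
qed

text \<open>When the reference operator \<open>B\<close> is not supported where \<open>A\<close> is, the value with the roles of \<open>A\<close> and \<open>B\<close>
  exchanged is infinite. It is then replaced by the largest part \<open>Y\<close> of \<open>B\<close> dominated by a multiple
  of \<open>A\<close>; approximate maximizers of the trace suffice.\<close>

lemma positive_family_monotone_reverse:
  assumes F: "positive_family d n F" and d: "0 < d"
    and A: "psd n A" "Re (mtrace A) = 1" and B: "psd n B" "Re (mtrace B) = 1"
    and c: "c > 0" and le: "psd n (complex_of_real c \<cdot>\<^sub>m B - A)"
    and p: "\<And>j. j < d \<Longrightarrow> p j > 0" and g: "\<And>j. j < d \<Longrightarrow> g j > 0" "(\<Sum>j<d. g j) = 1"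
    and q: "\<And>i. i < d \<Longrightarrow> q i > 0"
    and eqA: "\<And>i r s. i < d \<Longrightarrow> r < n \<Longrightarrow> s < n \<Longrightarrow>
      (\<Sum>j<d. complex_of_real (p j) * F i j A $$ (r, s)) = complex_of_real (q i) * A $$ (r, s)"
    and eqB: "\<And>i r s. i < d \<Longrightarrow> r < n \<Longrightarrow> s < n \<Longrightarrow>
      (\<Sum>j<d. complex_of_real (g j) * F i j B $$ (r, s)) = complex_of_real (g i) * B $$ (r, s)"
    and \<alpha>: "\<alpha> > 1"
  shows "(\<Sum>i<d. g i powr \<alpha> * q i powr (1 - \<alpha>)) \<le> (\<Sum>j<d. g j powr \<alpha> * p j powr (1 - \<alpha>))"
proof (rule ccontr)
  define Sq where "Sq = (\<Sum>i<d. g i powr \<alpha> * q i powr (1 - \<alpha>))"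
  define Sp where "Sp = (\<Sum>j<d. g j powr \<alpha> * p j powr (1 - \<alpha>))"
  assume "\<not> ?thesis"
  then have lt: "Sp < Sq" by (simp add: Sq_def Sp_def)
  have f: "g i powr \<alpha> * q i powr (1 - \<alpha>) > 0" if "i < d" for i using q[OF that] g(1)[OF that] by simp
  have Sp: "Sp \<ge> 0" unfolding Sp_def by (intro sum_nonneg) auto
  define \<theta> where "\<theta> = Sp / Sq"
  have \<theta>: "0 \<le> \<theta>" "\<theta> < 1" using Sp lt by (simp_all add: \<theta>_def)
  have Sq: "Sq > 0" using lt Sp by simp
  note Ac = psd_carrier[OF A(1)] and Bc = psd_carrier[OF B(1)]
  have lin: "linear_map_mat n n (F i j)" and pos: "psd n Y \<Longrightarrow> psd n (F i j Y)" if "i < d" "j < d" for i j Y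
    using F that by (auto simp: positive_family_def)
  have Fc: "F i j Y \<in> carrier_mat n n" if "i < d" "j < d" "Y \<in> carrier_mat n n" for i j Y
    using lin[OF that(1,2)] that(3) by (auto simp: linear_map_mat_def)
  \<comment> \<open>The multiple of \<open>A\<close> is left free because the family may enlarge it;
    this keeps the set of admissible parts stable.\<close>
  define C where "C Y \<longleftrightarrow> psd n Y \<and> psd n (complex_of_real 1 \<cdot>\<^sub>m B - Y) \<and> (\<exists>c>0. psd n (complex_of_real c \<cdot>\<^sub>m A - Y))" for Y
  have trC: "Re (mtrace Y) \<le> 1" if "C Y" for Y
  proof -
    have "0 \<le> Re (mtrace (complex_of_real 1 \<cdot>\<^sub>m B - Y))" using that psd_trace_nonneg by (auto simp: C_def)
    then show ?thesis using that B Bc psd_carrier[of n Y] by (simp add: C_def mtrace_minus[of _ n] mtrace_smult[of _ n])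
  qed
  define m where "m = Sup {Re (mtrace Y) | Y. C Y}"
  have bdd: "bdd_above {Re (mtrace Y) | Y. C Y}" using trC by (auto simp: bdd_above_def)
  have m_upper: "Re (mtrace Y) \<le> m" if "C Y" for Y
    unfolding m_def by (rule cSup_upper[OF _ bdd]) (use that in auto)
  \<comment> \<open>Domination of \<open>A\<close> by \<open>c * B\<close> says that
    \<open>A\<close> divided by \<open>c\<close> is admissible, which makes the supremum
    \<open>m\<close> positive.\<close>
  have CA: "C (complex_of_real (1 / c) \<cdot>\<^sub>m A)"
  proof -
    have "complex_of_real 1 \<cdot>\<^sub>m B - complex_of_real (1 / c) \<cdot>\<^sub>m A = complex_of_real (1 / c) \<cdot>\<^sub>m (complex_of_real c \<cdot>\<^sub>m B - A)"
      using Ac Bc c by (intro eq_matI) (auto simp: right_diff_distrib)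
    then have "psd n (complex_of_real 1 \<cdot>\<^sub>m B - complex_of_real (1 / c) \<cdot>\<^sub>m A)" using psd_smult[OF le, of "1 / c"] c by simp
    moreover have "complex_of_real (1 / c) \<cdot>\<^sub>m A - complex_of_real (1 / c) \<cdot>\<^sub>m A = 0\<^sub>m n n" using Ac by (intro eq_matI) auto
    then have "psd n (complex_of_real (1 / c) \<cdot>\<^sub>m A - complex_of_real (1 / c) \<cdot>\<^sub>m A)" using psd_zero by simp
    ultimately show ?thesis using psd_smult[OF A(1), of "1 / c"] c unfolding C_def by (meson less_imp_le zero_less_divide_1_iff)
  qed
  have m0: "m > 0"
  proof -
    have "Re (mtrace (complex_of_real (1 / c) \<cdot>\<^sub>m A)) = 1 / c" using A(2) by (simp add: mtrace_smult[OF Ac])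
    then show ?thesis using m_upper[OF CA] c by (metis less_le_trans zero_less_divide_1_iff)
  qed
  have near: "\<exists>Y. C Y \<and> m - \<zeta> \<le> Re (mtrace Y)" if "\<zeta> > 0" for \<zeta>
  proof -
    have "m - \<zeta> < Sup {Re (mtrace Y) | Y. C Y}" using that by (simp add: m_def)
    then obtain x where "x \<in> {Re (mtrace Y) | Y. C Y}" "m - \<zeta> < x"
      using less_cSupD[of "{Re (mtrace Y) | Y. C Y}" "m - \<zeta>"] CA by blast
    then show ?thesis by force
  qed
  \<comment> \<open>The traces of the outputs, none above \<open>m\<close>, average with weights
    \<open>g i\<close> to the trace of the input. A deficit \<open>\<zeta>\<close> can at worst sit
    in one outcome, whose weight is at least \<open>\<gamma>\<close>, so a step magnifies it by at
    most \<open>1 / \<gamma>\<close>.\<close>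
  define \<gamma> where "\<gamma> = Min (g ` {..<d})"
  have "\<gamma> > 0" unfolding \<gamma>_def by (subst Min_gr_iff) (use g(1) d in auto)
  moreover have "\<gamma> \<le> g i" if "i < d" for i unfolding \<gamma>_def by (rule Min_le) (use that in auto)
  ultimately have \<gamma>: "\<gamma> > 0" "\<And>i. i < d \<Longrightarrow> \<gamma> \<le> g i" by auto
  have step: "\<exists>Y' L'. C Y' \<and> m - \<zeta> / \<gamma> \<le> Re (mtrace Y') \<and> joint_decomp n L' Y' A \<and> decomp_value \<alpha> L' \<le> \<theta> * decomp_value \<alpha> L"
    if Y: "C Y" and tr: "m - \<zeta> \<le> Re (mtrace Y)" and \<zeta>: "\<zeta> \<ge> 0" and L: "joint_decomp n L Y A" for Y \<zeta> L
  proof -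
    have Ypsd: "psd n Y" and Yle: "psd n (complex_of_real 1 \<cdot>\<^sub>m B - Y)" using Y by (auto simp: C_def)
    note Yc = psd_carrier[OF Ypsd]
    obtain k where k: "k > 0" "psd n (complex_of_real k \<cdot>\<^sub>m A - Y)" using Y by (auto simp: C_def)
    define Z where "Z i = wsum d n (\<lambda>j. g j / g i) (\<lambda>j. F i j Y)" for i
    have w0: "g j / g i \<ge> 0" if "i < d" "j < d" for i j using g(1)[OF that(1)] g(1)[OF that(2)] by simp
    have CZ: "C (Z i)" if i: "i < d" for i
    proof -
      have 1: "psd n (Z i)" unfolding Z_def by (intro psd_wsum w0 pos Ypsd i)
      have "complex_of_real 1 \<cdot>\<^sub>m B - Z i = wsum d n (\<lambda>j. g j / g i) (\<lambda>j. F i j (complex_of_real 1 \<cdot>\<^sub>m B - Y))"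
      proof (rule eq_matI)
        fix r s assume "r < dim_row (wsum d n (\<lambda>j. g j / g i) (\<lambda>j. F i j (complex_of_real 1 \<cdot>\<^sub>m B - Y)))"
          "s < dim_col (wsum d n (\<lambda>j. g j / g i) (\<lambda>j. F i j (complex_of_real 1 \<cdot>\<^sub>m B - Y)))"
        then have rs: "r < n" "s < n" by (auto simp: wsum_def)
        have "B $$ (r, s) = (\<Sum>j<d. complex_of_real (g j / g i) * F i j B $$ (r, s))"
        proof -
          have "(\<Sum>j<d. complex_of_real (g j / g i) * F i j B $$ (r, s)) = (\<Sum>j<d. complex_of_real (g j) * F i j B $$ (r, s)) / complex_of_real (g i)"
            by (simp add: sum_divide_distrib)
          then show ?thesis unfolding eqB[OF i rs] using g(1)[OF i] by simp
        qed
        then have "(complex_of_real 1 \<cdot>\<^sub>m B - Z i) $$ (r, s) = (\<Sum>j<d. complex_of_real (g j / g i) * (complex_of_real 1 * F i j B $$ (r, s) - F i j Y $$ (r, s)))"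
          using rs Bc by (simp add: Z_def right_diff_distrib sum_subtractf)
        also have "\<dots> = wsum d n (\<lambda>j. g j / g i) (\<lambda>j. F i j (complex_of_real 1 \<cdot>\<^sub>m B - Y)) $$ (r, s)"
          unfolding wsum_index[OF rs] by (intro sum.cong refl) (use linear_map_minus[OF lin[OF i] Bc Yc rs, of _ 1] in auto)
        finally show "(complex_of_real 1 \<cdot>\<^sub>m B - Z i) $$ (r, s) = wsum d n (\<lambda>j. g j / g i) (\<lambda>j. F i j (complex_of_real 1 \<cdot>\<^sub>m B - Y)) $$ (r, s)" .
      qed (auto simp: Z_def wsum_def)
      then have 2: "psd n (complex_of_real 1 \<cdot>\<^sub>m B - Z i)" using psd_wsum[OF w0[OF i] pos[OF i _ Yle]] by simp
      \<comment> \<open>\<open>K\<close> is at least each \<open>g j / (g i * p j)\<close>, so the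
        weights \<open>g j / g i\<close> that form \<open>Z i\<close> can be compared with the
        weights \<open>p j\<close> under which the family reproduces \<open>A\<close>. Here
        positivity of all \<open>p j\<close> enters.\<close>
      define K where "K = (\<Sum>j<d. g j / (g i * p j))"
      have Kj: "g j / (g i * p j) \<le> K" if "j < d" for j
        unfolding K_def by (rule member_le_sum) (use that g(1) p i in \<open>auto simp: less_imp_le\<close>)
      have K0: "K > 0" unfolding K_def by (intro sum_pos) (use g(1) p i d in auto)
      have "complex_of_real (K * k * q i) \<cdot>\<^sub>m A - Z i = wsum d n (\<lambda>j. (K - g j / (g i * p j)) * (k * p j)) (\<lambda>j. F i j A) +
        wsum d n (\<lambda>j. g j / g i) (\<lambda>j. F i j (complex_of_real k \<cdot>\<^sub>m A - Y))" (is "?lhs = ?rhs")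
      proof (rule eq_matI)
        fix r s assume "r < dim_row ?rhs" "s < dim_col ?rhs"
        then have rs: "r < n" "s < n" by (auto simp: wsum_def)
        have "?rhs $$ (r, s) = (\<Sum>j<d. complex_of_real ((K - g j / (g i * p j)) * (k * p j)) * F i j A $$ (r, s)
          + complex_of_real (g j / g i) * (complex_of_real k * F i j A $$ (r, s) - F i j Y $$ (r, s)))"
          using rs linear_map_minus[OF lin[OF i] Ac Yc rs, of _ k] by (simp add: sum.distrib)
        also have "\<dots> = (\<Sum>j<d. complex_of_real (K * k) * (complex_of_real (p j) * F i j A $$ (r, s)) - complex_of_real (g j / g i) * F i j Y $$ (r, s))"
        proof (intro sum.cong refl)
          fix j assume "j \<in> {..<d}"
          then have pj: "p j > 0" using p by simp
          have "(K - g j / (g i * p j)) * (k * p j) + g j / g i * k = K * k * p j"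
            using pj g(1)[OF i] by (simp add: field_simps)
          then have e: "complex_of_real ((K - g j / (g i * p j)) * (k * p j)) + complex_of_real (g j / g i) * complex_of_real k = complex_of_real (K * k) * complex_of_real (p j)"
            by (metis of_real_add of_real_mult)
          show "complex_of_real ((K - g j / (g i * p j)) * (k * p j)) * F i j A $$ (r, s)
          + complex_of_real (g j / g i) * (complex_of_real k * F i j A $$ (r, s) - F i j Y $$ (r, s)) =
            complex_of_real (K * k) * (complex_of_real (p j) * F i j A $$ (r, s)) - complex_of_real (g j / g i) * F i j Y $$ (r, s)"
            unfolding mult.assoc[symmetric] e[symmetric] by (simp only: distrib_right right_diff_distrib mult.assoc add_diff_eq)
        qed
        also have "\<dots> = complex_of_real (K * k) * (complex_of_real (q i) * A $$ (r, s)) - Z i $$ (r, s)"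
          using rs by (simp only: sum_subtractf sum_distrib_left[symmetric] eqA[OF i rs] Z_def wsum_index)
        also have "\<dots> = ?lhs $$ (r, s)" using rs Ac by (simp add: Z_def mult.assoc)
        finally show "?lhs $$ (r, s) = ?rhs $$ (r, s)" by simp
      qed (auto simp: Z_def wsum_def)
      moreover have "psd n ?rhs"
        by (intro psd_add psd_wsum pos[OF i] k(2) A(1) w0[OF i]) (use Kj k(1) p in \<open>auto intro!: mult_nonneg_nonneg simp: less_imp_le\<close>)
      ultimately have "psd n (complex_of_real (K * k * q i) \<cdot>\<^sub>m A - Z i)" by simp
      moreover have "K * k * q i > 0" using K0 k(1) q[OF i] by simp
      ultimately show ?thesis using 1 2 unfolding C_def by blast
    qed
    have trZ: "g i * Re (mtrace (Z i)) = (\<Sum>j<d. g j * Re (mtrace (F i j Y)))" if i: "i < d" for i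
    proof -
      have "mtrace (Z i) = (\<Sum>j<d. complex_of_real (g j / g i) * mtrace (F i j Y))"
        unfolding Z_def by (rule mtrace_wsum) (use Fc[OF i _ Yc] in auto)
      then have "Re (mtrace (Z i)) = (\<Sum>j<d. g j / g i * Re (mtrace (F i j Y)))" by simp
      then show ?thesis using g(1)[OF i] by (simp add: sum_distrib_left)
    qed
    have sumtr: "(\<Sum>i<d. g i * Re (mtrace (Z i))) = Re (mtrace Y)"
    proof -
      have "(\<Sum>i<d. g i * Re (mtrace (Z i))) = (\<Sum>i<d. \<Sum>j<d. g j * Re (mtrace (F i j Y)))" by (intro sum.cong refl) (simp add: trZ)
      also have "\<dots> = (\<Sum>j<d. g j * Re (\<Sum>i<d. mtrace (F i j Y)))" by (subst sum.swap) (simp add: sum_distrib_left)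
      also have "\<dots> = (\<Sum>j<d. g j * Re (mtrace Y))"
        using F Yc by (intro sum.cong refl) (auto simp: positive_family_def)
      finally show ?thesis using g(2) by (simp flip: sum_distrib_right)
    qed
    have trlow: "m - \<zeta> / \<gamma> \<le> Re (mtrace (Z i))" if i: "i < d" for i
    proof -
      have "(\<Sum>l\<in>{..<d} - {i}. g l * Re (mtrace (Z l))) \<le> (\<Sum>l\<in>{..<d} - {i}. g l * m)"
        by (intro sum_mono mult_left_mono m_upper CZ) (use g in \<open>auto simp: less_imp_le\<close>)
      also have "\<dots> = (1 - g i) * m" using g(2) i by (simp add: sum_diff1 flip: sum_distrib_right)
      finally have "Re (mtrace Y) - g i * Re (mtrace (Z i)) \<le> (1 - g i) * m"
        using sumtr i by (simp add: sum_diff1)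
      then have "g i * (m - Re (mtrace (Z i))) \<le> \<zeta>" using tr by (simp add: algebra_simps)
      then have "m - Re (mtrace (Z i)) \<le> \<zeta> / g i" using g(1)[OF i] by (simp add: field_simps)
      also have "\<dots> \<le> \<zeta> / \<gamma>" using \<gamma> \<zeta> i g(1)[OF i] by (intro divide_left_mono) auto
      finally show ?thesis by simp
    qed
    have eqZ: "(\<Sum>j<d. complex_of_real (g j) * F i j Y $$ (r, s)) = complex_of_real (g i) * Z i $$ (r, s)"
      if "i < d" "r < n" "s < n" for i r s
      using that g(1)[OF that(1)] by (simp add: Z_def sum_distrib_left)
    have Zc: "Z i \<in> carrier_mat n n" for i by (simp add: Z_def)
    obtain L' where L': "\<And>i. i < d \<Longrightarrow> joint_decomp n (L' i) (Z i) A"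
      "(\<Sum>i<d. g i powr \<alpha> * q i powr (1 - \<alpha>) * decomp_value \<alpha> (L' i)) =
       (\<Sum>j<d. g j powr \<alpha> * p j powr (1 - \<alpha>)) * decomp_value \<alpha> L"
      using joint_decomp_transfer[OF F L less_imp_le[OF g(1)] p g(1) q Zc Ac eqZ eqA, of \<alpha>] by blast
    have "(\<Sum>i<d. g i powr \<alpha> * q i powr (1 - \<alpha>) * decomp_value \<alpha> (L' i)) = (\<Sum>i<d. g i powr \<alpha> * q i powr (1 - \<alpha>)) * (\<theta> * decomp_value \<alpha> L)"
      unfolding L'(2) Sq_def[symmetric] Sp_def[symmetric] using Sq by (simp add: \<theta>_def)
    from weighted_min(1)[OF f d this] obtain i where "i < d" "decomp_value \<alpha> (L' i) \<le> \<theta> * decomp_value \<alpha> L" by blast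
    then show ?thesis using CZ trlow L'(1) by blast
  qed
  \<comment> \<open>An initial deficit of \<open>m / 2 * \<gamma> ^ k\<close> has grown to at most
    \<open>m / 2\<close> after \<open>k\<close> steps.\<close>
  have iter: "\<exists>Y' L'. C Y' \<and> m - m / 2 \<le> Re (mtrace Y') \<and> joint_decomp n L' Y' A \<and> decomp_value \<alpha> L' \<le> \<theta> ^ k * decomp_value \<alpha> L"
    if "C Y" "m - m / 2 * \<gamma> ^ k \<le> Re (mtrace Y)" "joint_decomp n L Y A" for Y L k
    using that
  proof (induction k arbitrary: Y L)
    case 0
    then show ?case by auto
  next
    case (Suc k)
    obtain Y' L' where Y': "C Y'" "m - m / 2 * \<gamma> ^ Suc k / \<gamma> \<le> Re (mtrace Y')" "joint_decomp n L' Y' A" "decomp_value \<alpha> L' \<le> \<theta> * decomp_value \<alpha> L"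
      using step[OF Suc.prems(1,2) _ Suc.prems(3)] m0 \<gamma> by auto
    then have "m - m / 2 * \<gamma> ^ k \<le> Re (mtrace Y')" using \<gamma>(1) by simp
    from Suc.IH[OF Y'(1) this Y'(3)] obtain Y'' L'' where Y'': "C Y''" "m - m / 2 \<le> Re (mtrace Y'')" "joint_decomp n L'' Y'' A"
      "decomp_value \<alpha> L'' \<le> \<theta> ^ k * decomp_value \<alpha> L'" by blast
    have "\<theta> ^ k * decomp_value \<alpha> L' \<le> \<theta> ^ k * (\<theta> * decomp_value \<alpha> L)" using Y'(4) \<theta> by (intro mult_left_mono) auto
    then show ?case using Y'' by (intro exI[of _ Y''] exI[of _ L'']) (auto simp: mult_ac)
  qed
  \<comment> \<open>The starting part of \<open>B\<close> depends on the number of steps, but its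
    value is bounded by \<open>C0\<close> throughout, since the multiple of \<open>A\<close> above
    it can be chosen from \<open>A\<close> alone.\<close>
  obtain \<mu> where \<mu>: "\<mu> > 0"
    "\<And>Y c. psd n Y \<Longrightarrow> psd n (complex_of_real c \<cdot>\<^sub>m A - Y) \<Longrightarrow> Re (mtrace Y) \<le> 1 \<Longrightarrow> psd n (complex_of_real (1 / \<mu>) \<cdot>\<^sub>m A - Y)"
    using psd_le_uniform[OF A(1)] by blast
  define C0 where "C0 = (1 / \<mu>) powr (\<alpha> - 1)"
  have C0: "C0 > 0" using \<mu> by (simp add: C0_def)
  obtain k where k: "\<theta> ^ k < (m / 2) powr \<alpha> / C0" using real_arch_pow_inv[of "(m / 2) powr \<alpha> / C0" \<theta>] \<theta> C0 m0 by auto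
  obtain Y where Y: "C Y" "m - m / 2 * \<gamma> ^ k \<le> Re (mtrace Y)" using near[of "m / 2 * \<gamma> ^ k"] m0 \<gamma> by auto
  obtain L where L: "joint_decomp n L Y A" "decomp_value \<alpha> L = C0 * Re (mtrace Y)"
    using joint_decomp_of_le[of n Y A "1 / \<mu>" \<alpha>] \<mu> Y(1) trC[OF Y(1)] Ac \<alpha> unfolding C_def C0_def by auto
  obtain Y' L' where Y': "C Y'" "m - m / 2 \<le> Re (mtrace Y')" "joint_decomp n L' Y' A" "decomp_value \<alpha> L' \<le> \<theta> ^ k * decomp_value \<alpha> L"
    using iter[OF Y L(1)] by blast
  define x where "x = Re (mtrace Y')"
  have x: "x \<ge> m / 2" "x > 0" using Y'(2) m0 by (auto simp: x_def)
  have "(m / 2) powr \<alpha> \<le> x powr \<alpha>" using x m0 \<alpha> by (intro powr_mono2) auto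
  \<comment> \<open>This is the tangent bound at the ratio of the traces, which are \<open>x\<close>
    and 1.\<close>
  also have "\<dots> = \<alpha> * x powr (\<alpha> - 1) * x + (1 - \<alpha>) * x powr \<alpha> * 1"
    using x by (simp add: powr_diff algebra_simps)
  also have "\<dots> \<le> decomp_value \<alpha> L'"
    using decomp_value_bounds(1)[OF Y'(3) x(2) \<alpha>] A(2) by (simp add: x_def)
  also have "\<dots> \<le> \<theta> ^ k * C0"
    using Y'(4) L(2) trC[OF Y(1)] C0 \<theta> by (smt (verit) mult_left_le mult_left_mono zero_le_power less_imp_le)
  also have "\<dots> < (m / 2) powr \<alpha>" using k C0 by (simp add: pos_less_divide_eq)
  finally show False by simp
qed

subsection \<open>Channels with a catalyst\<close>

lemma sum_prod_index: "(\<Sum>x<d * n. f x) = (\<Sum>a<d. \<Sum>r<n. f (a * n + r))" for f :: "nat \<Rightarrow> 'a :: comm_monoid_add"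
proof (induction d)
  case (Suc d)
  have "{..<Suc d * n} = {..<d * n} \<union> (\<lambda>r. d * n + r) ` {..<n}"
  proof (intro equalityI subsetI)
    fix x assume x: "x \<in> {..<Suc d * n}"
    show "x \<in> {..<d * n} \<union> (\<lambda>r. d * n + r) ` {..<n}"
    proof (cases "x < d * n")
      case False
      then have "x = d * n + (x - d * n)" "x - d * n < n" using x by auto
      then show ?thesis by blast
    qed simp
  qed auto
  then have "(\<Sum>x<Suc d * n. f x) = (\<Sum>x<d * n. f x) + sum f ((\<lambda>r. d * n + r) ` {..<n})"
    by (simp only:) (rule sum.union_disjoint; auto)
  also have "sum f ((\<lambda>r. d * n + r) ` {..<n}) = (\<Sum>r<n. f (d * n + r))"
    by (subst sum.reindex) (auto simp: inj_on_def)
  finally show ?case using Suc by simp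
qed simp

lemma prod_index_less: "a < d \<Longrightarrow> r < n \<Longrightarrow> a * n + r < d * n" for a d r n :: nat
proof -
  assume "a < d" "r < n"
  then have "a * n + r < Suc a * n" by simp
  also have "\<dots> \<le> d * n" using \<open>a < d\<close> by (intro mult_le_mono1) simp
  finally show ?thesis .
qed

lemma kron_carrier: "A \<in> carrier_mat d d \<Longrightarrow> B \<in> carrier_mat n n \<Longrightarrow> kron A B \<in> carrier_mat (d * n) (d * n)"
  by (simp add: kron_def)

lemma kron_index:
  assumes "A \<in> carrier_mat d d" "B \<in> carrier_mat n n" "a < d" "b < d" "r < n" "s < n"
  shows "kron A B $$ (a * n + r, b * n + s) = A $$ (a, b) * B $$ (r, s)"
  using assms prod_index_less[OF assms(3,5)] prod_index_less[OF assms(4,6)] by (simp add: kron_def)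

lemma kron_index':
  assumes "A \<in> carrier_mat d d" "B \<in> carrier_mat n n" "i < d * n" "j < d * n"
  shows "kron A B $$ (i, j) = A $$ (i div n, j div n) * B $$ (i mod n, j mod n)"
  using assms by (simp add: kron_def)

lemma div_mod_less: "i < d * n \<Longrightarrow> i div n < d \<and> i mod n < n" for i d n :: nat
  by (metis less_mult_imp_div_less mod_less_divisor mult_0_right not_gr_zero not_less_zero)

lemma mtrace_kron:
  assumes "A \<in> carrier_mat d d" "B \<in> carrier_mat n n"
  shows "mtrace (kron A B) = mtrace A * mtrace B"
proof -
  have "mtrace (kron A B) = (\<Sum>a<d. \<Sum>r<n. kron A B $$ (a * n + r, a * n + r))"
    unfolding mtrace_def carrier_matD(1)[OF kron_carrier[OF assms]] by (rule sum_prod_index)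
  also have "\<dots> = (\<Sum>a<d. \<Sum>r<n. A $$ (a, a) * B $$ (r, r))"
    by (intro sum.cong refl) (simp add: kron_index[OF assms])
  finally show ?thesis using assms by (simp add: mtrace_def sum_product)
qed

lemma qform_prod_index:
  "qform (d * n) X u = (\<Sum>a<d. \<Sum>r<n. \<Sum>b<d. \<Sum>s<n. X $$ (a * n + r, b * n + s) * u (b * n + s) * cnj (u (a * n + r)))"
  unfolding qform_def sum_prod_index ..

lemma sum_reorder4:
  "(\<Sum>a<d. \<Sum>r<n. \<Sum>b<d. \<Sum>s<n. G a r b s) = (\<Sum>r<n. \<Sum>s<n. \<Sum>a<d. \<Sum>b<d. G a r b s)"
  for G :: "nat \<Rightarrow> nat \<Rightarrow> nat \<Rightarrow> nat \<Rightarrow> 'a :: comm_monoid_add"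
proof -
  have "(\<Sum>a<d. \<Sum>r<n. \<Sum>b<d. \<Sum>s<n. G a r b s) = (\<Sum>r<n. \<Sum>a<d. \<Sum>b<d. \<Sum>s<n. G a r b s)" by (rule sum.swap)
  also have "\<dots> = (\<Sum>r<n. \<Sum>a<d. \<Sum>s<n. \<Sum>b<d. G a r b s)" by (intro sum.cong refl sum.swap)
  also have "\<dots> = (\<Sum>r<n. \<Sum>s<n. \<Sum>a<d. \<Sum>b<d. G a r b s)" by (intro sum.cong refl sum.swap)
  finally show ?thesis .
qed

definition rank_one :: "nat \<Rightarrow> complex Matrix.vec \<Rightarrow> complex Matrix.mat" where
  "rank_one d v = Matrix.mat d d (\<lambda>(a, b). v $ a * cnj (v $ b))"

lemma rank_one_carrier [simp]: "rank_one d v \<in> carrier_mat d d"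
  by (simp add: rank_one_def)

lemma psd_kron_rank_one:
  assumes Y: "psd n Y"
  shows "psd (d * n) (kron (rank_one d v) Y)"
  unfolding psd_iff
proof (intro conjI allI impI)
  note Yc = psd_carrier[OF Y]
  show "kron (rank_one d v) Y \<in> carrier_mat (d * n) (d * n)" by (rule kron_carrier[OF rank_one_carrier Yc])
  fix i j assume ij: "i < d * n" "j < d * n"
  show "cnj (kron (rank_one d v) Y $$ (j, i)) = kron (rank_one d v) Y $$ (i, j)"
    unfolding kron_index'[OF rank_one_carrier Yc ij] kron_index'[OF rank_one_carrier Yc ij(2,1)]
    using div_mod_less[OF ij(1)] div_mod_less[OF ij(2)] psd_herm[OF Y, of "i mod n" "j mod n"]
    by (simp add: rank_one_def mult.commute)
next
  fix u
  note Yc = psd_carrier[OF Y]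
  have "qform (d * n) (kron (rank_one d v) Y) u =
    (\<Sum>a<d. \<Sum>r<n. \<Sum>b<d. \<Sum>s<n. Y $$ (r, s) * (cnj (v $ b) * u (b * n + s)) * cnj (cnj (v $ a) * u (a * n + r)))"
    unfolding qform_prod_index
    by (intro sum.cong refl) (simp add: kron_index[OF rank_one_carrier Yc], simp add: rank_one_def mult_ac)
  also have "\<dots> = (\<Sum>r<n. \<Sum>s<n. \<Sum>a<d. \<Sum>b<d. Y $$ (r, s) * (cnj (v $ b) * u (b * n + s)) * cnj (cnj (v $ a) * u (a * n + r)))"
    by (rule sum_reorder4)
  also have "\<dots> = qform n Y (\<lambda>s. \<Sum>b<d. cnj (v $ b) * u (b * n + s))"
    unfolding qform_def
  proof (intro sum.cong refl)
    fix r s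
    have "(\<Sum>a<d. \<Sum>b<d. Y $$ (r, s) * (cnj (v $ b) * u (b * n + s)) * cnj (cnj (v $ a) * u (a * n + r))) =
      (\<Sum>a<d. (Y $$ (r, s) * (\<Sum>b<d. cnj (v $ b) * u (b * n + s))) * cnj (cnj (v $ a) * u (a * n + r)))"
      by (simp only: sum_distrib_left sum_distrib_right)
    then show "(\<Sum>a<d. \<Sum>b<d. Y $$ (r, s) * (cnj (v $ b) * u (b * n + s)) * cnj (cnj (v $ a) * u (a * n + r))) =
      Y $$ (r, s) * (\<Sum>b<d. cnj (v $ b) * u (b * n + s)) * cnj (\<Sum>a<d. cnj (v $ a) * u (a * n + r))"
      by (simp only: cnj_sum sum_distrib_left)
  qed
  finally show "0 \<le> Re (qform (d * n) (kron (rank_one d v) Y) u)" using Y by (simp add: psd_iff)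
qed

text \<open>The unnormalized catalyst operator left when the first factor of \<open>X\<close> is
  found in the pure state \<open>v\<close>.\<close>

definition compress :: "nat \<Rightarrow> nat \<Rightarrow> complex Matrix.vec \<Rightarrow> complex Matrix.mat \<Rightarrow> complex Matrix.mat" where
  "compress d n v X = Matrix.mat n n (\<lambda>(r, s). \<Sum>a<d. \<Sum>b<d. cnj (v $ a) * X $$ (a * n + r, b * n + s) * v $ b)"

lemma compress_carrier [simp]: "compress d n v X \<in> carrier_mat n n"
  by (simp add: compress_def)

lemma compress_index:
  "r < n \<Longrightarrow> s < n \<Longrightarrow> compress d n v X $$ (r, s) = (\<Sum>a<d. \<Sum>b<d. cnj (v $ a) * X $$ (a * n + r, b * n + s) * v $ b)"
  by (simp add: compress_def)

lemma psd_compress: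
  assumes X: "psd (d * n) X"
  shows "psd n (compress d n v X)"
  unfolding psd_iff
proof (intro conjI allI impI)
  fix r s assume rs: "r < n" "s < n"
  have hX: "cnj (X $$ (a * n + s, b * n + r)) = X $$ (b * n + r, a * n + s)" if "a < d" "b < d" for a b
    by (rule psd_herm[OF X prod_index_less prod_index_less, symmetric]) (use that rs in auto)
  have "cnj (compress d n v X $$ (s, r)) = (\<Sum>a<d. \<Sum>b<d. cnj (v $ b) * X $$ (b * n + r, a * n + s) * v $ a)"
    unfolding compress_index[OF rs(2,1)] cnj_sum by (intro sum.cong refl) (simp add: hX)
  also have "\<dots> = compress d n v X $$ (r, s)"
    unfolding compress_index[OF rs] by (rule sum.swap)
  finally show "cnj (compress d n v X $$ (s, r)) = compress d n v X $$ (r, s)" .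
next
  fix u
  have "qform n (compress d n v X) u = (\<Sum>r<n. \<Sum>s<n. \<Sum>a<d. \<Sum>b<d. X $$ (a * n + r, b * n + s) * (v $ b * u s) * cnj (v $ a * u r))"
    unfolding qform_def
    by (intro sum.cong refl) (simp add: compress_index sum_distrib_right, simp add: mult_ac)
  also have "\<dots> = (\<Sum>a<d. \<Sum>r<n. \<Sum>b<d. \<Sum>s<n. X $$ (a * n + r, b * n + s) * (v $ b * u s) * cnj (v $ a * u r))"
    by (rule sum_reorder4[symmetric])
  also have "\<dots> = qform (d * n) X (\<lambda>x. v $ (x div n) * u (x mod n))"
    unfolding qform_prod_index by (intro sum.cong refl) simp
  finally show "0 \<le> Re (qform n (compress d n v X) u)" using X by (simp add: psd_iff)
qed simp

lemma mtrace_compress: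
  assumes h: "orthonormal_basis d h" and X: "X \<in> carrier_mat (d * n) (d * n)"
  shows "(\<Sum>i<d. mtrace (compress d n (h i) X)) = mtrace X"
proof -
  have comp: "(\<Sum>i<d. cnj (h i $ a) * h i $ b) = (if a = b then 1 else 0)" if "a < d" "b < d" for a b
  proof -
    have "(\<Sum>i<d. cnj (h i $ a) * h i $ b) = spectral_sum d h (\<lambda>_. 1) $$ (b, a)"
      using that by (simp add: spectral_sum_index mult.commute)
    then show ?thesis unfolding orthonormal_basis_complete[OF h] using that by auto
  qed
  have "(\<Sum>i<d. mtrace (compress d n (h i) X)) = (\<Sum>i<d. \<Sum>r<n. \<Sum>a<d. \<Sum>b<d. cnj (h i $ a) * X $$ (a * n + r, b * n + r) * h i $ b)"
    unfolding mtrace_def carrier_matD(1)[OF compress_carrier] by (intro sum.cong refl) (simp add: compress_index)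
  also have "\<dots> = (\<Sum>r<n. \<Sum>i<d. \<Sum>a<d. \<Sum>b<d. cnj (h i $ a) * X $$ (a * n + r, b * n + r) * h i $ b)" by (rule sum.swap)
  also have "\<dots> = (\<Sum>r<n. \<Sum>a<d. X $$ (a * n + r, a * n + r))"
  proof (rule sum.cong[OF refl])
    fix r
    have "(\<Sum>i<d. \<Sum>a<d. \<Sum>b<d. cnj (h i $ a) * X $$ (a * n + r, b * n + r) * h i $ b) =
      (\<Sum>a<d. \<Sum>i<d. \<Sum>b<d. cnj (h i $ a) * X $$ (a * n + r, b * n + r) * h i $ b)" by (rule sum.swap)
    also have "\<dots> = (\<Sum>a<d. \<Sum>b<d. \<Sum>i<d. cnj (h i $ a) * X $$ (a * n + r, b * n + r) * h i $ b)"
      by (intro sum.cong refl sum.swap)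
    also have "\<dots> = (\<Sum>a<d. \<Sum>b<d. if a = b then X $$ (a * n + r, a * n + r) else 0)"
    proof (intro sum.cong refl)
      fix a b assume ab: "a \<in> {..<d}" "b \<in> {..<d}"
      have "(\<Sum>i<d. cnj (h i $ a) * X $$ (a * n + r, b * n + r) * h i $ b) = X $$ (a * n + r, b * n + r) * (\<Sum>i<d. cnj (h i $ a) * h i $ b)"
        by (simp add: sum_distrib_left mult_ac)
      then show "(\<Sum>i<d. cnj (h i $ a) * X $$ (a * n + r, b * n + r) * h i $ b) = (if a = b then X $$ (a * n + r, a * n + r) else 0)"
        using comp ab by simp
    qed
    finally show "(\<Sum>i<d. \<Sum>a<d. \<Sum>b<d. cnj (h i $ a) * X $$ (a * n + r, b * n + r) * h i $ b) = (\<Sum>a<d. X $$ (a * n + r, a * n + r))"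
      by simp
  qed
  also have "\<dots> = mtrace X"
    unfolding mtrace_def carrier_matD(1)[OF X] sum_prod_index by (rule sum.swap)
  finally show ?thesis .
qed

lemma channel_psd:
  assumes \<Phi>: "channel m m \<Phi>" and X: "psd m X"
  shows "psd m (\<Phi> X)"
proof -
  note Xc = psd_carrier[OF X]
  have lin: "linear_map_mat m m \<Phi>" and cp: "completely_positive m m \<Phi>" using \<Phi> by (auto simp: channel_def)
  have c: "\<Phi> X \<in> carrier_mat m m" using lin Xc by (simp add: linear_map_mat_def)
  have b: "mat_block m X 0 0 = X" using Xc by (intro eq_matI) (auto simp: mat_block_def)
  have "ampliation 1 m m \<Phi> X = \<Phi> X" using c b by (intro eq_matI) (auto simp: ampliation_def)
  then show ?thesis using cp X unfolding completely_positive_def by (metis mult_1)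
qed

text \<open>Each entry is the channel on a \<open>rank_one\<close> input followed by a compression,
  hence positive, and the outcomes in an orthonormal basis exhaust the trace. Coherences of the
  output are discarded, as only diagonal weights are compared.\<close>

lemma channel_positive_family:
  assumes h: "orthonormal_basis d h" and \<Phi>: "channel (d * n) (d * n) \<Phi>"
  shows "positive_family d n (\<lambda>i j Y. compress d n (h i) (\<Phi> (kron (rank_one d (h j)) Y)))"
  unfolding positive_family_def
proof (intro conjI allI impI ballI)
  have lin: "linear_map_mat (d * n) (d * n) \<Phi>" using \<Phi> by (simp add: channel_def)
  fix i j assume "i < d" "j < d"
  show "linear_map_mat n n (\<lambda>Y. compress d n (h i) (\<Phi> (kron (rank_one d (h j)) Y)))"
    unfolding linear_map_mat_def
  proof (intro conjI ballI allI)
    fix A B :: "complex Matrix.mat" and c assume A: "A \<in> carrier_mat n n" and B: "B \<in> carrier_mat n n"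
    note kA = kron_carrier[OF rank_one_carrier[of d "h j"] A] and kB = kron_carrier[OF rank_one_carrier[of d "h j"] B]
    have "kron (rank_one d (h j)) (A + B) = kron (rank_one d (h j)) A + kron (rank_one d (h j)) B"
      using kA kB A B div_mod_less rank_one_carrier[of d "h j"] by (intro eq_matI) (auto simp: kron_def distrib_left)
    then have e: "\<Phi> (kron (rank_one d (h j)) (A + B)) = \<Phi> (kron (rank_one d (h j)) A) + \<Phi> (kron (rank_one d (h j)) B)"
      using lin kA kB by (simp add: linear_map_mat_def)
    have cA: "\<Phi> (kron (rank_one d (h j)) A) \<in> carrier_mat (d * n) (d * n)" and cB: "\<Phi> (kron (rank_one d (h j)) B) \<in> carrier_mat (d * n) (d * n)"
      using lin kA kB by (auto simp: linear_map_mat_def)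
    show "compress d n (h i) (\<Phi> (kron (rank_one d (h j)) (A + B))) =
      compress d n (h i) (\<Phi> (kron (rank_one d (h j)) A)) + compress d n (h i) (\<Phi> (kron (rank_one d (h j)) B))"
      unfolding e using cA cB prod_index_less by (intro eq_matI) (auto simp: compress_def algebra_simps sum.distrib)
    show "compress d n (h i) (\<Phi> (kron (rank_one d (h j)) A)) \<in> carrier_mat n n" by simp
  next
    fix A :: "complex Matrix.mat" and c assume A: "A \<in> carrier_mat n n"
    note kA = kron_carrier[OF rank_one_carrier[of d "h j"] A]
    have "kron (rank_one d (h j)) (c \<cdot>\<^sub>m A) = c \<cdot>\<^sub>m kron (rank_one d (h j)) A"
      using kA A div_mod_less rank_one_carrier[of d "h j"] by (intro eq_matI) (auto simp: kron_def)
    then have e: "\<Phi> (kron (rank_one d (h j)) (c \<cdot>\<^sub>m A)) = c \<cdot>\<^sub>m \<Phi> (kron (rank_one d (h j)) A)"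
      using lin kA by (simp add: linear_map_mat_def)
    have cA: "\<Phi> (kron (rank_one d (h j)) A) \<in> carrier_mat (d * n) (d * n)" using lin kA by (auto simp: linear_map_mat_def)
    show "compress d n (h i) (\<Phi> (kron (rank_one d (h j)) (c \<cdot>\<^sub>m A))) = c \<cdot>\<^sub>m compress d n (h i) (\<Phi> (kron (rank_one d (h j)) A))"
      unfolding e using cA prod_index_less by (intro eq_matI) (auto simp: compress_def sum_distrib_left mult_ac)
  qed
  show "psd n (compress d n (h i) (\<Phi> (kron (rank_one d (h j)) Y)))" if "psd n Y" for Y
    by (intro psd_compress channel_psd[OF \<Phi>] psd_kron_rank_one that)
next
  have lin: "linear_map_mat (d * n) (d * n) \<Phi>" using \<Phi> by (simp add: channel_def)
  fix j and Y :: "complex Matrix.mat" assume j: "j < d" and Y: "Y \<in> carrier_mat n n"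
  note kY = kron_carrier[OF rank_one_carrier[of d "h j"] Y]
  have "mtrace (rank_one d (h j)) = 1"
    using onb_sum[OF h j j] by (simp add: mtrace_def rank_one_def)
  then have "mtrace (\<Phi> (kron (rank_one d (h j)) Y)) = mtrace Y"
    using \<Phi> kY mtrace_kron[OF rank_one_carrier Y, of d "h j"] by (simp add: channel_def)
  moreover have "\<Phi> (kron (rank_one d (h j)) Y) \<in> carrier_mat (d * n) (d * n)" using lin kY by (auto simp: linear_map_mat_def)
  ultimately show "(\<Sum>i<d. mtrace (compress d n (h i) (\<Phi> (kron (rank_one d (h j)) Y)))) = mtrace Y"
    using mtrace_compress[OF h] by simp
qed

text \<open>A diagonal input is a mixture of the \<open>rank_one\<close> inputs, and linearity
  applies. On the output side only the diagonal of \<open>S\<close> survives; thus the approximating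
  state may have coherences in the energy eigenbasis.\<close>

lemma channel_family_eq:
  assumes h: "orthonormal_basis d h" and \<Phi>: "channel (d * n) (d * n) \<Phi>"
    and T: "T \<in> carrier_mat n n" and S: "S \<in> carrier_mat d d"
    and eq: "\<Phi> (kron (spectral_sum d h p) T) = kron S T" and rs: "r < n" "s < n"
  shows "(\<Sum>j<d. complex_of_real (p j) * compress d n (h i) (\<Phi> (kron (rank_one d (h j)) T)) $$ (r, s)) =
    qform d S (\<lambda>a. h i $ a) * T $$ (r, s)"
proof -
  have lin: "linear_map_mat (d * n) (d * n) \<Phi>" using \<Phi> by (simp add: channel_def)
  define L where "L = map (\<lambda>j. (complex_of_real (p j), kron (rank_one d (h j)) T)) [0..<d]"
  have kT: "kron (rank_one d (h j)) T \<in> carrier_mat (d * n) (d * n)" for j by (rule kron_carrier[OF rank_one_carrier T])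
  have Lc: "w \<in> carrier_mat (d * n) (d * n)" if "(c, w) \<in> set L" for c w using that kT by (auto simp: L_def)
  have sl: "(\<Sum>x\<leftarrow>map f [0..<d]. G x) = (\<Sum>j<d. G (f j))" for f :: "nat \<Rightarrow> complex \<times> complex Matrix.mat" and G :: "_ \<Rightarrow> complex"
    by (simp add: comp_def interv_sum_list_conv_sum_set_nat atLeast0LessThan)
  have "kron (spectral_sum d h p) T = lincomb (d * n) L"
  proof (rule eq_matI)
    fix x y assume "x < dim_row (lincomb (d * n) L)" "y < dim_col (lincomb (d * n) L)"
    then have xy: "x < d * n" "y < d * n" using lincomb_carrier[of "d * n" L] by auto
    have "lincomb (d * n) L $$ (x, y) = (\<Sum>j<d. complex_of_real (p j) * kron (rank_one d (h j)) T $$ (x, y))"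
      using lincomb_index[OF Lc xy] by (simp only: L_def sl case_prod_conv)
    also have "\<dots> = kron (spectral_sum d h p) T $$ (x, y)"
      unfolding kron_index'[OF rank_one_carrier T xy] kron_index'[OF spectral_sum_carrier T xy]
      using div_mod_less[OF xy(1)] div_mod_less[OF xy(2)] by (simp add: spectral_sum_index rank_one_def sum_distrib_left mult_ac)
    finally show "kron (spectral_sum d h p) T $$ (x, y) = lincomb (d * n) L $$ (x, y)" by simp
  qed (use lincomb_carrier[of "d * n" L] kron_carrier[OF spectral_sum_carrier[of d h p] T] in auto)
  moreover have "\<Phi> (lincomb (d * n) L) = lincomb (d * n) (map (\<lambda>(c, w). (c, \<Phi> w)) L)"
    by (rule linear_map_lincomb[OF lin Lc])
  ultimately have e: "kron S T = lincomb (d * n) (map (\<lambda>j. (complex_of_real (p j), \<Phi> (kron (rank_one d (h j)) T))) [0..<d])"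
    using eq by (simp add: L_def comp_def)
  have idx: "kron S T $$ (x, y) = (\<Sum>j<d. complex_of_real (p j) * \<Phi> (kron (rank_one d (h j)) T) $$ (x, y))"
    if xy: "x < d * n" "y < d * n" for x y
  proof -
    have "w \<in> carrier_mat (d * n) (d * n)" if "(c, w) \<in> set (map (\<lambda>j. (complex_of_real (p j), \<Phi> (kron (rank_one d (h j)) T))) [0..<d])" for c w
      using that lin kT by (auto simp: linear_map_mat_def)
    from lincomb_index[OF this xy] show ?thesis unfolding e by (simp only: sl case_prod_conv)
  qed
  have "(\<Sum>j<d. complex_of_real (p j) * compress d n (h i) (\<Phi> (kron (rank_one d (h j)) T)) $$ (r, s)) =
    (\<Sum>a<d. \<Sum>b<d. cnj (h i $ a) * (\<Sum>j<d. complex_of_real (p j) * \<Phi> (kron (rank_one d (h j)) T) $$ (a * n + r, b * n + s)) * h i $ b)"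
  proof -
    have "(\<Sum>j<d. complex_of_real (p j) * compress d n (h i) (\<Phi> (kron (rank_one d (h j)) T)) $$ (r, s)) =
      (\<Sum>j<d. \<Sum>a<d. \<Sum>b<d. cnj (h i $ a) * (complex_of_real (p j) * \<Phi> (kron (rank_one d (h j)) T) $$ (a * n + r, b * n + s)) * h i $ b)"
      unfolding compress_index[OF rs] by (simp add: sum_distrib_left mult_ac)
    also have "\<dots> = (\<Sum>a<d. \<Sum>j<d. \<Sum>b<d. cnj (h i $ a) * (complex_of_real (p j) * \<Phi> (kron (rank_one d (h j)) T) $$ (a * n + r, b * n + s)) * h i $ b)" by (rule sum.swap)
    also have "\<dots> = (\<Sum>a<d. \<Sum>b<d. \<Sum>j<d. cnj (h i $ a) * (complex_of_real (p j) * \<Phi> (kron (rank_one d (h j)) T) $$ (a * n + r, b * n + s)) * h i $ b)"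
      by (intro sum.cong refl sum.swap)
    finally show ?thesis by (simp only: sum_distrib_left sum_distrib_right)
  qed
  also have "\<dots> = (\<Sum>a<d. \<Sum>b<d. (S $$ (a, b) * h i $ b * cnj (h i $ a)) * T $$ (r, s))"
    by (intro sum.cong refl) (use idx[symmetric] prod_index_less rs kron_index[OF S T _ _ rs] in \<open>simp add: mult_ac\<close>)
  also have "\<dots> = qform d S (\<lambda>a. h i $ a) * T $$ (r, s)" by (simp add: qform_def sum_distrib_right)
  finally show ?thesis .
qed

text \<open>With probability \<epsilon> the outcome is resampled from \<open>g\<close>. Positive
  \<open>g\<close> and \<epsilon> make all output weights positive, while output weights equal to
  \<open>g\<close> are unchanged.\<close>

lemma positive_family_mix:
  assumes F: "positive_family d n F" and g: "\<And>i. i < d \<Longrightarrow> g i \<ge> 0" "(\<Sum>i<d. g i) = 1" and \<epsilon>: "0 \<le> \<epsilon>" "\<epsilon> \<le> 1"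
  shows "positive_family d n (\<lambda>i j Y. wsum d n (\<lambda>k. (if k = i then 1 - \<epsilon> else 0) + \<epsilon> * g i) (\<lambda>k. F k j Y))"
  unfolding positive_family_def
proof (intro conjI allI impI ballI)
  have lin: "linear_map_mat n n (F k j)" and pos: "psd n Y \<Longrightarrow> psd n (F k j Y)" if "k < d" "j < d" for k j Y
    using F that by (auto simp: positive_family_def)
  have Fc: "F k j A \<in> carrier_mat n n" if "k < d" "j < d" "A \<in> carrier_mat n n" for k j A
    using lin[OF that(1,2)] that(3) by (auto simp: linear_map_mat_def)
  fix i j assume i: "i < d" and j: "j < d"
  show "linear_map_mat n n (\<lambda>Y. wsum d n (\<lambda>k. (if k = i then 1 - \<epsilon> else 0) + \<epsilon> * g i) (\<lambda>k. F k j Y))"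
    unfolding linear_map_mat_def
  proof (intro conjI ballI allI)
    fix A B :: "complex Matrix.mat" assume A: "A \<in> carrier_mat n n" and B: "B \<in> carrier_mat n n"
    have "F k j (A + B) = F k j A + F k j B" if "k < d" for k using lin[OF that j] A B by (simp add: linear_map_mat_def)
    then show "wsum d n (\<lambda>k. (if k = i then 1 - \<epsilon> else 0) + \<epsilon> * g i) (\<lambda>k. F k j (A + B)) =
      wsum d n (\<lambda>k. (if k = i then 1 - \<epsilon> else 0) + \<epsilon> * g i) (\<lambda>k. F k j A) + wsum d n (\<lambda>k. (if k = i then 1 - \<epsilon> else 0) + \<epsilon> * g i) (\<lambda>k. F k j B)"
      using carrier_matD[OF Fc[OF _ j A]] carrier_matD[OF Fc[OF _ j B]]
      by (intro eq_matI) (auto simp: wsum_def distrib_left sum.distrib)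
  next
    fix A :: "complex Matrix.mat" and c assume A: "A \<in> carrier_mat n n"
    have "F k j (c \<cdot>\<^sub>m A) = c \<cdot>\<^sub>m F k j A" if "k < d" for k using lin[OF that j] A by (simp add: linear_map_mat_def)
    then show "wsum d n (\<lambda>k. (if k = i then 1 - \<epsilon> else 0) + \<epsilon> * g i) (\<lambda>k. F k j (c \<cdot>\<^sub>m A)) =
      c \<cdot>\<^sub>m wsum d n (\<lambda>k. (if k = i then 1 - \<epsilon> else 0) + \<epsilon> * g i) (\<lambda>k. F k j A)"
      using carrier_matD[OF Fc[OF _ j A]]
      by (intro eq_matI) (auto simp: wsum_def sum_distrib_left mult_ac intro!: sum.cong)
  qed simp
  show "psd n (wsum d n (\<lambda>k. (if k = i then 1 - \<epsilon> else 0) + \<epsilon> * g i) (\<lambda>k. F k j Y))" if "psd n Y" for Y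
    using g(1)[OF i] \<epsilon> by (intro psd_wsum pos[OF _ j that]) auto
next
  fix j and Y :: "complex Matrix.mat" assume j: "j < d" and Y: "Y \<in> carrier_mat n n"
  have Fc: "F k j Y \<in> carrier_mat n n" if "k < d" for k
    using F that j Y by (auto simp: positive_family_def linear_map_mat_def)
  have "(\<Sum>i<d. mtrace (wsum d n (\<lambda>k. (if k = i then 1 - \<epsilon> else 0) + \<epsilon> * g i) (\<lambda>k. F k j Y))) =
    (\<Sum>i<d. \<Sum>k<d. complex_of_real ((if k = i then 1 - \<epsilon> else 0) + \<epsilon> * g i) * mtrace (F k j Y))"
    by (intro sum.cong refl mtrace_wsum Fc)
  also have "\<dots> = (\<Sum>k<d. complex_of_real (\<Sum>i<d. (if k = i then 1 - \<epsilon> else 0) + \<epsilon> * g i) * mtrace (F k j Y))"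
    by (subst sum.swap) (simp only: of_real_sum sum_distrib_right)
  also have "\<dots> = (\<Sum>k<d. mtrace (F k j Y))"
    using g(2) by (intro sum.cong refl) (simp add: sum.distrib flip: sum_distrib_left)
  finally show "(\<Sum>i<d. mtrace (wsum d n (\<lambda>k. (if k = i then 1 - \<epsilon> else 0) + \<epsilon> * g i) (\<lambda>k. F k j Y))) = mtrace Y"
    using F j Y by (simp add: positive_family_def)
qed

lemma positive_family_mix_eq:
  assumes "\<And>k. k < d \<Longrightarrow> (\<Sum>j<d. complex_of_real (p j) * F k j A $$ (r, s)) = complex_of_real (q k) * A $$ (r, s)"
    and "i < d" "r < n" "s < n" "(\<Sum>k<d. q k) = 1"
  shows "(\<Sum>j<d. complex_of_real (p j) * wsum d n (\<lambda>k. (if k = i then 1 - \<epsilon> else 0) + \<epsilon> * g i) (\<lambda>k. F k j A) $$ (r, s)) =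
    complex_of_real ((1 - \<epsilon>) * q i + \<epsilon> * g i) * A $$ (r, s)"
proof -
  have "(\<Sum>j<d. complex_of_real (p j) * wsum d n (\<lambda>k. (if k = i then 1 - \<epsilon> else 0) + \<epsilon> * g i) (\<lambda>k. F k j A) $$ (r, s)) =
    (\<Sum>j<d. \<Sum>k<d. complex_of_real ((if k = i then 1 - \<epsilon> else 0) + \<epsilon> * g i) * (complex_of_real (p j) * F k j A $$ (r, s)))"
    by (intro sum.cong refl) (simp add: assms(3,4) sum_distrib_left mult_ac)
  also have "\<dots> = (\<Sum>k<d. complex_of_real ((if k = i then 1 - \<epsilon> else 0) + \<epsilon> * g i) * (complex_of_real (q k) * A $$ (r, s)))"
    by (subst sum.swap, intro sum.cong refl) (simp only: sum_distrib_left[symmetric] assms(1) lessThan_iff)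
  also have "\<dots> = complex_of_real (\<Sum>k<d. ((if k = i then 1 - \<epsilon> else 0) + \<epsilon> * g i) * q k) * A $$ (r, s)"
    by (simp add: sum_distrib_right mult.assoc)
  also have "(\<Sum>k<d. ((if k = i then 1 - \<epsilon> else 0) + \<epsilon> * g i) * q k) = (\<Sum>k<d. if k = i then (1 - \<epsilon>) * q i else 0) + \<epsilon> * g i * (\<Sum>k<d. q k)"
    unfolding sum_distrib_left sum.distrib[symmetric] by (intro sum.cong refl) (simp add: distrib_right)
  also have "\<dots> = (1 - \<epsilon>) * q i + \<epsilon> * g i" using assms(2,5) by simp
  finally show ?thesis .
qed

lemma psd_qform_real:
  assumes "psd n A"
  shows "qform n A v = complex_of_real (Re (qform n A v))"
proof -
  obtain h e where "A = spectral_sum n h e" using psd_spectral[OF assms] by metis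
  then show ?thesis by (simp only: qform_spectral_sum Re_complex_of_real)
qed

lemma sum_qform_onb:
  assumes h: "orthonormal_basis n h" and A: "A \<in> carrier_mat n n"
  shows "(\<Sum>i<n. qform n A (\<lambda>a. h i $ a)) = mtrace A"
proof -
  have "(\<Sum>i<n. qform n A (\<lambda>a. h i $ a)) = (\<Sum>a<n. \<Sum>i<n. \<Sum>b<n. A $$ (a, b) * h i $ b * cnj (h i $ a))"
    unfolding qform_def by (rule sum.swap)
  also have "\<dots> = (\<Sum>a<n. \<Sum>b<n. A $$ (a, b) * (\<Sum>i<n. h i $ b * cnj (h i $ a)))"
    by (subst sum.swap) (simp add: sum_distrib_left mult.assoc)
  also have "\<dots> = (\<Sum>a<n. \<Sum>b<n. if b = a then A $$ (a, a) else 0)"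
  proof (intro sum.cong refl)
    fix a b assume ab: "a \<in> {..<n}" "b \<in> {..<n}"
    have "(\<Sum>i<n. h i $ b * cnj (h i $ a)) = 1\<^sub>m n $$ (b, a)"
      using ab unfolding orthonormal_basis_complete[OF h, symmetric] by (simp add: spectral_sum_index)
    then show "A $$ (a, b) * (\<Sum>i<n. h i $ b * cnj (h i $ a)) = (if b = a then A $$ (a, a) else 0)" using ab by simp
  qed
  finally show ?thesis using A by (simp add: mtrace_def)
qed

text \<open>The diagonal of the approximating state may contain zeros, whereas transferring
  decompositions divides by the output weights; hence the regularization of \<open>q\<close> by
  \<open>g\<close>.\<close>

lemma channel_renyi_monotone:
  fixes h :: "nat \<Rightarrow> complex Matrix.vec"
  assumes h: "orthonormal_basis d h" and d: "0 < d" and \<Phi>: "channel (d * n) (d * n) \<Phi>"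
    and t1: "state n \<tau>1" and t2: "state n \<tau>2" and supp: "supp \<tau>1 \<subseteq> supp \<tau>2" and S: "state d \<sigma>'"
    and p: "\<And>i. i < d \<Longrightarrow> p i \<ge> 0" and g: "\<And>i. i < d \<Longrightarrow> g i > 0" "(\<Sum>i<d. g i) = 1"
    and eq1: "\<Phi> (kron (spectral_sum d h p) \<tau>1) = kron \<sigma>' \<tau>1"
    and eq2: "\<Phi> (kron (spectral_sum d h g) \<tau>2) = kron (spectral_sum d h g) \<tau>2"
    and \<epsilon>: "0 < \<epsilon>" "\<epsilon> < 1"
  defines "q \<equiv> \<lambda>i. (1 - \<epsilon>) * Re (qform d \<sigma>' (\<lambda>a. h i $ a)) + \<epsilon> * g i"
  shows "\<And>i. i < d \<Longrightarrow> q i > 0"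
    and "\<And>\<alpha>. \<alpha> > 1 \<Longrightarrow> (\<Sum>i<d. q i powr \<alpha> * g i powr (1 - \<alpha>)) \<le> (\<Sum>i<d. p i powr \<alpha> * g i powr (1 - \<alpha>))"
    and "\<And>\<alpha>. 0 < \<alpha> \<Longrightarrow> \<alpha> < 1 \<Longrightarrow> (\<Sum>i<d. p i powr \<alpha> * g i powr (1 - \<alpha>)) \<le> (\<Sum>i<d. q i powr \<alpha> * g i powr (1 - \<alpha>))"
    and "\<And>\<alpha>. \<alpha> > 1 \<Longrightarrow> (\<And>i. i < d \<Longrightarrow> p i > 0) \<Longrightarrow>
      (\<Sum>i<d. g i powr \<alpha> * q i powr (1 - \<alpha>)) \<le> (\<Sum>i<d. g i powr \<alpha> * p i powr (1 - \<alpha>))"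
proof -
  have P1: "psd n \<tau>1" "Re (mtrace \<tau>1) = 1" and P2: "psd n \<tau>2" "Re (mtrace \<tau>2) = 1" and PS: "psd d \<sigma>'" "Re (mtrace \<sigma>') = 1"
    using t1 t2 S by (auto simp: state_def)
  define q0 where "q0 i = Re (qform d \<sigma>' (\<lambda>a. h i $ a))" for i
  have q0: "q0 i \<ge> 0" for i using PS by (simp add: q0_def psd_iff)
  have q0sum: "(\<Sum>i<d. q0 i) = 1" unfolding q0_def using arg_cong[OF sum_qform_onb[OF h psd_carrier[OF PS(1)]], of Re] PS(2) by simp
  show qpos: "q i > 0" if "i < d" for i
    using q0[of i] g(1)[OF that] \<epsilon> unfolding q_def q0_def[symmetric] by (intro add_nonneg_pos) auto
  define F where "F = (\<lambda>i j Y. compress d n (h i) (\<Phi> (kron (rank_one d (h j)) Y)))"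
  have F: "positive_family d n F" unfolding F_def by (rule channel_positive_family[OF h \<Phi>])
  have e1: "(\<Sum>j<d. complex_of_real (p j) * F i j \<tau>1 $$ (r, s)) = complex_of_real (q0 i) * \<tau>1 $$ (r, s)"
    if "i < d" "r < n" "s < n" for i r s
    unfolding F_def channel_family_eq[OF h \<Phi> psd_carrier[OF P1(1)] psd_carrier[OF PS(1)] eq1 that(2,3)]
    using psd_qform_real[OF PS(1), of "\<lambda>a. h i $ a"] by (simp add: q0_def)
  have e2: "(\<Sum>j<d. complex_of_real (g j) * F i j \<tau>2 $$ (r, s)) = complex_of_real (g i) * \<tau>2 $$ (r, s)"
    if "i < d" "r < n" "s < n" for i r s
    unfolding F_def channel_family_eq[OF h \<Phi> psd_carrier[OF P2(1)] spectral_sum_carrier eq2 that(2,3)]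
      spectral_sum_eigenvalue[OF h that(1)] ..
  define F' where "F' = (\<lambda>i j Y. wsum d n (\<lambda>k. (if k = i then 1 - \<epsilon> else 0) + \<epsilon> * g i) (\<lambda>k. F k j Y))"
  have F': "positive_family d n F'" unfolding F'_def
    by (rule positive_family_mix[OF F]) (use g \<epsilon> in \<open>auto simp: less_imp_le\<close>)
  have f1: "(\<Sum>j<d. complex_of_real (p j) * F' i j \<tau>1 $$ (r, s)) = complex_of_real (q i) * \<tau>1 $$ (r, s)"
    if "i < d" "r < n" "s < n" for i r s
    unfolding F'_def q_def q0_def[symmetric] by (rule positive_family_mix_eq[where F = F and A = \<tau>1 and q = q0]) (use that q0sum e1 in auto)
  have f2: "(\<Sum>j<d. complex_of_real (g j) * F' i j \<tau>2 $$ (r, s)) = complex_of_real (g i) * \<tau>2 $$ (r, s)"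
    if "i < d" "r < n" "s < n" for i r s
  proof -
    have "(\<Sum>j<d. complex_of_real (g j) * F' i j \<tau>2 $$ (r, s)) = complex_of_real ((1 - \<epsilon>) * g i + \<epsilon> * g i) * \<tau>2 $$ (r, s)"
      unfolding F'_def by (rule positive_family_mix_eq[where F = F and A = \<tau>2 and q = g]) (use that g e2 in auto)
    then show ?thesis by (simp add: left_diff_distrib)
  qed
  obtain c where c: "c > 0" "psd n (complex_of_real c \<cdot>\<^sub>m \<tau>2 - \<tau>1)" using psd_le_of_supp[OF P1(1) P2(1) supp] by blast
  show "(\<Sum>i<d. q i powr \<alpha> * g i powr (1 - \<alpha>)) \<le> (\<Sum>i<d. p i powr \<alpha> * g i powr (1 - \<alpha>))" if "\<alpha> > 1" for \<alpha>
    by (rule positive_family_monotone(1)[OF F' d P1 P2 c p g(1) qpos f1 f2 that])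
  show "(\<Sum>i<d. p i powr \<alpha> * g i powr (1 - \<alpha>)) \<le> (\<Sum>i<d. q i powr \<alpha> * g i powr (1 - \<alpha>))" if "0 < \<alpha>" "\<alpha> < 1" for \<alpha>
    by (rule positive_family_monotone(2)[OF F' d P1 P2 c p g(1) qpos f1 f2 that])
  show "(\<Sum>i<d. g i powr \<alpha> * q i powr (1 - \<alpha>)) \<le> (\<Sum>i<d. g i powr \<alpha> * p i powr (1 - \<alpha>))"
    if "\<alpha> > 1" "\<And>i. i < d \<Longrightarrow> p i > 0" for \<alpha>
    by (rule positive_family_monotone_reverse[OF F' d P1 P2 c that(2) g qpos f1 f2 that(1)])
qed

subsection \<open>Measure-and-prepare channels\<close>

lemma sum_swap3: "(\<Sum>a\<in>A. \<Sum>b\<in>B. \<Sum>y\<in>C. F a b y) = (\<Sum>y\<in>C. \<Sum>a\<in>A. \<Sum>b\<in>B. F a b y)"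
proof -
  have "(\<Sum>a\<in>A. \<Sum>b\<in>B. \<Sum>y\<in>C. F a b y) = (\<Sum>a\<in>A. \<Sum>y\<in>C. \<Sum>b\<in>B. F a b y)"
    by (rule sum.cong[OF refl], rule sum.swap)
  also have "\<dots> = (\<Sum>y\<in>C. \<Sum>a\<in>A. \<Sum>b\<in>B. F a b y)" by (rule sum.swap)
  finally show ?thesis .
qed

lemma qform_blocks:
  "qform (k * n) M v = (\<Sum>a<k. \<Sum>b<k. \<Sum>r<n. \<Sum>s<n. M $$ (a * n + r, b * n + s) * v (b * n + s) * cnj (v (a * n + r)))"
  unfolding qform_def sum_prod_index by (rule sum.cong[OF refl], rule sum.swap)

text \<open>Measure in the basis \<open>k\<close>, pass the outcome through the kernel
  \<open>T\<close>, and prepare the corresponding basis state: an entanglement-breaking map.\<close>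

definition measure_prepare ::
    "nat \<Rightarrow> (nat \<Rightarrow> complex Matrix.vec) \<Rightarrow> (nat \<Rightarrow> nat \<Rightarrow> real) \<Rightarrow> complex Matrix.mat \<Rightarrow> complex Matrix.mat" where
  "measure_prepare n k T X = Matrix.mat n n (\<lambda>(a, b). \<Sum>y<n.
     (\<Sum>x<n. complex_of_real (T x y) * qform n X (\<lambda>a. k x $ a)) * k y $ a * cnj (k y $ b))"

lemma measure_prepare_carrier [simp]: "measure_prepare n k T X \<in> carrier_mat n n"
  by (simp add: measure_prepare_def)

lemma measure_prepare_index:
  "r < n \<Longrightarrow> s < n \<Longrightarrow> measure_prepare n k T X $$ (r, s) =
    (\<Sum>y<n. (\<Sum>x<n. complex_of_real (T x y) * qform n X (\<lambda>a. k x $ a)) * k y $ r * cnj (k y $ s))"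
  by (simp add: measure_prepare_def)

lemma linear_measure_prepare: "linear_map_mat n n (measure_prepare n k T)"
  unfolding linear_map_mat_def
proof (intro conjI ballI allI)
  fix A B :: "complex Matrix.mat" assume "A \<in> carrier_mat n n" "B \<in> carrier_mat n n"
  then show "measure_prepare n k T (A + B) = measure_prepare n k T A + measure_prepare n k T B"
    by (intro eq_matI) (auto simp: measure_prepare_def qform_add distrib_left distrib_right sum.distrib)
next
  fix A :: "complex Matrix.mat" and c assume "A \<in> carrier_mat n n"
  then show "measure_prepare n k T (c \<cdot>\<^sub>m A) = c \<cdot>\<^sub>m measure_prepare n k T A"
    by (intro eq_matI) (auto simp: measure_prepare_def qform_smult sum_distrib_left sum_distrib_right mult_ac)
qed simp

lemma mtrace_measure_prepare:
  assumes k: "orthonormal_basis n k" and T: "\<And>x. x < n \<Longrightarrow> (\<Sum>y<n. T x y) = 1" and X: "X \<in> carrier_mat n n"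
  shows "mtrace (measure_prepare n k T X) = mtrace X"
proof -
  define q where "q x = qform n X (\<lambda>a. k x $ a)" for x
  have "mtrace (measure_prepare n k T X) = (\<Sum>r<n. \<Sum>y<n. (\<Sum>x<n. complex_of_real (T x y) * q x) * (k y $ r * cnj (k y $ r)))"
    unfolding mtrace_def carrier_matD(1)[OF measure_prepare_carrier] q_def
    by (intro sum.cong refl) (simp add: measure_prepare_index mult.assoc)
  also have "\<dots> = (\<Sum>y<n. (\<Sum>x<n. complex_of_real (T x y) * q x) * (\<Sum>r<n. k y $ r * cnj (k y $ r)))"
    by (subst sum.swap) (simp only: sum_distrib_left)
  also have "\<dots> = (\<Sum>y<n. \<Sum>x<n. complex_of_real (T x y) * q x)"
    by (intro sum.cong refl) (simp add: onb_sum[OF k])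
  also have "\<dots> = (\<Sum>x<n. complex_of_real (\<Sum>y<n. T x y) * q x)"
    by (subst sum.swap) (simp add: sum_distrib_right)
  also have "\<dots> = mtrace X" using sum_qform_onb[OF k X] T by (simp add: q_def)
  finally show ?thesis .
qed

text \<open>The form of the ampliated output at \<open>v\<close> is a sum, with coefficients
  \<open>T x y \<ge> 0\<close>, of forms of \<open>X\<close> at the product vectors
  \<open>U y \<otimes> k x\<close>, where \<open>U y\<close> is the contraction of \<open>v\<close>
  with the basis vector \<open>k y\<close>.\<close>

lemma completely_positive_measure_prepare:
  assumes T: "\<And>x y. x < n \<Longrightarrow> y < n \<Longrightarrow> 0 \<le> T x y"
  shows "completely_positive n n (measure_prepare n k T)"
  unfolding completely_positive_def
proof (intro allI impI)
  fix m X assume X: "psd (m * n) X"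
  define Q where "Q x a b = qform n (mat_block n X a b) (\<lambda>a. k x $ a)" for x a b
  define c where "c y a b = (\<Sum>x<n. complex_of_real (T x y) * Q x a b)" for y a b
  let ?A = "ampliation m n n (measure_prepare n k T) X"
  have idx: "?A $$ (a * n + r, b * n + s) = (\<Sum>y<n. c y a b * k y $ r * cnj (k y $ s))"
    if "a < m" "b < m" "r < n" "s < n" for a b r s
    using that prod_index_less[OF that(1,3)] prod_index_less[OF that(2,4)]
    by (simp add: ampliation_def measure_prepare_index c_def Q_def)
  have Q_cnj: "cnj (Q x b a) = Q x a b" if ab: "a < m" "b < m" for x a b
  proof -
    have "cnj (Q x b a) = (\<Sum>r<n. \<Sum>s<n. mat_block n X a b $$ (s, r) * k x $ r * cnj (k x $ s))"
      unfolding Q_def qform_def cnj_sum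
    proof (intro sum.cong refl)
      fix r s assume "r \<in> {..<n}" "s \<in> {..<n}"
      then have "mat_block n X a b $$ (s, r) = cnj (mat_block n X b a $$ (r, s))"
        using psd_herm[OF X prod_index_less[OF ab(1)] prod_index_less[OF ab(2)], of s r] by (simp add: mat_block_def)
      then show "cnj (mat_block n X b a $$ (r, s) * k x $ s * cnj (k x $ r)) = mat_block n X a b $$ (s, r) * k x $ r * cnj (k x $ s)"
        by (simp add: mult_ac)
    qed
    also have "\<dots> = Q x a b" unfolding Q_def qform_def by (rule sum.swap)
    finally show ?thesis .
  qed
  have herm: "cnj (?A $$ (j, i)) = ?A $$ (i, j)" if ij: "i < m * n" "j < m * n" for i j
  proof -
    have "cnj (?A $$ (j div n * n + j mod n, i div n * n + i mod n)) = ?A $$ (i div n * n + i mod n, j div n * n + j mod n)"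
      using div_mod_less[OF ij(1)] div_mod_less[OF ij(2)] by (simp only: idx) (simp add: c_def Q_cnj mult_ac)
    then show ?thesis by simp
  qed
  have "0 \<le> Re (qform (m * n) ?A v)" for v
  proof -
    define U where "U y b = (\<Sum>s<n. v (b * n + s) * cnj (k y $ s))" for y b
    have sep: "(\<Sum>r<n. \<Sum>s<n. ?A $$ (a * n + r, b * n + s) * v (b * n + s) * cnj (v (a * n + r))) = (\<Sum>y<n. c y a b * U y b * cnj (U y a))"
      if ab: "a < m" "b < m" for a b
    proof -
      have "(\<Sum>r<n. \<Sum>s<n. ?A $$ (a * n + r, b * n + s) * v (b * n + s) * cnj (v (a * n + r))) =
        (\<Sum>r<n. \<Sum>s<n. \<Sum>y<n. c y a b * k y $ r * cnj (k y $ s) * v (b * n + s) * cnj (v (a * n + r)))"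
        by (intro sum.cong refl) (simp add: idx ab sum_distrib_right)
      also have "\<dots> = (\<Sum>y<n. \<Sum>r<n. \<Sum>s<n. c y a b * k y $ r * cnj (k y $ s) * v (b * n + s) * cnj (v (a * n + r)))" by (rule sum_swap3)
      also have "\<dots> = (\<Sum>y<n. c y a b * U y b * cnj (U y a))"
      proof (rule sum.cong[OF refl])
        fix y
        have "c y a b * U y b * cnj (U y a) = (\<Sum>r<n. c y a b * U y b * (cnj (v (a * n + r)) * k y $ r))"
          by (simp add: U_def[of y a] sum_distrib_left)
        also have "\<dots> = (\<Sum>r<n. \<Sum>s<n. c y a b * k y $ r * cnj (k y $ s) * v (b * n + s) * cnj (v (a * n + r)))"
          unfolding U_def sum_distrib_left sum_distrib_right by (intro sum.cong refl) (simp add: mult_ac)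
        finally show "(\<Sum>r<n. \<Sum>s<n. c y a b * k y $ r * cnj (k y $ s) * v (b * n + s) * cnj (v (a * n + r))) = c y a b * U y b * cnj (U y a)" ..
      qed
      finally show ?thesis .
    qed
    have Xw: "qform (m * n) X (\<lambda>i. U y (i div n) * k x $ (i mod n)) = (\<Sum>a<m. \<Sum>b<m. Q x a b * U y b * cnj (U y a))" for x y
      unfolding qform_blocks
    proof (intro sum.cong refl)
      fix a b assume "a \<in> {..<m}" "b \<in> {..<m}"
      have "Q x a b * U y b * cnj (U y a) = (\<Sum>r<n. \<Sum>s<n. X $$ (a * n + r, b * n + s) * k x $ s * cnj (k x $ r) * U y b * cnj (U y a))"
        unfolding Q_def qform_def sum_distrib_right by (intro sum.cong refl) (simp add: mat_block_def)
      then show "(\<Sum>r<n. \<Sum>s<n. X $$ (a * n + r, b * n + s) * (U y ((b * n + s) div n) * k x $ ((b * n + s) mod n)) *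
          cnj (U y ((a * n + r) div n) * k x $ ((a * n + r) mod n))) = Q x a b * U y b * cnj (U y a)"
        by (auto simp: mult_ac intro!: sum.cong)
    qed
    have "qform (m * n) ?A v = (\<Sum>a<m. \<Sum>b<m. \<Sum>y<n. c y a b * U y b * cnj (U y a))"
      unfolding qform_blocks by (intro sum.cong refl sep) auto
    also have "\<dots> = (\<Sum>y<n. \<Sum>a<m. \<Sum>b<m. c y a b * U y b * cnj (U y a))" by (rule sum_swap3)
    also have "\<dots> = (\<Sum>y<n. \<Sum>a<m. \<Sum>b<m. \<Sum>x<n. complex_of_real (T x y) * (Q x a b * U y b * cnj (U y a)))"
      by (intro sum.cong refl) (simp add: c_def sum_distrib_right mult.assoc)
    also have "\<dots> = (\<Sum>y<n. \<Sum>x<n. complex_of_real (T x y) * qform (m * n) X (\<lambda>i. U y (i div n) * k x $ (i mod n)))"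
      unfolding Xw sum_distrib_left by (intro sum.cong refl sum_swap3)
    finally have "Re (qform (m * n) ?A v) = (\<Sum>y<n. \<Sum>x<n. T x y * Re (qform (m * n) X (\<lambda>i. U y (i div n) * k x $ (i mod n))))" by simp
    also have "\<dots> \<ge> 0" using X T by (intro sum_nonneg mult_nonneg_nonneg) (auto simp: psd_iff)
    finally show ?thesis .
  qed
  with herm show "psd (m * n) ?A" unfolding psd_iff by (simp add: ampliation_def)
qed

lemma channel_measure_prepare:
  assumes "orthonormal_basis n k" "\<And>x y. x < n \<Longrightarrow> y < n \<Longrightarrow> 0 \<le> T x y" "\<And>x. x < n \<Longrightarrow> (\<Sum>y<n. T x y) = 1"
  shows "channel n n (measure_prepare n k T)"
  unfolding channel_def
proof (intro conjI ballI)
  show "completely_positive n n (measure_prepare n k T)" by (rule completely_positive_measure_prepare) (rule assms(2))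
  show "mtrace (measure_prepare n k T A) = mtrace A" if "A \<in> carrier_mat n n" for A
    by (rule mtrace_measure_prepare[OF assms(1) _ that]) (rule assms(3))
qed (rule linear_measure_prepare)

lemma measure_prepare_spectral_sum:
  assumes k: "orthonormal_basis n k"
  shows "measure_prepare n k T (spectral_sum n k P) = spectral_sum n k (\<lambda>y. \<Sum>x<n. P x * T x y)"
  by (intro eq_matI) (auto simp: measure_prepare_index spectral_sum_index spectral_sum_eigenvalue[OF k] spectral_sum_def[of n k "\<lambda>y. \<Sum>x<n. P x * T x y"] measure_prepare_def[of n k T "spectral_sum n k P"] mult_ac)

section \<open>Stochastic kernels as channels in a product basis\<close>

definition product_basis :: "nat \<Rightarrow> (nat \<Rightarrow> complex Matrix.vec) \<Rightarrow> nat \<Rightarrow> (nat \<Rightarrow> complex Matrix.vec) \<Rightarrow> nat \<Rightarrow> complex Matrix.vec" where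
  "product_basis d h n e x = vec (d * n) (\<lambda>a. h (x div n) $ (a div n) * e (x mod n) $ (a mod n))"

lemma product_basis_onb:
  assumes h: "orthonormal_basis d h" and e: "orthonormal_basis n e"
  shows "orthonormal_basis (d * n) (product_basis d h n e)"
  unfolding orthonormal_basis_def
proof (intro conjI allI impI)
  fix x y assume x: "x < d * n" and y: "y < d * n"
  have "product_basis d h n e x \<bullet>c product_basis d h n e y =
    (\<Sum>a<d * n. product_basis d h n e x $ a * cnj (product_basis d h n e y $ a))"
    by (rule cscalar_prod_sum) (simp_all add: product_basis_def)
  also have "\<dots> = (\<Sum>a<d. \<Sum>r<n. (h (x div n) $ a * cnj (h (y div n) $ a)) * (e (x mod n) $ r * cnj (e (y mod n) $ r)))"
    unfolding sum_prod_index by (intro sum.cong refl) (auto simp: product_basis_def prod_index_less mult_ac)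
  also have "\<dots> = (\<Sum>a<d. h (x div n) $ a * cnj (h (y div n) $ a)) * (\<Sum>r<n. e (x mod n) $ r * cnj (e (y mod n) $ r))"
    by (simp only: sum_product)
  also have "\<dots> = (if x div n = y div n \<and> x mod n = y mod n then 1 else 0)"
    using div_mod_less[OF x] div_mod_less[OF y] by (simp add: onb_sum[OF h] onb_sum[OF e])
  also have "(x div n = y div n \<and> x mod n = y mod n) \<longleftrightarrow> x = y" by (metis div_mult_mod_eq)
  finally show "product_basis d h n e x \<bullet>c product_basis d h n e y = (if x = y then 1 else 0)" .
qed (simp add: product_basis_def)

lemma kron_spectral_sum:
  "kron (spectral_sum d h p) (spectral_sum n e r) = spectral_sum (d * n) (product_basis d h n e) (\<lambda>x. p (x div n) * r (x mod n))"
proof (rule eq_matI)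
  fix i j assume "i < dim_row (spectral_sum (d * n) (product_basis d h n e) (\<lambda>x. p (x div n) * r (x mod n)))"
    "j < dim_col (spectral_sum (d * n) (product_basis d h n e) (\<lambda>x. p (x div n) * r (x mod n)))"
  then have ij: "i < d * n" "j < d * n" by (simp_all add: spectral_sum_def)
  note lt = div_mod_less[OF ij(1)] div_mod_less[OF ij(2)]
  have "spectral_sum (d * n) (product_basis d h n e) (\<lambda>x. p (x div n) * r (x mod n)) $$ (i, j) =
    (\<Sum>a<d. \<Sum>m<n. (complex_of_real (p a) * h a $ (i div n) * cnj (h a $ (j div n))) * (complex_of_real (r m) * e m $ (i mod n) * cnj (e m $ (j mod n))))"
    unfolding spectral_sum_index[OF ij] sum_prod_index using ij by (intro sum.cong refl) (simp add: product_basis_def mult_ac)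
  also have "\<dots> = kron (spectral_sum d h p) (spectral_sum n e r) $$ (i, j)"
    unfolding kron_index'[OF spectral_sum_carrier spectral_sum_carrier ij] using lt by (simp add: spectral_sum_index sum_product)
  finally show "kron (spectral_sum d h p) (spectral_sum n e r) $$ (i, j) =
    spectral_sum (d * n) (product_basis d h n e) (\<lambda>x. p (x div n) * r (x mod n)) $$ (i, j)" ..
qed (simp_all add: kron_def spectral_sum_def)

lemma unit_vec_onb: "orthonormal_basis n (unit_vec n :: nat \<Rightarrow> complex Matrix.vec)"
  unfolding orthonormal_basis_def
proof (intro conjI allI impI)
  fix i j assume "i < n" "j < n"
  then show "unit_vec n i \<bullet>c (unit_vec n j :: complex Matrix.vec) = (if i = j then 1 else 0)"
    by (subst cscalar_prod_sum[of _ n]) (auto simp: if_distrib cong: if_cong)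
qed simp

lemma channel_of_converts:
  assumes h: "orthonormal_basis d h" and e: "orthonormal_basis n e"
    and conv: "converts ({..<d} \<times> {..<n}) (\<lambda>(i, m). p i * r m) (\<lambda>(i, m). g i * s m)
      ({..<d} \<times> {..<n}) (\<lambda>(i, m). q i * r m) (\<lambda>(i, m). g i * s m)"
  obtains \<Phi> where "channel (d * n) (d * n) \<Phi>"
    "\<Phi> (kron (spectral_sum d h p) (spectral_sum n e r)) = kron (spectral_sum d h q) (spectral_sum n e r)"
    "\<Phi> (kron (spectral_sum d h g) (spectral_sum n e s)) = kron (spectral_sum d h g) (spectral_sum n e s)"
proof -
  obtain T where T: "\<And>x y. x \<in> {..<d} \<times> {..<n} \<Longrightarrow> y \<in> {..<d} \<times> {..<n} \<Longrightarrow> 0 \<le> T x y"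
    "\<And>x. x \<in> {..<d} \<times> {..<n} \<Longrightarrow> (\<Sum>y\<in>{..<d} \<times> {..<n}. T x y) = 1"
    "\<And>y. y \<in> {..<d} \<times> {..<n} \<Longrightarrow> (\<Sum>x\<in>{..<d} \<times> {..<n}. (case x of (i, m) \<Rightarrow> p i * r m) * T x y) = (case y of (i, m) \<Rightarrow> q i * r m)"
    "\<And>y. y \<in> {..<d} \<times> {..<n} \<Longrightarrow> (\<Sum>x\<in>{..<d} \<times> {..<n}. (case x of (i, m) \<Rightarrow> g i * s m) * T x y) = (case y of (i, m) \<Rightarrow> g i * s m)"
    using conv by (rule convertsE) blast
  define pair where "pair x = (x div n, x mod n)" for x
  have pair: "pair x \<in> {..<d} \<times> {..<n}" if "x < d * n" for x using div_mod_less[OF that] by (simp add: pair_def)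
  have sum_pair: "(\<Sum>x<d * n. f (pair x)) = (\<Sum>x\<in>{..<d} \<times> {..<n}. f x)" for f :: "_ \<Rightarrow> real"
  proof -
    have "(\<Sum>x<d * n. f (pair x)) = (\<Sum>a<d. \<Sum>r<n. f (a, r))"
      unfolding sum_prod_index by (intro sum.cong refl) (simp add: pair_def)
    then show ?thesis by (simp add: sum.cartesian_product)
  qed
  define k where "k = product_basis d h n e"
  define \<Phi> where "\<Phi> = measure_prepare (d * n) k (\<lambda>x y. T (pair x) (pair y))"
  have k: "orthonormal_basis (d * n) k" unfolding k_def by (rule product_basis_onb[OF h e])
  have channel: "channel (d * n) (d * n) \<Phi>" unfolding \<Phi>_def
  proof (rule channel_measure_prepare[OF k])
    show "(\<Sum>y<d * n. T (pair x) (pair y)) = 1" if "x < d * n" for x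
      unfolding sum_pair[of "T (pair x)"] by (rule T(2)[OF pair[OF that]])
  qed (rule T(1)[OF pair pair])
  have img: "\<Phi> (kron (spectral_sum d h a) (spectral_sum n e t)) = kron (spectral_sum d h b) (spectral_sum n e t)"
    if "\<And>y. y \<in> {..<d} \<times> {..<n} \<Longrightarrow> (\<Sum>x\<in>{..<d} \<times> {..<n}. (case x of (i, m) \<Rightarrow> a i * t m) * T x y) = (case y of (i, m) \<Rightarrow> b i * t m)" for a b t
    unfolding kron_spectral_sum k_def[symmetric] \<Phi>_def measure_prepare_spectral_sum[OF k]
  proof (rule spectral_sum_cong)
    fix y assume y: "y < d * n"
    have "(\<Sum>x<d * n. a (x div n) * t (x mod n) * T (pair x) (pair y)) = (\<Sum>x<d * n. (case pair x of (i, m) \<Rightarrow> a i * t m) * T (pair x) (pair y))"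
      by (simp add: pair_def)
    also have "\<dots> = b (y div n) * t (y mod n)" unfolding sum_pair[of "\<lambda>x. (case x of (i, m) \<Rightarrow> a i * t m) * T x (pair y)"] that[OF pair[OF y]] by (simp add: pair_def)
    finally show "(\<Sum>x<d * n. a (x div n) * t (x mod n) * T (pair x) (pair y)) = b (y div n) * t (y mod n)" .
  qed
  show ?thesis by (rule that[OF channel img[OF T(3)] img[OF T(4)]])
qed

subsection \<open>The order given by the free energies\<close>

text \<open>This supplies the relative entropies: the two power sums agree at order 1, so their
  inequality at larger orders passes to the derivatives there.\<close>

lemma has_derivative_le_right:
  fixes F G :: "real \<Rightarrow> real"
  assumes F: "(F has_real_derivative F') (at x)" and G: "(G has_real_derivative G') (at x)"
    and eq: "F x = G x" and le: "\<And>y. y > x \<Longrightarrow> F y \<le> G y"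
  shows "F' \<le> G'"
proof -
  have "((\<lambda>y. (F y - F x) / (y - x)) \<longlongrightarrow> F') (at_right x)" "((\<lambda>y. (G y - G x) / (y - x)) \<longlongrightarrow> G') (at_right x)"
    using has_field_derivative_at_within[OF F, of "{x<..}"] has_field_derivative_at_within[OF G, of "{x<..}"]
    by (simp_all add: has_field_derivative_iff)
  moreover have "\<forall>\<^sub>F y in at_right x. (F y - F x) / (y - x) \<le> (G y - G x) / (y - x)"
    using eventually_at_right_less[of x] by eventually_elim (auto intro!: divide_right_mono simp: eq le)
  ultimately show ?thesis by (intro tendsto_le[of "at_right x"]) auto
qed

lemma renyi_sum_derivative:
  fixes e f :: "nat \<Rightarrow> real"
  assumes "\<And>i. i < d \<Longrightarrow> e i \<ge> 0" "\<And>i. i < d \<Longrightarrow> f i > 0"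
  shows "((\<lambda>\<alpha>. \<Sum>i<d. e i powr \<alpha> * f i powr (1 - \<alpha>)) has_real_derivative (\<Sum>i<d. e i * (ln (e i) - ln (f i)))) (at 1)"
proof (rule DERIV_sum)
  fix i assume "i \<in> {..<d}"
  then have i: "e i \<ge> 0" "f i > 0" using assms by auto
  show "((\<lambda>\<alpha>. e i powr \<alpha> * f i powr (1 - \<alpha>)) has_real_derivative e i * (ln (e i) - ln (f i))) (at 1)"
  proof (cases "e i = 0")
    case False
    then have "e i powr \<alpha> * f i powr (1 - \<alpha>) = exp (\<alpha> * ln (e i) + (1 - \<alpha>) * ln (f i))" for \<alpha>
      using i by (simp add: powr_def exp_add)
    moreover have "((\<lambda>\<alpha>. exp (\<alpha> * ln (e i) + (1 - \<alpha>) * ln (f i))) has_real_derivative e i * (ln (e i) - ln (f i))) (at 1)"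
      using False i by (auto intro!: derivative_eq_intros)
    ultimately show ?thesis by simp
  qed simp
qed

lemma renyi_sum_pos:
  fixes e f :: "nat \<Rightarrow> real"
  assumes "i < d" "e i > 0" "f i > 0"
  shows "(\<Sum>i<d. e i powr \<alpha> * f i powr \<beta>) > 0"
  by (rule sum_pos2[of _ i]) (use assms in auto)

lemma ln_div_le_iff:
  fixes S S' \<alpha> :: real
  assumes "S > 0" "S' > 0"
  shows "\<alpha> > 1 \<Longrightarrow> 1 / (\<alpha> - 1) * ln S \<le> 1 / (\<alpha> - 1) * ln S' \<longleftrightarrow> S \<le> S'"
    and "\<alpha> < 1 \<Longrightarrow> 1 / (\<alpha> - 1) * ln S \<le> 1 / (\<alpha> - 1) * ln S' \<longleftrightarrow> S' \<le> S"
  using assms by (simp_all add: divide_le_cancel)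

text \<open>Sums of positive order are continuous up to the boundary. For the reversed sums
  positivity of the limit must come first; a uniform bound at order 2 gives it, since an
  \<open>r n i\<close> tending to 0 would make its term blow up.\<close>

lemma renyi_sum_limits:
  fixes p q g :: "nat \<Rightarrow> real" and r :: "nat \<Rightarrow> nat \<Rightarrow> real"
  assumes p: "\<And>i. i < d \<Longrightarrow> p i \<ge> 0" and g: "\<And>i. i < d \<Longrightarrow> g i > 0" and q: "\<And>i. i < d \<Longrightarrow> q i \<ge> 0"
    and r: "\<And>n i. i < d \<Longrightarrow> r n i > 0" "\<And>i. i < d \<Longrightarrow> (\<lambda>n. r n i) \<longlonglongrightarrow> q i"
  shows "\<alpha> > 0 \<Longrightarrow> (\<And>n. (\<Sum>i<d. r n i powr \<alpha> * g i powr (1 - \<alpha>)) \<le> c) \<Longrightarrow> (\<Sum>i<d. q i powr \<alpha> * g i powr (1 - \<alpha>)) \<le> c"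
    and "\<alpha> > 0 \<Longrightarrow> (\<And>n. c \<le> (\<Sum>i<d. r n i powr \<alpha> * g i powr (1 - \<alpha>))) \<Longrightarrow> c \<le> (\<Sum>i<d. q i powr \<alpha> * g i powr (1 - \<alpha>))"
    and "(\<And>n. (\<Sum>i<d. g i powr 2 * r n i powr (1 - 2)) \<le> c) \<Longrightarrow> i < d \<Longrightarrow> q i > 0"
    and "(\<And>i. i < d \<Longrightarrow> q i > 0) \<Longrightarrow> (\<And>n. (\<Sum>i<d. g i powr \<alpha> * r n i powr (1 - \<alpha>)) \<le> c) \<Longrightarrow> (\<Sum>i<d. g i powr \<alpha> * q i powr (1 - \<alpha>)) \<le> c"
proof -
  have lim: "(\<lambda>n. \<Sum>i<d. r n i powr \<alpha> * g i powr (1 - \<alpha>)) \<longlonglongrightarrow> (\<Sum>i<d. q i powr \<alpha> * g i powr (1 - \<alpha>))" if "\<alpha> > 0"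
    by (intro tendsto_sum tendsto_mult tendsto_const tendsto_powr' r(2)) (use that r(1) in \<open>auto simp: less_imp_le\<close>)
  show "(\<Sum>i<d. q i powr \<alpha> * g i powr (1 - \<alpha>)) \<le> c" if "\<alpha> > 0" "\<And>n. (\<Sum>i<d. r n i powr \<alpha> * g i powr (1 - \<alpha>)) \<le> c"
    by (rule LIMSEQ_le_const2[OF lim]) (use that in auto)
  show "c \<le> (\<Sum>i<d. q i powr \<alpha> * g i powr (1 - \<alpha>))" if "\<alpha> > 0" "\<And>n. c \<le> (\<Sum>i<d. r n i powr \<alpha> * g i powr (1 - \<alpha>))"
    by (rule LIMSEQ_le_const[OF lim]) (use that in auto)
  show "q i > 0" if c: "\<And>n. (\<Sum>i<d. g i powr 2 * r n i powr (1 - 2)) \<le> c" and i: "i < d"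
  proof -
    have le: "(g i)\<^sup>2 \<le> c * r n i" for n
    proof -
      have "g i powr 2 * r n i powr (1 - 2) \<le> (\<Sum>i<d. g i powr 2 * r n i powr (1 - 2))"
        by (rule member_le_sum) (use i in auto)
      also have "\<dots> \<le> c" by (rule c)
      finally have "(g i)\<^sup>2 / r n i \<le> c" using g[OF i] r(1)[OF i, of n] by (simp add: powr_minus field_simps)
      then show ?thesis using r(1)[OF i, of n] by (simp add: field_simps)
    qed
    have "(g i)\<^sup>2 \<le> c * q i" by (rule LIMSEQ_le_const[OF tendsto_mult_left[OF r(2)[OF i]]]) (use le in auto)
    moreover have "(g i)\<^sup>2 > 0" using g[OF i] by simp
    ultimately show ?thesis using q[OF i] by (cases "q i = 0") auto
  qed
  show "(\<Sum>i<d. g i powr \<alpha> * q i powr (1 - \<alpha>)) \<le> c"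
    if qp: "\<And>i. i < d \<Longrightarrow> q i > 0" and c: "\<And>n. (\<Sum>i<d. g i powr \<alpha> * r n i powr (1 - \<alpha>)) \<le> c"
  proof (rule LIMSEQ_le_const2)
    show "(\<lambda>n. \<Sum>i<d. g i powr \<alpha> * r n i powr (1 - \<alpha>)) \<longlonglongrightarrow> (\<Sum>i<d. g i powr \<alpha> * q i powr (1 - \<alpha>))"
      by (intro tendsto_sum tendsto_mult tendsto_const tendsto_powr r(2)) (use qp in force)+
  qed (use c in auto)
qed

text \<open>The free-energy conditions in terms of spectra. If \<open>p\<close> has a zero, the
  divergences of \<open>g\<close> from \<open>p\<close> of order at least 1 are infinite and impose
  nothing on \<open>q\<close>; hence the implication in the last clause.\<close>

definition renyi_order :: "nat \<Rightarrow> (nat \<Rightarrow> real) \<Rightarrow> (nat \<Rightarrow> real) \<Rightarrow> (nat \<Rightarrow> real) \<Rightarrow> bool" where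
  "renyi_order d g p q \<longleftrightarrow>
    (\<forall>\<alpha>>1. (\<Sum>i<d. q i powr \<alpha> * g i powr (1 - \<alpha>)) \<le> (\<Sum>i<d. p i powr \<alpha> * g i powr (1 - \<alpha>))) \<and>
    (\<forall>\<alpha>. 0 < \<alpha> \<and> \<alpha> < 1 \<longrightarrow> (\<Sum>i<d. p i powr \<alpha> * g i powr (1 - \<alpha>)) \<le> (\<Sum>i<d. q i powr \<alpha> * g i powr (1 - \<alpha>))) \<and>
    (\<Sum>i<d. q i * (ln (q i) - ln (g i))) \<le> (\<Sum>i<d. p i * (ln (p i) - ln (g i))) \<and>
    ((\<forall>i<d. p i > 0) \<longrightarrow> (\<forall>i<d. q i > 0) \<and>
      (\<Sum>i<d. g i * (ln (g i) - ln (q i))) \<le> (\<Sum>i<d. g i * (ln (g i) - ln (p i))) \<and>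
      (\<forall>\<alpha>>1. (\<Sum>i<d. g i powr \<alpha> * q i powr (1 - \<alpha>)) \<le> (\<Sum>i<d. g i powr \<alpha> * p i powr (1 - \<alpha>))))"

text \<open>Exponents below \<open>1/2\<close> come from the second free energy, since swapping the two arguments replaces \<open>\<alpha>\<close> by \<open>1 - \<alpha>\<close>.\<close>

lemma free_energy_order_iff:
  fixes p q g :: "nat \<Rightarrow> real"
  assumes h: "orthonormal_basis d h" and g: "\<And>i. i < d \<Longrightarrow> g i > 0"
    and p: "\<And>i. i < d \<Longrightarrow> p i \<ge> 0" "(\<Sum>i<d. p i) = 1" and q: "\<And>i. i < d \<Longrightarrow> q i \<ge> 0" "(\<Sum>i<d. q i) = 1"
  shows "(\<forall>\<alpha>\<ge>1/2.
      sandwiched_renyi \<alpha> (spectral_sum d h p) (spectral_sum d h g) \<ge> sandwiched_renyi \<alpha> (spectral_sum d h q) (spectral_sum d h g) \<and>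
      sandwiched_renyi \<alpha> (spectral_sum d h g) (spectral_sum d h p) \<ge> sandwiched_renyi \<alpha> (spectral_sum d h g) (spectral_sum d h q)) \<longleftrightarrow>
    renyi_order d g p q" (is "?L \<longleftrightarrow> _")
proof -
  let ?A = "(\<forall>\<alpha>>1. (\<Sum>i<d. q i powr \<alpha> * g i powr (1 - \<alpha>)) \<le> (\<Sum>i<d. p i powr \<alpha> * g i powr (1 - \<alpha>)))"
  let ?B = "(\<forall>\<alpha>. 0 < \<alpha> \<and> \<alpha> < 1 \<longrightarrow> (\<Sum>i<d. p i powr \<alpha> * g i powr (1 - \<alpha>)) \<le> (\<Sum>i<d. q i powr \<alpha> * g i powr (1 - \<alpha>)))"
  let ?C = "(\<Sum>i<d. q i * (ln (q i) - ln (g i))) \<le> (\<Sum>i<d. p i * (ln (p i) - ln (g i)))"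
  let ?D = "((\<forall>i<d. p i > 0) \<longrightarrow> (\<forall>i<d. q i > 0) \<and>
      (\<Sum>i<d. g i * (ln (g i) - ln (q i))) \<le> (\<Sum>i<d. g i * (ln (g i) - ln (p i))) \<and>
      (\<forall>\<alpha>>1. (\<Sum>i<d. g i powr \<alpha> * q i powr (1 - \<alpha>)) \<le> (\<Sum>i<d. g i powr \<alpha> * p i powr (1 - \<alpha>))))"
  let ?plus = "\<lambda>\<alpha>. sandwiched_renyi \<alpha> (spectral_sum d h q) (spectral_sum d h g) \<le> sandwiched_renyi \<alpha> (spectral_sum d h p) (spectral_sum d h g)"
  let ?minus = "\<lambda>\<alpha>. sandwiched_renyi \<alpha> (spectral_sum d h g) (spectral_sum d h q) \<le> sandwiched_renyi \<alpha> (spectral_sum d h g) (spectral_sum d h p)"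
  have g0: "\<And>i. i < d \<Longrightarrow> g i \<ge> 0" "\<And>i. i < d \<Longrightarrow> g i \<noteq> 0" using g by (auto simp: less_imp_le order.strict_iff_order)
  have ex: "\<exists>i<d. e i > 0" if "\<And>i. i < d \<Longrightarrow> e i \<ge> 0" "(\<Sum>i<d. e i) = 1" for e :: "nat \<Rightarrow> real"
  proof (rule ccontr)
    assume "\<not> ?thesis"
    then have "e i \<le> 0" if "i < d" for i using that by (meson not_less)
    then have "(\<Sum>i<d. e i) \<le> 0" by (intro sum_nonpos) simp
    then show False using that by simp
  qed
  obtain i j where i: "i < d" "p i > 0" and j: "j < d" "q j > 0" using ex[OF p] ex[OF q] by blast
  have pos: "(\<Sum>i<d. p i powr \<alpha> * g i powr \<beta>) > 0" "(\<Sum>i<d. q i powr \<alpha> * g i powr \<beta>) > 0"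
    "(\<Sum>i<d. g i powr \<beta> * p i powr \<alpha>) > 0" "(\<Sum>i<d. g i powr \<beta> * q i powr \<alpha>) > 0" for \<alpha> \<beta>
    using renyi_sum_pos[of i d p g] renyi_sum_pos[of j d q g] renyi_sum_pos[of i d g p] renyi_sum_pos[of j d g q] i j g by blast+
  have plus: "sandwiched_renyi \<alpha> (spectral_sum d h e) (spectral_sum d h g) =
     (if \<alpha> = 1 then ereal (\<Sum>i<d. e i * (ln (e i) - ln (g i))) else ereal (1 / (\<alpha> - 1) * ln (\<Sum>i<d. e i powr \<alpha> * g i powr (1 - \<alpha>))))"
    if "\<alpha> \<ge> 1/2" "\<And>i. i < d \<Longrightarrow> e i \<ge> 0" "\<exists>i<d. e i > 0" for \<alpha> e
  proof -
    have "\<exists>i<d. e i \<noteq> 0 \<and> g i \<noteq> 0" using that(3) g0(2) by force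
    moreover have "\<forall>i<d. g i = 0 \<longrightarrow> e i = 0" using g0(2) by blast
    ultimately show ?thesis using that(1) by (subst sandwiched_renyi_spectral_sum[OF h that(2) g0(1)]) auto
  qed
  have minus: "sandwiched_renyi \<alpha> (spectral_sum d h g) (spectral_sum d h e) =
     (if \<alpha> < 1 then ereal (1 / (\<alpha> - 1) * ln (\<Sum>i<d. g i powr \<alpha> * e i powr (1 - \<alpha>)))
      else if \<forall>i<d. e i > 0 then (if \<alpha> = 1 then ereal (\<Sum>i<d. g i * (ln (g i) - ln (e i)))
        else ereal (1 / (\<alpha> - 1) * ln (\<Sum>i<d. g i powr \<alpha> * e i powr (1 - \<alpha>)))) else \<infinity>)"
    if "\<alpha> \<ge> 1/2" "\<And>i. i < d \<Longrightarrow> e i \<ge> 0" "\<exists>i<d. e i > 0" for \<alpha> e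
  proof -
    have 1: "\<exists>i<d. g i \<noteq> 0 \<and> e i \<noteq> 0" using that(3) g0(2) by force
    have 2: "(\<forall>i<d. e i = 0 \<longrightarrow> g i = 0) \<longleftrightarrow> (\<forall>i<d. e i > 0)"
      using that(2) g0(2) by (metis less_irrefl order_le_less)
    show ?thesis using 1 that(1) by (subst sandwiched_renyi_spectral_sum[OF h g0(1) that(2)]) (auto simp: 2)
  qed
  have ip: "\<exists>i<d. p i > 0" and iq: "\<exists>i<d. q i > 0" using i j by auto
  note P = plus[OF _ p(1) ip] plus[OF _ q(1) iq] and M = minus[OF _ p(1) ip] minus[OF _ q(1) iq]
  have plus1: "?plus 1 \<longleftrightarrow> ?C" by (simp add: P)
  have plus_gt: "?plus \<alpha> \<longleftrightarrow> (\<Sum>i<d. q i powr \<alpha> * g i powr (1 - \<alpha>)) \<le> (\<Sum>i<d. p i powr \<alpha> * g i powr (1 - \<alpha>))" if "\<alpha> > 1" for \<alpha>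
    using that ln_div_le_iff(1)[OF pos(2,1) that] by (simp add: P)
  have plus_lt: "?plus \<alpha> \<longleftrightarrow> (\<Sum>i<d. p i powr \<alpha> * g i powr (1 - \<alpha>)) \<le> (\<Sum>i<d. q i powr \<alpha> * g i powr (1 - \<alpha>))" if "1/2 \<le> \<alpha>" "\<alpha> < 1" for \<alpha>
    using that ln_div_le_iff(2)[OF pos(2,1) that(2)] by (simp add: P)
  have minus_lt: "?minus \<alpha> \<longleftrightarrow> (\<Sum>i<d. g i powr \<alpha> * p i powr (1 - \<alpha>)) \<le> (\<Sum>i<d. g i powr \<alpha> * q i powr (1 - \<alpha>))" if "1/2 \<le> \<alpha>" "\<alpha> < 1" for \<alpha>
    using that by (simp only: M if_True ereal_less_eq(3) ln_div_le_iff(2)[OF pos(4,3)])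
  have minus_gt: "?minus \<alpha> \<longleftrightarrow> ((\<forall>i<d. p i > 0) \<longrightarrow> (\<forall>i<d. q i > 0) \<and>
      (\<Sum>i<d. g i powr \<alpha> * q i powr (1 - \<alpha>)) \<le> (\<Sum>i<d. g i powr \<alpha> * p i powr (1 - \<alpha>)))" if "\<alpha> > 1" for \<alpha>
    using that ln_div_le_iff(1)[OF pos(4,3) that] by (auto simp: M)
  have minus1: "?minus 1 \<longleftrightarrow> ((\<forall>i<d. p i > 0) \<longrightarrow> (\<forall>i<d. q i > 0) \<and>
      (\<Sum>i<d. g i * (ln (g i) - ln (q i))) \<le> (\<Sum>i<d. g i * (ln (g i) - ln (p i))))"
    by (auto simp: M)
  show ?thesis unfolding renyi_order_def
  proof
    assume L: ?L
    have ?A using L plus_gt by simp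
    moreover have ?B
    proof (intro allI impI)
      fix \<alpha> :: real assume \<alpha>: "0 < \<alpha> \<and> \<alpha> < 1"
      show "(\<Sum>i<d. p i powr \<alpha> * g i powr (1 - \<alpha>)) \<le> (\<Sum>i<d. q i powr \<alpha> * g i powr (1 - \<alpha>))"
      proof (cases "1/2 \<le> \<alpha>")
        case True
        then show ?thesis using L plus_lt \<alpha> by blast
      next
        case False
        then have "?minus (1 - \<alpha>)" using L \<alpha> by simp
        then show ?thesis using minus_lt[of "1 - \<alpha>"] False \<alpha> by (simp add: mult.commute)
      qed
    qed
    moreover have ?C using L plus1 by simp
    moreover have ?D
    proof -
      have "?minus 1" "\<And>\<alpha>. \<alpha> > 1 \<Longrightarrow> ?minus \<alpha>" using L by simp_all
      then show ?thesis using minus1 minus_gt by blast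
    qed
    ultimately show "?A \<and> ?B \<and> ?C \<and> ?D" by blast
  next
    assume R: "?A \<and> ?B \<and> ?C \<and> ?D"
    have "?plus \<alpha>" if "\<alpha> \<ge> 1/2" for \<alpha>
      using R that plus1 plus_gt[of \<alpha>] plus_lt[of \<alpha>] by (cases \<alpha> "1 :: real" rule: linorder_cases) auto
    moreover have "?minus \<alpha>" if \<alpha>: "\<alpha> \<ge> 1/2" for \<alpha>
    proof (cases \<alpha> "1 :: real" rule: linorder_cases)
      case less
      then have "(\<Sum>i<d. p i powr (1 - \<alpha>) * g i powr (1 - (1 - \<alpha>))) \<le> (\<Sum>i<d. q i powr (1 - \<alpha>) * g i powr (1 - (1 - \<alpha>)))"
        using R \<alpha> by (intro R[THEN conjunct2, THEN conjunct1, rule_format]) auto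
      then show ?thesis unfolding minus_lt[OF \<alpha> less] by (simp add: mult.commute)
    next
      case equal
      then show ?thesis using R minus1 by blast
    next
      case greater
      then show ?thesis using R minus_gt by blast
    qed
    ultimately show ?L by blast
  qed
qed

text \<open>The sum of order 2 exceeds 1 by exactly the chi-square distance of \<open>q\<close> from
  \<open>g\<close>.\<close>

lemma renyi_sum_determines_uniform:
  fixes q g :: "nat \<Rightarrow> real"
  assumes g: "\<And>i. i < d \<Longrightarrow> g i > 0" "(\<Sum>i<d. g i) = 1" and q: "\<And>i. i < d \<Longrightarrow> q i \<ge> 0" "(\<Sum>i<d. q i) = 1"
    and le: "(\<Sum>i<d. q i powr 2 * g i powr (1 - 2)) \<le> 1" and i: "i < d"
  shows "q i = g i"
proof -
  have e: "(q i - g i)\<^sup>2 / g i = q i powr 2 * g i powr (1 - 2) - 2 * q i + g i" if "i < d" for i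
    using q(1)[OF that] g(1)[OF that] by (simp add: powr_minus field_simps power2_eq_square)
  have "(\<Sum>i<d. (q i - g i)\<^sup>2 / g i) = (\<Sum>i<d. q i powr 2 * g i powr (1 - 2) - 2 * q i + g i)"
    using e by (intro sum.cong) auto
  also have "\<dots> \<le> 0" using le g(2) q(2) by (simp add: sum.distrib sum_subtractf flip: sum_distrib_left)
  finally have "(\<Sum>i<d. (q i - g i)\<^sup>2 / g i) \<le> 0" .
  moreover have nn: "(q i - g i)\<^sup>2 / g i \<ge> 0" if "i < d" for i using g(1)[OF that] by simp
  ultimately have "(\<Sum>i<d. (q i - g i)\<^sup>2 / g i) = 0" by (intro antisym sum_nonneg) auto
  then have "(q i - g i)\<^sup>2 / g i = 0" using nn i by (subst (asm) sum_nonneg_eq_0_iff) auto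
  then show ?thesis using g(1)[OF i] by simp
qed

text \<open>If \<open>p\<close> is the Gibbs distribution, no strictness can be gained; but then the
  inequality of order 2 makes \<open>q\<close> the Gibbs distribution too, and the identity kernel
  does. Otherwise one passes to likelihood ratios, whose sums of negative order \<alpha> are the
  reversed sums of order \<open>1 - \<alpha>\<close>.\<close>

lemma classical_conversion:
  fixes p q g :: "nat \<Rightarrow> real"
  assumes g: "\<And>i. i < d \<Longrightarrow> g i > 0" "(\<Sum>i<d. g i) = 1"
    and p: "\<And>i. i < d \<Longrightarrow> p i \<ge> 0" "(\<Sum>i<d. p i) = 1" and q: "\<And>i. i < d \<Longrightarrow> q i \<ge> 0" "(\<Sum>i<d. q i) = 1"
    and order: "renyi_order d g p q"
    and \<epsilon>: "0 < \<epsilon>" "\<epsilon> < 1"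
  obtains N and r s :: "nat \<Rightarrow> real" where "\<And>m. r m > 0 \<and> s m > 0" "sum r {..<N} = 1" "sum s {..<N} = 1"
    "converts ({..<d} \<times> {..<N}) (\<lambda>(i, m). p i * r m) (\<lambda>(i, m). g i * s m)
      ({..<d} \<times> {..<N}) (\<lambda>(i, m). ((1 - \<epsilon>)\<^sup>2 * q i + (1 - (1 - \<epsilon>)\<^sup>2) * g i) * r m) (\<lambda>(i, m). g i * s m)"
proof -
  note gt1 = order[unfolded renyi_order_def, THEN conjunct1]
    and lt1 = order[unfolded renyi_order_def, THEN conjunct2, THEN conjunct1]
    and kl = order[unfolded renyi_order_def, THEN conjunct2, THEN conjunct2, THEN conjunct1]
    and neg = order[unfolded renyi_order_def, THEN conjunct2, THEN conjunct2, THEN conjunct2]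
  show ?thesis
proof (cases "\<forall>i<d. p i = g i")
  case True
  have "(\<Sum>i<d. q i powr 2 * g i powr (1 - 2)) \<le> (\<Sum>i<d. p i powr 2 * g i powr (1 - 2))" using gt1[rule_format, of 2] by simp
  also have "\<dots> = (\<Sum>i<d. g i)"
  proof (intro sum.cong refl)
    fix i assume "i \<in> {..<d}"
    then have "p i = g i" "g i > 0" using True g(1) by auto
    then show "p i powr 2 * g i powr (1 - 2) = g i" by (simp add: powr_minus power2_eq_square)
  qed
  finally have "q i = g i" if "i < d" for i using renyi_sum_determines_uniform[OF g q _ that] g(2) by simp
  then have qg: "(1 - \<epsilon>)\<^sup>2 * q i + (1 - (1 - \<epsilon>)\<^sup>2) * g i = p i" if "i < d" for i using that True by (simp add: algebra_simps)
  have "converts ({..<d} \<times> {..<1 :: nat}) (\<lambda>(i, m). p i * 1) (\<lambda>(i, m). g i * 1)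
      ({..<d} \<times> {..<1 :: nat}) (\<lambda>(i, m). p i * 1) (\<lambda>(i, m). g i * 1)"
    by (rule converts_refl) simp
  then have "converts ({..<d} \<times> {..<1 :: nat}) (\<lambda>(i, m). p i * 1) (\<lambda>(i, m). g i * 1)
      ({..<d} \<times> {..<1 :: nat}) (\<lambda>(i, m). ((1 - \<epsilon>)\<^sup>2 * q i + (1 - (1 - \<epsilon>)\<^sup>2) * g i) * 1) (\<lambda>(i, m). g i * 1)"
    by (rule iffD1[OF converts_cong, rotated -1]) (auto simp: qg)
  then show ?thesis by (rule that[rotated -1]) simp_all
next
  case False
  define a where "a i = p i / g i" for i
  define b where "b i = q i / g i" for i
  have g0: "g i \<noteq> 0" if "i < d" for i using g(1)[OF that] by simp
  have ab: "g i * a i = p i" "g i * b i = q i" if "i < d" for i using g0[OF that] by (simp_all add: a_def b_def)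
  have powr: "g i * (u / g i) powr \<alpha> = u powr \<alpha> * g i powr (1 - \<alpha>)" if "i < d" "u \<ge> 0" for i u \<alpha>
    using that g(1)[OF that(1)] by (simp add: powr_divide powr_diff less_imp_le)
  have powr': "g i * (u / g i) powr \<alpha> = g i powr (1 - \<alpha>) * u powr (1 - (1 - \<alpha>))" if "i < d" "u \<ge> 0" for i u \<alpha>
    using powr[OF that] by (simp add: mult.commute)
  have entropy: "g i * (u / g i * ln (u / g i)) = u * (ln u - ln (g i))" if "i < d" "u \<ge> 0" for i u
    using that g(1)[OF that(1)] by (cases "u = 0") (simp_all add: ln_div)
  have entropies: "(\<Sum>i<d. g i * (u i / g i * ln (u i / g i))) = (\<Sum>i<d. u i * (ln (u i) - ln (g i)))"
    if "\<And>i. i < d \<Longrightarrow> u i \<ge> 0" for u by (intro sum.cong refl entropy) (use that in auto)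
  have log: "g i * ln (u / g i) = - (g i * (ln (g i) - ln u))" if "i < d" "u > 0" for i u
    using that g(1)[OF that(1)] by (simp add: ln_div algebra_simps)
  show ?thesis
  proof (rule catalytic_conversion[where I = "{..<d}" and g = g and a = a and b = b and \<epsilon> = \<epsilon>])
    show "(\<Sum>i<d. g i * b i powr \<alpha>) \<le> (\<Sum>i<d. g i * a i powr \<alpha>)" if "\<alpha> > 1" for \<alpha>
      using gt1[rule_format, OF that] p(1) q(1) by (simp add: a_def b_def powr)
    show "(\<Sum>i<d. g i * a i powr \<alpha>) \<le> (\<Sum>i<d. g i * b i powr \<alpha>)" if "0 < \<alpha>" "\<alpha> < 1" for \<alpha>
      using lt1[rule_format, of \<alpha>] that p(1) q(1) by (simp add: a_def b_def powr)
    show "(\<Sum>i<d. g i * (b i * ln (b i))) \<le> (\<Sum>i<d. g i * (a i * ln (a i)))"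
      unfolding a_def b_def using kl entropies[OF p(1)] entropies[OF q(1)] by simp
    show "(\<forall>i\<in>{..<d}. b i > 0) \<and> (\<Sum>i<d. g i * ln (a i)) \<le> (\<Sum>i<d. g i * ln (b i)) \<and>
       (\<forall>\<alpha><0. (\<Sum>i<d. g i * b i powr \<alpha>) \<le> (\<Sum>i<d. g i * a i powr \<alpha>))" if apos: "\<And>i. i \<in> {..<d} \<Longrightarrow> a i > 0"
    proof -
      have pp: "\<And>i. i < d \<Longrightarrow> p i > 0" using apos g(1) by (force simp: a_def zero_less_divide_iff)
      then have N: "\<forall>i<d. q i > 0" "(\<Sum>i<d. g i * (ln (g i) - ln (q i))) \<le> (\<Sum>i<d. g i * (ln (g i) - ln (p i)))"
        "\<And>\<alpha>. \<alpha> > 1 \<Longrightarrow> (\<Sum>i<d. g i powr \<alpha> * q i powr (1 - \<alpha>)) \<le> (\<Sum>i<d. g i powr \<alpha> * p i powr (1 - \<alpha>))"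
        using neg by blast+
      have "(\<Sum>i<d. g i * ln (a i)) = - (\<Sum>i<d. g i * (ln (g i) - ln (p i)))" "(\<Sum>i<d. g i * ln (b i)) = - (\<Sum>i<d. g i * (ln (g i) - ln (q i)))"
        unfolding sum_negf[symmetric] a_def b_def by (intro sum.cong refl log; use pp N(1) in simp)+
      moreover have "(\<Sum>i<d. g i * b i powr \<alpha>) \<le> (\<Sum>i<d. g i * a i powr \<alpha>)" if "\<alpha> < 0" for \<alpha>
      proof -
        have "(\<Sum>i<d. g i * a i powr \<alpha>) = (\<Sum>i<d. g i powr (1 - \<alpha>) * p i powr (1 - (1 - \<alpha>)))"
          "(\<Sum>i<d. g i * b i powr \<alpha>) = (\<Sum>i<d. g i powr (1 - \<alpha>) * q i powr (1 - (1 - \<alpha>)))"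
          unfolding a_def b_def by (intro sum.cong refl powr'; use p(1) q(1) in simp)+
        then show ?thesis using N(3)[of "1 - \<alpha>"] that by simp
      qed
      ultimately show ?thesis using N g(1) by (auto simp: b_def)
    qed
    show "\<exists>i\<in>{..<d}. a i \<noteq> 1" using False g0 unfolding a_def by (metis divide_eq_1_iff lessThan_iff)
    fix N and r s :: "nat \<Rightarrow> real"
    assume rs: "\<And>m. r m > 0 \<and> s m > 0" "sum r {..N} = 1" "sum s {..N} = 1"
      and conv: "converts ({..<d} \<times> {..N}) (\<lambda>(i, m). g i * a i * r m) (\<lambda>(i, m). g i * s m)
        ({..<d} \<times> {..N}) (\<lambda>(i, m). ((1 - \<epsilon>)\<^sup>2 * (g i * b i) + (1 - (1 - \<epsilon>)\<^sup>2) * g i) * r m) (\<lambda>(i, m). g i * s m)"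
    have "converts ({..<d} \<times> {..N}) (\<lambda>(i, m). p i * r m) (\<lambda>(i, m). g i * s m)
        ({..<d} \<times> {..N}) (\<lambda>(i, m). ((1 - \<epsilon>)\<^sup>2 * q i + (1 - (1 - \<epsilon>)\<^sup>2) * g i) * r m) (\<lambda>(i, m). g i * s m)"
      by (rule iffD1[OF converts_cong conv]) (auto simp: ab)
    then show ?thesis using rs by (intro that[of r s "Suc N"]) (auto simp: lessThan_Suc_atMost)
  qed (use g p q \<epsilon> ab in \<open>auto simp: a_def b_def less_imp_le\<close>)
qed
qed

section \<open>The two directions for diagonal states\<close>

lemma asymp_cat_converse:
  fixes h :: "nat \<Rightarrow> complex Matrix.vec"
  assumes h: "orthonormal_basis d h" and gibbs: "gibbs_state H \<beta> = spectral_sum d h g"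
    and g: "\<And>i. i < d \<Longrightarrow> g i > 0" "(\<Sum>i<d. g i) = 1"
    and p: "\<And>i. i < d \<Longrightarrow> p i \<ge> 0" "(\<Sum>i<d. p i) = 1" and q: "\<And>i. i < d \<Longrightarrow> q i \<ge> 0" "(\<Sum>i<d. q i) = 1"
    and order: "renyi_order d g p q"
  shows "asymp_cat_thermally_majorizes d H \<beta> (spectral_sum d h p) (spectral_sum d h q)"
  unfolding asymp_cat_thermally_majorizes_def gibbs
proof (intro allI impI)
  fix \<epsilon> :: real assume \<epsilon>: "\<epsilon> > 0"
  \<comment> \<open>The two mixings replace \<open>q\<close> by \<open>g\<close> with total weight
    \<open>w \<le> 2 * \<delta>\<close>, and two distributions differ by at most 2 in the sum norm,
    so the trace norm is at most \<open>4 * \<delta>\<close>.\<close>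
  define \<delta> where "\<delta> = min (\<epsilon> / 8) (1 / 2)"
  have \<delta>: "0 < \<delta>" "\<delta> < 1" "4 * \<delta> < \<epsilon>" using \<epsilon> by (auto simp: \<delta>_def min_def)
  show "\<exists>n \<tau>1 \<tau>2 \<sigma>' \<Phi>. state n \<tau>1 \<and> state n \<tau>2 \<and> supp \<tau>1 \<subseteq> supp \<tau>2 \<and> state d \<sigma>' \<and>
      trace_norm (spectral_sum d h q - \<sigma>') < \<epsilon> \<and> channel (d * n) (d * n) \<Phi> \<and>
      \<Phi> (kron (spectral_sum d h p) \<tau>1) = kron \<sigma>' \<tau>1 \<and> \<Phi> (kron (spectral_sum d h g) \<tau>2) = kron (spectral_sum d h g) \<tau>2"
  proof (rule classical_conversion[OF g p q order \<delta>(1,2)])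
    fix N and r s :: "nat \<Rightarrow> real" assume rs: "\<And>m. r m > 0 \<and> s m > 0" "sum r {..<N} = 1" "sum s {..<N} = 1"
      and conv: "converts ({..<d} \<times> {..<N}) (\<lambda>(i, m). p i * r m) (\<lambda>(i, m). g i * s m)
      ({..<d} \<times> {..<N}) (\<lambda>(i, m). ((1 - \<delta>)\<^sup>2 * q i + (1 - (1 - \<delta>)\<^sup>2) * g i) * r m) (\<lambda>(i, m). g i * s m)"
    define w where "w = 1 - (1 - \<delta>)\<^sup>2"
    have w: "0 \<le> w" "w \<le> 2 * \<delta>" using \<delta> by (auto simp: w_def power2_eq_square algebra_simps mult_le_one)
    define q' where "q' i = (1 - \<delta>)\<^sup>2 * q i + w * g i" for i
    let ?e = "unit_vec N :: nat \<Rightarrow> complex Matrix.vec"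
    let ?r = "spectral_sum N ?e r" and ?s = "spectral_sum N ?e s" and ?q = "spectral_sum d h q'"
    obtain \<Phi> where \<Phi>: "channel (d * N) (d * N) \<Phi>" "\<Phi> (kron (spectral_sum d h p) ?r) = kron ?q ?r"
      "\<Phi> (kron (spectral_sum d h g) ?s) = kron (spectral_sum d h g) ?s"
      using channel_of_converts[OF h unit_vec_onb conv[folded w_def, folded q'_def]] by blast
    have r0: "r m \<ge> 0" "s m \<ge> 0" "s m \<noteq> 0" for m using rs(1)[of m] by auto
    have "state N ?r" "state N ?s" by (rule state_spectral_sum[OF unit_vec_onb r0(1) rs(2)], rule state_spectral_sum[OF unit_vec_onb r0(2) rs(3)])
    moreover have "supp ?r \<subseteq> supp ?s" unfolding supp_spectral_sum_subset[OF unit_vec_onb] using r0(3) by simp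
    moreover have "state d ?q"
    proof (rule state_spectral_sum[OF h])
      show "0 \<le> q' i" if "i < d" for i using that q(1) g(1) w by (simp add: q'_def less_imp_le)
      have "(\<Sum>i<d. q' i) = (1 - \<delta>)\<^sup>2 * (\<Sum>i<d. q i) + w * (\<Sum>i<d. g i)" by (simp add: q'_def sum.distrib sum_distrib_left)
      then show "(\<Sum>i<d. q' i) = 1" using g(2) q(2) by (simp add: w_def)
    qed
    moreover have "trace_norm (spectral_sum d h q - ?q) < \<epsilon>"
    proof -
      have "(\<Sum>i<d. \<bar>q i - q' i\<bar>) = (\<Sum>i<d. w * \<bar>q i - g i\<bar>)"
      proof (intro sum.cong refl)
        fix i
        have "q i - q' i = w * (q i - g i)" by (simp add: q'_def w_def algebra_simps)
        then show "\<bar>q i - q' i\<bar> = w * \<bar>q i - g i\<bar>" using w by (simp add: abs_mult)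
      qed
      also have "\<dots> \<le> (\<Sum>i<d. w * (q i + g i))"
        using w q(1) g(1) by (intro sum_mono mult_left_mono) (auto simp: abs_le_iff less_imp_le add_increasing add_increasing2)
      also have "\<dots> = w * 2" using q(2) g(2) by (simp add: sum.distrib flip: sum_distrib_left)
      also have "\<dots> < \<epsilon>" using w \<delta> by simp
      finally show ?thesis unfolding spectral_sum_minus trace_norm_spectral_sum[OF h] .
    qed
    ultimately show ?thesis
      using \<Phi> by (intro exI[of _ N] exI[of _ ?r] exI[of _ ?s] exI[of _ ?q] exI[of _ \<Phi>] conjI)
  qed
qed

lemma asymp_cat_renyi_order:
  fixes h :: "nat \<Rightarrow> complex Matrix.vec"
  assumes h: "orthonormal_basis d h" and gibbs: "gibbs_state H \<beta> = spectral_sum d h g"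
    and g: "\<And>i. i < d \<Longrightarrow> g i > 0" "(\<Sum>i<d. g i) = 1"
    and p: "\<And>i. i < d \<Longrightarrow> p i \<ge> 0" "(\<Sum>i<d. p i) = 1" and q: "\<And>i. i < d \<Longrightarrow> q i \<ge> 0" "(\<Sum>i<d. q i) = 1"
    and maj: "asymp_cat_thermally_majorizes d H \<beta> (spectral_sum d h p) (spectral_sum d h q)"
  shows "renyi_order d g p q"
proof -
  have d: "0 < d" using p(2) by (cases d) auto
  \<comment> \<open>One null sequence serves both as approximation error and as regularizing weight;
    the double successor keeps it strictly below 1.\<close>
  define \<epsilon> where "\<epsilon> n = inverse (real (Suc (Suc n)))" for n
  have \<epsilon>: "0 < \<epsilon> n" "\<epsilon> n < 1" for n by (simp_all add: \<epsilon>_def field_simps)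
  have \<epsilon>_lim: "\<epsilon> \<longlonglongrightarrow> 0" unfolding \<epsilon>_def using LIMSEQ_Suc[OF LIMSEQ_inverse_real_of_nat] .
  have "\<exists>\<sigma>'. state d \<sigma>' \<and> trace_norm (spectral_sum d h q - \<sigma>') < \<epsilon> n \<and> (\<exists>m \<tau>1 \<tau>2 \<Phi>. state m \<tau>1 \<and> state m \<tau>2 \<and> supp \<tau>1 \<subseteq> supp \<tau>2 \<and>
      channel (d * m) (d * m) \<Phi> \<and> \<Phi> (kron (spectral_sum d h p) \<tau>1) = kron \<sigma>' \<tau>1 \<and> \<Phi> (kron (spectral_sum d h g) \<tau>2) = kron (spectral_sum d h g) \<tau>2)" for n
    using maj \<epsilon>(1)[of n] unfolding asymp_cat_thermally_majorizes_def gibbs by meson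
  then obtain S where S: "\<And>n. state d (S n)" "\<And>n. trace_norm (spectral_sum d h q - S n) < \<epsilon> n"
    "\<And>n. \<exists>m \<tau>1 \<tau>2 \<Phi>. state m \<tau>1 \<and> state m \<tau>2 \<and> supp \<tau>1 \<subseteq> supp \<tau>2 \<and>
      channel (d * m) (d * m) \<Phi> \<and> \<Phi> (kron (spectral_sum d h p) \<tau>1) = kron (S n) \<tau>1 \<and> \<Phi> (kron (spectral_sum d h g) \<tau>2) = kron (spectral_sum d h g) \<tau>2"
    by metis
  define q0 where "q0 n i = Re (qform d (S n) (\<lambda>a. h i $ a))" for n i
  define r where "r n i = (1 - \<epsilon> n) * q0 n i + \<epsilon> n * g i" for n i
  have mono: "(\<forall>i<d. r n i > 0) \<and>
    (\<forall>\<alpha>>1. (\<Sum>i<d. r n i powr \<alpha> * g i powr (1 - \<alpha>)) \<le> (\<Sum>i<d. p i powr \<alpha> * g i powr (1 - \<alpha>))) \<and>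
    (\<forall>\<alpha>. 0 < \<alpha> \<longrightarrow> \<alpha> < 1 \<longrightarrow> (\<Sum>i<d. p i powr \<alpha> * g i powr (1 - \<alpha>)) \<le> (\<Sum>i<d. r n i powr \<alpha> * g i powr (1 - \<alpha>))) \<and>
    (\<forall>\<alpha>>1. (\<forall>i<d. p i > 0) \<longrightarrow> (\<Sum>i<d. g i powr \<alpha> * r n i powr (1 - \<alpha>)) \<le> (\<Sum>i<d. g i powr \<alpha> * p i powr (1 - \<alpha>)))" for n
  proof -
    obtain m \<tau>1 \<tau>2 \<Phi> where \<Phi>: "state m \<tau>1" "state m \<tau>2" "supp \<tau>1 \<subseteq> supp \<tau>2" "channel (d * m) (d * m) \<Phi>"
      "\<Phi> (kron (spectral_sum d h p) \<tau>1) = kron (S n) \<tau>1" "\<Phi> (kron (spectral_sum d h g) \<tau>2) = kron (spectral_sum d h g) \<tau>2"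
      using S(3)[of n] by blast
    show ?thesis unfolding r_def q0_def
      by (intro conjI allI impI channel_renyi_monotone[OF h d \<Phi>(4,1-3) S(1) p(1) g \<Phi>(5,6) \<epsilon>[of n]]; assumption?; blast?)
  qed
  have q0_lim: "(\<lambda>n. q0 n i) \<longlonglongrightarrow> q i" if i: "i < d" for i
  proof -
    have "\<bar>q0 n i - q i\<bar> \<le> \<epsilon> n" for n
    proof -
      have P: "psd d (S n)" using S(1)[of n] by (simp add: state_def)
      note Sc = psd_carrier[OF P] and herm = psd_herm[OF P]
      have "\<bar>Re (qform d (spectral_sum d h q - S n) (\<lambda>a. h i $ a))\<bar> \<le> trace_norm (spectral_sum d h q - S n)"
      proof (rule qform_le_trace_norm)
        show "spectral_sum d h q - S n \<in> carrier_mat d d" by (rule minus_carrier_mat[OF Sc])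
        fix a b assume ab: "a < d" "b < d"
        show "(spectral_sum d h q - S n) $$ (a, b) = cnj ((spectral_sum d h q - S n) $$ (b, a))"
          using ab Sc herm[OF ab] spectral_sum_herm[OF ab, of h q] by simp
      qed (use h i in \<open>auto simp: orthonormal_basis_def\<close>)
      then show ?thesis using S(2)[of n]
        by (simp add: qform_minus[OF spectral_sum_carrier Sc] spectral_sum_eigenvalue[OF h i] q0_def)
    qed
    then have "(\<lambda>n. q0 n i - q i) \<longlonglongrightarrow> 0"
      by (intro tendsto_rabs_zero_cancel[OF tendsto_sandwich[OF _ _ tendsto_const \<epsilon>_lim]]) auto
    then show ?thesis by (simp add: LIM_zero_iff)
  qed
  have r_lim: "(\<lambda>n. r n i) \<longlonglongrightarrow> q i" if "i < d" for i
  proof -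
    have "(\<lambda>n. (1 - \<epsilon> n) * q0 n i + \<epsilon> n * g i) \<longlonglongrightarrow> (1 - 0) * q i + 0 * g i"
      by (intro tendsto_intros \<epsilon>_lim q0_lim that)
    then show ?thesis by (simp add: r_def)
  qed
  have r_pos: "r n i > 0" if "i < d" for n i using mono that by blast
  have gt1: "(\<Sum>i<d. q i powr \<alpha> * g i powr (1 - \<alpha>)) \<le> (\<Sum>i<d. p i powr \<alpha> * g i powr (1 - \<alpha>))" if "\<alpha> > 1" for \<alpha>
    by (rule renyi_sum_limits(1)[where r = r]) (use p q g r_pos r_lim mono that in auto)
  have lt1: "(\<Sum>i<d. p i powr \<alpha> * g i powr (1 - \<alpha>)) \<le> (\<Sum>i<d. q i powr \<alpha> * g i powr (1 - \<alpha>))" if "0 < \<alpha>" "\<alpha> < 1" for \<alpha>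
    by (rule renyi_sum_limits(2)[where r = r]) (use p q g r_pos r_lim mono that in auto)
  have one: "(\<Sum>i<d. u i powr 1 * v i powr (1 - 1)) = (\<Sum>i<d. u i)" if "\<And>i. i < d \<Longrightarrow> u i \<ge> 0" "\<And>i. i < d \<Longrightarrow> v i > 0" for u v :: "nat \<Rightarrow> real"
    by (intro sum.cong refl) (use that in \<open>force simp: less_imp_le\<close>)
  have kl: "(\<Sum>i<d. q i * (ln (q i) - ln (g i))) \<le> (\<Sum>i<d. p i * (ln (p i) - ln (g i)))"
  proof (rule has_derivative_le_right[OF renyi_sum_derivative renyi_sum_derivative])
    show "(\<Sum>i<d. q i powr 1 * g i powr (1 - 1)) = (\<Sum>i<d. p i powr 1 * g i powr (1 - 1))"
      using one[OF q(1) g(1)] one[OF p(1) g(1)] p(2) q(2) by simp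
  qed (use p q g gt1 in auto)
  have neg: "(\<forall>i<d. q i > 0) \<and>
      (\<Sum>i<d. g i * (ln (g i) - ln (q i))) \<le> (\<Sum>i<d. g i * (ln (g i) - ln (p i))) \<and>
      (\<forall>\<alpha>>1. (\<Sum>i<d. g i powr \<alpha> * q i powr (1 - \<alpha>)) \<le> (\<Sum>i<d. g i powr \<alpha> * p i powr (1 - \<alpha>)))"
    if pp: "\<forall>i<d. p i > 0"
  proof -
    have mono': "(\<Sum>i<d. g i powr \<alpha> * r n i powr (1 - \<alpha>)) \<le> (\<Sum>i<d. g i powr \<alpha> * p i powr (1 - \<alpha>))" if "\<alpha> > 1" for n \<alpha>
      using mono pp that by blast
    have qp: "q i > 0" if "i < d" for i
      by (rule renyi_sum_limits(3)[where r = r, OF _ _ _ _ _ mono'[of 2]]) (use p q g r_pos r_lim that in auto)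
    have rev: "(\<Sum>i<d. g i powr \<alpha> * q i powr (1 - \<alpha>)) \<le> (\<Sum>i<d. g i powr \<alpha> * p i powr (1 - \<alpha>))" if "\<alpha> > 1" for \<alpha>
      by (rule renyi_sum_limits(4)[where r = r, OF _ _ _ _ _ qp mono'[OF that]]) (use p q g r_pos r_lim in auto)
    have "(\<Sum>i<d. g i * (ln (g i) - ln (q i))) \<le> (\<Sum>i<d. g i * (ln (g i) - ln (p i)))"
    proof (rule has_derivative_le_right[OF renyi_sum_derivative renyi_sum_derivative])
      show "(\<Sum>i<d. g i powr 1 * q i powr (1 - 1)) = (\<Sum>i<d. g i powr 1 * p i powr (1 - 1))"
        using one[of g q] one[of g p] g qp pp by (simp add: less_imp_le)
    qed (use qp pp g rev in \<open>auto simp: less_imp_le\<close>)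
    then show ?thesis using qp rev by blast
  qed
  show ?thesis unfolding renyi_order_def using gt1 lt1 kl neg by blast
qed

theorem corollary30:
  fixes d :: nat and h :: "nat \<Rightarrow> complex Matrix.vec" and E :: "nat \<Rightarrow> real" and \<beta> :: real
    and H \<rho> \<sigma> :: "complex Matrix.mat"
  assumes "orthonormal_basis d h"
    and "H = spectral_sum d h E"
    and "\<And>i. i < d \<Longrightarrow> E i > 0"
    and "\<beta> > 0"
    and "state d \<rho>" and "state d \<sigma>"
    and "diagonal_in_basis d h \<rho>" and "diagonal_in_basis d h \<sigma>"
  shows "asymp_cat_thermally_majorizes d H \<beta> \<rho> \<sigma> \<longleftrightarrow>
    (\<forall>\<alpha>\<ge>1/2. free_energy_plus H \<alpha> \<beta> \<rho> \<ge> free_energy_plus H \<alpha> \<beta> \<sigma> \<and>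
            free_energy_minus H \<alpha> \<beta> \<rho> \<ge> free_energy_minus H \<alpha> \<beta> \<sigma>)"
proof -
  obtain p where p: "\<rho> = spectral_sum d h p" "\<And>i. i < d \<Longrightarrow> p i \<ge> 0" "(\<Sum>i<d. p i) = 1"
    using state_diagonal[OF assms(1,5,7)] by blast
  obtain q where q: "\<sigma> = spectral_sum d h q" "\<And>i. i < d \<Longrightarrow> q i \<ge> 0" "(\<Sum>i<d. q i) = 1"
    using state_diagonal[OF assms(1,6,8)] by blast
  \<comment> \<open>Trace 1 excludes dimension 0, where normalizing the Gibbs weights would divide
    by zero.\<close>
  have d: "d > 0" using p(3) by (cases d) auto
  define Z where "Z = (\<Sum>j<d. exp (- \<beta> * E j))"
  define g where "g i = exp (- \<beta> * E i) / Z" for i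
  have Z: "Z > 0" unfolding Z_def using d by (intro sum_pos) auto
  have g: "\<And>i. i < d \<Longrightarrow> g i > 0" "(\<Sum>i<d. g i) = 1"
    using Z by (simp_all add: g_def Z_def flip: sum_divide_distrib)
  have gibbs: "gibbs_state H \<beta> = spectral_sum d h g"
    unfolding assms(2) gibbs_state_spectral_sum[OF assms(1) d] g_def Z_def ..
  have order: "asymp_cat_thermally_majorizes d H \<beta> (spectral_sum d h p) (spectral_sum d h q) \<longleftrightarrow> renyi_order d g p q"
    using asymp_cat_renyi_order[OF assms(1) gibbs g p(2,3) q(2,3)]
      asymp_cat_converse[OF assms(1) gibbs g p(2,3) q(2,3)] by blast
  show ?thesis
    unfolding p(1) q(1) order free_energy_plus_def free_energy_minus_def gibbs
    by (rule free_energy_order_iff[OF assms(1) g(1) p(2,3) q(2,3), symmetric])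
qed

end
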